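(* If $\mathsf{ZFC}$ is consistent, then the theory $\mathsf{ZF}+$ "$\aleph_\omega$ is the least cardinal not in $\mathcal{U}$" is consistent, where $\mathcal{U}$ is the class of all infinite cardinals which carry a uniform ultrafilter.
   Context: The ambient theory of the conclusion is $\mathsf{ZF}$ (no Axiom of Choice). "Cardinal" here means an infinite initial ordinal (an aleph). A proper ultrafilter $U$ over an infinite cardinal $\kappa$ is uniform if every element of $U$ has cardinality $\kappa$. $\mathcal{U}$ denotes the class of all infinite cardinals $\kappa$ such that there is a uniform ultrafilter over $\kappa$. Thus "$\aleph_\omega$ is the least cardinal not in $\mathcal{U}$" means that every $\aleph_n$ ($n<\omega$) carries a uniform ultrafilter and $\aleph_\omega$ does not. *)

theory Defs
  imports Main
begin

section \<open>First-order logic with equality in the language of set theory\<close>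

text \<open>
  Variables are de Bruijn indices: index 0 is bound by the innermost quantifier. The language has
  no function symbols, so the only terms are variables and substitution is renaming of indices.
\<close>

datatype fm =
    Mem nat nat  (infix "\<^bold>\<in>" 50)
  | Eq nat nat   (infix "\<^bold>=" 50)
  | Fls          ("\<^bold>\<bottom>")
  | Imp fm fm    (infixr "\<^bold>\<longrightarrow>" 25)
  | Forall fm    ("\<^bold>\<forall>_" [40] 40)

abbreviation Neg :: "fm \<Rightarrow> fm"  ("\<^bold>\<not>_" [40] 40)
  where "\<^bold>\<not>p \<equiv> p \<^bold>\<longrightarrow> \<^bold>\<bottom>"

abbreviation Conj :: "fm \<Rightarrow> fm \<Rightarrow> fm"  (infixr "\<^bold>\<and>" 35)
  where "p \<^bold>\<and> q \<equiv> \<^bold>\<not>(p \<^bold>\<longrightarrow> \<^bold>\<not>q)"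

abbreviation Disj :: "fm \<Rightarrow> fm \<Rightarrow> fm"  (infixr "\<^bold>\<or>" 30)
  where "p \<^bold>\<or> q \<equiv> \<^bold>\<not>p \<^bold>\<longrightarrow> q"

abbreviation Iff :: "fm \<Rightarrow> fm \<Rightarrow> fm"  (infixr "\<^bold>\<longleftrightarrow>" 25)
  where "p \<^bold>\<longleftrightarrow> q \<equiv> (p \<^bold>\<longrightarrow> q) \<^bold>\<and> (q \<^bold>\<longrightarrow> p)"

abbreviation Exists :: "fm \<Rightarrow> fm"  ("\<^bold>\<exists>_" [40] 40)
  where "\<^bold>\<exists>p \<equiv> \<^bold>\<not>(\<^bold>\<forall>(\<^bold>\<not>p))"

text \<open>The bounded quantifiers bind index 0 in the body, but their bound lives outside the binder.\<close>

abbreviation AllIn :: "nat \<Rightarrow> fm \<Rightarrow> fm"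
  where "AllIn x p \<equiv> \<^bold>\<forall>(0 \<^bold>\<in> x + 1 \<^bold>\<longrightarrow> p)"

abbreviation ExIn :: "nat \<Rightarrow> fm \<Rightarrow> fm"
  where "ExIn x p \<equiv> \<^bold>\<exists>(0 \<^bold>\<in> x + 1 \<^bold>\<and> p)"

primrec rename :: "(nat \<Rightarrow> nat) \<Rightarrow> fm \<Rightarrow> fm" where
  "rename f (x \<^bold>\<in> y) = (f x \<^bold>\<in> f y)"
| "rename f (x \<^bold>= y) = (f x \<^bold>= f y)"
| "rename f \<^bold>\<bottom> = \<^bold>\<bottom>"
| "rename f (p \<^bold>\<longrightarrow> q) = (rename f p \<^bold>\<longrightarrow> rename f q)"
| "rename f (\<^bold>\<forall>p) = (\<^bold>\<forall>(rename (case_nat 0 (\<lambda>n. f n + 1)) p))"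

text \<open>\<open>lift k\<close> makes room for one new variable at index \<open>k\<close>, which does not occur in the result;
  \<open>inst p t\<close> replaces index 0 by the variable \<open>t\<close> and removes its binder.\<close>

definition lift :: "nat \<Rightarrow> fm \<Rightarrow> fm"
  where "lift k = rename (\<lambda>n. if n < k then n else n + 1)"

definition inst :: "fm \<Rightarrow> nat \<Rightarrow> fm"
  where "inst p t = rename (case_nat t (\<lambda>n. n)) p"

text \<open>Every free index of \<open>p\<close> is below \<open>arity p\<close>, and \<open>arity p\<close> is the least such bound.\<close>

primrec arity :: "fm \<Rightarrow> nat" where
  "arity (x \<^bold>\<in> y) = max (x + 1) (y + 1)"
| "arity (x \<^bold>= y) = max (x + 1) (y + 1)"
| "arity \<^bold>\<bottom> = 0"
| "arity (p \<^bold>\<longrightarrow> q) = max (arity p) (arity q)"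
| "arity (\<^bold>\<forall>p) = arity p - 1"

definition univ_closure :: "fm \<Rightarrow> fm"
  where "univ_closure p = (Forall ^^ arity p) p"

text \<open>Classical natural deduction. Hypotheses may be infinite in number and may have free variables;
  in \<open>AllI\<close> they are lifted, so that the eigenvariable 0 is not free in them.\<close>

inductive derives :: "fm set \<Rightarrow> fm \<Rightarrow> bool"  (infix "\<turnstile>" 20) where
  Assm: "p \<in> H \<Longrightarrow> H \<turnstile> p"
| ImpI: "insert p H \<turnstile> q \<Longrightarrow> H \<turnstile> (p \<^bold>\<longrightarrow> q)"
| ImpE: "H \<turnstile> (p \<^bold>\<longrightarrow> q) \<Longrightarrow> H \<turnstile> p \<Longrightarrow> H \<turnstile> q"
| Classical: "insert (\<^bold>\<not>p) H \<turnstile> \<^bold>\<bottom> \<Longrightarrow> H \<turnstile> p"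
| AllI: "lift 0 ` H \<turnstile> p \<Longrightarrow> H \<turnstile> \<^bold>\<forall>p"
| AllE: "H \<turnstile> \<^bold>\<forall>p \<Longrightarrow> H \<turnstile> inst p t"
| EqRefl: "H \<turnstile> (t \<^bold>= t)"
| EqSubst: "H \<turnstile> (s \<^bold>= t) \<Longrightarrow> H \<turnstile> inst p s \<Longrightarrow> H \<turnstile> inst p t"

definition consistent :: "fm set \<Rightarrow> bool"
  where "consistent T \<longleftrightarrow> \<not> (T \<turnstile> \<^bold>\<bottom>)"


section \<open>Basic set-theoretic formulas\<close>

text \<open>Arguments are indices of variables. Under a quantifier every index coming from outside is
  increased by one, so in a body under \<open>k\<close> quantifiers the argument \<open>x\<close> appears as \<open>x + k\<close>.\<close>

definition empty_fm :: "nat \<Rightarrow> fm"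
  where "empty_fm x = (\<^bold>\<not>(\<^bold>\<exists>(0 \<^bold>\<in> x + 1)))"

definition subset_fm :: "nat \<Rightarrow> nat \<Rightarrow> fm"
  where "subset_fm x y = AllIn x (0 \<^bold>\<in> y + 1)"

text \<open>\<open>z = {x, y}\<close>\<close>
definition upair_fm :: "nat \<Rightarrow> nat \<Rightarrow> nat \<Rightarrow> fm"
  where "upair_fm x y z = (\<^bold>\<forall>(0 \<^bold>\<in> z + 1 \<^bold>\<longleftrightarrow> 0 \<^bold>= x + 1 \<^bold>\<or> 0 \<^bold>= y + 1))"

text \<open>\<open>z = (x, y) = {{x}, {x, y}}\<close>\<close>
definition pair_fm :: "nat \<Rightarrow> nat \<Rightarrow> nat \<Rightarrow> fm"
  where "pair_fm x y z =
    (\<^bold>\<exists>\<^bold>\<exists>(upair_fm (x + 2) (x + 2) 1 \<^bold>\<and> upair_fm (x + 2) (y + 2) 0 \<^bold>\<and> upair_fm 1 0 (z + 2)))"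

text \<open>\<open>z = x \<inter> y\<close>\<close>
definition inter_fm :: "nat \<Rightarrow> nat \<Rightarrow> nat \<Rightarrow> fm"
  where "inter_fm x y z = (\<^bold>\<forall>(0 \<^bold>\<in> z + 1 \<^bold>\<longleftrightarrow> 0 \<^bold>\<in> x + 1 \<^bold>\<and> 0 \<^bold>\<in> y + 1))"

text \<open>\<open>z = x - y\<close>\<close>
definition diff_fm :: "nat \<Rightarrow> nat \<Rightarrow> nat \<Rightarrow> fm"
  where "diff_fm x y z = (\<^bold>\<forall>(0 \<^bold>\<in> z + 1 \<^bold>\<longleftrightarrow> 0 \<^bold>\<in> x + 1 \<^bold>\<and> \<^bold>\<not>(0 \<^bold>\<in> y + 1)))"

text \<open>\<open>y = x \<union> {x}\<close>\<close>
definition succ_fm :: "nat \<Rightarrow> nat \<Rightarrow> fm"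
  where "succ_fm x y = (\<^bold>\<forall>(0 \<^bold>\<in> y + 1 \<^bold>\<longleftrightarrow> 0 \<^bold>\<in> x + 1 \<^bold>\<or> 0 \<^bold>= x + 1))"

text \<open>\<open>(x, y) \<in> f\<close>\<close>
definition app_fm :: "nat \<Rightarrow> nat \<Rightarrow> nat \<Rightarrow> fm"
  where "app_fm f x y = ExIn f (pair_fm (x + 1) (y + 1) 0)"

text \<open>\<open>f\<close> is a function from \<open>A\<close> to \<open>B\<close>: a subset of \<open>A \<times> B\<close> that is total and single-valued.\<close>
definition fun_fm :: "nat \<Rightarrow> nat \<Rightarrow> nat \<Rightarrow> fm"
  where "fun_fm f A B =
    (AllIn f (ExIn (A + 1) (ExIn (B + 2) (pair_fm 1 0 2)))
     \<^bold>\<and> AllIn A (\<^bold>\<exists>(app_fm (f + 2) 1 0))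
     \<^bold>\<and> \<^bold>\<forall>\<^bold>\<forall>\<^bold>\<forall>(app_fm (f + 3) 2 1 \<^bold>\<and> app_fm (f + 3) 2 0 \<^bold>\<longrightarrow> 1 \<^bold>= 0))"

definition bij_fm :: "nat \<Rightarrow> nat \<Rightarrow> nat \<Rightarrow> fm"
  where "bij_fm f A B =
    (fun_fm f A B
     \<^bold>\<and> \<^bold>\<forall>\<^bold>\<forall>\<^bold>\<forall>(app_fm (f + 3) 2 0 \<^bold>\<and> app_fm (f + 3) 1 0 \<^bold>\<longrightarrow> 2 \<^bold>= 1)
     \<^bold>\<and> AllIn B (\<^bold>\<exists>(app_fm (f + 2) 0 1)))"

definition eqpoll_fm :: "nat \<Rightarrow> nat \<Rightarrow> fm"
  where "eqpoll_fm A B = (\<^bold>\<exists>(bij_fm 0 (A + 1) (B + 1)))"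


section \<open>The theories ZF and ZFC\<close>

definition extensionality_ax :: fm
  where "extensionality_ax = (\<^bold>\<forall>\<^bold>\<forall>(\<^bold>\<forall>(0 \<^bold>\<in> 2 \<^bold>\<longleftrightarrow> 0 \<^bold>\<in> 1) \<^bold>\<longrightarrow> 1 \<^bold>= 0))"

definition foundation_ax :: fm
  where "foundation_ax = (\<^bold>\<forall>(\<^bold>\<exists>(0 \<^bold>\<in> 1) \<^bold>\<longrightarrow> ExIn 0 (\<^bold>\<not>(\<^bold>\<exists>(0 \<^bold>\<in> 2 \<^bold>\<and> 0 \<^bold>\<in> 1)))))"

definition pairing_ax :: fm
  where "pairing_ax = (\<^bold>\<forall>\<^bold>\<forall>\<^bold>\<exists>(upair_fm 2 1 0))"

definition union_ax :: fm
  where "union_ax = (\<^bold>\<forall>\<^bold>\<exists>\<^bold>\<forall>(0 \<^bold>\<in> 1 \<^bold>\<longleftrightarrow> ExIn 2 (1 \<^bold>\<in> 0)))"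

definition powerset_ax :: fm
  where "powerset_ax = (\<^bold>\<forall>\<^bold>\<exists>\<^bold>\<forall>(0 \<^bold>\<in> 1 \<^bold>\<longleftrightarrow> subset_fm 0 2))"

definition infinity_ax :: fm
  where "infinity_ax = (\<^bold>\<exists>(ExIn 0 (empty_fm 0) \<^bold>\<and> AllIn 0 (ExIn 1 (succ_fm 1 0))))"

text \<open>In \<open>separation_ax p\<close> the formula \<open>p\<close> has index 0 for the element, index 1 for the set \<open>A\<close> being
  separated from, and the remaining indices for parameters:
  \<open>\<forall>A. \<exists>B. \<forall>x. x \<in> B \<longleftrightarrow> x \<in> A \<and> p(x, A, \<dots>)\<close>.\<close>

definition separation_ax :: "fm \<Rightarrow> fm"
  where "separation_ax p = univ_closure (\<^bold>\<forall>\<^bold>\<exists>\<^bold>\<forall>(0 \<^bold>\<in> 1 \<^bold>\<longleftrightarrow> 0 \<^bold>\<in> 2 \<^bold>\<and> lift 1 p))"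

definition Unique :: "fm \<Rightarrow> fm"
  where "Unique p = (\<^bold>\<exists>\<^bold>\<forall>(lift 1 p \<^bold>\<longleftrightarrow> 0 \<^bold>= 1))"

text \<open>In \<open>replacement_ax p\<close> the formula \<open>p\<close> has index 0 for the value, index 1 for the argument, index 2
  for the domain \<open>A\<close>, and the remaining indices for parameters:
  \<open>\<forall>A. (\<forall>x \<in> A. \<exists>!y. p(y, x, A, \<dots>)) \<longrightarrow> (\<exists>B. \<forall>x \<in> A. \<exists>y \<in> B. p(y, x, A, \<dots>))\<close>.\<close>

definition replacement_ax :: "fm \<Rightarrow> fm"
  where "replacement_ax p =
    univ_closure (\<^bold>\<forall>(AllIn 0 (Unique p) \<^bold>\<longrightarrow> \<^bold>\<exists>(AllIn 1 (ExIn 1 (lift 2 p)))))"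

text \<open>Every family \<open>F\<close> of nonempty sets has a choice function.\<close>

definition choice_ax :: fm
  where "choice_ax = (\<^bold>\<forall>(AllIn 0 (\<^bold>\<not>(empty_fm 0)) \<^bold>\<longrightarrow>
    \<^bold>\<exists>\<^bold>\<exists>(fun_fm 0 2 1 \<^bold>\<and> AllIn 2 (ExIn 0 (app_fm 2 1 0)))))"

definition ZF :: "fm set"
  where "ZF = {extensionality_ax, foundation_ax, pairing_ax, union_ax, powerset_ax, infinity_ax}
    \<union> range separation_ax \<union> range replacement_ax"

definition ZFC :: "fm set"
  where "ZFC = insert choice_ax ZF"


section \<open>Cardinals and uniform ultrafilters\<close>

definition transitive_fm :: "nat \<Rightarrow> fm"
  where "transitive_fm x = AllIn x (subset_fm 0 (x + 1))"

text \<open>In the presence of foundation, an ordinal is a transitive set of transitive sets.\<close>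

definition ordinal_fm :: "nat \<Rightarrow> fm"
  where "ordinal_fm x = (transitive_fm x \<^bold>\<and> AllIn x (transitive_fm 0))"

definition limit_fm :: "nat \<Rightarrow> fm"
  where "limit_fm x =
    (ordinal_fm x \<^bold>\<and> \<^bold>\<not>(empty_fm x) \<^bold>\<and> AllIn x (ExIn (x + 1) (succ_fm 1 0)))"

text \<open>\<open>x = \<omega>\<close>\<close>
definition omega_fm :: "nat \<Rightarrow> fm"
  where "omega_fm x = (limit_fm x \<^bold>\<and> AllIn x (\<^bold>\<not>(limit_fm 0)))"

text \<open>\<open>x\<close> is an infinite initial ordinal.\<close>

definition cardinal_fm :: "nat \<Rightarrow> fm"
  where "cardinal_fm x =
    (ordinal_fm x \<^bold>\<and> \<^bold>\<exists>(omega_fm 0 \<^bold>\<and> subset_fm 0 (x + 1)) \<^bold>\<and> AllIn x (\<^bold>\<not>(eqpoll_fm 0 (x + 1))))"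

text \<open>\<open>U\<close> is a proper ultrafilter over \<open>k\<close>.\<close>

definition ultrafilter_fm :: "nat \<Rightarrow> nat \<Rightarrow> fm"
  where "ultrafilter_fm U k =
    (AllIn U (subset_fm 0 (k + 1))
     \<^bold>\<and> k \<^bold>\<in> U
     \<^bold>\<and> AllIn U (\<^bold>\<not>(empty_fm 0))
     \<^bold>\<and> AllIn U (AllIn (U + 1) (ExIn (U + 2) (inter_fm 2 1 0)))
     \<^bold>\<and> AllIn U (\<^bold>\<forall>(subset_fm 1 0 \<^bold>\<and> subset_fm 0 (k + 2) \<^bold>\<longrightarrow> 0 \<^bold>\<in> U + 2))
     \<^bold>\<and> \<^bold>\<forall>(subset_fm 0 (k + 1) \<^bold>\<longrightarrow> 0 \<^bold>\<in> U + 1 \<^bold>\<or> ExIn (U + 1) (diff_fm (k + 2) 1 0)))"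

definition uniform_ultrafilter_fm :: "nat \<Rightarrow> nat \<Rightarrow> fm"
  where "uniform_ultrafilter_fm U k = (ultrafilter_fm U k \<^bold>\<and> AllIn U (eqpoll_fm 0 (k + 1)))"

text \<open>\<open>k\<close> belongs to the class \<open>\<U>\<close> of infinite cardinals that carry a uniform ultrafilter.\<close>

definition inU_fm :: "nat \<Rightarrow> fm"
  where "inU_fm k = (cardinal_fm k \<^bold>\<and> \<^bold>\<exists>(uniform_ultrafilter_fm 0 (k + 1)))"

text \<open>\<open>m\<close> is the least infinite cardinal greater than \<open>k\<close>.\<close>

definition next_cardinal_fm :: "nat \<Rightarrow> nat \<Rightarrow> fm"
  where "next_cardinal_fm k m =
    (cardinal_fm m \<^bold>\<and> k \<^bold>\<in> m \<^bold>\<and> AllIn m (k + 1 \<^bold>\<in> 0 \<^bold>\<longrightarrow> \<^bold>\<not>(cardinal_fm 0)))"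

text \<open>\<open>f\<close> is the sequence of the \<open>\<aleph>\<^sub>n\<close> for \<open>n \<in> w\<close>, where \<open>w\<close> is meant to be \<open>\<omega>\<close>: it is a function with
  domain \<open>w\<close>, \<open>f(0) = w\<close>, and \<open>f(n + 1)\<close> is the next cardinal after \<open>f(n)\<close>.\<close>

definition aleph_sequence_fm :: "nat \<Rightarrow> nat \<Rightarrow> fm"
  where "aleph_sequence_fm f w =
    (\<^bold>\<exists>(fun_fm (f + 1) (w + 1) 0)
     \<^bold>\<and> \<^bold>\<exists>(empty_fm 0 \<^bold>\<and> app_fm (f + 1) 0 (w + 1))
     \<^bold>\<and> AllIn w (\<^bold>\<forall>\<^bold>\<forall>\<^bold>\<forall>(succ_fm 3 2 \<^bold>\<and> app_fm (f + 4) 3 1 \<^bold>\<and> app_fm (f + 4) 2 0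
          \<^bold>\<longrightarrow> next_cardinal_fm 1 0)))"

text \<open>\<open>x = \<aleph>\<^sub>\<omega>\<close>, the supremum of the \<open>\<aleph>\<^sub>n\<close> for \<open>n < \<omega>\<close>.\<close>

definition aleph_omega_fm :: "nat \<Rightarrow> fm"
  where "aleph_omega_fm x =
    (\<^bold>\<exists>\<^bold>\<exists>(omega_fm 1 \<^bold>\<and> aleph_sequence_fm 0 1
       \<^bold>\<and> \<^bold>\<forall>(0 \<^bold>\<in> x + 3 \<^bold>\<longleftrightarrow> ExIn 2 (\<^bold>\<exists>(app_fm 3 1 0 \<^bold>\<and> 2 \<^bold>\<in> 0)))))"

definition least_cardinal_not_inU_fm :: "nat \<Rightarrow> fm"
  where "least_cardinal_not_inU_fm x =
    (cardinal_fm x \<^bold>\<and> \<^bold>\<not>(inU_fm x) \<^bold>\<and> AllIn x (cardinal_fm 0 \<^bold>\<longrightarrow> inU_fm 0))"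

definition aleph_omega_least_not_inU :: fm
  where "aleph_omega_least_not_inU = (\<^bold>\<exists>(aleph_omega_fm 0 \<^bold>\<and> least_cardinal_not_inU_fm 0))"

end

theory Submission
  imports Defs "HOL-Library.Countable_Set"
begin

text \<open>
  By completeness there is a countable model of ZFC. In it let \<open>\<kappa>\<^sub>0 = \<omega>\<close>, let \<open>\<kappa>\<^sub>n\<^sub>+\<^sub>1\<close> be the Hartogs number of
  \<open>V(\<kappa>\<^sub>n)\<close>, and let \<open>\<lambda>\<close> be the supremum of these regular cardinals. Force with the full product over \<open>n\<close> of the partial
  functions from \<open>\<lambda>\<close> to \<open>V(\<kappa>\<^sub>n)\<close> with fewer than \<open>\<kappa>\<^sub>n\<close> arguments. The group that toggles membership of \<open>\<emptyset>\<close> in arbitrary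
  entries acts on the names, and the names hereditarily fixed by all toggles outside of finitely many coordinates
  give a model \<open>N\<close> of ZF.

  The coordinates up to \<open>n\<close> form a small forcing and the others are highly closed: one condition on the others decides a small family
  of statements up to conditions on the former. Hence in \<open>N\<close> each \<open>\<kappa>\<^sub>n\<close> is still regular, it is \<open>\<aleph>\<^sub>n\<close> because coordinate \<open>n\<close>
  collapses \<open>V(\<kappa>\<^sub>n)\<close> to \<open>\<kappa>\<^sub>n\<close>, and its power set can be well-ordered. So a uniform ultrafilter over it is
  found by deciding one subset after the other.

  An ultrafilter \<open>U\<close> over \<open>\<lambda>\<close> in \<open>N\<close> has a name that is fixed by all toggles at some coordinate \<open>n\<close>. Let \<open>X\<close> be the set of
  the arguments in \<open>\<lambda>\<close> at which the value of the generic function of coordinate \<open>n\<close> contains \<open>\<emptyset>\<close>. A condition decides fewer than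
  \<open>\<kappa>\<^sub>n\<close> of its elements, and toggling the other ones shows that \<open>X\<close> is in \<open>U\<close> iff it is still in \<open>U\<close> after being
  complemented off that small set. So the small set is in \<open>U\<close>, and \<open>U\<close> is not uniform.
\<close>

section \<open>Semantics and soundness\<close>

text \<open>The countable model need not be well-founded, so nothing can be borrowed from transitive
  models: ordinals, ranks and recursion are developed inside it from instances of the schemes, and
  for that every predicate in use is shown to be definable with parameters. For the same reason the
  extension is a quotient of the names by forced equality, not the result of evaluating them. The
  difficulty is that choice must fail for ultrafilters over \<open>\<lambda>\<close> while power
  sets below \<open>\<lambda>\<close> stay well-ordered. Finite supports achieve this because
  \<open>\<lambda>\<close> is approached through the coordinates: a subset of
  \<open>\<kappa>\<^sub>n\<close> is governed by the first \<open>n + 1\<close> of them, whereas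
  subsets of \<open>\<lambda>\<close> can be read off from coordinates beyond any given support.
  Letting every coordinate take arguments in all of \<open>\<lambda>\<close> provides such subsets,
  and allowing fewer than \<open>\<kappa>\<^sub>n\<close> entries keeps the decided part small.
  Toggles have order two and commute, so that supports are invariant under the group. Values in
  \<open>V(\<kappa>\<^sub>n)\<close> make each coordinate collapse just what the Hartogs number,
  used in place of GCH, has skipped.\<close>

primrec sat :: "('a \<Rightarrow> 'a \<Rightarrow> bool) \<Rightarrow> (nat \<Rightarrow> 'a) \<Rightarrow> fm \<Rightarrow> bool" where
  "sat E e (x \<^bold>\<in> y) = E (e x) (e y)"
| "sat E e (x \<^bold>= y) = (e x = e y)"
| "sat E e \<^bold>\<bottom> = False"
| "sat E e (p \<^bold>\<longrightarrow> q) = (sat E e p \<longrightarrow> sat E e q)"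
| "sat E e (\<^bold>\<forall>p) = (\<forall>a. sat E (case_nat a e) p)"

lemma sat_rename: "sat E e (rename f p) = sat E (\<lambda>n. e (f n)) p"
proof (induction p arbitrary: e f)
  case (Forall p)
  have "(\<lambda>n. case_nat a e (case n of 0 \<Rightarrow> 0 | Suc n \<Rightarrow> Suc (f n))) = case_nat a (\<lambda>n. e (f n))" for a
    by (auto simp: fun_eq_iff split: nat.splits)
  then show ?case by (simp add: Forall)
qed auto

lemma sat_inst: "sat E e (inst p t) = sat E (case_nat (e t) e) p"
proof -
  have "(\<lambda>n. e (case n of 0 \<Rightarrow> t | Suc n \<Rightarrow> n)) = case_nat (e t) e"
    by (auto simp: fun_eq_iff split: nat.splits)
  then show ?thesis by (simp add: inst_def sat_rename)
qed

lemma sat_lift: "sat E e (lift k p) = sat E (\<lambda>n. if n < k then e n else e (n + 1)) p"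
  by (simp add: lift_def sat_rename if_distrib cong: if_cong)

lemma sat_lift_0: "sat E (case_nat a e) (lift 0 p) = sat E e p"
  by (simp add: sat_lift)

lemma sat_arity: "(\<And>n. n < arity p \<Longrightarrow> e n = e' n) \<Longrightarrow> sat E e p = sat E e' p"
proof (induction p arbitrary: e e')
  case (Imp p q)
  have "sat E e p = sat E e' p" "sat E e q = sat E e' q"
    using Imp.prems by (auto intro!: Imp.IH)
  then show ?case by simp
next
  case (Forall p)
  have "sat E (case_nat a e) p = sat E (case_nat a e') p" for a
    by (rule Forall.IH) (use Forall.prems in \<open>auto split: nat.splits\<close>)
  then show ?case by simp
qed auto

lemma arity_Forall_pow: "arity ((Forall ^^ k) p) = arity p - k"
  by (induction k) auto

lemma arity_univ_closure: "arity (univ_closure p) = 0"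
  by (simp add: univ_closure_def arity_Forall_pow)

text \<open>The iterated quantifier ranges over the assignments that agree with \<open>e\<close>
  after a shift by \<open>arity p\<close>. Since \<open>p\<close> does not look at that tail, these
  are as good as all assignments.\<close>

lemma sat_univ_closure: "sat E e (univ_closure p) = (\<forall>e. sat E e p)"
proof -
  have *: "sat E e ((Forall ^^ k) p) \<longleftrightarrow> (\<forall>e'. (\<forall>n. e' (n + k) = e n) \<longrightarrow> sat E e' p)" for k e
  proof (induction k arbitrary: e)
    case 0
    have "(\<forall>n. e' n = e n) \<longleftrightarrow> e' = e" for e' by auto
    then show ?case by simp
  next
    case (Suc k)
    have "(\<exists>a. \<forall>n. e' (n + k) = case_nat a e n) \<longleftrightarrow> (\<forall>n. e' (n + Suc k) = e n)" for e' :: "nat \<Rightarrow> 'a"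
    proof
      assume "\<forall>n. e' (n + Suc k) = e n"
      then show "\<exists>a. \<forall>n. e' (n + k) = case_nat a e n"
        by (intro exI[of _ "e' k"]) (auto split: nat.splits)
    next
      assume "\<exists>a. \<forall>n. e' (n + k) = case_nat a e n"
      then obtain a where "\<forall>n. e' (n + k) = case_nat a e n" by blast
      from spec[OF this, of "Suc _"] show "\<forall>n. e' (n + Suc k) = e n" by simp
    qed
    then show ?case by (simp add: Suc) blast
  qed
  show ?thesis
  proof
    assume L: "sat E e (univ_closure p)"
    show "\<forall>e. sat E e p"
    proof
      fix e'
      define e'' where "e'' n = (if n < arity p then e' n else e (n - arity p))" for n
      have "sat E e'' p" using L by (simp add: univ_closure_def * e''_def)
      moreover have "sat E e'' p = sat E e' p"
        by (rule sat_arity) (simp add: e''_def)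
      ultimately show "sat E e' p" by simp
    qed
  qed (simp add: univ_closure_def *)
qed

lemma soundness: "H \<turnstile> p \<Longrightarrow> (\<And>q. q \<in> H \<Longrightarrow> sat E e q) \<Longrightarrow> sat E e p"
proof (induction arbitrary: e rule: derives.induct)
  case (AllI H p)
  have "sat E (case_nat a e) p" for a
    by (rule AllI.IH) (use AllI.prems in \<open>auto simp: sat_lift_0\<close>)
  then show ?case by simp
next
  case (EqSubst H s t p)
  from EqSubst.IH[of e] EqSubst.prems show ?case by (simp add: sat_inst)
next
  case (ImpI p H q)
  have "sat E e q" if "sat E e p"
    by (rule ImpI.IH) (use ImpI.prems that in auto)
  then show ?case by simp
next
  case (Classical p H)
  have "sat E e (\<^bold>\<not>p) \<Longrightarrow> sat E e \<^bold>\<bottom>"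
    by (rule Classical.IH) (use Classical.prems in auto)
  then show ?case by auto
qed (auto simp: sat_inst)

lemma model_imp_consistent: "(\<And>q. q \<in> T \<Longrightarrow> sat E e q) \<Longrightarrow> consistent T"
  using soundness[of T "\<^bold>\<bottom>" E e] by (auto simp: consistent_def)


section \<open>Completeness\<close>

lemma weakening: "H \<turnstile> p \<Longrightarrow> H \<subseteq> H' \<Longrightarrow> H' \<turnstile> p"
proof (induction arbitrary: H' rule: derives.induct)
  case (Assm p H)
  then show ?case by (blast intro: derives.Assm)
next
  case (ImpI p H q)
  then show ?case by (meson derives.ImpI insert_mono)
next
  case (ImpE H p q)
  then show ?case by (meson derives.ImpE)
next
  case (Classical p H)
  then show ?case by (meson derives.Classical insert_mono)
next
  case (AllI H p)
  then show ?case by (meson derives.AllI image_mono)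
next
  case (AllE H p t)
  show ?case by (rule derives.AllE) (use AllE in blast)
next
  case (EqRefl H t)
  show ?case by (rule derives.EqRefl)
next
  case (EqSubst H s t p)
  show ?case by (rule derives.EqSubst[of _ s]) (use EqSubst in blast)+
qed

lemma rename_rename: "rename f (rename g p) = rename (\<lambda>n. f (g n)) p"
proof (induction p arbitrary: f g)
  case (Forall p)
  have "(\<lambda>n. case (case n of 0 \<Rightarrow> 0 | Suc n \<Rightarrow> Suc (g n)) of 0 \<Rightarrow> 0 | Suc n \<Rightarrow> Suc (f n))
      = (\<lambda>n. case n of 0 \<Rightarrow> 0 | Suc n \<Rightarrow> Suc (f (g n)))"
    by (auto simp: fun_eq_iff split: nat.splits)
  then show ?case by (simp add: Forall)
qed auto

lemma rename_arity: "(\<And>n. n < arity p \<Longrightarrow> f n = g n) \<Longrightarrow> rename f p = rename g p"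
proof (induction p arbitrary: f g)
  case (Imp p q)
  have "rename f p = rename g p" "rename f q = rename g q"
    using Imp.prems by (auto intro!: Imp.IH)
  then show ?case by simp
next
  case (Forall p)
  have "rename (case_nat 0 (\<lambda>n. f n + 1)) p = rename (case_nat 0 (\<lambda>n. g n + 1)) p"
    by (rule Forall.IH) (use Forall.prems in \<open>auto split: nat.splits\<close>)
  then show ?case by simp
qed auto

lemma rename_id: "rename (\<lambda>n. n) p = p"
proof (induction p)
  case (Forall p)
  have "case_nat 0 (\<lambda>n. n + 1) = (\<lambda>n::nat. n)" by (auto simp: fun_eq_iff split: nat.splits)
  then show ?case using Forall by simp
qed auto

lemma rename_inst: "rename f (inst p t) = inst (rename (case_nat 0 (\<lambda>n. f n + 1)) p) (f t)"
  unfolding inst_def rename_rename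
  by (rule arg_cong[where f="\<lambda>g. rename g p"]) (auto simp: fun_eq_iff split: nat.splits)

lemma rename_lift_0: "rename (case_nat 0 (\<lambda>n. f n + 1)) (lift 0 p) = lift 0 (rename f p)"
  by (simp add: lift_def rename_rename)

lemma derives_rename: "H \<turnstile> p \<Longrightarrow> rename f ` H \<turnstile> rename f p"
proof (induction arbitrary: f rule: derives.induct)
  case (Assm p H)
  then show ?case by (intro derives.Assm imageI)
next
  case (AllI H p)
  have "rename (case_nat 0 (\<lambda>n. Suc (f n))) ` lift 0 ` H = lift 0 ` rename f ` H"
    using rename_lift_0[of f] by (simp add: image_image)
  with AllI.IH[of "case_nat 0 (\<lambda>n. Suc (f n))"] show ?case
    by (simp add: derives.AllI)
next
  case (AllE H p t)
  show ?case unfolding rename_inst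
    by (rule derives.AllE) (use AllE.IH in simp)
next
  case (EqSubst H s t p)
  show ?case unfolding rename_inst
    by (rule derives.EqSubst[of _ "f s"]) (use EqSubst.IH[of f] in \<open>simp_all add: rename_inst\<close>)
next
  case (EqRefl H t)
  show ?case by (simp add: derives.EqRefl)
next
  case (ImpI p H q)
  from ImpI.IH[of f] show ?case by (simp add: derives.ImpI)
next
  case (ImpE H p q)
  show ?case by (rule derives.ImpE[of _ "rename f p"]) (use ImpE.IH[of f] in simp_all)
next
  case (Classical p H)
  from Classical.IH[of f] show ?case by (simp add: derives.Classical)
qed

text \<open>Sending \<open>y\<close> to 0 and every other index up by one turns the hypotheses into
  their lifts and \<open>inst p y\<close> back into \<open>p\<close>, so that \<open>AllI\<close>
  applies.\<close>

lemma derives_fresh_AllI: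
  assumes "H \<turnstile> inst p y" and "\<And>q. q \<in> H \<Longrightarrow> arity q \<le> y" and "arity p \<le> Suc y"
  shows "H \<turnstile> \<^bold>\<forall>p"
proof (rule derives.AllI)
  let ?f = "\<lambda>n. if n = y then 0 else n + 1"
  have "rename ?f ` H = lift 0 ` H"
  proof (rule image_cong)
    fix q assume "q \<in> H"
    then show "rename ?f q = lift 0 q"
      unfolding lift_def using assms(2)[OF \<open>q \<in> H\<close>] by (intro rename_arity) auto
  qed simp
  moreover have "rename ?f (inst p y) = rename (\<lambda>n. n) p"
    unfolding inst_def rename_rename using assms(3)
    by (intro rename_arity) (auto split: nat.splits)
  ultimately show "lift 0 ` H \<turnstile> p"
    using derives_rename[OF assms(1), of ?f] by (simp add: rename_id)
qed

lemma derives_cut: "H \<turnstile> p \<Longrightarrow> insert p H \<turnstile> q \<Longrightarrow> H \<turnstile> q"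
  by (rule derives.ImpE[of H p q]) (rule derives.ImpI)

text \<open>Compactness of derivations: an inconsistency of the union of the Henkin stages already
  shows at one stage.\<close>

lemma derives_finite: "H \<turnstile> p \<Longrightarrow> \<exists>F. finite F \<and> F \<subseteq> H \<and> (F \<turnstile> p)"
proof (induction rule: derives.induct)
  case (Assm p H)
  then show ?case by (intro exI[of _ "{p}"]) (simp add: derives.Assm)
next
  case (ImpI p H q)
  then obtain F where F: "finite F" "F \<subseteq> insert p H" "F \<turnstile> q" by blast
  have "F - {p} \<turnstile> (p \<^bold>\<longrightarrow> q)"
    by (rule derives.ImpI, rule weakening[OF F(3)]) blast
  with F show ?case by (intro exI[of _ "F - {p}"]) auto
next
  case (ImpE H p q)
  then obtain F F' where F: "finite F" "F \<subseteq> H" "F \<turnstile> (p \<^bold>\<longrightarrow> q)" "finite F'" "F' \<subseteq> H" "F' \<turnstile> p" by blast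
  have "F \<union> F' \<turnstile> q"
    by (rule derives.ImpE[of _ p]; rule weakening[OF F(3)] weakening[OF F(6)]; blast)
  with F show ?case by (intro exI[of _ "F \<union> F'"]) auto
next
  case (Classical p H)
  then obtain F where F: "finite F" "F \<subseteq> insert (\<^bold>\<not>p) H" "F \<turnstile> \<^bold>\<bottom>" by blast
  have "F - {\<^bold>\<not>p} \<turnstile> p"
    by (rule derives.Classical, rule weakening[OF F(3)]) blast
  with F show ?case by (intro exI[of _ "F - {\<^bold>\<not>p}"]) auto
next
  case (AllI H p)
  then obtain F where F: "finite F" "F \<subseteq> lift 0 ` H" "F \<turnstile> p" by blast
  then obtain G where "finite G" "G \<subseteq> H" "F = lift 0 ` G"
    by (meson finite_subset_image)
  with F(3) show ?case by (intro exI[of _ G]) (simp add: derives.AllI)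
next
  case (AllE H p t)
  then obtain F where "finite F" "F \<subseteq> H" "F \<turnstile> \<^bold>\<forall>p" by blast
  then show ?case by (intro exI[of _ F]) (simp add: derives.AllE)
next
  case (EqRefl H t)
  show ?case by (intro exI[of _ "{}"]) (simp add: derives.EqRefl)
next
  case (EqSubst H s t p)
  then obtain F F' where F: "finite F" "F \<subseteq> H" "F \<turnstile> (s \<^bold>= t)" "finite F'" "F' \<subseteq> H" "F' \<turnstile> inst p s"
    by blast
  have "F \<union> F' \<turnstile> inst p t"
    by (rule derives.EqSubst[of _ s]; rule weakening[OF F(3)] weakening[OF F(6)]; blast)
  with F show ?case by (intro exI[of _ "F \<union> F'"]) auto
qed

instance fm :: countable
  by countable_datatype

lemma derives_False: "H \<turnstile> \<^bold>\<bottom> \<Longrightarrow> H \<turnstile> p"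
  by (rule derives.Classical) (erule weakening, blast)

text \<open>The extension has to live on the type of the ground model, so the classes of names are numbered by
  \<open>nat\<close>; the classes of \<open>e, g e, g (g e), \<dots>\<close> show that there are infinitely many.\<close>

lemma infinite_quotient_naming:
  fixes D :: "nat set" and eq :: "nat \<Rightarrow> nat \<Rightarrow> bool"
  assumes refl: "\<And>x. x \<in> D \<Longrightarrow> eq x x"
    and sym: "\<And>x y. x \<in> D \<Longrightarrow> y \<in> D \<Longrightarrow> eq x y \<Longrightarrow> eq y x"
    and trans: "\<And>x y z. x \<in> D \<Longrightarrow> y \<in> D \<Longrightarrow> z \<in> D \<Longrightarrow> eq x y \<Longrightarrow> eq y z \<Longrightarrow> eq x z"
    and g: "\<And>x. x \<in> D \<Longrightarrow> g x \<in> D" "\<And>x y. x \<in> D \<Longrightarrow> y \<in> D \<Longrightarrow> eq (g x) (g y) \<longleftrightarrow> eq x y"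
    and e: "e \<in> D" "\<And>x. x \<in> D \<Longrightarrow> \<not> eq e (g x)"
  obtains v :: "nat \<Rightarrow> nat" where "v ` D = UNIV"
    and "\<And>x y. x \<in> D \<Longrightarrow> y \<in> D \<Longrightarrow> v x = v y \<longleftrightarrow> eq x y"
proof -
  define f where "f x = {y \<in> D. eq x y}" for x
  have f: "f x = f y \<longleftrightarrow> eq x y" if "x \<in> D" "y \<in> D" for x y
    using that refl sym trans unfolding f_def by blast
  \<comment> \<open>The map that \<open>g\<close> induces on classes is injective but misses the
    class of \<open>e\<close>, hence there are infinitely many classes.\<close>
  define G where "G c = f (g (SOME x. x \<in> D \<and> f x = c))" for c
  have G: "G (f x) = f (g x)" if "x \<in> D" for x
  proof -
    let ?s = "SOME y. y \<in> D \<and> f y = f x"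
    have s: "?s \<in> D \<and> f ?s = f x"
      by (rule someI[of _ x]) (use that in simp)
    then have "eq ?s x" using f[of ?s x] that by simp
    then have "f (g ?s) = f (g x)" using f[of "g ?s" "g x"] g that s by simp
    then show ?thesis by (simp add: G_def)
  qed
  have "inj_on G (f ` D)"
    by (rule inj_onI) (metis (no_types, lifting) G f g imageE)
  moreover have "G ` f ` D \<subseteq> f ` D" using G g by auto
  moreover have "f e \<notin> G ` f ` D" using G f g e by auto
  ultimately have "infinite (f ` D)"
    using e(1) endo_inj_surj[of "f ` D" G] by blast
  then have b: "bij_betw (to_nat_on (f ` D)) (f ` D) UNIV"
    by (intro to_nat_on_infinite) auto
  show ?thesis
  proof (rule that[of "\<lambda>x. to_nat_on (f ` D) (f x)"])
    show "(\<lambda>x. to_nat_on (f ` D) (f x)) ` D = UNIV"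
      using b by (auto simp: bij_betw_def image_image)
    show "to_nat_on (f ` D) (f x) = to_nat_on (f ` D) (f y) \<longleftrightarrow> eq x y" if "x \<in> D" "y \<in> D" for x y
      using b that f by (auto simp: bij_betw_def inj_on_def)
  qed
qed

section \<open>The Henkin construction\<close>

locale henkin =
  fixes T :: "fm set"
  assumes closed: "q \<in> T \<Longrightarrow> arity q = 0" and con: "consistent T"
begin

text \<open>The variables themselves serve as Henkin constants. At any stage only finitely many
  formulas have been added to the closed theory, so a fresh variable exists; the sum bounds each
  single arity.\<close>

definition fresh :: "fm list \<Rightarrow> fm \<Rightarrow> nat" where
  "fresh L p = sum_list (map arity L) + arity p"

definition witness :: "fm list \<Rightarrow> fm \<Rightarrow> fm list" where
  "witness L p = (case p of (\<^bold>\<forall>q) \<^bold>\<longrightarrow> \<^bold>\<bottom> \<Rightarrow> [\<^bold>\<not>(inst q (fresh L p))] | _ \<Rightarrow> [])"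

primrec stage :: "nat \<Rightarrow> fm list" where
  "stage 0 = []"
| "stage (Suc n) = (if consistent (T \<union> set (from_nat n # stage n))
    then witness (stage n) (from_nat n) @ from_nat n # stage n else stage n)"

definition S :: "fm set" where "S = T \<union> (\<Union>n. set (stage n))"

text \<open>If the counterexample at the fresh variable were refutable, the universal statement
  would be derivable, against its negation that has just been added.\<close>

lemma stage_consistent: "consistent (T \<union> set (stage n))"
proof (induction n)
  case 0
  then show ?case using con by simp
next
  case (Suc n)
  let ?p = "from_nat n :: fm" and ?L = "stage n"
  show ?case
  proof (cases "consistent (T \<union> set (?p # ?L)) \<and> witness ?L ?p \<noteq> []")
    case True
    then obtain q where q: "?p = (\<^bold>\<not>(\<^bold>\<forall>q))"
      by (auto simp: witness_def split: fm.splits)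
    let ?y = "fresh ?L ?p" and ?H = "T \<union> set (?p # ?L)"
    have y: "arity r \<le> ?y" if "r \<in> ?H" for r
      using that closed[of r] member_le_sum_list[of "arity r" "map arity ?L"] by (auto simp: fresh_def)
    have "\<not> (insert (\<^bold>\<not>(inst q ?y)) ?H \<turnstile> \<^bold>\<bottom>)"
    proof
      assume "insert (\<^bold>\<not>(inst q ?y)) ?H \<turnstile> \<^bold>\<bottom>"
      then have "?H \<turnstile> inst q ?y" by (rule derives.Classical)
      then have "?H \<turnstile> \<^bold>\<forall>q"
        by (rule derives_fresh_AllI) (use y q in \<open>auto simp: fresh_def\<close>)
      moreover have "?H \<turnstile> \<^bold>\<not>(\<^bold>\<forall>q)" using q by (intro derives.Assm) auto
      ultimately have "?H \<turnstile> \<^bold>\<bottom>" by (rule derives.ImpE[rotated])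
      then show False using True by (simp add: consistent_def)
    qed
    then show ?thesis using True q by (simp add: consistent_def witness_def)
  next
    case False
    then show ?thesis using Suc by auto
  qed
qed

lemma stage_mono: "m \<le> n \<Longrightarrow> set (stage m) \<subseteq> set (stage n)"
  by (rule lift_Suc_mono_le[of "\<lambda>n. set (stage n)"]) auto

lemma S_consistent: "\<not> (S \<turnstile> \<^bold>\<bottom>)"
proof
  assume "S \<turnstile> \<^bold>\<bottom>"
  then obtain F where F: "finite F" "F \<subseteq> S" "F \<turnstile> \<^bold>\<bottom>"
    using derives_finite by blast
  have "\<exists>n. F \<subseteq> T \<union> set (stage n)"
    using F(1,2)
  proof (induction F rule: finite_induct)
    case empty
    then show ?case by simp
  next
    case (insert x F)
    then obtain n m where "F \<subseteq> T \<union> set (stage n)" "x \<in> T \<union> set (stage m)"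
      by (auto simp: S_def)
    then have "insert x F \<subseteq> T \<union> set (stage (max n m))"
      using stage_mono[of n "max n m"] stage_mono[of m "max n m"] by auto
    then show ?case by blast
  qed
  then obtain n where "T \<union> set (stage n) \<turnstile> \<^bold>\<bottom>"
    using F(3) weakening by blast
  then show False using stage_consistent[of n] by (simp add: consistent_def)
qed

text \<open>If \<open>p\<close> were consistent with \<open>S\<close>, it would be consistent with
  the stage at which its number comes up, and that stage would have added it.\<close>

lemma S_cases:
  assumes "p \<notin> S" shows "insert p S \<turnstile> \<^bold>\<bottom>"
proof (rule ccontr)
  assume A: "\<not> (insert p S \<turnstile> \<^bold>\<bottom>)"
  obtain n where n: "p = from_nat n" by (metis from_nat_to_nat)
  have "consistent (T \<union> set (from_nat n # stage n))"
    unfolding consistent_def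
  proof
    assume "T \<union> set (from_nat n # stage n) \<turnstile> \<^bold>\<bottom>"
    then have "insert p S \<turnstile> \<^bold>\<bottom>"
      by (rule weakening) (auto simp: S_def n)
    then show False using A by simp
  qed
  then have "p \<in> set (stage (Suc n))" using n by simp
  then show False using assms unfolding S_def by blast
qed

lemma S_derives: "S \<turnstile> p \<Longrightarrow> p \<in> S"
  using S_cases S_consistent derives_cut by blast

lemma S_Imp: "(p \<^bold>\<longrightarrow> q) \<in> S \<longleftrightarrow> (p \<in> S \<longrightarrow> q \<in> S)"
proof
  show "(p \<^bold>\<longrightarrow> q) \<in> S \<Longrightarrow> p \<in> S \<longrightarrow> q \<in> S"
    using S_derives derives.ImpE[of S p q] derives.Assm by blast
next
  assume "p \<in> S \<longrightarrow> q \<in> S"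
  then have "insert p S \<turnstile> q"
    using S_cases[of p] derives_False derives.Assm[of q "insert p S"] by blast
  then show "(p \<^bold>\<longrightarrow> q) \<in> S" using S_derives derives.ImpI by blast
qed

lemma S_False: "\<^bold>\<bottom> \<notin> S"
  using S_consistent derives.Assm by blast

lemma S_Forall: "(\<^bold>\<forall>p) \<in> S \<longleftrightarrow> (\<forall>t. inst p t \<in> S)"
proof
  show "(\<^bold>\<forall>p) \<in> S \<Longrightarrow> \<forall>t. inst p t \<in> S"
    using S_derives derives.AllE derives.Assm by blast
next
  assume A: "\<forall>t. inst p t \<in> S"
  show "(\<^bold>\<forall>p) \<in> S"
  proof (rule ccontr)
    assume "(\<^bold>\<forall>p) \<notin> S"
    then have N: "(\<^bold>\<not>(\<^bold>\<forall>p)) \<in> S" by (simp add: S_Imp)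
    obtain n where n: "(\<^bold>\<not>(\<^bold>\<forall>p)) = from_nat n" by (metis from_nat_to_nat)
    have "consistent (T \<union> set (from_nat n # stage n))"
      unfolding consistent_def
    proof
      assume "T \<union> set (from_nat n # stage n) \<turnstile> \<^bold>\<bottom>"
      then have "S \<turnstile> \<^bold>\<bottom>"
        by (rule weakening) (use N in \<open>auto simp: S_def n\<close>)
      then show False using S_consistent by simp
    qed
    then have "(\<^bold>\<not>(inst p (fresh (stage n) (from_nat n)))) \<in> set (stage (Suc n))"
      by (simp add: witness_def flip: n)
    then have "(\<^bold>\<not>(inst p (fresh (stage n) (from_nat n)))) \<in> S" unfolding S_def by blast
    then show False using A by (simp add: S_Imp S_False)
  qed
qed

text \<open>Truth in the term structure, whose elements are the variables, up to provable equality.\<close>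

definition tsat :: "(nat \<Rightarrow> nat) \<Rightarrow> fm \<Rightarrow> bool" where
  "tsat f p \<longleftrightarrow> rename f p \<in> S"

definition teq :: "nat \<Rightarrow> nat \<Rightarrow> bool" where "teq x y \<longleftrightarrow> (x \<^bold>= y) \<in> S"

definition tmem :: "nat \<Rightarrow> nat \<Rightarrow> bool" where "tmem x y \<longleftrightarrow> (x \<^bold>\<in> y) \<in> S"

lemma tsat_simps [simp]:
  "tsat f (x \<^bold>\<in> y) \<longleftrightarrow> tmem (f x) (f y)"
  "tsat f (x \<^bold>= y) \<longleftrightarrow> teq (f x) (f y)"
  "\<not> tsat f \<^bold>\<bottom>"
  "tsat f (p \<^bold>\<longrightarrow> q) \<longleftrightarrow> (tsat f p \<longrightarrow> tsat f q)"
  "tsat f (\<^bold>\<forall>p) \<longleftrightarrow> (\<forall>a. tsat (case_nat a f) p)"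
proof -
  have "(\<lambda>n. case (case n of 0 \<Rightarrow> 0 | Suc n \<Rightarrow> Suc (f n)) of 0 \<Rightarrow> t | Suc n \<Rightarrow> n) = case_nat t f" for t
    by (auto simp: fun_eq_iff split: nat.splits)
  then show "tsat f (\<^bold>\<forall>p) \<longleftrightarrow> (\<forall>a. tsat (case_nat a f) p)"
    by (simp add: tsat_def S_Forall inst_def rename_rename)
qed (simp_all add: tsat_def teq_def tmem_def S_Imp S_False)

lemma teq_refl: "teq x x"
  unfolding teq_def by (intro S_derives derives.EqRefl)

text \<open>Leibniz's law for all formulas; symmetry and transitivity of \<open>teq\<close> and the
  congruence of \<open>tmem\<close> are its atomic instances.\<close>

lemma tsat_cong: "teq s t \<Longrightarrow> tsat (case_nat s f) p \<Longrightarrow> tsat (case_nat t f) p"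
proof -
  assume A: "teq s t" "tsat (case_nat s f) p"
  have *: "rename (case_nat t f) p = inst (rename (case_nat 0 (\<lambda>n. Suc (f n))) p) t" for t
    unfolding inst_def rename_rename
    by (rule arg_cong[where f="\<lambda>g. rename g p"]) (auto simp: fun_eq_iff split: nat.splits)
  show ?thesis
    using A unfolding tsat_def teq_def *
    by (intro S_derives derives.EqSubst[of _ s t]) (auto intro: derives.Assm)
qed

lemma teq_sym: "teq x y \<Longrightarrow> teq y x"
  using tsat_cong[of x y "\<lambda>_. x" "0 \<^bold>= 1"] teq_refl by simp

lemma teq_trans: "teq x y \<Longrightarrow> teq y z \<Longrightarrow> teq x z"
  using tsat_cong[of y z "\<lambda>_. x" "1 \<^bold>= 0"] by simp

lemma tmem_cong: "teq x x' \<Longrightarrow> teq y y' \<Longrightarrow> tmem x y \<Longrightarrow> tmem x' y'"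
  using tsat_cong[of x x' "\<lambda>_. y" "0 \<^bold>\<in> 1"] tsat_cong[of y y' "\<lambda>_. x'" "1 \<^bold>\<in> 0"] by simp

lemma tsat_T: "p \<in> T \<Longrightarrow> tsat f p"
  using rename_arity[of p f "\<lambda>n. n"] closed[of p] by (simp add: tsat_def rename_id S_def)

text \<open>The three axioms supply an empty set and an injective singleton map that avoids it, so
  there are infinitely many classes of variables and all of \<open>nat\<close> can serve as the
  universe.\<close>

lemma countable_model:
  assumes "pairing_ax \<in> T" "infinity_ax \<in> T" "extensionality_ax \<in> T"
  obtains E :: "nat \<Rightarrow> nat \<Rightarrow> bool" where "\<And>p e. p \<in> T \<Longrightarrow> sat E e p"
proof -
  have "\<forall>x y. \<exists>z. \<forall>w. tmem w z \<longleftrightarrow> teq w x \<or> teq w y"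
    using tsat_T[OF assms(1), of "\<lambda>_. 0"] unfolding pairing_ax_def upair_fm_def by simp metis
  moreover have "\<exists>e. \<forall>w. \<not> tmem w e"
    using tsat_T[OF assms(2), of "\<lambda>_. 0"] by (auto simp: infinity_ax_def empty_fm_def)
  moreover have "\<forall>x y. (\<forall>w. tmem w x \<longleftrightarrow> tmem w y) \<longrightarrow> teq x y"
    using tsat_T[OF assms(3), of "\<lambda>_. 0"] unfolding extensionality_ax_def by simp
  ultimately obtain h e where h: "\<And>x y w. tmem w (h x y) \<longleftrightarrow> teq w x \<or> teq w y"
    and e: "\<And>w. \<not> tmem w e" and ext: "\<And>x y. (\<And>w. tmem w x \<longleftrightarrow> tmem w y) \<Longrightarrow> teq x y"
    by metis
  obtain v :: "nat \<Rightarrow> nat" where v: "v ` UNIV = UNIV" "\<And>x y. v x = v y \<longleftrightarrow> teq x y"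
  proof (rule infinite_quotient_naming[of UNIV teq "\<lambda>x. h x x" e])
    show "teq (h x x) (h y y) = teq x y" for x y
    proof
      assume "teq (h x x) (h y y)"
      then have "tmem x (h y y)" using tmem_cong[of x x "h x x" "h y y"] h teq_refl by blast
      then show "teq x y" using h by blast
    next
      assume "teq x y"
      then have "tmem w (h x x) \<longleftrightarrow> tmem w (h y y)" for w
        using h teq_trans teq_sym by blast
      then show "teq (h x x) (h y y)" using ext by blast
    qed
    show "\<not> teq e (h x x)" for x
      using tmem_cong[of x x "h x x" e] e h teq_refl teq_sym by blast
  qed (blast intro: teq_refl teq_sym teq_trans)+
  define E where "E a b \<longleftrightarrow> (\<exists>x y. v x = a \<and> v y = b \<and> tmem x y)" for a b
  have E: "E (v x) (v y) \<longleftrightarrow> tmem x y" for x y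
    unfolding E_def v(2) using tmem_cong teq_refl by blast
  have *: "sat E (\<lambda>n. v (f n)) p \<longleftrightarrow> tsat f p" for f p
  proof (induction p arbitrary: f)
    case (Forall p)
    have "(\<forall>a. sat E (case_nat a (\<lambda>n. v (f n))) p) \<longleftrightarrow> (\<forall>b. sat E (case_nat (v b) (\<lambda>n. v (f n))) p)"
      using v(1) by (metis surjD)
    moreover have "case_nat (v b) (\<lambda>n. v (f n)) = (\<lambda>n. v (case_nat b f n))" for b
      by (auto simp: fun_eq_iff split: nat.splits)
    ultimately show ?case by (simp add: Forall)
  qed (simp_all add: E v(2))
  show ?thesis
  proof
    fix p and e :: "nat \<Rightarrow> nat"
    assume "p \<in> T"
    have "e = (\<lambda>n. v (inv v (e n)))" using v(1) by (simp add: surj_f_inv_f)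
    with *[of "\<lambda>n. inv v (e n)" p] tsat_T[OF \<open>p \<in> T\<close>] show "sat E e p" by simp
  qed
qed

end

section \<open>Definable predicates and functions\<close>

named_theorems dfi

locale membership =
  fixes E :: "'a \<Rightarrow> 'a \<Rightarrow> bool"  (infix "\<epsilon>" 50)
begin

text \<open>Definability with parameters over \<open>E\<close>: \<open>dfb P\<close> for predicates and \<open>dft t\<close> for functions of an
  assignment. The value \<open>\<rho> n\<close> says whether variable \<open>n\<close> of the formula is bound to an entry of
  the assignment or to a parameter.\<close>

definition dfb :: "((nat \<Rightarrow> 'a) \<Rightarrow> bool) \<Rightarrow> bool" where
  "dfb P \<longleftrightarrow> (\<exists>\<phi> \<rho>. \<forall>e. P e \<longleftrightarrow> sat E (\<lambda>n. case \<rho> n of Inl i \<Rightarrow> e i | Inr c \<Rightarrow> c) \<phi>)"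

text \<open>The value is put in front of the assignment, so that a function is treated through its
  graph and \<open>dfb\<close> remains the only notion of definability.\<close>

definition dft :: "((nat \<Rightarrow> 'a) \<Rightarrow> 'a) \<Rightarrow> bool" where
  "dft t \<longleftrightarrow> dfb (\<lambda>e. e 0 = t (\<lambda>n. e (Suc n)))"

text \<open>The language has no terms but variables, so only entries and parameters can be
  substituted directly. Other functions enter through an existential quantifier, in
  \<open>dfb_comp\<close>.\<close>

definition atom :: "((nat \<Rightarrow> 'a) \<Rightarrow> 'a) \<Rightarrow> bool" where
  "atom a \<longleftrightarrow> (\<exists>i. a = (\<lambda>e. e i)) \<or> (\<exists>c. a = (\<lambda>e. c))"

lemma atom_simps [simp]: "atom (\<lambda>e. e i)" "atom (\<lambda>e. c)"
  by (auto simp: atom_def)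

lemma atom_case:
  "atom a \<Longrightarrow> (\<And>m. atom (b m)) \<Longrightarrow> atom (\<lambda>e. case n of 0 \<Rightarrow> a e | Suc m \<Rightarrow> b m e)"
  by (cases n) auto

lemma dfb_subst:
  assumes "dfb P" and "\<And>n. atom (\<lambda>e. \<sigma> e n)"
  shows "dfb (\<lambda>e. P (\<sigma> e))"
proof -
  obtain \<phi> \<rho> where P: "\<And>e. P e \<longleftrightarrow> sat E (\<lambda>n. case \<rho> n of Inl i \<Rightarrow> e i | Inr c \<Rightarrow> c) \<phi>"
    using assms(1) unfolding dfb_def by blast
  have "\<forall>n. \<exists>r. (\<lambda>e. \<sigma> e n) = (\<lambda>e. case r of Inl i \<Rightarrow> e i | Inr c \<Rightarrow> c)"
  proof
    fix n
    from assms(2)[of n] show "\<exists>r. (\<lambda>e. \<sigma> e n) = (\<lambda>e. case r of Inl i \<Rightarrow> e i | Inr c \<Rightarrow> c)"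
      unfolding atom_def
    proof (elim disjE exE)
      fix i assume "(\<lambda>e. \<sigma> e n) = (\<lambda>e. e i)"
      then show ?thesis by (intro exI[of _ "Inl i"]) simp
    next
      fix c assume "(\<lambda>e. \<sigma> e n) = (\<lambda>e. c)"
      then show ?thesis by (intro exI[of _ "Inr c"]) simp
    qed
  qed
  then obtain r where "\<forall>n. (\<lambda>e. \<sigma> e n) = (\<lambda>e. case r n of Inl i \<Rightarrow> e i | Inr c \<Rightarrow> c)"
    by metis
  then have r: "\<sigma> e n = (case r n of Inl i \<Rightarrow> e i | Inr c \<Rightarrow> c)" for e n
    by (metis (no_types))
  have "(\<lambda>n. case \<rho> n of Inl i \<Rightarrow> \<sigma> e i | Inr c \<Rightarrow> c)
      = (\<lambda>n. case (case \<rho> n of Inl i \<Rightarrow> r i | Inr c \<Rightarrow> Inr c) of Inl i \<Rightarrow> e i | Inr c \<Rightarrow> c)" for e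
    by (auto simp: fun_eq_iff r split: sum.splits)
  then show ?thesis
    unfolding dfb_def P
    by (intro exI[of _ \<phi>] exI[of _ "\<lambda>n. case \<rho> n of Inl i \<Rightarrow> r i | Inr c \<Rightarrow> Inr c"]) simp
qed

lemma dfb_mem_eq_var:
  "dfb (\<lambda>e. e i \<epsilon> e j)" "dfb (\<lambda>e. e i = e j)"
proof -
  show "dfb (\<lambda>e. e i \<epsilon> e j)" unfolding dfb_def
    by (intro exI[of _ "i \<^bold>\<in> j"] exI[of _ Inl]) simp
  show "dfb (\<lambda>e. e i = e j)" unfolding dfb_def
    by (intro exI[of _ "i \<^bold>= j"] exI[of _ Inl]) simp
qed

lemma dfb_imp [dfi]:
  assumes "dfb P" "dfb Q" shows "dfb (\<lambda>e. P e \<longrightarrow> Q e)"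
proof -
  obtain \<phi> \<rho> where P: "\<And>e. P e \<longleftrightarrow> sat E (\<lambda>n. case \<rho> n of Inl i \<Rightarrow> e i | Inr c \<Rightarrow> c) \<phi>"
    using assms(1) unfolding dfb_def by blast
  obtain \<psi> \<tau> where Q: "\<And>e. Q e \<longleftrightarrow> sat E (\<lambda>n. case \<tau> n of Inl i \<Rightarrow> e i | Inr c \<Rightarrow> c) \<psi>"
    using assms(2) unfolding dfb_def by blast
  \<comment> \<open>Even and odd indices keep the variables of the two formulas apart.\<close>
  let ?r = "\<lambda>n. if even n then \<rho> (n div 2) else \<tau> (n div 2)"
  show ?thesis unfolding dfb_def P Q
    by (intro exI[of _ "rename (\<lambda>n. 2 * n) \<phi> \<^bold>\<longrightarrow> rename (\<lambda>n. Suc (2 * n)) \<psi>"] exI[of _ ?r])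
      (simp add: sat_rename)
qed

lemma dfb_const [dfi]: "dfb (\<lambda>e. c)"
proof (cases c)
  case False
  then show ?thesis unfolding dfb_def by (intro exI[of _ "\<^bold>\<bottom>"] exI[of _ Inl]) simp
next
  case True
  then show ?thesis unfolding dfb_def by (intro exI[of _ "\<^bold>\<not>\<^bold>\<bottom>"] exI[of _ Inl]) simp
qed

lemma dfb_not [dfi]: "dfb P \<Longrightarrow> dfb (\<lambda>e. \<not> P e)"
  using dfb_imp[OF _ dfb_const[of False], of P] by simp

lemma dfb_or [dfi]: "dfb P \<Longrightarrow> dfb Q \<Longrightarrow> dfb (\<lambda>e. P e \<or> Q e)"
  using dfb_imp[OF dfb_not[of P], of Q] by (simp add: imp_conv_disj)

lemma dfb_and [dfi]: "dfb P \<Longrightarrow> dfb Q \<Longrightarrow> dfb (\<lambda>e. P e \<and> Q e)"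
  using dfb_not[OF dfb_or[OF dfb_not[of P] dfb_not[of Q]]] by simp

lemma dfb_iff [dfi]: "dfb P \<Longrightarrow> dfb Q \<Longrightarrow> dfb (\<lambda>e. P e \<longleftrightarrow> Q e)"
  using dfb_and[OF dfb_imp[of P Q] dfb_imp[of Q P]] by (simp add: iff_conv_conj_imp)

lemma dfb_all [dfi]:
  assumes "dfb (\<lambda>e. P (\<lambda>n. e (Suc n)) (e 0))"
  shows "dfb (\<lambda>e. \<forall>x. P e x)"
proof -
  obtain \<phi> \<rho> where P: "\<And>e. P (\<lambda>n. e (Suc n)) (e 0)
      \<longleftrightarrow> sat E (\<lambda>n. case \<rho> n of Inl i \<Rightarrow> e i | Inr c \<Rightarrow> c) \<phi>"
    using assms unfolding dfb_def by blast
  have P': "P e x \<longleftrightarrow> sat E (\<lambda>n. case \<rho> n of Inl i \<Rightarrow> case_nat x e i | Inr c \<Rightarrow> c) \<phi>" for e x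
    using P[of "case_nat x e"] by simp
  \<comment> \<open>All variables of \<open>\<phi>\<close> that stand for entry 0 become the bound
    variable; the others move up by one, while the entries they stand for move down by one.\<close>
  let ?g = "\<lambda>n. case \<rho> n of Inl 0 \<Rightarrow> 0 | _ \<Rightarrow> Suc n"
  let ?r = "\<lambda>n. case \<rho> n of Inl (Suc i) \<Rightarrow> Inl i | Inl 0 \<Rightarrow> Inl 0 | Inr c \<Rightarrow> Inr c"
  have "(\<lambda>n. case \<rho> n of Inl i \<Rightarrow> case_nat x e i | Inr c \<Rightarrow> c)
    = (\<lambda>n. case_nat x (\<lambda>m. case ?r m of Inl i \<Rightarrow> e i | Inr c \<Rightarrow> c) (?g n))" for x e
    by (auto simp: fun_eq_iff split: sum.splits nat.splits)
  then show ?thesis unfolding dfb_def P'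
    by (intro exI[of _ "\<^bold>\<forall>(rename ?g \<phi>)"] exI[of _ ?r]) (simp add: sat_rename)
qed

lemma dfb_ex [dfi]: "dfb (\<lambda>e. P (\<lambda>n. e (Suc n)) (e 0)) \<Longrightarrow> dfb (\<lambda>e. \<exists>x. P e x)"
  using dfb_not[OF dfb_all[OF dfb_not], of P] by simp

lemma dft_var [dfi]: "dft (\<lambda>e. e i)"
  unfolding dft_def by (rule dfb_mem_eq_var)

lemma dft_const [dfi]: "dft (\<lambda>e. c)"
  unfolding dft_def
  using dfb_subst[OF dfb_mem_eq_var(2)[of 0 1], of "\<lambda>e n. case n of 0 \<Rightarrow> e 0 | Suc _ \<Rightarrow> c"]
  by (simp add: atom_case)

lemma dft_shift: "dft t \<Longrightarrow> dft (\<lambda>e. t (\<lambda>n. e (k + n)))"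
  unfolding dft_def
  by (drule dfb_subst[of _ "\<lambda>e n. case n of 0 \<Rightarrow> e 0 | Suc m \<Rightarrow> e (Suc (k + m))"])
    (auto intro: atom_case)

lemma dfb_comp:
  assumes "dfb (\<lambda>e. P (e 0) (\<lambda>n. e (Suc n)))" "dft t"
  shows "dfb (\<lambda>e. P (t e) e)"
proof -
  have "dfb (\<lambda>e. \<exists>x. x = t e \<and> P x e)"
    by (intro dfb_ex dfb_and) (use assms in \<open>auto simp: dft_def\<close>)
  then show ?thesis by simp
qed

definition D1 :: "('a \<Rightarrow> bool) \<Rightarrow> bool" where "D1 P \<longleftrightarrow> dfb (\<lambda>e. P (e 0))"
definition D2 :: "('a \<Rightarrow> 'a \<Rightarrow> bool) \<Rightarrow> bool" where "D2 P \<longleftrightarrow> dfb (\<lambda>e. P (e 0) (e 1))"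
definition D3 :: "('a \<Rightarrow> 'a \<Rightarrow> 'a \<Rightarrow> bool) \<Rightarrow> bool" where
  "D3 P \<longleftrightarrow> dfb (\<lambda>e. P (e 0) (e 1) (e 2))"
definition D4 :: "('a \<Rightarrow> 'a \<Rightarrow> 'a \<Rightarrow> 'a \<Rightarrow> bool) \<Rightarrow> bool" where
  "D4 P \<longleftrightarrow> dfb (\<lambda>e. P (e 0) (e 1) (e 2) (e 3))"
definition F1 :: "('a \<Rightarrow> 'a) \<Rightarrow> bool" where "F1 f \<longleftrightarrow> dft (\<lambda>e. f (e 0))"
definition F2 :: "('a \<Rightarrow> 'a \<Rightarrow> 'a) \<Rightarrow> bool" where "F2 f \<longleftrightarrow> dft (\<lambda>e. f (e 0) (e 1))"
definition F3 :: "('a \<Rightarrow> 'a \<Rightarrow> 'a \<Rightarrow> 'a) \<Rightarrow> bool" where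
  "F3 f \<longleftrightarrow> dft (\<lambda>e. f (e 0) (e 1) (e 2))"

lemma D1I:
  assumes "D1 P" "dft t" shows "dfb (\<lambda>e. P (t e))"
proof -
  have "dfb (\<lambda>e. P (e 0))" using assms(1) by (simp add: D1_def)
  from dfb_comp[of "\<lambda>x e. P x", OF this assms(2)] show ?thesis .
qed

lemma D2I:
  assumes "D2 P" "dft s" "dft t" shows "dfb (\<lambda>e. P (s e) (t e))"
proof -
  have "dfb (\<lambda>e. P (e 0) (e 1))" using assms(1) by (simp add: D2_def)
  then have "dfb (\<lambda>e. P (e 1) (e 0))"
    by (drule_tac dfb_subst[of _ "\<lambda>e n. case n of 0 \<Rightarrow> e 1 | Suc _ \<Rightarrow> e 0"]) (auto intro: atom_case)
  then have "dfb (\<lambda>e. P (e 0) (t e))"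
    using dfb_comp[of "\<lambda>x e. P (e 0) x", OF _ assms(3)] by simp
  then have "dfb (\<lambda>e. P (e 0) (t (\<lambda>n. e (Suc n))))"
    using dfb_comp[of "\<lambda>x e. P (e 0) x" "\<lambda>e. t (\<lambda>n. e (1 + n))"] dft_shift[OF assms(3), of 1]
      \<open>dfb (\<lambda>e. P (e 1) (e 0))\<close> by simp
  from dfb_comp[of "\<lambda>x e. P x (t e)", OF this assms(2)] show ?thesis .
qed

lemma dfb_mem [dfi]: "dft s \<Longrightarrow> dft t \<Longrightarrow> dfb (\<lambda>e. s e \<epsilon> t e)"
  by (rule D2I) (auto simp: D2_def intro: dfb_mem_eq_var)

lemma dfb_eq [dfi]: "dft s \<Longrightarrow> dft t \<Longrightarrow> dfb (\<lambda>e. s e = t e)"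
  by (rule D2I) (auto simp: D2_def intro: dfb_mem_eq_var)

lemma D3I:
  assumes "D3 P" "dft r" "dft s" "dft t" shows "dfb (\<lambda>e. P (r e) (s e) (t e))"
proof -
  have "dfb (\<lambda>e. P (e 0) (e 1) (e 2))" using assms(1) by (simp add: D3_def)
  moreover note dft_shift[OF assms(2), of 3] dft_shift[OF assms(3), of 3] dft_shift[OF assms(4), of 3]
  ultimately have "dfb (\<lambda>e. \<exists>z y x. x = r e \<and> y = s e \<and> z = t e \<and> P x y z)"
    by (intro dfi) (simp_all add: numeral_2_eq_2 numeral_3_eq_3)
  then show ?thesis by simp
qed

lemma D4I:
  assumes "D4 P" "dft q" "dft r" "dft s" "dft t" shows "dfb (\<lambda>e. P (q e) (r e) (s e) (t e))"
proof -
  have "dfb (\<lambda>e. P (e 0) (e 1) (e 2) (e 3))" using assms(1) by (simp add: D4_def)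
  moreover note dft_shift[OF assms(2), of 4] dft_shift[OF assms(3), of 4] dft_shift[OF assms(4), of 4]
    dft_shift[OF assms(5), of 4]
  ultimately have "dfb (\<lambda>e. \<exists>z y x w. w = q e \<and> x = r e \<and> y = s e \<and> z = t e \<and> P w x y z)"
    by (intro dfi) (simp_all add: numeral_2_eq_2 numeral_3_eq_3 eval_nat_numeral)
  then show ?thesis by simp
qed

lemma F1I:
  assumes "F1 f" "dft t" shows "dft (\<lambda>e. f (t e))"
proof -
  have "D2 (\<lambda>x y. x = f y)" using assms(1) by (simp add: F1_def dft_def D2_def)
  then have "dfb (\<lambda>e. e 0 = f (t (\<lambda>n. e (1 + n))))"
    by (rule D2I) (intro dfi dft_shift assms)+
  then show ?thesis by (simp add: dft_def)
qed

lemma F2I: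
  assumes "F2 f" "dft s" "dft t" shows "dft (\<lambda>e. f (s e) (t e))"
proof -
  have "D3 (\<lambda>x y z. x = f y z)" using assms(1) by (simp add: F2_def dft_def D3_def numeral_2_eq_2)
  then have "dfb (\<lambda>e. e 0 = f (s (\<lambda>n. e (1 + n))) (t (\<lambda>n. e (1 + n))))"
    by (rule D3I) (intro dfi dft_shift assms)+
  then show ?thesis by (simp add: dft_def)
qed

lemma F3I:
  assumes "F3 f" "dft r" "dft s" "dft t" shows "dft (\<lambda>e. f (r e) (s e) (t e))"
proof -
  have "D4 (\<lambda>x y z w. x = f y z w)"
    using assms(1) by (simp add: F3_def dft_def D4_def numeral_2_eq_2 numeral_3_eq_3)
  then have "dfb (\<lambda>e. e 0 = f (r (\<lambda>n. e (1 + n))) (s (\<lambda>n. e (1 + n))) (t (\<lambda>n. e (1 + n))))"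
    by (rule D4I) (intro dfi dft_shift assms)+
  then show ?thesis by (simp add: dft_def)
qed

lemma dft_if [dfi]:
  assumes "dfb P" "dft s" "dft t" shows "dft (\<lambda>e. if P e then s e else t e)"
proof -
  have P: "dfb (\<lambda>e. P (\<lambda>n. e (Suc n)))"
    by (rule dfb_subst[OF assms(1)]) simp
  have "dfb (\<lambda>e. (P (\<lambda>n. e (Suc n)) \<longrightarrow> e 0 = s (\<lambda>n. e (1 + n)))
      \<and> (\<not> P (\<lambda>n. e (Suc n)) \<longrightarrow> e 0 = t (\<lambda>n. e (1 + n))))"
    by (intro dfb_and dfb_imp dfb_not P dfb_eq dft_var dft_shift assms)
  moreover have "(\<lambda>e. (P (\<lambda>n. e (Suc n)) \<longrightarrow> e 0 = s (\<lambda>n. e (1 + n)))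
      \<and> (\<not> P (\<lambda>n. e (Suc n)) \<longrightarrow> e 0 = t (\<lambda>n. e (1 + n))))
    = (\<lambda>e. e 0 = (if P (\<lambda>n. e (Suc n)) then s (\<lambda>n. e (Suc n)) else t (\<lambda>n. e (Suc n))))"
    by auto
  ultimately show ?thesis by (simp add: dft_def)
qed

text \<open>The element whose members are exactly the solutions of \<open>P\<close>; an arbitrary fixed element if there
  is none, so that \<open>col\<close> stays definable in that case.\<close>

definition isset :: "('a \<Rightarrow> bool) \<Rightarrow> bool" where
  "isset P \<longleftrightarrow> (\<exists>x. \<forall>z. z \<epsilon> x \<longleftrightarrow> P z)"

definition col :: "('a \<Rightarrow> bool) \<Rightarrow> 'a" where
  "col P = (if isset P then SOME x. \<forall>z. z \<epsilon> x \<longleftrightarrow> P z else undefined)"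

lemma mem_col_isset: "isset P \<Longrightarrow> z \<epsilon> col P \<longleftrightarrow> P z"
  unfolding isset_def col_def using someI_ex[of "\<lambda>x. \<forall>z. z \<epsilon> x \<longleftrightarrow> P z"] by auto

end

section \<open>Set theory inside a model of ZF\<close>

locale zf = membership E for E :: "'a \<Rightarrow> 'a \<Rightarrow> bool"  (infix "\<epsilon>" 50) +
  assumes ext: "(\<And>z. z \<epsilon> x \<longleftrightarrow> z \<epsilon> y) \<Longrightarrow> x = y"
    and foundation: "y \<epsilon> x \<Longrightarrow> \<exists>y. y \<epsilon> x \<and> (\<forall>z. z \<epsilon> y \<longrightarrow> \<not> z \<epsilon> x)"
    and pairing: "\<exists>z. \<forall>w. w \<epsilon> z \<longleftrightarrow> w = x \<or> w = y"
    and union: "\<exists>u. \<forall>z. z \<epsilon> u \<longleftrightarrow> (\<exists>y. y \<epsilon> x \<and> z \<epsilon> y)"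
    and power: "\<exists>u. \<forall>z. z \<epsilon> u \<longleftrightarrow> (\<forall>w. w \<epsilon> z \<longrightarrow> w \<epsilon> x)"
    and infinity: "\<exists>i. (\<exists>x. x \<epsilon> i \<and> (\<forall>z. \<not> z \<epsilon> x))
        \<and> (\<forall>x. x \<epsilon> i \<longrightarrow> (\<exists>y. y \<epsilon> i \<and> (\<forall>z. z \<epsilon> y \<longleftrightarrow> z \<epsilon> x \<or> z = x)))"
    and separation_sat: "\<exists>b. \<forall>x. x \<epsilon> b \<longleftrightarrow> x \<epsilon> a \<and> sat E (case_nat x e) \<phi>"
    and replacement_sat: "(\<And>x. x \<epsilon> a \<Longrightarrow> \<exists>!y. sat E (case_nat y (case_nat x e)) \<phi>) \<Longrightarrow>
      \<exists>b. \<forall>x. x \<epsilon> a \<longrightarrow> (\<exists>y. y \<epsilon> b \<and> sat E (case_nat y (case_nat x e)) \<phi>)"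

lemma sat_lift_below:
  "sat E (case_nat x (case_nat b e)) (lift (Suc 0) p) = sat E (case_nat x e) p"
  "sat E (case_nat x (case_nat y (case_nat b e))) (lift 2 p) = sat E (case_nat x (case_nat y e)) p"
  unfolding sat_lift
  by (rule arg_cong[where f="\<lambda>e. sat E e p"]; auto simp: fun_eq_iff split: nat.splits)+

lemma sat_separation_ax: "sat E e (separation_ax p) \<longleftrightarrow>
    (\<forall>e a. \<exists>b. \<forall>x. E x b \<longleftrightarrow> E x a \<and> sat E (case_nat x (case_nat a e)) p)"
  unfolding separation_ax_def sat_univ_closure
  by (simp add: sat_lift_below) (intro iff_allI iff_exI, blast)

lemma sat_replacement_ax: "sat E e (replacement_ax p) \<longleftrightarrow>
    (\<forall>e a. (\<forall>x. E x a \<longrightarrow> (\<exists>!y. sat E (case_nat y (case_nat x (case_nat a e))) p)) \<longrightarrow>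
      (\<exists>b. \<forall>x. E x a \<longrightarrow> (\<exists>y. E y b \<and> sat E (case_nat y (case_nat x (case_nat a e))) p)))"
proof -
  have "(\<exists>z. \<forall>y. (P y \<longrightarrow> y = z) \<and> (y = z \<longrightarrow> P y)) \<longleftrightarrow> (\<exists>!y. P y)" for P :: "'a \<Rightarrow> bool"
    by blast
  then show ?thesis
    unfolding replacement_ax_def sat_univ_closure Unique_def
    by (simp add: sat_lift_below)
qed

text \<open>In the axiom schemes the formula has an index for the set in question, in
  \<open>zf\<close> it has none. The renamings \<open>?p\<close> and \<open>?q\<close> skip that
  index; the other direction treats the set as one more parameter.\<close>

lemma zf_iff: "zf E \<longleftrightarrow> (\<forall>p\<in>ZF. \<forall>e. sat E e p)"
proof
  assume "zf E"
  then interpret zf E .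
  have "sat E e extensionality_ax" "sat E e foundation_ax" "sat E e pairing_ax" "sat E e union_ax"
    "sat E e powerset_ax" "sat E e infinity_ax" for e
  proof -
    show "sat E e extensionality_ax" by (simp add: extensionality_ax_def) (metis ext)
    show "sat E e foundation_ax" by (simp add: foundation_ax_def) (metis foundation)
    show "sat E e pairing_ax"
      using pairing by (simp add: pairing_ax_def upair_fm_def) (metis (no_types))
    show "sat E e union_ax"
      using union by (simp add: union_ax_def) (metis (no_types))
    show "sat E e powerset_ax"
      using power by (simp add: powerset_ax_def subset_fm_def) (metis (no_types))
    show "sat E e infinity_ax"
      using infinity by (simp add: infinity_ax_def empty_fm_def succ_fm_def) (metis (no_types))
  qed
  moreover have "sat E e (separation_ax p)" for p e
    by (simp add: sat_separation_ax separation_sat)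
  moreover have "sat E e (replacement_ax p)" for p e
    unfolding sat_replacement_ax using replacement_sat by blast
  ultimately show "\<forall>p\<in>ZF. \<forall>e. sat E e p" by (auto simp: ZF_def)
next
  assume A: "\<forall>p\<in>ZF. \<forall>e. sat E e p"
  then have ax: "sat E e extensionality_ax" "sat E e foundation_ax" "sat E e pairing_ax" "sat E e union_ax"
    "sat E e powerset_ax" "sat E e infinity_ax" "sat E e (separation_ax p)" "sat E e (replacement_ax p)" for e p
    by (auto simp: ZF_def)
  let ?p = "\<lambda>p. rename (\<lambda>n. case n of 0 \<Rightarrow> 0 | Suc n \<Rightarrow> Suc (Suc n)) p"
  let ?q = "\<lambda>p. rename (\<lambda>n. case n of 0 \<Rightarrow> 0 | Suc n \<Rightarrow> case n of 0 \<Rightarrow> Suc 0 | Suc n \<Rightarrow> Suc (Suc (Suc n))) p"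
  have p: "sat E (case_nat x (case_nat a e)) (?p p) \<longleftrightarrow> sat E (case_nat x e) p" for x a e p
    unfolding sat_rename by (rule arg_cong[where f="\<lambda>e. sat E e p"]) (auto simp: fun_eq_iff split: nat.splits)
  have q: "sat E (case_nat y (case_nat x (case_nat a e))) (?q p) \<longleftrightarrow> sat E (case_nat y (case_nat x e)) p" for y x a e p
    unfolding sat_rename by (rule arg_cong[where f="\<lambda>e. sat E e p"]) (auto simp: fun_eq_iff split: nat.splits)
  show "zf E"
  proof
    show "(\<And>z. E z x \<longleftrightarrow> E z y) \<Longrightarrow> x = y" for x y
      using ax(1) unfolding extensionality_ax_def by simp
    show "E y x \<Longrightarrow> \<exists>y. E y x \<and> (\<forall>z. E z y \<longrightarrow> \<not> E z x)" for x y
      using ax(2) unfolding foundation_ax_def by simp metis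
    show "\<exists>z. \<forall>w. E w z \<longleftrightarrow> w = x \<or> w = y" for x y
      using ax(3) unfolding pairing_ax_def upair_fm_def by simp metis
    show "\<exists>u. \<forall>z. E z u \<longleftrightarrow> (\<exists>y. E y x \<and> E z y)" for x
      using ax(4) unfolding union_ax_def by simp metis
    show "\<exists>u. \<forall>z. E z u \<longleftrightarrow> (\<forall>w. E w z \<longrightarrow> E w x)" for x
      using ax(5) unfolding powerset_ax_def subset_fm_def by simp metis
    show "\<exists>i. (\<exists>x. E x i \<and> (\<forall>z. \<not> E z x))
        \<and> (\<forall>x. E x i \<longrightarrow> (\<exists>y. E y i \<and> (\<forall>z. E z y \<longleftrightarrow> E z x \<or> z = x)))"
      using ax(6) unfolding infinity_ax_def empty_fm_def succ_fm_def by simp metis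
    show "\<exists>b. \<forall>x. E x b \<longleftrightarrow> E x a \<and> sat E (case_nat x e) \<phi>" for a e \<phi>
      using ax(7)[of _ "?p \<phi>"] unfolding sat_separation_ax p by blast
    show "\<exists>b. \<forall>x. E x a \<longrightarrow> (\<exists>y. E y b \<and> sat E (case_nat y (case_nat x e)) \<phi>)"
      if "\<And>x. E x a \<Longrightarrow> \<exists>!y. sat E (case_nat y (case_nat x e)) \<phi>" for a e \<phi>
      using ax(8)[of _ "?q \<phi>"] that unfolding sat_replacement_ax q by blast
  qed
qed

section \<open>Separation, replacement and the basic operations on sets\<close>

context zf
begin

lemma isset_sub:
  assumes "D1 P" and "\<And>z. P z \<Longrightarrow> z \<epsilon> a" shows "isset P"
proof -
  obtain \<phi> \<rho> where "\<forall>e::nat \<Rightarrow> 'a. P (e 0) \<longleftrightarrow> sat E (\<lambda>n. case \<rho> n of Inl i \<Rightarrow> e i | Inr c \<Rightarrow> c) \<phi>"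
    using assms(1) unfolding D1_def dfb_def by blast
  note P = this[rule_format]
  \<comment> \<open>\<open>P\<close> depends on entry 0 only, so under a constant assignment all
    variables that stand for entries can be identified with the element. The remaining indices hold
    the parameters.\<close>
  let ?e = "\<lambda>n. case \<rho> n of Inl i \<Rightarrow> undefined | Inr c \<Rightarrow> c"
  let ?p = "rename (\<lambda>n. case \<rho> n of Inl i \<Rightarrow> 0 | Inr c \<Rightarrow> Suc n) \<phi>"
  have "sat E (case_nat x ?e) ?p \<longleftrightarrow> P x" for x
    unfolding P[of "\<lambda>_. x"] sat_rename
    by (rule arg_cong[where f="\<lambda>e. sat E e \<phi>"]) (auto simp: fun_eq_iff split: sum.splits)
  then show ?thesis
    using separation_sat[of a ?e ?p] assms(2) unfolding isset_def by blast
qed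

definition sep :: "'a \<Rightarrow> ('a \<Rightarrow> bool) \<Rightarrow> 'a" where "sep a P = col (\<lambda>z. z \<epsilon> a \<and> P z)"

lemma mem_sep:
  assumes "D1 P" shows "z \<epsilon> sep a P \<longleftrightarrow> z \<epsilon> a \<and> P z"
proof -
  have "D1 (\<lambda>z. z \<epsilon> a \<and> P z)" unfolding D1_def by (intro dfi D1I[OF assms])
  then show ?thesis
    unfolding sep_def by (intro mem_col_isset isset_sub[of _ a]) auto
qed

lemma replacement_D2:
  assumes "D2 R" and "\<And>x. x \<epsilon> a \<Longrightarrow> \<exists>!y. R x y"
  shows "\<exists>b. \<forall>x. x \<epsilon> a \<longrightarrow> (\<exists>y. y \<epsilon> b \<and> R x y)"
proof -
  obtain \<phi> \<rho> where "\<forall>e::nat \<Rightarrow> 'a. R (e 0) (e 1) \<longleftrightarrow> sat E (\<lambda>n. case \<rho> n of Inl i \<Rightarrow> e i | Inr c \<Rightarrow> c) \<phi>"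
    using assms(1) unfolding D2_def dfb_def by blast
  note P = this[rule_format]
  let ?e = "\<lambda>n. case \<rho> n of Inl i \<Rightarrow> undefined | Inr c \<Rightarrow> c"
  let ?p = "rename (\<lambda>n. case \<rho> n of Inl i \<Rightarrow> if i = 0 then 1 else 0 | Inr c \<Rightarrow> Suc (Suc n)) \<phi>"
  have "sat E (case_nat y (case_nat x ?e)) ?p \<longleftrightarrow> R x y" for x y
    using P[of "\<lambda>n. if n = 0 then x else y"] unfolding sat_rename
    by (simp, intro arg_cong[where f="\<lambda>e. sat E e \<phi>"]) (auto simp: fun_eq_iff split: sum.splits)
  then show ?thesis
    using replacement_sat[of a ?e ?p] assms(2) by simp
qed

lemma ext_iff: "x = y \<longleftrightarrow> (\<forall>z. z \<epsilon> x \<longleftrightarrow> z \<epsilon> y)"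
  using ext by blast

lemma col_eq_iff: "y = col P \<longleftrightarrow> (if isset P then \<forall>z. z \<epsilon> y \<longleftrightarrow> P z else y = undefined)"
  using mem_col_isset[of P] by (auto simp: ext_iff) (simp_all add: col_def)

lemma dft_col [dfi]:
  assumes "dfb (\<lambda>e. P (\<lambda>n. e (Suc n)) (e 0))"
  shows "dft (\<lambda>e. col (P e))"
proof -
  have 1: "dfb (\<lambda>e. P (\<lambda>n. e (Suc (Suc (Suc n)))) (e 0))"
    using dfb_subst[OF assms, of "\<lambda>e n. case n of 0 \<Rightarrow> e 0 | Suc n \<Rightarrow> e (Suc (Suc (Suc n)))"]
    by (simp add: atom_case)
  have 2: "dfb (\<lambda>e. P (\<lambda>n. e (Suc (Suc n))) (e 0))"
    using dfb_subst[OF assms, of "\<lambda>e n. case n of 0 \<Rightarrow> e 0 | Suc n \<Rightarrow> e (Suc (Suc n))"]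
    by (simp add: atom_case)
  have "dfb (\<lambda>e. ((\<exists>x. \<forall>z. z \<epsilon> x \<longleftrightarrow> P (\<lambda>n. e (Suc n)) z) \<longrightarrow> (\<forall>z. z \<epsilon> e 0 \<longleftrightarrow> P (\<lambda>n. e (Suc n)) z))
      \<and> (\<not> (\<exists>x. \<forall>z. z \<epsilon> x \<longleftrightarrow> P (\<lambda>n. e (Suc n)) z) \<longrightarrow> e 0 = undefined))"
    by (intro dfi 1 2)
  then show ?thesis
    unfolding dft_def col_eq_iff isset_def[symmetric] by (simp add: if_bool_eq_conj)
qed

lemma dft_sep [dfi]: "dft a \<Longrightarrow> dfb (\<lambda>e. P (\<lambda>n. e (Suc n)) (e 0)) \<Longrightarrow> dft (\<lambda>e. sep (a e) (P e))"
  unfolding sep_def using dft_shift[of a 1] by (intro dft_col dfi) auto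

definition emp where "emp = col (\<lambda>_. False)"
definition upr where "upr x y = col (\<lambda>z. z = x \<or> z = y)"
definition uni where "uni x = col (\<lambda>z. \<exists>y. y \<epsilon> x \<and> z \<epsilon> y)"
definition sub where "sub x y \<longleftrightarrow> (\<forall>z. z \<epsilon> x \<longrightarrow> z \<epsilon> y)"
definition pw where "pw x = col (\<lambda>z. sub z x)"
definition cup where "cup x y = col (\<lambda>z. z \<epsilon> x \<or> z \<epsilon> y)"
definition suc where "suc x = col (\<lambda>z. z \<epsilon> x \<or> z = x)"
definition pair where "pair x y = upr (upr x x) (upr x y)"
definition rep where "rep a F = col (\<lambda>z. \<exists>x. x \<epsilon> a \<and> z = F x)"

lemma mem_emp [simp]: "\<not> x \<epsilon> emp"
  using isset_sub[of "\<lambda>_. False"] mem_col_isset[of "\<lambda>_. False"]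
  by (simp add: emp_def D1_def dfb_const)

lemma mem_upr [simp]: "z \<epsilon> upr x y \<longleftrightarrow> z = x \<or> z = y"
  unfolding upr_def by (rule mem_col_isset) (simp add: isset_def pairing)

lemma mem_uni [simp]: "z \<epsilon> uni x \<longleftrightarrow> (\<exists>y. y \<epsilon> x \<and> z \<epsilon> y)"
  unfolding uni_def by (rule mem_col_isset) (simp add: isset_def union)

lemma mem_pw [simp]: "z \<epsilon> pw x \<longleftrightarrow> sub z x"
  unfolding pw_def sub_def by (rule mem_col_isset) (simp add: isset_def power)

lemma mem_cup [simp]: "z \<epsilon> cup x y \<longleftrightarrow> z \<epsilon> x \<or> z \<epsilon> y"
  unfolding cup_def by (rule mem_col_isset) (unfold isset_def, rule exI[of _ "uni (upr x y)"], auto)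

lemma mem_suc [simp]: "z \<epsilon> suc x \<longleftrightarrow> z \<epsilon> x \<or> z = x"
  unfolding suc_def by (rule mem_col_isset) (unfold isset_def, rule exI[of _ "cup x (upr x x)"], auto)

lemma emp_iff: "x = emp \<longleftrightarrow> (\<forall>z. \<not> z \<epsilon> x)"
  by (auto simp: ext_iff)

lemma upr_eq: "upr x y = upr a b \<longleftrightarrow> x = a \<and> y = b \<or> x = b \<and> y = a"
  by (auto simp: ext_iff[of "upr _ _"])

lemma pair_eq [simp]: "pair x y = pair a b \<longleftrightarrow> x = a \<and> y = b"
  unfolding pair_def by (auto simp: upr_eq)

lemma F2_basic: "F2 upr" "F2 cup" "F2 pair"
  and F1_basic: "F1 uni" "F1 pw" "F1 suc" and D2_sub: "D2 sub"
proof -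
  show "F2 upr" "F2 cup" "F1 uni" "F1 suc"
    unfolding F2_def F1_def upr_def cup_def uni_def suc_def by (intro dfi)+
  show "D2 sub" unfolding D2_def sub_def by (intro dfi)
  show "F1 pw" unfolding F1_def pw_def sub_def by (intro dfi)
  show "F2 pair"
    unfolding F2_def pair_def by (intro F2I[OF \<open>F2 upr\<close>] dfi)
qed

lemmas [dfi] = F2I[OF F2_basic(1)] F2I[OF F2_basic(2)] F2I[OF F2_basic(3)] F1I[OF F1_basic(1)]
  F1I[OF F1_basic(2)] F1I[OF F1_basic(3)] D2I[OF D2_sub]

lemma mem_rep:
  assumes "F1 F" shows "z \<epsilon> rep a F \<longleftrightarrow> (\<exists>x. x \<epsilon> a \<and> z = F x)"
proof -
  have "D2 (\<lambda>x y. y = F x)" unfolding D2_def by (intro dfi F1I[OF assms])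
  from replacement_D2[OF this, of a] obtain b where b: "\<forall>x. x \<epsilon> a \<longrightarrow> F x \<epsilon> b" by auto
  show ?thesis unfolding rep_def
  proof (rule mem_col_isset, rule isset_sub[of _ b])
    show "D1 (\<lambda>z. \<exists>x. x \<epsilon> a \<and> z = F x)"
      unfolding D1_def by (intro dfi F1I[OF assms])
  qed (use b in auto)
qed

lemma dft_rep [dfi]:
  assumes "dft a" "dft (\<lambda>e. F (\<lambda>n. e (Suc n)) (e 0))"
  shows "dft (\<lambda>e. rep (a e) (F e))"
proof -
  have 1: "dft (\<lambda>e. F (\<lambda>n. e (Suc (Suc n))) (e 0))"
    unfolding dft_def
    using dfb_subst[OF assms(2)[unfolded dft_def], of "\<lambda>e n. case n of 0 \<Rightarrow> e 0 | Suc n \<Rightarrow>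
      (case n of 0 \<Rightarrow> e 1 | Suc n \<Rightarrow> e (Suc (Suc (Suc n))))"]
    by (simp add: atom_case)
  have 2: "dft (\<lambda>e. a (\<lambda>n. e (Suc (Suc n))))" using dft_shift[OF assms(1), of 2] by simp
  show ?thesis unfolding rep_def by (intro dfi 1 2)
qed

text \<open>Projections, and below also domains, ranges and application, are collections of their
  members, so that \<open>dft_col\<close> yields their definability.\<close>

definition fstp where "fstp p = col (\<lambda>z. \<exists>x y. p = pair x y \<and> z \<epsilon> x)"
definition sndp where "sndp p = col (\<lambda>z. \<exists>x y. p = pair x y \<and> z \<epsilon> y)"

lemma fstp_pair [simp]: "fstp (pair x y) = x" and sndp_pair [simp]: "sndp (pair x y) = y"
proof -
  have "z \<epsilon> fstp (pair x y) \<longleftrightarrow> z \<epsilon> x" for z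
    unfolding fstp_def by (subst mem_col_isset) (auto simp: isset_def)
  then show "fstp (pair x y) = x" by (simp add: ext_iff)
  have "z \<epsilon> sndp (pair x y) \<longleftrightarrow> z \<epsilon> y" for z
    unfolding sndp_def by (subst mem_col_isset) (auto simp: isset_def)
  then show "sndp (pair x y) = y" by (simp add: ext_iff)
qed

definition prod where "prod a b = uni (rep a (\<lambda>x. rep b (pair x)))"

definition func where "func f \<longleftrightarrow> (\<forall>x y z. pair x y \<epsilon> f \<longrightarrow> pair x z \<epsilon> f \<longrightarrow> y = z)"
definition dom where "dom f = col (\<lambda>x. \<exists>y. pair x y \<epsilon> f)"
definition rng where "rng f = col (\<lambda>y. \<exists>x. pair x y \<epsilon> f)"
definition ap where "ap f x = col (\<lambda>z. \<exists>y. pair x y \<epsilon> f \<and> z \<epsilon> y)"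
definition lam where "lam a F = rep a (\<lambda>x. pair x (F x))"

lemma F_basic2: "F1 fstp" "F1 sndp" "F2 prod" "F1 dom" "F1 rng" "F2 ap" "D1 func"
  unfolding F1_def F2_def D1_def fstp_def sndp_def prod_def dom_def rng_def ap_def func_def
  by (intro dfi)+

lemmas [dfi] = F1I[OF F_basic2(1)] F1I[OF F_basic2(2)] F2I[OF F_basic2(3)] F1I[OF F_basic2(4)]
  F1I[OF F_basic2(5)] F2I[OF F_basic2(6)] D1I[OF F_basic2(7)]

lemma mem_prod: "z \<epsilon> prod a b \<longleftrightarrow> (\<exists>x y. x \<epsilon> a \<and> y \<epsilon> b \<and> z = pair x y)"
proof -
  have 1: "F1 (pair x)" "F1 (\<lambda>x. rep b (pair x))" for x
    unfolding F1_def by (intro dfi)+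
  show ?thesis unfolding prod_def by (auto simp: mem_rep[OF 1(1)] mem_rep[OF 1(2)])
qed

lemma pair_mem_prod [simp]: "pair x y \<epsilon> prod a b \<longleftrightarrow> x \<epsilon> a \<and> y \<epsilon> b"
  by (auto simp: mem_prod)

lemma pair_mem_uni_uni: "pair x y \<epsilon> f \<Longrightarrow> x \<epsilon> uni (uni f) \<and> y \<epsilon> uni (uni f)"
  by (auto simp: pair_def) (metis mem_upr)+

lemma mem_dom [simp]: "x \<epsilon> dom f \<longleftrightarrow> (\<exists>y. pair x y \<epsilon> f)"
  unfolding dom_def
  by (rule mem_col_isset, rule isset_sub[of _ "uni (uni f)"])
    (auto simp del: mem_uni simp: D1_def dest: pair_mem_uni_uni intro!: dfi)

lemma mem_rng [simp]: "y \<epsilon> rng f \<longleftrightarrow> (\<exists>x. pair x y \<epsilon> f)"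
  unfolding rng_def
  by (rule mem_col_isset, rule isset_sub[of _ "uni (uni f)"])
    (auto simp del: mem_uni simp: D1_def dest: pair_mem_uni_uni intro!: dfi)

lemma funcD: "func f \<Longrightarrow> pair x y \<epsilon> f \<Longrightarrow> pair x z \<epsilon> f \<Longrightarrow> y = z"
  unfolding func_def by blast

lemma ap_eq: "func f \<Longrightarrow> pair x y \<epsilon> f \<Longrightarrow> ap f x = y"
proof -
  assume A: "func f" "pair x y \<epsilon> f"
  then have "pair x z \<epsilon> f \<longleftrightarrow> z = y" for z unfolding func_def by blast
  then have "z \<epsilon> ap f x \<longleftrightarrow> z \<epsilon> y" for z
    unfolding ap_def by (subst mem_col_isset) (auto simp: isset_def)
  then show ?thesis by (simp add: ext_iff)
qed

lemma mem_lam: "F1 F \<Longrightarrow> z \<epsilon> lam a F \<longleftrightarrow> (\<exists>x. x \<epsilon> a \<and> z = pair x (F x))"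
  unfolding lam_def by (rule mem_rep) (auto simp: F1_def intro!: dfi F1I[of F])

lemma pair_mem_lam: "F1 F \<Longrightarrow> pair x y \<epsilon> lam a F \<longleftrightarrow> x \<epsilon> a \<and> y = F x"
  by (auto simp: mem_lam)

lemma func_lam: "F1 F \<Longrightarrow> func (lam a F)"
  by (auto simp: func_def pair_mem_lam)

lemma ap_lam: "F1 F \<Longrightarrow> x \<epsilon> a \<Longrightarrow> ap (lam a F) x = F x"
  by (rule ap_eq) (auto simp: func_lam pair_mem_lam)

lemma sub_refl [simp]: "sub x x" by (simp add: sub_def)
lemma sub_trans: "sub x y \<Longrightarrow> sub y z \<Longrightarrow> sub x z" by (simp add: sub_def)
lemma subD: "sub x y \<Longrightarrow> z \<epsilon> x \<Longrightarrow> z \<epsilon> y" by (simp add: sub_def)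
lemma func_sub: "func f \<Longrightarrow> sub g f \<Longrightarrow> func g" unfolding func_def sub_def by blast

subsection \<open>Ordinals\<close>

definition trs where "trs x \<longleftrightarrow> (\<forall>y. y \<epsilon> x \<longrightarrow> sub y x)"
definition Ord where "Ord x \<longleftrightarrow> trs x \<and> (\<forall>y. y \<epsilon> x \<longrightarrow> trs y)"

lemma D1_ord: "D1 trs" "D1 Ord"
proof -
  show "D1 trs" unfolding D1_def trs_def by (intro dfi)
  then show "D1 Ord" unfolding D1_def Ord_def by (intro dfi D1I[OF \<open>D1 trs\<close>])
qed

lemmas [dfi] = D1I[OF D1_ord(1)] D1I[OF D1_ord(2)]

lemma mem_irrefl [simp]: "\<not> x \<epsilon> x"
  using foundation[of x "upr x x"] by auto

lemma mem_asym: "x \<epsilon> y \<Longrightarrow> \<not> y \<epsilon> x"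
  using foundation[of x "upr x y"] by auto

lemma Ord_in: "Ord x \<Longrightarrow> y \<epsilon> x \<Longrightarrow> Ord y"
  unfolding Ord_def trs_def sub_def by blast

lemma Ord_trans: "Ord x \<Longrightarrow> y \<epsilon> x \<Longrightarrow> z \<epsilon> y \<Longrightarrow> z \<epsilon> x"
  unfolding Ord_def trs_def sub_def by blast

lemma Ord_least_set:
  assumes "D1 P" "Ord a" "P a"
  obtains b where "Ord b" "P b" "\<And>c. c \<epsilon> b \<Longrightarrow> \<not> P c" "b \<epsilon> suc a"
proof -
  have "a \<epsilon> sep (suc a) P" using assms by (simp add: mem_sep)
  from foundation[OF this] obtain b where b: "b \<epsilon> suc a" "P b" "\<And>c. c \<epsilon> b \<Longrightarrow> \<not> (c \<epsilon> suc a \<and> P c)"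
    using assms by (auto simp: mem_sep)
  have "c \<epsilon> suc a" if "c \<epsilon> b" for c
    using b(1) that Ord_trans[OF assms(2)] by auto
  moreover have "Ord b" using b(1) assms(2) Ord_in by auto
  ultimately show ?thesis using b that by blast
qed

lemma Ord_induct:
  assumes "Ord a" "D1 P" "\<And>x. Ord x \<Longrightarrow> (\<And>y. y \<epsilon> x \<Longrightarrow> P y) \<Longrightarrow> P x"
  shows "P a"
proof (rule ccontr)
  assume "\<not> P a"
  have "D1 (\<lambda>x. \<not> P x)" using assms(2) unfolding D1_def by (intro dfi)
  from Ord_least_set[of "\<lambda>x. \<not> P x", OF this assms(1) \<open>\<not> P a\<close>] assms(3) show False by metis
qed

lemma Ord_linear: "Ord x \<Longrightarrow> Ord y \<Longrightarrow> x \<epsilon> y \<or> x = y \<or> y \<epsilon> x"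
proof -
  have 1: "D1 (\<lambda>x. \<forall>y. Ord y \<longrightarrow> x \<epsilon> y \<or> x = y \<or> y \<epsilon> x)" unfolding D1_def by (intro dfi)
  assume "Ord x" "Ord y"
  from \<open>Ord x\<close> have "\<forall>y. Ord y \<longrightarrow> x \<epsilon> y \<or> x = y \<or> y \<epsilon> x"
  proof (rule Ord_induct[OF _ 1], intro allI impI)
    fix x y assume x: "Ord x" "\<And>u. u \<epsilon> x \<Longrightarrow> \<forall>y. Ord y \<longrightarrow> u \<epsilon> y \<or> u = y \<or> y \<epsilon> u" and y: "Ord y"
    have 2: "D1 (\<lambda>y. x \<epsilon> y \<or> x = y \<or> y \<epsilon> x)" unfolding D1_def by (intro dfi)
    from y show "x \<epsilon> y \<or> x = y \<or> y \<epsilon> x"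
    proof (rule Ord_induct[OF _ 2])
      fix y assume y: "Ord y" "\<And>v. v \<epsilon> y \<Longrightarrow> x \<epsilon> v \<or> x = v \<or> v \<epsilon> x"
      show "x \<epsilon> y \<or> x = y \<or> y \<epsilon> x"
        using x y Ord_trans[OF y(1)] Ord_trans[OF x(1)] by (metis ext)
    qed
  qed
  then show ?thesis using \<open>Ord y\<close> by blast
qed

lemma Ord_emp [simp]: "Ord emp" by (simp add: Ord_def trs_def)

lemma Ord_suc [simp]: "Ord x \<Longrightarrow> Ord (suc x)"
  unfolding Ord_def trs_def sub_def mem_suc by blast

lemma Ord_uni: "(\<And>x. x \<epsilon> a \<Longrightarrow> Ord x) \<Longrightarrow> Ord (uni a)"
  unfolding Ord_def trs_def sub_def mem_uni by blast

lemma Ord_sub_iff: "Ord a \<Longrightarrow> Ord b \<Longrightarrow> sub a b \<longleftrightarrow> a \<epsilon> b \<or> a = b"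
  using Ord_linear[of a b] mem_irrefl mem_asym Ord_trans unfolding sub_def by blast

lemma Ord_not_mem: "Ord a \<Longrightarrow> Ord b \<Longrightarrow> \<not> a \<epsilon> b \<longleftrightarrow> sub b a"
  using Ord_linear[of a b] mem_irrefl mem_asym Ord_trans unfolding sub_def by blast

lemma suc_neq_emp [simp]: "suc x \<noteq> emp" "emp \<noteq> suc x"
  by (metis mem_emp mem_suc)+

subsection \<open>Natural numbers\<close>

text \<open>A description of the finite ordinals that does not presuppose \<open>om\<close>: no
  ordinal up to \<open>n\<close> is a nonzero limit.\<close>

definition natural where
  "natural n \<longleftrightarrow> Ord n \<and> (\<forall>m. m \<epsilon> suc n \<longrightarrow> m = emp \<or> (\<exists>k. m = suc k))"
definition om where "om = col natural"

lemma D1_natural: "D1 natural" unfolding D1_def natural_def by (intro dfi)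

lemmas [dfi] = D1I[OF D1_natural]

lemma natural_suc: "natural n \<Longrightarrow> natural (suc n)"
  unfolding natural_def by auto

lemma natural_in: "natural n \<Longrightarrow> m \<epsilon> n \<Longrightarrow> natural m"
  unfolding natural_def using Ord_in Ord_trans by (metis mem_suc)

lemma natural_emp: "natural emp" by (simp add: natural_def)

text \<open>A least natural number outside the inductive set would be the successor of a member of
  it.\<close>

lemma mem_om [simp]: "n \<epsilon> om \<longleftrightarrow> natural n"
proof -
  obtain i x where i: "x \<epsilon> i" "\<forall>z. \<not> z \<epsilon> x"
    "\<And>x. x \<epsilon> i \<Longrightarrow> \<exists>y. y \<epsilon> i \<and> (\<forall>z. z \<epsilon> y \<longleftrightarrow> z \<epsilon> x \<or> z = x)" using infinity by blast
  then have e: "emp \<epsilon> i" using emp_iff by metis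
  have s: "suc y \<epsilon> i" if y: "y \<epsilon> i" for y
  proof -
    obtain z where z: "z \<epsilon> i" "\<forall>w. w \<epsilon> z \<longleftrightarrow> w \<epsilon> y \<or> w = y" using i(3)[OF y] by blast
    then have "z = suc y" by (simp add: ext_iff)
    with z(1) show ?thesis by simp
  qed
  have "n \<epsilon> i" if n: "natural n" for n
  proof (rule ccontr)
    assume "\<not> n \<epsilon> i"
    have "D1 (\<lambda>n. natural n \<and> \<not> n \<epsilon> i)" unfolding D1_def by (intro dfi)
    then obtain m where m: "natural m" "\<not> m \<epsilon> i" "\<And>c. c \<epsilon> m \<Longrightarrow> \<not> (natural c \<and> \<not> c \<epsilon> i)"
      using Ord_least_set[of "\<lambda>n. natural n \<and> \<not> n \<epsilon> i" n] n \<open>\<not> n \<epsilon> i\<close> natural_def by metis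
    then obtain k where "m = suc k" using e unfolding natural_def by auto
    then show False using m natural_in[of m k] s[of k] by auto
  qed
  then show ?thesis unfolding om_def
    by (intro mem_col_isset isset_sub[of _ i]) (auto simp: D1_natural)
qed

lemma om_induct:
  assumes "natural n" "D1 P" "P emp" "\<And>n. natural n \<Longrightarrow> P n \<Longrightarrow> P (suc n)"
  shows "P n"
proof (rule ccontr)
  assume "\<not> P n"
  have "D1 (\<lambda>n. natural n \<and> \<not> P n)" unfolding D1_def by (intro dfi D1I[OF assms(2)])
  then obtain m where m: "natural m" "\<not> P m" "\<And>c. c \<epsilon> m \<Longrightarrow> \<not> (natural c \<and> \<not> P c)"
    using Ord_least_set[of "\<lambda>n. natural n \<and> \<not> P n" n] assms(1) \<open>\<not> P n\<close> natural_def by metis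
  then obtain k where "m = suc k" using assms(3) unfolding natural_def by auto
  then show False using m natural_in[of m k] assms(4)[of k] by auto
qed

lemma natural_Ord: "natural n \<Longrightarrow> Ord n" by (simp add: natural_def)

lemma Ord_om [simp]: "Ord om"
proof -
  have "trs om" unfolding trs_def sub_def using natural_in by simp
  moreover have "trs n" if "n \<epsilon> om" for n
    using that natural_Ord[of n] by (simp add: Ord_def)
  ultimately show ?thesis by (simp add: Ord_def)
qed

lemma natural_cases: "natural n \<Longrightarrow> n = emp \<or> (\<exists>k. natural k \<and> n = suc k)"
  using natural_in unfolding natural_def by (metis mem_suc)

lemma Ord_least_ex:
  assumes "D1 P" "Ord a" "P a"
  shows "\<exists>b. Ord b \<and> P b \<and> (\<forall>c. c \<epsilon> b \<longrightarrow> \<not> P c) \<and> b \<epsilon> suc a"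
  by (rule Ord_least_set[of P a]) (use assms in blast)+

subsection \<open>Well-founded recursion\<close>

lemma col_mem [simp]: "col (\<lambda>z. z \<epsilon> y) = y"
  by (rule ext, rule mem_col_isset) (auto simp: isset_def)

definition restr where "restr f a = sep f (\<lambda>p. fstp p \<epsilon> a)"

lemma F2_restr: "F2 restr" unfolding F2_def restr_def by (intro dfi)
lemmas [dfi] = F2I[OF F2_restr]

lemma mem_restr [simp]: "p \<epsilon> restr f a \<longleftrightarrow> p \<epsilon> f \<and> fstp p \<epsilon> a"
  unfolding restr_def by (rule mem_sep) (unfold D1_def, intro dfi)

text \<open>Partial solutions of a recursion along an arbitrary predecessor operation
  \<open>pr\<close>. Ordinary membership is the case of the identity; the action on names will
  recurse along \<open>dom\<close>.\<close>

definition rec_approx :: "('a \<Rightarrow> 'a) \<Rightarrow> ('a \<Rightarrow> 'a \<Rightarrow> 'a) \<Rightarrow> 'a \<Rightarrow> bool" where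
  "rec_approx pr F f \<longleftrightarrow> func f \<and> (\<forall>p. p \<epsilon> f \<longrightarrow>
    (\<exists>x. p = pair x (F x (restr f (pr x))) \<and> sub (pr x) (dom f)))"

definition wrec :: "('a \<Rightarrow> 'a) \<Rightarrow> ('a \<Rightarrow> 'a \<Rightarrow> 'a) \<Rightarrow> 'a \<Rightarrow> 'a" where
  "wrec pr F x = col (\<lambda>z. \<exists>f y. rec_approx pr F f \<and> pair x y \<epsilon> f \<and> z \<epsilon> y)"

definition wfpr :: "('a \<Rightarrow> 'a) \<Rightarrow> bool" where
  "wfpr pr \<longleftrightarrow> (\<forall>s x. x \<epsilon> s \<longrightarrow> (\<exists>m. m \<epsilon> s \<and> (\<forall>y. y \<epsilon> pr m \<longrightarrow> \<not> y \<epsilon> s)))"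

lemma F1_wrec: "F1 pr \<Longrightarrow> F2 F \<Longrightarrow> F1 (wrec pr F)"
  unfolding F1_def[of "wrec pr F"] wrec_def rec_approx_def by (intro dfi F1I[of pr] F2I[of F])

text \<open>Two partial solutions agree, since at a minimal disagreement the earlier values would be
  the same. If some points of \<open>t\<close> had no partial solution, a minimal one among them
  could be given its value on top of those below it.\<close>

lemma wrec_eq:
  assumes pr: "F1 pr" "wfpr pr" and F: "F2 F"
    and t: "\<And>u. u \<epsilon> t \<Longrightarrow> sub (pr u) t" "x \<epsilon> t"
  shows "wrec pr F x = F x (lam (pr x) (wrec pr F))"
proof -
  note [dfi] = F1I[OF pr(1)] F2I[OF F] F1I[OF F1_wrec[OF pr(1) F]]
  have val: "y = F x (restr f (pr x))" "sub (pr x) (dom f)"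
    if "rec_approx pr F f" "pair x y \<epsilon> f" for f x y
    using that unfolding rec_approx_def by auto
  have agree: "y = z" if f: "rec_approx pr F f" "pair x y \<epsilon> f" and g: "rec_approx pr F g" "pair x z \<epsilon> g"
    for f g x y z
  proof (rule ccontr)
    assume "y \<noteq> z"
    let ?P = "\<lambda>x. \<exists>y z. pair x y \<epsilon> f \<and> pair x z \<epsilon> g \<and> y \<noteq> z"
    have P: "D1 ?P" unfolding D1_def by (intro dfi)
    have "x \<epsilon> sep (dom f) ?P" unfolding mem_sep[OF P] using f g \<open>y \<noteq> z\<close> by auto
    then obtain m where m: "m \<epsilon> sep (dom f) ?P" "\<And>u. u \<epsilon> pr m \<Longrightarrow> \<not> u \<epsilon> sep (dom f) ?P"
      using pr(2) unfolding wfpr_def by blast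
    then obtain y z where yz: "pair m y \<epsilon> f" "pair m z \<epsilon> g" "y \<noteq> z" unfolding mem_sep[OF P] by blast
    have "p \<epsilon> restr f (pr m) \<longleftrightarrow> p \<epsilon> restr g (pr m)" for p
    proof -
      have *: "pair u v \<epsilon> f \<longleftrightarrow> pair u v \<epsilon> g" if u: "u \<epsilon> pr m" for u v
      proof -
        have "u \<epsilon> dom f" "u \<epsilon> dom g"
          using val(2)[OF f(1) yz(1)] val(2)[OF g(1) yz(2)] u by (blast dest: subD)+
        then obtain v1 v2 where v: "pair u v1 \<epsilon> f" "pair u v2 \<epsilon> g" by auto
        then have "v1 = v2" using m(2)[OF u] unfolding mem_sep[OF P] by auto
        then show ?thesis using v f(1) g(1) unfolding rec_approx_def by (metis funcD)
      qed
      then show ?thesis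
        using f(1) g(1) unfolding rec_approx_def by (metis fstp_pair mem_restr)
    qed
    then have "restr f (pr m) = restr g (pr m)" by (rule ext)
    then show False using val(1)[OF f(1) yz(1)] val(1)[OF g(1) yz(2)] yz(3) by simp
  qed
  have wrec: "wrec pr F x = y" if f: "rec_approx pr F f" "pair x y \<epsilon> f" for f x y
  proof -
    have "(\<exists>f y. rec_approx pr F f \<and> pair x y \<epsilon> f \<and> z \<epsilon> y) \<longleftrightarrow> z \<epsilon> y" for z
      using f agree by blast
    then show ?thesis unfolding wrec_def by simp
  qed
  have lam: "restr f (pr x) = lam (pr x) (wrec pr F)"
    if f: "rec_approx pr F f" and x: "sub (pr x) (dom f)" for f x
  proof (rule ext)
    fix p
    show "p \<epsilon> restr f (pr x) \<longleftrightarrow> p \<epsilon> lam (pr x) (wrec pr F)"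
    proof
      assume "p \<epsilon> restr f (pr x)"
      then obtain u v where "p = pair u v" "pair u v \<epsilon> f" "u \<epsilon> pr x"
        using f unfolding rec_approx_def by (metis fstp_pair mem_restr)
      then show "p \<epsilon> lam (pr x) (wrec pr F)"
        using wrec[OF f] by (auto simp: mem_lam[OF F1_wrec[OF pr(1) F]])
    next
      assume "p \<epsilon> lam (pr x) (wrec pr F)"
      then obtain u where u: "u \<epsilon> pr x" "p = pair u (wrec pr F u)"
        by (auto simp: mem_lam[OF F1_wrec[OF pr(1) F]])
      then obtain v where "pair u v \<epsilon> f" using x by (auto simp: sub_def)
      then show "p \<epsilon> restr f (pr x)" using u wrec[OF f] by auto
    qed
  qed
  define ok where "ok x \<longleftrightarrow> (\<exists>f. rec_approx pr F f \<and> x \<epsilon> dom f)" for x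
  have okD: "D1 ok" unfolding D1_def ok_def rec_approx_def by (intro dfi)
  note [dfi] = D1I[OF okD]
  have ok: "wrec pr F x = F x (lam (pr x) (wrec pr F)) \<and> (\<forall>u. u \<epsilon> pr x \<longrightarrow> ok u)" if "ok x" for x
  proof -
    obtain f y where f: "rec_approx pr F f" "pair x y \<epsilon> f" using \<open>ok x\<close> by (auto simp: ok_def)
    show ?thesis
      using val[OF f] wrec[OF f] lam[OF f(1)] f(1) unfolding ok_def sub_def by metis
  qed
  have "ok x"
  proof (rule ccontr)
    assume "\<not> ok x"
    have nok: "D1 (\<lambda>x. \<not> ok x)" unfolding D1_def by (intro dfi)
    have "x \<epsilon> sep t (\<lambda>x. \<not> ok x)" using t \<open>\<not> ok x\<close> by (simp add: mem_sep[OF nok])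
    then obtain m where m: "m \<epsilon> sep t (\<lambda>x. \<not> ok x)" "\<And>u. u \<epsilon> pr m \<Longrightarrow> \<not> u \<epsilon> sep t (\<lambda>x. \<not> ok x)"
      using pr(2) unfolding wfpr_def by blast
    then have mt: "m \<epsilon> t" "\<not> ok m" by (auto simp: mem_sep[OF nok])
    \<comment> \<open>The partial solution for \<open>m\<close>: the values of the recursion on the
      part \<open>?d\<close> of \<open>t\<close> where solutions exist already, and one more value
      at \<open>m\<close>.\<close>
    let ?w = "wrec pr F" and ?d = "sep t ok"
    let ?g = "lam ?d ?w"
    let ?v = "F m (lam (pr m) ?w)"
    let ?h = "cup ?g (upr (pair m ?v) (pair m ?v))"
    note w = F1_wrec[OF pr(1) F]
    have d: "u \<epsilon> ?d \<longleftrightarrow> u \<epsilon> t \<and> ok u" for u by (simp add: mem_sep[OF okD])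
    have prm: "u \<epsilon> ?d" if "u \<epsilon> pr m" for u
      using m(2)[OF that] t(1)[OF mt(1)] that by (auto simp: d mem_sep[OF nok] sub_def)
    have prd: "v \<epsilon> ?d" if "u \<epsilon> ?d" "v \<epsilon> pr u" for u v
      using that t(1)[of u] ok[of u] by (auto simp: d sub_def)
    have h: "pair a b \<epsilon> ?h \<longleftrightarrow> a \<epsilon> ?d \<and> b = ?w a \<or> a = m \<and> b = ?v" for a b
      by (auto simp: pair_mem_lam[OF w])
    have dh: "a \<epsilon> dom ?h \<longleftrightarrow> a \<epsilon> ?d \<or> a = m" for a using h by auto
    have r: "restr ?h (pr a) = lam (pr a) ?w" if "\<And>u. u \<epsilon> pr a \<Longrightarrow> u \<epsilon> ?d" for a
    proof (rule ext)
      fix p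
      show "p \<epsilon> restr ?h (pr a) \<longleftrightarrow> p \<epsilon> lam (pr a) ?w"
        using that mt(2) by (auto simp: mem_lam[OF w] d)
    qed
    have "rec_approx pr F ?h" unfolding rec_approx_def
    proof (intro conjI allI impI)
      show "func ?h" unfolding func_def h using mt(2) by (auto simp: d)
      fix p assume p: "p \<epsilon> ?h"
      then consider u where "u \<epsilon> ?d" "p = pair u (?w u)" | "p = pair m ?v"
        by (auto simp: mem_lam[OF w])
      then show "\<exists>x. p = pair x (F x (restr ?h (pr x))) \<and> sub (pr x) (dom ?h)"
      proof cases
        case 1
        then show ?thesis using ok[of u] r[of u] prd[of u] unfolding sub_def dh by (auto simp: d)
      next
        case 2
        then show ?thesis using r[of m] prm unfolding sub_def dh by auto
      qed
    qed
    moreover have "m \<epsilon> dom ?h" using dh by blast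
    ultimately have "ok m" unfolding ok_def[of m] by blast
    then show False using mt by simp
  qed
  then show ?thesis using ok by blast
qed

lemma wfpr_id: "wfpr (\<lambda>x. x)"
  unfolding wfpr_def using foundation by blast

lemma F1_id: "F1 (\<lambda>x. x)" unfolding F1_def by (intro dfi)

lemma rng_lam: "F1 F \<Longrightarrow> rng (lam a F) = rep a F"
  by (auto simp: ext_iff pair_mem_lam mem_rep)

lemma mem_uni_rep: "F1 F \<Longrightarrow> z \<epsilon> uni (rep a F) \<longleftrightarrow> (\<exists>x. x \<epsilon> a \<and> z \<epsilon> F x)"
  by (auto simp: mem_rep)

subsection \<open>Transitive closure and the cumulative hierarchy\<close>

text \<open>The union operation is iterated along \<open>om\<close> and all stages are collected.
  The recursion is justified on \<open>suc n\<close>, which is transitive, because recursion over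
  arbitrary sets presupposes this lemma.\<close>

lemma ex_transitive: "\<exists>t. trs t \<and> x \<epsilon> t"
proof -
  define F where "F n g = cup (upr x x) (uni (uni (rng g)))" for n g :: 'a
  have F: "F2 F" unfolding F2_def F_def by (intro dfi)
  define U where "U = wrec (\<lambda>x. x) F"
  have U: "F1 U" unfolding U_def by (intro F1_wrec F1_id F)
  have eq: "U n = cup (upr x x) (uni (uni (rep n U)))" if "natural n" for n
  proof -
    have "U n = F n (lam n U)"
      unfolding U_def
      by (rule wrec_eq[OF F1_id wfpr_id F, of "suc n"])
        (use that in \<open>auto simp: sub_def dest: Ord_trans[OF natural_Ord]\<close>)
    then show ?thesis by (simp add: F_def rng_lam[OF U])
  qed
  let ?t = "uni (rep om U)"
  have "trs ?t"
  proof -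
    have "z \<epsilon> ?t" if n: "natural n" "y \<epsilon> U n" "z \<epsilon> y" for n y z
    proof -
      have "z \<epsilon> U (suc n)"
        unfolding eq[OF natural_suc[OF n(1)]] mem_cup mem_uni mem_rep[OF U] mem_suc using n by blast
      then show ?thesis using natural_suc[OF n(1)] by (auto simp: mem_rep[OF U])
    qed
    then show ?thesis by (auto simp: trs_def sub_def mem_rep[OF U])
  qed
  moreover have "x \<epsilon> ?t" using eq[OF natural_emp] natural_emp by (auto simp: mem_rep[OF U])
  ultimately show ?thesis by blast
qed

lemma eps_induct:
  assumes "D1 P" "\<And>x. (\<And>y. y \<epsilon> x \<Longrightarrow> P y) \<Longrightarrow> P x" shows "P a"
proof (rule ccontr)
  assume "\<not> P a"
  have N: "D1 (\<lambda>x. \<not> P x)" unfolding D1_def by (intro dfi D1I[OF assms(1)])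
  obtain t where t: "trs t" "a \<epsilon> t" using ex_transitive by blast
  then have "a \<epsilon> sep t (\<lambda>x. \<not> P x)" using \<open>\<not> P a\<close> by (simp add: mem_sep[OF N])
  from foundation[OF this] show False
    using t assms(2) unfolding mem_sep[OF N] trs_def sub_def by blast
qed

lemma erec_eq: "F2 F \<Longrightarrow> wrec (\<lambda>x. x) F x = F x (lam x (wrec (\<lambda>x. x) F))"
  using ex_transitive[of x] wrec_eq[OF F1_id wfpr_id] unfolding trs_def by metis

text \<open>\<open>Vs a\<close> is the union of \<open>pw (Vs b)\<close> for \<open>b\<close> in
  \<open>a\<close>, for an ordinal \<open>a\<close> the usual level of the cumulative hierarchy;
  \<open>rk x\<close> is the union of the successors of the ranks of members.\<close>

definition Vs where "Vs = wrec (\<lambda>x. x) (\<lambda>x g. uni (rep (rng g) pw))"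
definition rk where "rk = wrec (\<lambda>x. x) (\<lambda>x g. uni (rep (rng g) suc))"

lemma F1_Vs: "F1 Vs" and F1_rk: "F1 rk"
  unfolding Vs_def rk_def by (intro F1_wrec F1_id, unfold F2_def, intro dfi)+

lemmas [dfi] = F1I[OF F1_Vs] F1I[OF F1_rk]

lemma mem_Vs: "x \<epsilon> Vs a \<longleftrightarrow> (\<exists>b. b \<epsilon> a \<and> sub x (Vs b))"
proof -
  have F: "F2 (\<lambda>x g. uni (rep (rng g) pw))" unfolding F2_def by (intro dfi)
  have "Vs a = uni (rep (rep a Vs) pw)"
    using erec_eq[OF F, of a] unfolding Vs_def[symmetric] by (simp add: rng_lam[OF F1_Vs])
  then show ?thesis by (auto simp del: mem_uni simp: mem_uni_rep[OF F1_basic(2)] mem_rep[OF F1_Vs])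
qed

lemma mem_rk: "z \<epsilon> rk x \<longleftrightarrow> (\<exists>y. y \<epsilon> x \<and> (z \<epsilon> rk y \<or> z = rk y))"
proof -
  have F: "F2 (\<lambda>x g. uni (rep (rng g) suc))" unfolding F2_def by (intro dfi)
  have "rk x = uni (rep (rep x rk) suc)"
    using erec_eq[OF F, of x] unfolding rk_def[symmetric] by (simp add: rng_lam[OF F1_rk])
  then show ?thesis by (auto simp del: mem_uni simp: mem_uni_rep[OF F1_basic(3)] mem_rep[OF F1_rk])
qed

lemma Ord_rk [simp]: "Ord (rk x)"
proof (rule eps_induct[of "\<lambda>x. Ord (rk x)"])
  show "D1 (\<lambda>x. Ord (rk x))" unfolding D1_def by (intro dfi)
  fix x assume "\<And>y. y \<epsilon> x \<Longrightarrow> Ord (rk y)"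
  then show "Ord (rk x)"
    unfolding Ord_def trs_def sub_def using mem_rk[of _ x] by metis
qed

lemma rk_mem: "y \<epsilon> x \<Longrightarrow> rk y \<epsilon> rk x"
  using mem_rk by blast

lemma sub_Vs_rk: "sub x (Vs (rk x))"
proof (rule eps_induct[of "\<lambda>x. sub x (Vs (rk x))"])
  show "D1 (\<lambda>x. sub x (Vs (rk x)))" unfolding D1_def by (intro dfi)
  fix x assume "\<And>y. y \<epsilon> x \<Longrightarrow> sub y (Vs (rk y))"
  then show "sub x (Vs (rk x))" unfolding sub_def[of x] using mem_Vs rk_mem by blast
qed

lemma rk_least: "Ord b \<Longrightarrow> sub x (Vs b) \<Longrightarrow> sub (rk x) b"
proof -
  have D: "D1 (\<lambda>x. \<forall>b. Ord b \<longrightarrow> sub x (Vs b) \<longrightarrow> sub (rk x) b)" unfolding D1_def by (intro dfi)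
  have "\<forall>b. Ord b \<longrightarrow> sub x (Vs b) \<longrightarrow> sub (rk x) b"
  proof (rule eps_induct[OF D], intro allI impI)
    fix x b assume IH: "\<And>y. y \<epsilon> x \<Longrightarrow> \<forall>b. Ord b \<longrightarrow> sub y (Vs b) \<longrightarrow> sub (rk y) b"
      and b: "Ord b" and x: "sub x (Vs b)"
    show "sub (rk x) b" unfolding sub_def
    proof (intro allI impI)
      fix z assume "z \<epsilon> rk x"
      then obtain y where y: "y \<epsilon> x" "z \<epsilon> rk y \<or> z = rk y" using mem_rk by blast
      then obtain c where c: "c \<epsilon> b" "sub y (Vs c)" using x mem_Vs subD by blast
      then have "sub (rk y) c" using IH y(1) b Ord_in by blast
      then have "rk y \<epsilon> b" using Ord_sub_iff[of "rk y" c] c(1) b Ord_in Ord_trans Ord_rk by metis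
      then show "z \<epsilon> b" using y(2) b Ord_trans by blast
    qed
  qed
  then show "Ord b \<Longrightarrow> sub x (Vs b) \<Longrightarrow> sub (rk x) b" by blast
qed

lemma mem_Vs_iff: "Ord a \<Longrightarrow> x \<epsilon> Vs a \<longleftrightarrow> rk x \<epsilon> a"
proof
  assume a: "Ord a"
  show "x \<epsilon> Vs a \<Longrightarrow> rk x \<epsilon> a"
    using a mem_Vs rk_least Ord_sub_iff Ord_rk Ord_in Ord_trans by metis
  show "rk x \<epsilon> a \<Longrightarrow> x \<epsilon> Vs a" using mem_Vs sub_Vs_rk by blast
qed

lemma rk_Ord: "Ord a \<Longrightarrow> rk a = a"
proof (rule Ord_induct[of a "\<lambda>a. rk a = a"])
  show "D1 (\<lambda>a. rk a = a)" unfolding D1_def by (intro dfi)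
  fix x assume x: "Ord x" "\<And>y. y \<epsilon> x \<Longrightarrow> rk y = y"
  have "z \<epsilon> rk x \<longleftrightarrow> z \<epsilon> x" for z
    unfolding mem_rk[of z x] using x Ord_trans[OF x(1)] by metis
  then show "rk x = x" by (rule ext)
qed

lemma wfprI:
  assumes "\<And>x y. y \<epsilon> pr x \<Longrightarrow> rk y \<epsilon> rk x" shows "wfpr pr"
  unfolding wfpr_def
proof (intro allI impI)
  fix s x assume x: "x \<epsilon> s"
  have D: "D1 (\<lambda>a. \<exists>x. x \<epsilon> s \<and> rk x = a)" unfolding D1_def by (intro dfi)
  from x have "\<exists>y. y \<epsilon> s \<and> rk y = rk x" by blast
  from Ord_least_ex[OF D Ord_rk this] obtain b where
    "\<exists>x. x \<epsilon> s \<and> rk x = b" "\<And>c. c \<epsilon> b \<Longrightarrow> \<not> (\<exists>x. x \<epsilon> s \<and> rk x = c)" by blast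
  then show "\<exists>m. m \<epsilon> s \<and> (\<forall>y. y \<epsilon> pr m \<longrightarrow> \<not> y \<epsilon> s)" using assms by blast
qed

text \<open>If \<open>pr\<close> lowers the rank, a level of the cumulative hierarchy is a set that
  contains \<open>x\<close> and is closed under \<open>pr\<close>.\<close>

lemma wrec_rk_eq:
  assumes "F1 pr" "F2 F" "\<And>x y. y \<epsilon> pr x \<Longrightarrow> rk y \<epsilon> rk x"
  shows "wrec pr F x = F x (lam (pr x) (wrec pr F))"
proof (rule wrec_eq[OF assms(1) wfprI[OF assms(3)] assms(2)])
  show "x \<epsilon> Vs (suc (rk x))" by (simp add: mem_Vs_iff)
  show "sub (pr u) (Vs (suc (rk x)))" if "u \<epsilon> Vs (suc (rk x))" for u
    using that assms(3)[of _ u] Ord_trans[of "suc (rk x)"] unfolding sub_def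
    by (metis mem_Vs_iff Ord_suc Ord_rk)
qed

lemma rk_induct:
  assumes "D1 P" "\<And>x. (\<And>y. rk y \<epsilon> rk x \<Longrightarrow> P y) \<Longrightarrow> P x" shows "P a"
proof -
  have D: "D1 (\<lambda>b. \<forall>x. rk x = b \<longrightarrow> P x)" unfolding D1_def by (intro dfi D1I[OF assms(1)])
  have "\<forall>x. rk x = rk a \<longrightarrow> P x"
    by (rule Ord_induct[OF _ D]) (use assms(2) in auto)
  then show ?thesis by blast
qed

text \<open>Scott's trick: replacement applies to the least rank of a witness, which is unique, and
  a level above all these ranks contains witnesses.\<close>

lemma collection:
  assumes "D2 R" shows "\<exists>b. \<forall>x. x \<epsilon> a \<longrightarrow> (\<exists>y. R x y) \<longrightarrow> (\<exists>y. y \<epsilon> b \<and> R x y)"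
proof -
  note [dfi] = D2I[OF assms]
  let ?Q = "\<lambda>x c. \<exists>y. R x y \<and> rk y = c"
  let ?S = "\<lambda>x c. Ord c \<and> ?Q x c \<and> (\<forall>d. d \<epsilon> c \<longrightarrow> \<not> ?Q x d)"
  have S: "D2 ?S" unfolding D2_def by (intro dfi)
  have D: "D1 (\<lambda>x. \<exists>y. R x y)" unfolding D1_def by (intro dfi)
  have "\<exists>!c. ?S x c" if "x \<epsilon> sep a (\<lambda>x. \<exists>y. R x y)" for x
  proof -
    obtain y where "R x y" using \<open>x \<epsilon> _\<close> by (auto simp: mem_sep[OF D])
    moreover have "D1 (?Q x)" unfolding D1_def by (intro dfi)
    ultimately obtain c where "?S x c" using Ord_least_ex[of "?Q x" "rk y"] Ord_rk by blast
    then show ?thesis using Ord_linear by metis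
  qed
  from replacement_D2[OF S this] obtain b where
    b: "\<And>x. x \<epsilon> sep a (\<lambda>x. \<exists>y. R x y) \<Longrightarrow> \<exists>c. c \<epsilon> b \<and> ?S x c" by blast
  let ?g = "uni (rep (sep b Ord) suc)"
  have g: "z \<epsilon> ?g \<longleftrightarrow> (\<exists>c. c \<epsilon> b \<and> Ord c \<and> (z \<epsilon> c \<or> z = c))" for z
    by (auto simp del: mem_uni simp: mem_uni_rep[OF F1_basic(3)] mem_sep[OF D1_ord(2)])
  have og: "Ord ?g" by (rule Ord_uni) (auto simp: mem_rep[OF F1_basic(3)] mem_sep[OF D1_ord(2)])
  show ?thesis
  proof (rule exI[of _ "Vs ?g"], intro allI impI)
    fix x assume "x \<epsilon> a" "\<exists>y. R x y"
    then have "x \<epsilon> sep a (\<lambda>x. \<exists>y. R x y)" by (simp add: mem_sep[OF D])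
    from b[OF this] obtain c y where "c \<epsilon> b" "Ord c" "R x y" "rk y = c" by blast
    then show "\<exists>y. y \<epsilon> Vs ?g \<and> R x y" using g mem_Vs_iff[OF og] by metis
  qed
qed

subsection \<open>Coverings\<close>

text \<open>A partial surjection instead of an injection: such maps compose, pass to larger sources
  and smaller targets, handle the empty set uniformly, and carry over to the extension.\<close>

definition cov where
  "cov a x \<longleftrightarrow> (\<exists>f. func f \<and> (\<forall>z. z \<epsilon> x \<longrightarrow> (\<exists>u. u \<epsilon> a \<and> pair u z \<epsilon> f)))"

lemma D2_cov: "D2 cov" unfolding D2_def cov_def by (intro dfi)
lemmas [dfi] = D2I[OF D2_cov]

lemma covI:
  assumes R: "D2 R" and "\<And>u z z'. u \<epsilon> a \<Longrightarrow> z \<epsilon> x \<Longrightarrow> z' \<epsilon> x \<Longrightarrow> R u z \<Longrightarrow> R u z' \<Longrightarrow> z = z'"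
    and "\<And>z. z \<epsilon> x \<Longrightarrow> \<exists>u. u \<epsilon> a \<and> R u z"
  shows "cov a x"
proof -
  have D: "D1 (\<lambda>p. R (fstp p) (sndp p))" unfolding D1_def by (intro dfi D2I[OF R])
  show ?thesis unfolding cov_def
    by (rule exI[of _ "sep (prod a x) (\<lambda>p. R (fstp p) (sndp p))"])
      (use assms(2,3) in \<open>auto simp: mem_sep[OF D] func_def\<close>)
qed

lemma cov_refl: "cov a a"
  by (rule covI[of "\<lambda>x y. x = y"]) (auto simp: D2_def intro!: dfi)

lemma cov_rep: "F1 F \<Longrightarrow> cov a (rep a F)"
  by (rule covI[of "\<lambda>x y. y = F x"]) (auto simp: D2_def mem_rep intro!: dfi F1I[of F])

lemma cov_mono: "cov a x \<Longrightarrow> sub a b \<Longrightarrow> sub y x \<Longrightarrow> cov b y"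
  unfolding cov_def sub_def by blast

lemma cov_trans:
  assumes "cov a x" "cov x y" shows "cov a y"
proof -
  obtain f g where f: "func f" "\<And>z. z \<epsilon> x \<Longrightarrow> \<exists>u. u \<epsilon> a \<and> pair u z \<epsilon> f"
    and g: "func g" "\<And>z. z \<epsilon> y \<Longrightarrow> \<exists>u. u \<epsilon> x \<and> pair u z \<epsilon> g"
    using assms unfolding cov_def by blast
  show ?thesis
  proof (rule covI[of "\<lambda>u z. \<exists>v. pair u v \<epsilon> f \<and> pair v z \<epsilon> g"])
    show "D2 (\<lambda>u z. \<exists>v. pair u v \<epsilon> f \<and> pair v z \<epsilon> g)" unfolding D2_def by (intro dfi)
    show "z = z'" if "\<exists>v. pair u v \<epsilon> f \<and> pair v z \<epsilon> g" "\<exists>v. pair u v \<epsilon> f \<and> pair v z' \<epsilon> g" for u z z'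
      using that f(1) g(1) unfolding func_def by metis
    show "\<exists>u. u \<epsilon> a \<and> (\<exists>v. pair u v \<epsilon> f \<and> pair v z \<epsilon> g)" if "z \<epsilon> y" for z
      using f(2) g(2)[OF that] by blast
  qed
qed

subsection \<open>Order types of sets of ordinals\<close>

text \<open>The Mostowski collapse of \<open>x\<close>. Its value at \<open>u\<close> is the set of
  the values at the members of \<open>u\<close> in \<open>x\<close>; it is strictly increasing on
  \<open>x\<close> and never exceeds \<open>u\<close>.\<close>

lemma order_type:
  assumes "Ord a" "sub x a"
  obtains p where "F1 p" "Ord (rep x p)" "sub (rep x p) a"
    "\<And>u v. u \<epsilon> x \<Longrightarrow> v \<epsilon> x \<Longrightarrow> p u = p v \<Longrightarrow> u = v"
proof -
  define F where "F u g = rng (restr g x)" for u g :: 'a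
  have F: "F2 F" unfolding F2_def F_def by (intro dfi)
  define p where "p = wrec (\<lambda>x. x) F"
  have p: "F1 p" unfolding p_def by (intro F1_wrec F1_id F)
  have eq: "z \<epsilon> p u \<longleftrightarrow> (\<exists>v. v \<epsilon> u \<and> v \<epsilon> x \<and> z = p v)" for u z
    using erec_eq[OF F, of u] unfolding p_def[symmetric] F_def
    by (auto simp: pair_mem_lam[OF p])
  have x: "Ord u" if "u \<epsilon> x" for u using assms Ord_in that by (auto simp: sub_def)
  have D: "D1 (\<lambda>u. Ord (p u) \<and> sub (p u) u)" unfolding D1_def by (intro dfi F1I[OF p])
  have sub: "Ord (p u) \<and> sub (p u) u" if "Ord u" for u
  proof (rule Ord_induct[OF that D])
    fix u assume u: "Ord u" "\<And>v. v \<epsilon> u \<Longrightarrow> Ord (p v) \<and> sub (p v) v"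
    have "trs (p u)" unfolding trs_def sub_def
      using eq Ord_trans[OF u(1)] by metis
    then have o: "Ord (p u)" unfolding Ord_def using eq u(2) by (metis Ord_def)
    have "z \<epsilon> u" if "z \<epsilon> p u" for z
    proof -
      obtain v where v: "v \<epsilon> u" "z = p v" using eq \<open>z \<epsilon> p u\<close> by blast
      then show ?thesis using u Ord_sub_iff[of "p v" v] Ord_in Ord_trans by metis
    qed
    with o show "Ord (p u) \<and> sub (p u) u" by (simp add: sub_def)
  qed
  have mono: "p v \<epsilon> p u" if "u \<epsilon> x" "v \<epsilon> x" "v \<epsilon> u" for u v using eq that by blast
  show ?thesis
  proof
    show "F1 p" by (rule p)
    show "u = v" if "u \<epsilon> x" "v \<epsilon> x" "p u = p v" for u v
      using mono[of u v] mono[of v u] that x Ord_linear[of u v] by auto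
    have "trs (rep x p)" unfolding trs_def sub_def mem_rep[OF p] using eq by blast
    then show "Ord (rep x p)" unfolding Ord_def mem_rep[OF p] using sub x by (metis Ord_def)
    show "sub (rep x p) a" unfolding sub_def mem_rep[OF p]
      using sub x assms Ord_sub_iff Ord_trans by (metis sub_def)
  qed
qed

subsection \<open>Regular cardinals\<close>

definition sm where "sm k x \<longleftrightarrow> (\<exists>b. b \<epsilon> k \<and> cov b x)"

lemma D2_sm: "D2 sm" unfolding D2_def sm_def by (intro dfi)
lemmas [dfi] = D2I[OF D2_sm]

text \<open>Regularity as closure of smallness under small unions, the form used in counting. That
  small subsets are bounded follows in \<open>reg_bounded\<close>.\<close>

definition reg where
  "reg k \<longleftrightarrow> Ord k \<and> sub om k \<and> (\<forall>a. a \<epsilon> k \<longrightarrow> suc a \<epsilon> k) \<and> \<not> sm k k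
    \<and> (\<forall>x. sm k x \<longrightarrow> (\<forall>y. y \<epsilon> x \<longrightarrow> sm k y) \<longrightarrow> sm k (uni x))"

lemma D1_reg: "D1 reg" unfolding D1_def reg_def by (intro dfi)
lemmas [dfi] = D1I[OF D1_reg]

lemma sm_sub: "sm k x \<Longrightarrow> sub y x \<Longrightarrow> sm k y"
  unfolding sm_def using cov_mono sub_refl by blast

lemma sm_cov: "sm k x \<Longrightarrow> cov x y \<Longrightarrow> sm k y"
  unfolding sm_def using cov_trans by blast

lemma sm_mem: "b \<epsilon> k \<Longrightarrow> sm k b"
  unfolding sm_def using cov_refl by blast

lemma sm_mono: "sm k x \<Longrightarrow> sub k k' \<Longrightarrow> sm k' x"
  unfolding sm_def sub_def by blast

lemma regD:
  assumes "reg k"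
  shows "Ord k" "\<And>n. natural n \<Longrightarrow> n \<epsilon> k" "\<And>a. a \<epsilon> k \<Longrightarrow> suc a \<epsilon> k" "\<not> sm k k"
    "\<And>x. sm k x \<Longrightarrow> (\<And>y. y \<epsilon> x \<Longrightarrow> sm k y) \<Longrightarrow> sm k (uni x)"
  using assms by (auto simp: reg_def sub_def)

text \<open>The supremum of the successors is a union of few small sets, hence small, and therefore
  an ordinal different from \<open>k\<close>.\<close>

lemma reg_bounded:
  assumes k: "reg k" and x: "sub x k" "sm k x"
  shows "\<exists>b. b \<epsilon> k \<and> sub x b"
proof -
  let ?u = "uni (rep x suc)"
  note s = mem_uni_rep[OF F1_basic(3)] mem_rep[OF F1_basic(3)]
  have xk: "y \<epsilon> k" if "y \<epsilon> x" for y using x(1) that by (simp add: sub_def)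
  have "sm k (rep x suc)" using x(2) cov_rep[OF F1_basic(3)] sm_cov by blast
  then have "sm k ?u"
    by (rule regD(5)[OF k]) (use regD(3)[OF k] xk sm_mem in \<open>auto simp: s\<close>)
  moreover have "Ord ?u"
    by (rule Ord_uni) (use xk Ord_in[OF regD(1)[OF k]] in \<open>auto simp: s\<close>)
  moreover have "sub ?u k"
    unfolding sub_def s using xk Ord_trans[OF regD(1)[OF k]] by auto
  ultimately have "?u \<epsilon> k" using Ord_sub_iff[of ?u k] regD(1,4)[OF k] by auto
  moreover have "sub x ?u" unfolding sub_def s by auto
  ultimately show ?thesis by blast
qed

text \<open>Dropping what is covered by the index \<open>n\<close> alone loses at most one element.
  This drives the inductions on finite sizes.\<close>

lemma cov_suc_split:
  assumes "cov (suc n) x" "\<not> n \<epsilon> n"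
  obtains y where "cov n y" "sub y x" "\<And>z z'. z \<epsilon> x \<Longrightarrow> \<not> z \<epsilon> y \<Longrightarrow> z' \<epsilon> x \<Longrightarrow> \<not> z' \<epsilon> y \<Longrightarrow> z = z'"
proof -
  obtain f where f: "func f" "\<And>z. z \<epsilon> x \<Longrightarrow> \<exists>u. u \<epsilon> suc n \<and> pair u z \<epsilon> f"
    using assms unfolding cov_def by blast
  have D: "D1 (\<lambda>z. \<exists>u. u \<epsilon> n \<and> pair u z \<epsilon> f)" unfolding D1_def by (intro dfi)
  let ?y = "sep x (\<lambda>z. \<exists>u. u \<epsilon> n \<and> pair u z \<epsilon> f)"
  show ?thesis
  proof (rule that[of ?y])
    show "cov n ?y" unfolding cov_def by (rule exI[of _ f]) (auto simp: f mem_sep[OF D])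
    show "sub ?y x" by (auto simp: sub_def mem_sep[OF D])
    show "z = z'" if "z \<epsilon> x" "\<not> z \<epsilon> ?y" "z' \<epsilon> x" "\<not> z' \<epsilon> ?y" for z z'
    proof -
      have "pair n w \<epsilon> f" if "w \<epsilon> x" "\<not> w \<epsilon> ?y" for w
        using f(2)[OF that(1)] that unfolding mem_sep[OF D] mem_suc by blast
      then have "pair n z \<epsilon> f" "pair n z' \<epsilon> f" using that by blast+
      then show ?thesis using f(1) funcD by blast
    qed
  qed
qed

lemma sm_om_insert: "sm om x \<Longrightarrow> (\<And>z. z \<epsilon> y \<Longrightarrow> z \<epsilon> x \<or> z = a) \<Longrightarrow> sm om y"
proof -
  assume "sm om x" and y: "\<And>z. z \<epsilon> y \<Longrightarrow> z \<epsilon> x \<or> z = a"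
  then obtain n f where n: "natural n" "func f" "\<And>z. z \<epsilon> x \<Longrightarrow> \<exists>u. u \<epsilon> n \<and> pair u z \<epsilon> f"
    unfolding sm_def cov_def by auto
  have "cov (suc n) y"
  proof (rule covI[of "\<lambda>u z. u \<epsilon> n \<and> pair u z \<epsilon> f \<or> u = n \<and> z = a"])
    show "D2 (\<lambda>u z. u \<epsilon> n \<and> pair u z \<epsilon> f \<or> u = n \<and> z = a)" unfolding D2_def by (intro dfi)
    show "\<exists>u. u \<epsilon> suc n \<and> (u \<epsilon> n \<and> pair u z \<epsilon> f \<or> u = n \<and> z = a)" if "z \<epsilon> y" for z
      using y[OF that] n(3)[of z] unfolding mem_suc by blast
  qed (use n(2) funcD in auto)
  then show "sm om y" using natural_suc[OF n(1)] by (auto simp: sm_def)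
qed

text \<open>Two inductions on finite sizes: one for the union of two sets, one for the number of
  sets.\<close>

lemma sm_om_union:
  assumes x: "sm om x" and y: "\<And>y. y \<epsilon> x \<Longrightarrow> sm om y" shows "sm om (uni x)"
proof -
  have two: "sm om (cup x y)" if "sm om x" "sm om y" for x y
  proof -
    have D: "D1 (\<lambda>n. \<forall>y. cov n y \<longrightarrow> sm om (cup x y))" unfolding D1_def by (intro dfi)
    have "\<forall>y. cov n y \<longrightarrow> sm om (cup x y)" if "natural n" for n
    proof (rule om_induct[OF that D], intro allI impI)
      fix y assume "cov emp y"
      then have "sub (cup x y) x" by (auto simp: cov_def sub_def)
      then show "sm om (cup x y)" using sm_sub \<open>sm om x\<close> by blast
    next
      fix n assume n: "natural n" "\<forall>y. cov n y \<longrightarrow> sm om (cup x y)"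
      show "\<forall>y. cov (suc n) y \<longrightarrow> sm om (cup x y)"
      proof (intro allI impI)
        fix y assume "cov (suc n) y"
        then obtain y' where y': "cov n y'" "sub y' y"
          "\<And>z z'. z \<epsilon> y \<Longrightarrow> \<not> z \<epsilon> y' \<Longrightarrow> z' \<epsilon> y \<Longrightarrow> \<not> z' \<epsilon> y' \<Longrightarrow> z = z'"
          using cov_suc_split by (metis mem_irrefl)
        then have "sm om (cup x y')" using n by blast
        then show "sm om (cup x y)"
          by (rule sm_om_insert[of _ _ "SOME z. z \<epsilon> y \<and> \<not> z \<epsilon> y'"])
            (use y'(3) someI[of "\<lambda>z. z \<epsilon> y \<and> \<not> z \<epsilon> y'"] in \<open>metis mem_cup\<close>)
      qed
    qed
    then show ?thesis using \<open>sm om y\<close> by (auto simp: sm_def)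
  qed
  let ?Q = "\<lambda>n. \<forall>x. cov n x \<longrightarrow> (\<forall>y. y \<epsilon> x \<longrightarrow> sm om y) \<longrightarrow> sm om (uni x)"
  have D: "D1 ?Q" unfolding D1_def by (intro dfi)
  have "?Q n" if "natural n" for n
  proof (rule om_induct[OF that D], intro allI impI)
    fix x assume "cov emp x"
    then have "sub (uni x) emp" by (auto simp: cov_def sub_def)
    then show "sm om (uni x)" using sm_sub sm_mem natural_emp mem_om by blast
  next
    fix n assume n: "natural n" "?Q n"
    show "?Q (suc n)"
    proof (intro allI impI)
      fix x assume "cov (suc n) x" and x: "\<forall>y. y \<epsilon> x \<longrightarrow> sm om y"
      then obtain y where y: "cov n y" "sub y x"
        "\<And>z z'. z \<epsilon> x \<Longrightarrow> \<not> z \<epsilon> y \<Longrightarrow> z' \<epsilon> x \<Longrightarrow> \<not> z' \<epsilon> y \<Longrightarrow> z = z'"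
        using cov_suc_split by (metis mem_irrefl)
      have s: "sm om (uni y)" using n(2) y(1,2) x by (auto simp: sub_def)
      show "sm om (uni x)"
      proof (cases "\<exists>z. z \<epsilon> x \<and> \<not> z \<epsilon> y")
        case True
        then obtain z where z: "z \<epsilon> x" "\<not> z \<epsilon> y" by blast
        then have "sub (uni x) (cup (uni y) z)" using y(3) by (auto simp: sub_def)
        then show ?thesis using two[OF s, of z] x z sm_sub by blast
      next
        case False
        then have "sub (uni x) (uni y)" by (auto simp: sub_def)
        then show ?thesis using s sm_sub by blast
      qed
    qed
  qed
  then show ?thesis using x y by (auto simp: sm_def)
qed

lemma cup_Ord: "Ord a \<Longrightarrow> Ord b \<Longrightarrow> cup a b = a \<or> cup a b = b"
  using Ord_linear[of a b] Ord_sub_iff[of a b] Ord_sub_iff[of b a]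
  unfolding sub_def ext_iff mem_cup by blast

text \<open>By induction on the size, a finite subset of \<open>om\<close> has a natural number as a
  bound, which \<open>om\<close> itself has not.\<close>

lemma not_sm_om: "\<not> sm om om"
proof
  assume "sm om om"
  let ?Q = "\<lambda>n. \<forall>x. sub x om \<longrightarrow> cov n x \<longrightarrow> (\<exists>b. natural b \<and> sub x b)"
  have D: "D1 ?Q" unfolding D1_def by (intro dfi)
  have "?Q n" if "natural n" for n
  proof (rule om_induct[OF that D], intro allI impI)
    fix x assume "cov emp x"
    then have "sub x emp" by (auto simp: cov_def sub_def)
    then show "\<exists>b. natural b \<and> sub x b" using natural_emp by blast
  next
    fix n assume n: "natural n" "?Q n"
    show "?Q (suc n)"
    proof (intro allI impI)
      fix x assume "cov (suc n) x" and x: "sub x om"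
      then obtain y where y: "cov n y" "sub y x"
        "\<And>z z'. z \<epsilon> x \<Longrightarrow> \<not> z \<epsilon> y \<Longrightarrow> z' \<epsilon> x \<Longrightarrow> \<not> z' \<epsilon> y \<Longrightarrow> z = z'"
        using cov_suc_split by (metis mem_irrefl)
      obtain b where b: "natural b" "sub y b" using n(2) y(1,2) x sub_trans by blast
      show "\<exists>b. natural b \<and> sub x b"
      proof (cases "\<exists>z. z \<epsilon> x \<and> \<not> z \<epsilon> y")
        case True
        then obtain z where z: "z \<epsilon> x" "\<not> z \<epsilon> y" by blast
        then have zn: "natural z" using x by (auto simp: sub_def)
        have "sub x (cup (suc z) b)" using y(3) b(2) z by (auto simp: sub_def)
        moreover have "cup (suc z) b = suc z \<or> cup (suc z) b = b"
          by (rule cup_Ord) (use natural_Ord[OF zn] natural_Ord[OF b(1)] in auto)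
        ultimately show ?thesis using natural_suc[OF zn] b(1) by metis
      next
        case False
        then have "sub x y" by (auto simp: sub_def)
        then show ?thesis using b sub_trans by blast
      qed
    qed
  qed
  with \<open>sm om om\<close> obtain b where "natural b" "sub om b" using sub_refl mem_om unfolding sm_def by blast
  then show False by (metis mem_om subD mem_irrefl)
qed

lemma reg_om: "reg om"
  unfolding reg_def using sm_om_union not_sm_om natural_suc by auto

lemma Vs_pair:
  assumes "Ord k" "\<And>a. a \<epsilon> k \<Longrightarrow> suc a \<epsilon> k" "x \<epsilon> Vs k" "y \<epsilon> Vs k"
  shows "pair x y \<epsilon> Vs k"
proof -
  have up: "upr u v \<epsilon> Vs k" if "u \<epsilon> Vs k" "v \<epsilon> Vs k" for u v
  proof -
    have uv: "rk u \<epsilon> k" "rk v \<epsilon> k" using that assms(1) by (simp_all add: mem_Vs_iff)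
    have "suc (rk u) \<epsilon> suc (rk v) \<or> suc (rk u) = suc (rk v) \<or> suc (rk v) \<epsilon> suc (rk u)"
      by (rule Ord_linear) auto
    then obtain c where c: "c \<epsilon> k" "Ord c" "rk u \<epsilon> c" "rk v \<epsilon> c"
      using assms(2)[OF uv(1)] assms(2)[OF uv(2)] Ord_trans[of "suc (rk u)"] Ord_trans[of "suc (rk v)"]
        Ord_suc[OF Ord_rk] by (metis mem_suc)
    then have "sub (upr u v) (Vs c)" by (auto simp: sub_def mem_Vs_iff)
    then show ?thesis using c mem_Vs by blast
  qed
  show ?thesis unfolding pair_def by (intro up assms)
qed

lemma reg_Vs_pair: "reg k \<Longrightarrow> x \<epsilon> Vs k \<Longrightarrow> y \<epsilon> Vs k \<Longrightarrow> pair x y \<epsilon> Vs k"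
  using Vs_pair regD(1,3) by blast

lemma Ord_sub_Vs: "Ord a \<Longrightarrow> sub a (Vs a)"
  unfolding sub_def using mem_Vs_iff rk_Ord Ord_in by metis

text \<open>The ranks of the members form a small subset of \<open>k\<close> and are thus bounded
  below \<open>k\<close>.\<close>

lemma reg_Vs_small:
  assumes k: "reg k" and x: "sub x (Vs k)" "sm k x" shows "x \<epsilon> Vs k"
proof -
  have "sm k (rep x rk)" using x(2) cov_rep[OF F1_rk] sm_cov by blast
  moreover have "sub (rep x rk) k"
    using x(1) mem_Vs_iff[OF regD(1)[OF k]] by (auto simp: sub_def mem_rep[OF F1_rk])
  ultimately obtain b where b: "b \<epsilon> k" "sub (rep x rk) b" using reg_bounded[OF k] by blast
  then have "sub x (Vs b)"
    using mem_Vs_iff[of b] Ord_in[OF regD(1)[OF k]] by (auto simp: sub_def mem_rep[OF F1_rk])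
  then show ?thesis using b mem_Vs by blast
qed

end

section \<open>Choice, well-orderings and Hartogs numbers\<close>

locale zfc = zf +
  assumes choice: "(\<And>x. x \<epsilon> a \<Longrightarrow> \<exists>y. y \<epsilon> x) \<Longrightarrow>
    \<exists>f. func f \<and> (\<forall>x. x \<epsilon> a \<longrightarrow> (\<exists>y. y \<epsilon> x \<and> pair x y \<epsilon> f))"
begin

text \<open>Collection first confines the witnesses to a set \<open>b\<close>; then choice is
  applied to the subsets of \<open>b\<close> in question.\<close>

lemma choice_rel:
  assumes R: "D2 R" and "\<And>x. x \<epsilon> a \<Longrightarrow> \<exists>y. R x y"
  shows "\<exists>f. \<forall>x. x \<epsilon> a \<longrightarrow> R x (ap f x)"
proof -
  obtain b where b: "\<And>x. x \<epsilon> a \<Longrightarrow> \<exists>y. y \<epsilon> b \<and> R x y"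
    using collection[OF R, of a] assms(2) by blast
  have D: "D1 (R x)" for x unfolding D1_def by (intro dfi D2I[OF R])
  have F: "F1 (\<lambda>x. sep b (R x))" unfolding F1_def by (intro dfi D2I[OF R])
  have "\<exists>y. y \<epsilon> x" if "x \<epsilon> rep a (\<lambda>x. sep b (R x))" for x
    using that b by (auto simp: mem_rep[OF F] mem_sep[OF D])
  from choice[OF this] obtain f where
    f: "func f" "\<And>x. x \<epsilon> rep a (\<lambda>x. sep b (R x)) \<Longrightarrow> \<exists>y. y \<epsilon> x \<and> pair x y \<epsilon> f" by blast
  have G: "F1 (\<lambda>x. ap f (sep b (R x)))" unfolding F1_def by (intro dfi D2I[OF R])
  have "R x (ap (lam a (\<lambda>x. ap f (sep b (R x)))) x)" if x: "x \<epsilon> a" for x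
  proof -
    have "sep b (R x) \<epsilon> rep a (\<lambda>x. sep b (R x))" using x by (auto simp: mem_rep[OF F])
    from f(2)[OF this] obtain y where "y \<epsilon> sep b (R x)" "pair (sep b (R x)) y \<epsilon> f" by blast
    then have "R x y" "ap f (sep b (R x)) = y" using ap_eq[OF f(1)] by (auto simp: mem_sep[OF D])
    then show ?thesis using x by (simp add: ap_lam[OF G])
  qed
  then show ?thesis by blast
qed

text \<open>Choose a covering of every member. A pair then combines an index of a member with an
  index inside it; closure of \<open>a\<close> under pairs takes the place of cardinal
  multiplication.\<close>

lemma cov_union:
  assumes p: "\<And>u v. u \<epsilon> a \<Longrightarrow> v \<epsilon> a \<Longrightarrow> pair u v \<epsilon> a"
    and x: "cov a x" "\<And>y. y \<epsilon> x \<Longrightarrow> cov a y"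
  shows "cov a (uni x)"
proof -
  obtain f where f: "func f" "\<And>z. z \<epsilon> x \<Longrightarrow> \<exists>u. u \<epsilon> a \<and> pair u z \<epsilon> f"
    using x(1) unfolding cov_def by blast
  let ?R = "\<lambda>y f. func f \<and> (\<forall>z. z \<epsilon> y \<longrightarrow> (\<exists>u. u \<epsilon> a \<and> pair u z \<epsilon> f))"
  have R: "D2 ?R" unfolding D2_def by (intro dfi)
  obtain g where g: "\<And>y. y \<epsilon> x \<Longrightarrow> ?R y (ap g y)"
    using choice_rel[OF R, of x] x(2) unfolding cov_def by blast
  show ?thesis
  proof (rule covI[of "\<lambda>q z. \<exists>u v y. q = pair u v \<and> pair u y \<epsilon> f \<and> y \<epsilon> x \<and> pair v z \<epsilon> ap g y"])
    show "D2 (\<lambda>q z. \<exists>u v y. q = pair u v \<and> pair u y \<epsilon> f \<and> y \<epsilon> x \<and> pair v z \<epsilon> ap g y)"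
      unfolding D2_def by (intro dfi)
  next
    fix q z z'
    assume "\<exists>u v y. q = pair u v \<and> pair u y \<epsilon> f \<and> y \<epsilon> x \<and> pair v z \<epsilon> ap g y"
      "\<exists>u v y. q = pair u v \<and> pair u y \<epsilon> f \<and> y \<epsilon> x \<and> pair v z' \<epsilon> ap g y"
    then obtain u v y y' where *: "pair u y \<epsilon> f" "y \<epsilon> x" "pair v z \<epsilon> ap g y"
        "pair u y' \<epsilon> f" "y' \<epsilon> x" "pair v z' \<epsilon> ap g y'"
      by auto
    then have "y = y'" using f(1) funcD by blast
    then show "z = z'" using * g funcD by blast
  next
    fix z assume "z \<epsilon> uni x"
    then obtain y where y: "y \<epsilon> x" "z \<epsilon> y" by auto
    obtain u where u: "u \<epsilon> a" "pair u y \<epsilon> f" using f(2)[OF y(1)] by blast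
    obtain v where v: "v \<epsilon> a" "pair v z \<epsilon> ap g y" using g[OF y(1)] y(2) by blast
    show "\<exists>q. q \<epsilon> a \<and> (\<exists>u v y. q = pair u v \<and> pair u y \<epsilon> f \<and> y \<epsilon> x \<and> pair v z \<epsilon> ap g y)"
      using p[OF u(1) v(1)] u v y by blast
  qed
qed

text \<open>Zermelo's argument: a choice function for the nonempty subsets enumerates
  \<open>a\<close> along the ordinals. The enumeration stops, since otherwise it would be injective
  and collection would put all ordinals into a set.\<close>

lemma well_order: "\<exists>m. Ord m \<and> cov m a \<and> cov a m"
proof -
  have "D2 (\<lambda>x y. y \<epsilon> x)" unfolding D2_def by (intro dfi)
  moreover have DN: "D1 (\<lambda>x. \<exists>y. y \<epsilon> x)" unfolding D1_def by (intro dfi)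
  ultimately obtain c where "\<forall>x. x \<epsilon> sep (pw a) (\<lambda>x. \<exists>y. y \<epsilon> x) \<longrightarrow> ap c x \<epsilon> x"
    using choice_rel[of "\<lambda>x y. y \<epsilon> x" "sep (pw a) (\<lambda>x. \<exists>y. y \<epsilon> x)"] by (auto simp: mem_sep)
  then have c: "ap c x \<epsilon> x" if "sub x a" "y \<epsilon> x" for x y
    using that by (auto simp: mem_sep[OF DN])
  define rest where "rest g = sep a (\<lambda>z. \<not> z \<epsilon> g)" for g
  have rest: "z \<epsilon> rest g \<longleftrightarrow> z \<epsilon> a \<and> \<not> z \<epsilon> g" for z g
    unfolding rest_def by (rule mem_sep) (unfold D1_def, intro dfi)
  \<comment> \<open>The value \<open>a\<close>, which is not a member of \<open>a\<close>, signals
    that nothing is left.\<close>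
  define F where "F x g = (if rest (rng g) = emp then a else ap c (rest (rng g)))" for x g :: 'a
  have F: "F2 F" unfolding F2_def F_def rest_def by (intro dfi)
  define s where "s = wrec (\<lambda>x. x) F"
  have s: "F1 s" unfolding s_def by (intro F1_wrec F1_id F)
  note [dfi] = F1I[OF s]
  have eq: "s x = (if rest (rep x s) = emp then a else ap c (rest (rep x s)))" for x
    using erec_eq[OF F, of x] unfolding s_def[symmetric] F_def by (simp add: rng_lam[OF s])
  have val: "s x \<epsilon> a \<and> (\<forall>y. y \<epsilon> x \<longrightarrow> s y \<noteq> s x)" if "s x \<noteq> a" for x
  proof -
    have "rest (rep x s) \<noteq> emp" "s x = ap c (rest (rep x s))" using eq[of x] that by presburger+
    moreover then obtain z where "z \<epsilon> rest (rep x s)" using emp_iff by blast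
    ultimately have "s x \<epsilon> rest (rep x s)" using c[of "rest (rep x s)" z] rest by (simp add: sub_def)
    then show ?thesis by (auto simp: rest mem_rep[OF s])
  qed
  have inj: "x = y" if "s x = s y" "s x \<noteq> a" "Ord x" "Ord y" for x y
    using val[of x] val[of y] that Ord_linear[of x y] by auto
  have "\<exists>x. Ord x \<and> s x = a"
  proof (rule ccontr)
    assume "\<not> ?thesis"
    then have ne: "\<And>x. Ord x \<Longrightarrow> s x \<noteq> a" by blast
    let ?R = "\<lambda>z x. Ord x \<and> s x = z"
    have "D2 ?R" unfolding D2_def by (intro dfi)
    from collection[OF this, of a] obtain b where
      b: "\<And>z. z \<epsilon> a \<Longrightarrow> (\<exists>x. ?R z x) \<Longrightarrow> \<exists>x. x \<epsilon> b \<and> ?R z x" by blast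
    have all: "x \<epsilon> b" if "Ord x" for x
      using b[of "s x"] val[OF ne[OF that]] inj ne that by blast
    let ?o = "uni (sep b Ord)"
    have o: "Ord ?o" by (rule Ord_uni) (simp add: mem_sep[OF D1_ord(2)])
    then have "suc ?o \<epsilon> b" by (intro all) simp
    then have "suc ?o \<epsilon> sep b Ord" using o by (simp add: mem_sep[OF D1_ord(2)])
    moreover have "?o \<epsilon> suc ?o" by simp
    ultimately have "?o \<epsilon> ?o" using mem_uni by blast
    then show False by simp
  qed
  then obtain x where x: "Ord x" "s x = a" by blast
  have "D1 (\<lambda>x. s x = a)" unfolding D1_def by (intro dfi)
  from Ord_least_ex[OF this x] obtain m where m: "Ord m" "s m = a" "\<And>y. y \<epsilon> m \<Longrightarrow> s y \<noteq> a" by blast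
  have "rest (rep m s) = emp"
    using eq[of m] m(2) c[of "rest (rep m s)"] emp_iff rest mem_irrefl by (metis sub_def)
  then have surj: "\<And>z. z \<epsilon> a \<Longrightarrow> \<exists>x. x \<epsilon> m \<and> z = s x"
    using rest by (metis emp_iff mem_rep[OF s])
  have "cov m a"
    by (rule covI[of "\<lambda>x z. z = s x"]) (use surj in \<open>auto simp: D2_def intro!: dfi\<close>)
  moreover have "cov a m"
  proof (rule covI[of "\<lambda>z x. z = s x"])
    show "D2 (\<lambda>z x. z = s x)" unfolding D2_def by (intro dfi)
    show "x = y" if "x \<epsilon> m" "y \<epsilon> m" "z = s x" "z = s y" for x y z
      using inj that m(3) Ord_in[OF m(1)] by metis
    show "\<exists>z. z \<epsilon> a \<and> z = s x" if "x \<epsilon> m" for x using val m(3)[OF that] by blast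
  qed
  ultimately show ?thesis using m(1) by blast
qed

definition hart where "hart a = col (\<lambda>x. Ord x \<and> cov a x)"

lemma F1_hart: "F1 hart" unfolding F1_def hart_def by (intro dfi)
lemmas [dfi] = F1I[OF F1_hart]

text \<open>An ordinal that covers the power set of \<open>a\<close> is not covered by
  \<open>a\<close>, by Cantor's diagonal argument. It bounds the ordinals in question, which
  therefore form a set.\<close>

lemma mem_hart: "x \<epsilon> hart a \<longleftrightarrow> Ord x \<and> cov a x"
proof -
  obtain m where m: "Ord m" "cov m (pw a)" using well_order by blast
  have "\<not> cov a m"
  proof
    assume "cov a m"
    then have "cov a (pw a)" using m(2) cov_trans by blast
    then obtain f where f: "func f" "\<And>z. sub z a \<Longrightarrow> \<exists>u. u \<epsilon> a \<and> pair u z \<epsilon> f"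
      unfolding cov_def by auto
    have D: "D1 (\<lambda>u. \<exists>z. pair u z \<epsilon> f \<and> \<not> u \<epsilon> z)" unfolding D1_def by (intro dfi)
    define d where "d = sep a (\<lambda>u. \<exists>z. pair u z \<epsilon> f \<and> \<not> u \<epsilon> z)"
    have d: "u \<epsilon> d \<longleftrightarrow> u \<epsilon> a \<and> (\<exists>z. pair u z \<epsilon> f \<and> \<not> u \<epsilon> z)" for u
      unfolding d_def by (rule mem_sep[OF D])
    then obtain u where "u \<epsilon> a" "pair u d \<epsilon> f" using f(2)[of d] by (auto simp: sub_def)
    then show False using d[of u] funcD[OF f(1), of u d] by blast
  qed
  then have "x \<epsilon> m" if "Ord x" "cov a x" for x
    using Ord_not_mem[of x m] that m(1) cov_mono sub_refl by blast
  moreover have "D1 (\<lambda>x. Ord x \<and> cov a x)" unfolding D1_def by (intro dfi)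
  ultimately show ?thesis
    unfolding hart_def by (intro mem_col_isset isset_sub[of _ m]) auto
qed

lemma Ord_hart: "Ord (hart a)"
proof -
  have "trs (hart a)"
    unfolding trs_def sub_def mem_hart using Ord_in cov_mono sub_refl
    by (metis Ord_trans sub_def)
  then show ?thesis unfolding Ord_def using mem_hart by (metis Ord_def)
qed

text \<open>Skipping to the Hartogs number of \<open>Vs k\<close> makes the regular cardinals \<open>K n\<close> below sufficiently strong
  without assuming GCH: a set is smaller than \<open>nx k\<close> iff \<open>Vs k\<close> covers it.\<close>

definition nx where "nx k = hart (Vs k)"

lemma F1_nx: "F1 nx" unfolding F1_def nx_def by (intro dfi)
lemmas [dfi] = F1I[OF F1_nx]

lemma sm_nx: "sm (nx k) x \<longleftrightarrow> cov (Vs k) x"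
proof
  show "sm (nx k) x \<Longrightarrow> cov (Vs k) x" unfolding sm_def nx_def mem_hart using cov_trans by blast
  assume "cov (Vs k) x"
  moreover obtain m where "Ord m" "cov m x" "cov x m" using well_order by blast
  ultimately show "sm (nx k) x" unfolding sm_def nx_def mem_hart using cov_trans by blast
qed

text \<open>Small for \<open>nx k\<close> means covered by \<open>Vs k\<close>. Since
  \<open>Vs k\<close> is closed under pairs, \<open>cov_union\<close> shows that small unions of
  small sets are small.\<close>

lemma reg_nx:
  assumes k: "reg k" shows "reg (nx k)" "k \<epsilon> nx k"
proof -
  note p = reg_Vs_pair[OF k]
  have kV: "sub k (Vs k)" by (rule Ord_sub_Vs[OF regD(1)[OF k]])
  show kn: "k \<epsilon> nx k" unfolding nx_def mem_hart
    using regD(1)[OF k] cov_mono[OF cov_refl sub_refl kV] by auto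
  have on: "Ord (nx k)" by (simp add: nx_def Ord_hart)
  have un: "cov (Vs k) (uni x)" if "cov (Vs k) x" "\<And>y. y \<epsilon> x \<Longrightarrow> cov (Vs k) y" for x
    by (rule cov_union[OF p that])
  have "suc a \<epsilon> nx k" if a: "a \<epsilon> nx k" for a
  proof -
    have a': "Ord a" "cov (Vs k) a" using a by (simp_all add: nx_def mem_hart)
    have 0: "emp \<epsilon> Vs k" "suc emp \<epsilon> Vs k"
      using kV regD(2)[OF k] natural_emp natural_suc by (meson subD)+
    have s: "cov (Vs k) (upr b c)" for b c
    proof (rule covI[of "\<lambda>u z. u = emp \<and> z = b \<or> u = suc emp \<and> z = c"])
      show "\<exists>u. u \<epsilon> Vs k \<and> (u = emp \<and> z = b \<or> u = suc emp \<and> z = c)" if "z \<epsilon> upr b c" for z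
        using that 0 unfolding mem_upr by blast
    qed (auto simp: D2_def intro!: dfi)
    have "suc a = uni (upr a (upr a a))" by (rule ext) auto
    then have "cov (Vs k) (suc a)" using un[of "upr a (upr a a)"] s a' by auto
    then show ?thesis using a' by (simp add: nx_def mem_hart)
  qed
  moreover have "\<not> sm (nx k) (nx k)"
    unfolding sm_nx using mem_hart[of "nx k" "Vs k"] on by (auto simp: nx_def)
  moreover have "sub om (nx k)"
    unfolding sub_def using kn regD(2)[OF k] Ord_trans[OF on] by simp
  ultimately show "reg (nx k)"
    unfolding reg_def sm_nx using on un by blast
qed

subsection \<open>The cardinals \<open>K n\<close>\<close>

text \<open>For a successor \<open>n\<close>, \<open>uni n\<close> is its predecessor.\<close>

definition K where "K = wrec (\<lambda>x. x) (\<lambda>n g. if n = emp then om else nx (ap g (uni n)))"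

lemma F1_K: "F1 K"
  unfolding K_def by (intro F1_wrec F1_id, unfold F2_def, intro dfi)
lemmas [dfi] = F1I[OF F1_K]

lemma K_eq: "K n = (if n = emp then om else nx (ap (lam n K) (uni n)))"
proof -
  have "F2 (\<lambda>n g. if n = emp then om else nx (ap g (uni n)))" unfolding F2_def by (intro dfi)
  from erec_eq[OF this, of n] show ?thesis unfolding K_def[symmetric] .
qed

lemma K_emp [simp]: "K emp = om" by (simp add: K_eq)

lemma uni_suc: "Ord n \<Longrightarrow> uni (suc n) = n"
  by (rule ext) (auto dest: Ord_trans)

lemma K_suc: "natural n \<Longrightarrow> K (suc n) = nx (K n)"
  using uni_suc[OF natural_Ord[of n]] by (simp add: K_eq[of "suc n"] ap_lam[OF F1_K])

lemma reg_K: "natural n \<Longrightarrow> reg (K n)"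
  by (rule om_induct[of n "\<lambda>n. reg (K n)"])
    (auto simp: D1_def reg_om K_suc reg_nx intro!: dfi)

lemma K_mem_suc: "natural n \<Longrightarrow> K n \<epsilon> K (suc n)"
  by (simp add: K_suc reg_nx reg_K)

lemma Ord_K: "natural n \<Longrightarrow> Ord (K n)"
  by (rule regD(1)[OF reg_K])

lemma K_mono: "natural n \<Longrightarrow> m \<epsilon> n \<Longrightarrow> K m \<epsilon> K n"
proof -
  have D: "D1 (\<lambda>n. \<forall>m. m \<epsilon> n \<longrightarrow> K m \<epsilon> K n)" unfolding D1_def by (intro dfi)
  assume "natural n" "m \<epsilon> n"
  moreover from \<open>natural n\<close> have "\<forall>m. m \<epsilon> n \<longrightarrow> K m \<epsilon> K n"
  proof (rule om_induct[OF _ D])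
    fix n assume n: "natural n" "\<forall>m. m \<epsilon> n \<longrightarrow> K m \<epsilon> K n"
    then show "\<forall>m. m \<epsilon> suc n \<longrightarrow> K m \<epsilon> K (suc n)"
      using K_mem_suc[OF n(1)] Ord_trans[OF Ord_K[OF natural_suc[OF n(1)]]] unfolding mem_suc by metis
  qed simp
  ultimately show ?thesis by blast
qed

lemma K_sub: "natural n \<Longrightarrow> m \<epsilon> suc n \<Longrightarrow> sub (K m) (K n)"
  using K_mono[of n m] Ord_trans[OF Ord_K[of n]] unfolding mem_suc sub_def by blast

text \<open>The ordinal \<open>\<lambda>\<close> of the overview, which becomes
  \<open>\<aleph>\<^sub>\<omega>\<close> in the extension.\<close>

definition lm where "lm = uni (rep om K)"

lemma mem_lm: "a \<epsilon> lm \<longleftrightarrow> (\<exists>n. natural n \<and> a \<epsilon> K n)"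
  unfolding lm_def by (auto simp del: mem_uni simp: mem_uni_rep[OF F1_K])

lemma Ord_lm: "Ord lm"
  unfolding lm_def by (rule Ord_uni) (auto simp: mem_rep[OF F1_K] Ord_K)

lemma K_sub_lm: "natural n \<Longrightarrow> sub (K n) lm"
  by (auto simp: sub_def mem_lm)

end

subsection \<open>The meaning of the set-theoretic formulas\<close>

context zf
begin

definition fn where
  "fn f a b \<longleftrightarrow> (\<forall>p. p \<epsilon> f \<longrightarrow> (\<exists>x. x \<epsilon> a \<and> (\<exists>y. y \<epsilon> b \<and> p = pair x y)))
    \<and> (\<forall>x. x \<epsilon> a \<longrightarrow> (\<exists>y. pair x y \<epsilon> f)) \<and> func f"

definition bij where
  "bij f a b \<longleftrightarrow> fn f a b \<and> (\<forall>x y z. pair x z \<epsilon> f \<and> pair y z \<epsilon> f \<longrightarrow> x = y)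
    \<and> (\<forall>y. y \<epsilon> b \<longrightarrow> (\<exists>x. pair x y \<epsilon> f))"

definition eqp where "eqp a b \<longleftrightarrow> (\<exists>f. bij f a b)"

definition lim where
  "lim x \<longleftrightarrow> Ord x \<and> x \<noteq> emp \<and> (\<forall>y. y \<epsilon> x \<longrightarrow> suc y \<epsilon> x)"

definition card where
  "card x \<longleftrightarrow> Ord x \<and> sub om x \<and> (\<forall>y. y \<epsilon> x \<longrightarrow> \<not> eqp y x)"

lemma lim_om: "lim om"
  using natural_emp natural_suc by (auto simp: lim_def emp_iff)

lemma not_lim_suc: "\<not> lim (suc k)"
  unfolding lim_def using mem_irrefl[of "suc k"] mem_suc[of k k] by blast

lemma not_lim_natural: "natural x \<Longrightarrow> \<not> lim x"
  using natural_cases[of x] not_lim_suc by (auto simp: lim_def)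

lemma om_unique: "lim x \<Longrightarrow> (\<forall>y. y \<epsilon> x \<longrightarrow> \<not> lim y) \<Longrightarrow> x = om"
proof -
  assume x: "lim x" "\<forall>y. y \<epsilon> x \<longrightarrow> \<not> lim y"
  have "\<not> om \<epsilon> x" using x lim_om by blast
  moreover have "\<not> x \<epsilon> om" using not_lim_natural x by auto
  ultimately show ?thesis using Ord_linear[of x om] x(1) by (auto simp: lim_def)
qed

lemma sat_empty [simp]: "sat E e (empty_fm x) \<longleftrightarrow> e x = emp"
  by (simp add: empty_fm_def emp_iff)

lemma sat_subset [simp]: "sat E e (subset_fm x y) \<longleftrightarrow> sub (e x) (e y)"
  by (simp add: subset_fm_def sub_def)

lemma sat_upair [simp]: "sat E e (upair_fm x y z) \<longleftrightarrow> e z = upr (e x) (e y)"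
  unfolding ext_iff[of "e z"] mem_upr
  by (simp add: upair_fm_def) blast

lemma sat_pair [simp]: "sat E e (pair_fm x y z) \<longleftrightarrow> e z = pair (e x) (e y)"
  by (simp add: pair_fm_def pair_def)

lemma sat_inter [simp]:
  "sat E e (inter_fm x y z) \<longleftrightarrow> (\<forall>w. w \<epsilon> e z \<longleftrightarrow> w \<epsilon> e x \<and> w \<epsilon> e y)"
  by (simp add: inter_fm_def) blast

lemma sat_diff [simp]:
  "sat E e (diff_fm x y z) \<longleftrightarrow> (\<forall>w. w \<epsilon> e z \<longleftrightarrow> w \<epsilon> e x \<and> \<not> w \<epsilon> e y)"
  by (simp add: diff_fm_def) blast

lemma sat_succ [simp]: "sat E e (succ_fm x y) \<longleftrightarrow> e y = suc (e x)"
  unfolding ext_iff[of "e y"] mem_suc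
  by (simp add: succ_fm_def) blast

lemma sat_app [simp]: "sat E e (app_fm f x y) \<longleftrightarrow> pair (e x) (e y) \<epsilon> e f"
  by (simp add: app_fm_def)

lemma sat_fun [simp]: "sat E e (fun_fm f a b) \<longleftrightarrow> fn (e f) (e a) (e b)"
  by (simp add: fun_fm_def fn_def func_def eval_nat_numeral)

lemma sat_bij [simp]: "sat E e (bij_fm f a b) \<longleftrightarrow> bij (e f) (e a) (e b)"
  by (simp add: bij_fm_def bij_def eval_nat_numeral) blast

lemma sat_eqpoll [simp]: "sat E e (eqpoll_fm a b) \<longleftrightarrow> eqp (e a) (e b)"
  by (simp add: eqpoll_fm_def eqp_def)

lemma sat_transitive [simp]: "sat E e (transitive_fm x) \<longleftrightarrow> trs (e x)"
  by (simp add: transitive_fm_def trs_def)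

lemma sat_ordinal [simp]: "sat E e (ordinal_fm x) \<longleftrightarrow> Ord (e x)"
  by (simp add: ordinal_fm_def Ord_def)

lemma sat_limit [simp]: "sat E e (limit_fm x) \<longleftrightarrow> lim (e x)"
  by (simp add: limit_fm_def lim_def)

lemma sat_omega [simp]: "sat E e (omega_fm x) \<longleftrightarrow> e x = om"
proof -
  have "sat E e (omega_fm x) \<longleftrightarrow> lim (e x) \<and> (\<forall>y. y \<epsilon> e x \<longrightarrow> \<not> lim y)"
    by (simp add: omega_fm_def)
  then show ?thesis using om_unique[of "e x"] lim_om not_lim_natural mem_om by metis
qed

lemma sat_cardinal [simp]: "sat E e (cardinal_fm x) \<longleftrightarrow> card (e x)"
  by (simp add: cardinal_fm_def card_def)

end

lemma (in zf) zfcI: "(\<And>e. sat E e choice_ax) \<Longrightarrow> zfc E"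
proof
  fix a assume ax: "\<And>e. sat E e choice_ax" and a: "\<And>x. x \<epsilon> a \<Longrightarrow> \<exists>y. y \<epsilon> x"
  have "\<forall>a. (\<forall>x. x \<epsilon> a \<longrightarrow> x \<noteq> emp) \<longrightarrow> (\<exists>b f. fn f a b \<and> (\<forall>x. x \<epsilon> a \<longrightarrow> (\<exists>y. y \<epsilon> x \<and> pair x y \<epsilon> f)))"
    using ax[of undefined] by (simp add: choice_ax_def eval_nat_numeral)
  moreover have "\<forall>x. x \<epsilon> a \<longrightarrow> x \<noteq> emp" using a by (auto simp: emp_iff)
  ultimately show "\<exists>f. func f \<and> (\<forall>x. x \<epsilon> a \<longrightarrow> (\<exists>y. y \<epsilon> x \<and> pair x y \<epsilon> f))"
    unfolding fn_def by blast
qed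

context zf
begin

text \<open>The clauses follow \<open>ultrafilter_fm\<close> literally, so that the translation is
  mere rewriting.\<close>

definition uf where
  "uf u k \<longleftrightarrow> (\<forall>x. x \<epsilon> u \<longrightarrow> sub x k) \<and> k \<epsilon> u \<and> (\<forall>x. x \<epsilon> u \<longrightarrow> x \<noteq> emp)
    \<and> (\<forall>x. x \<epsilon> u \<longrightarrow> (\<forall>y. y \<epsilon> u \<longrightarrow> (\<exists>z. z \<epsilon> u \<and> (\<forall>w. w \<epsilon> z \<longleftrightarrow> w \<epsilon> x \<and> w \<epsilon> y))))
    \<and> (\<forall>x. x \<epsilon> u \<longrightarrow> (\<forall>y. sub x y \<and> sub y k \<longrightarrow> y \<epsilon> u))
    \<and> (\<forall>x. sub x k \<longrightarrow> \<not> x \<epsilon> u \<longrightarrow> (\<exists>z. z \<epsilon> u \<and> (\<forall>w. w \<epsilon> z \<longleftrightarrow> w \<epsilon> k \<and> \<not> w \<epsilon> x)))"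

lemma sat_ultrafilter [simp]: "sat E e (ultrafilter_fm u k) \<longleftrightarrow> uf (e u) (e k)"
  unfolding ultrafilter_fm_def uf_def
  by (simp only: sat.simps sat_subset sat_inter sat_diff sat_empty not_imp not_not simp_thms nat.case
      not_ex[symmetric] add_2_eq_Suc' add_Suc_right add_0_right One_nat_def numeral_2_eq_2)

lemma eqpI:
  assumes R: "D2 R"
    and tot: "\<And>x. x \<epsilon> a \<Longrightarrow> \<exists>y. y \<epsilon> b \<and> R x y"
    and sv: "\<And>x y y'. x \<epsilon> a \<Longrightarrow> y \<epsilon> b \<Longrightarrow> y' \<epsilon> b \<Longrightarrow> R x y \<Longrightarrow> R x y' \<Longrightarrow> y = y'"
    and inj: "\<And>x x' y. x \<epsilon> a \<Longrightarrow> x' \<epsilon> a \<Longrightarrow> y \<epsilon> b \<Longrightarrow> R x y \<Longrightarrow> R x' y \<Longrightarrow> x = x'"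
    and sur: "\<And>y. y \<epsilon> b \<Longrightarrow> \<exists>x. x \<epsilon> a \<and> R x y"
  shows "eqp a b"
proof -
  have D: "D1 (\<lambda>p. R (fstp p) (sndp p))" unfolding D1_def by (intro dfi D2I[OF R])
  let ?f = "sep (prod a b) (\<lambda>p. R (fstp p) (sndp p))"
  have f: "pair x y \<epsilon> ?f \<longleftrightarrow> x \<epsilon> a \<and> y \<epsilon> b \<and> R x y" for x y
    unfolding mem_sep[OF D] by simp
  have "func ?f" unfolding func_def f using sv by blast
  moreover have "\<forall>p. p \<epsilon> ?f \<longrightarrow> (\<exists>x. x \<epsilon> a \<and> (\<exists>y. y \<epsilon> b \<and> p = pair x y))"
    unfolding mem_sep[OF D] mem_prod by blast
  ultimately have "bij ?f a b" unfolding bij_def fn_def f using tot inj sur by blast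
  then show ?thesis unfolding eqp_def by blast
qed

lemma eqp_sym: "eqp a b \<Longrightarrow> eqp b a"
proof -
  assume "eqp a b"
  then obtain f where f: "bij f a b" unfolding eqp_def by blast
  have D: "D2 (\<lambda>x y. pair y x \<epsilon> f)" unfolding D2_def by (intro dfi)
  have i: "pair x y \<epsilon> f \<Longrightarrow> x \<epsilon> a \<and> y \<epsilon> b" for x y using f unfolding bij_def fn_def by fastforce
  show ?thesis
  proof (rule eqpI[OF D])
    fix x assume "x \<epsilon> b" then show "\<exists>y. y \<epsilon> a \<and> pair y x \<epsilon> f" using f i unfolding bij_def by blast
  next
    fix x y y' assume "pair y x \<epsilon> f" "pair y' x \<epsilon> f" then show "y = y'" using f unfolding bij_def by blast
  next
    fix x x' y assume "pair y x \<epsilon> f" "pair y x' \<epsilon> f"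
    then show "x = x'" using f funcD unfolding bij_def fn_def by blast
  next
    fix y assume "y \<epsilon> a" then show "\<exists>x. x \<epsilon> b \<and> pair y x \<epsilon> f" using f i unfolding bij_def fn_def by blast
  qed
qed

lemma eqp_cov: "eqp a b \<Longrightarrow> cov a b"
proof -
  assume "eqp a b"
  then obtain f where f: "bij f a b" unfolding eqp_def by blast
  have i: "pair x y \<epsilon> f \<Longrightarrow> x \<epsilon> a" for x y using f unfolding bij_def fn_def by fastforce
  have "func f" "\<And>z. z \<epsilon> b \<Longrightarrow> \<exists>u. u \<epsilon> a \<and> pair u z \<epsilon> f" using f i unfolding bij_def fn_def by blast+
  then show ?thesis unfolding cov_def by (intro exI[of _ f]) simp
qed

text \<open>Stated without choice because it will be applied in the extension: every member of
  \<open>x\<close> is represented by its least index, and the set of these indices is collapsed to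
  an ordinal.\<close>

lemma cov_Ord_eqp:
  assumes a: "Ord a" and x: "cov a x"
  shows "\<exists>g. Ord g \<and> sub g a \<and> eqp g x"
proof -
  obtain f where f: "func f" "\<And>z. z \<epsilon> x \<Longrightarrow> \<exists>u. u \<epsilon> a \<and> pair u z \<epsilon> f"
    using x unfolding cov_def by blast
  define least where "least u z \<longleftrightarrow> pair u z \<epsilon> f \<and> (\<forall>w. w \<epsilon> u \<longrightarrow> \<not> pair w z \<epsilon> f)" for u z
  have L: "D2 least" unfolding D2_def least_def by (intro dfi)
  note [dfi] = D2I[OF L]
  have D: "D1 (\<lambda>u. \<exists>z. z \<epsilon> x \<and> least u z)" unfolding D1_def by (intro dfi)
  define d where "d = sep a (\<lambda>u. \<exists>z. z \<epsilon> x \<and> least u z)"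
  have d: "u \<epsilon> d \<longleftrightarrow> u \<epsilon> a \<and> (\<exists>z. z \<epsilon> x \<and> least u z)" for u unfolding d_def mem_sep[OF D] ..
  have ex: "\<exists>u. u \<epsilon> d \<and> least u z" if z: "z \<epsilon> x" for z
  proof -
    obtain u where u: "u \<epsilon> a" "pair u z \<epsilon> f" using f(2)[OF z] by blast
    have "D1 (\<lambda>u. pair u z \<epsilon> f)" unfolding D1_def by (intro dfi)
    from Ord_least_ex[OF this Ord_in[OF a u(1)]] u(2)
    obtain w where w: "pair w z \<epsilon> f" "\<forall>c. c \<epsilon> w \<longrightarrow> \<not> pair c z \<epsilon> f" "w \<epsilon> suc u" by blast
    have "w \<epsilon> a" using w(3) u(1) Ord_trans[OF a u(1)] unfolding mem_suc by blast
    then show ?thesis using w z unfolding d least_def by blast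
  qed
  have un: "u = w" if "least u z" "least w z" "u \<epsilon> d" "w \<epsilon> d" for u w z
    using that Ord_linear[OF Ord_in[OF a] Ord_in[OF a], of u w] unfolding d least_def by blast
  have "sub d a" unfolding sub_def d by blast
  from order_type[OF a this] obtain p where p: "F1 p" "Ord (rep d p)" "sub (rep d p) a"
    "\<And>u v. u \<epsilon> d \<Longrightarrow> v \<epsilon> d \<Longrightarrow> p u = p v \<Longrightarrow> u = v" by metis
  have R: "D2 (\<lambda>t z. \<exists>u. u \<epsilon> d \<and> t = p u \<and> least u z)" unfolding D2_def by (intro dfi F1I[OF p(1)])
  have "eqp (rep d p) x"
  proof (rule eqpI[OF R])
    fix t assume "t \<epsilon> rep d p"
    then obtain u where "u \<epsilon> d" "t = p u" unfolding mem_rep[OF p(1)] by blast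
    then show "\<exists>z. z \<epsilon> x \<and> (\<exists>u. u \<epsilon> d \<and> t = p u \<and> least u z)" using d by blast
  next
    fix t z z' assume "\<exists>u. u \<epsilon> d \<and> t = p u \<and> least u z" "\<exists>u. u \<epsilon> d \<and> t = p u \<and> least u z'"
    then obtain u where "least u z" "least u z'" using p(4) by metis
    then show "z = z'" using funcD[OF f(1)] unfolding least_def by blast
  next
    fix t t' z assume "\<exists>u. u \<epsilon> d \<and> t = p u \<and> least u z" "\<exists>u. u \<epsilon> d \<and> t' = p u \<and> least u z"
    then show "t = t'" using un by blast
  next
    fix z assume "z \<epsilon> x"
    then obtain u where "u \<epsilon> d" "least u z" using ex by blast
    then show "\<exists>t. t \<epsilon> rep d p \<and> (\<exists>u. u \<epsilon> d \<and> t = p u \<and> least u z)" unfolding mem_rep[OF p(1)] by blast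
  qed
  then show ?thesis using p(2,3) by blast
qed

subsection \<open>Uniform ultrafilters on regular cardinals with well-orderable power set\<close>

text \<open>Filters that contain all co-bounded sets and have only unbounded members. The third
  clause combines closure under intersections and under supersets.\<close>

definition fil where
  "fil k w \<longleftrightarrow> (\<forall>y. y \<epsilon> w \<longrightarrow> sub y k)
    \<and> (\<forall>d y. d \<epsilon> k \<longrightarrow> sub y k \<longrightarrow> (\<forall>x. x \<epsilon> k \<longrightarrow> x \<epsilon> d \<or> x \<epsilon> y) \<longrightarrow> y \<epsilon> w)
    \<and> (\<forall>a b y. a \<epsilon> w \<longrightarrow> b \<epsilon> w \<longrightarrow> sub y k \<longrightarrow> (\<forall>x. x \<epsilon> a \<longrightarrow> x \<epsilon> b \<longrightarrow> x \<epsilon> y) \<longrightarrow> y \<epsilon> w)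
    \<and> (\<forall>d y. d \<epsilon> k \<longrightarrow> y \<epsilon> w \<longrightarrow> (\<exists>x. x \<epsilon> y \<and> \<not> x \<epsilon> d))"

lemma D2_fil: "D2 fil" unfolding D2_def fil_def by (intro dfi)
lemmas [dfi] = D2I[OF D2_fil]

lemma fil_sub: "fil k w \<Longrightarrow> y \<epsilon> w \<Longrightarrow> sub y k"
  and fil_base: "fil k w \<Longrightarrow> d \<epsilon> k \<Longrightarrow> sub y k \<Longrightarrow> (\<And>x. x \<epsilon> k \<Longrightarrow> x \<epsilon> d \<or> x \<epsilon> y) \<Longrightarrow> y \<epsilon> w"
  and fil_int: "fil k w \<Longrightarrow> a \<epsilon> w \<Longrightarrow> b \<epsilon> w \<Longrightarrow> sub y k \<Longrightarrow> (\<And>x. x \<epsilon> a \<Longrightarrow> x \<epsilon> b \<Longrightarrow> x \<epsilon> y) \<Longrightarrow> y \<epsilon> w"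
  and fil_unb: "fil k w \<Longrightarrow> d \<epsilon> k \<Longrightarrow> y \<epsilon> w \<Longrightarrow> \<exists>x. x \<epsilon> y \<and> \<not> x \<epsilon> d"
  unfolding fil_def by ((elim conjE, blast)+)

text \<open>The filter generated by \<open>w\<close> and \<open>x\<close>, if that still has only
  unbounded members; otherwise \<open>w\<close> is kept.\<close>

definition stp where
  "stp k w x = (if \<forall>a. a \<epsilon> w \<longrightarrow> (\<forall>d. d \<epsilon> k \<longrightarrow> (\<exists>z. z \<epsilon> a \<and> z \<epsilon> x \<and> \<not> z \<epsilon> d))
    then sep (pw k) (\<lambda>y. \<exists>a. a \<epsilon> w \<and> (\<forall>z. z \<epsilon> a \<longrightarrow> z \<epsilon> x \<longrightarrow> z \<epsilon> y)) else w)"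

lemma F3_stp: "F3 stp" unfolding F3_def stp_def by (intro dfi)
lemmas [dfi] = F3I[OF F3_stp]

lemma mem_stp:
  assumes "\<And>a d. a \<epsilon> w \<Longrightarrow> d \<epsilon> k \<Longrightarrow> \<exists>z. z \<epsilon> a \<and> z \<epsilon> x \<and> \<not> z \<epsilon> d"
  shows "y \<epsilon> stp k w x \<longleftrightarrow> sub y k \<and> (\<exists>a. a \<epsilon> w \<and> (\<forall>z. z \<epsilon> a \<longrightarrow> z \<epsilon> x \<longrightarrow> z \<epsilon> y))"
proof -
  have D: "D1 (\<lambda>y. \<exists>a. a \<epsilon> w \<and> (\<forall>z. z \<epsilon> a \<longrightarrow> z \<epsilon> x \<longrightarrow> z \<epsilon> y))" unfolding D1_def by (intro dfi)
  show ?thesis using assms unfolding stp_def by (simp add: mem_sep[OF D])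
qed

text \<open>If \<open>x\<close> cannot be adjoined, some \<open>a\<close> in \<open>w\<close> meets
  it only below some \<open>d\<close>. Then \<open>a\<close> minus \<open>d\<close> is a member of
  \<open>w\<close> that avoids \<open>x\<close>, so \<open>w\<close> already contains the
  complement.\<close>

lemma stp:
  assumes k: "e \<epsilon> k" and w: "fil k w"
  shows "fil k (stp k w x)" "sub w (stp k w x)"
    "sub x k \<Longrightarrow> \<not> x \<epsilon> stp k w x \<Longrightarrow> sub y k \<Longrightarrow> (\<And>z. z \<epsilon> k \<Longrightarrow> z \<epsilon> x \<or> z \<epsilon> y) \<Longrightarrow> y \<epsilon> stp k w x"
proof -
  let ?c = "\<forall>a. a \<epsilon> w \<longrightarrow> (\<forall>d. d \<epsilon> k \<longrightarrow> (\<exists>z. z \<epsilon> a \<and> z \<epsilon> x \<and> \<not> z \<epsilon> d))"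
  have "fil k (stp k w x) \<and> sub w (stp k w x) \<and>
    (sub x k \<longrightarrow> \<not> x \<epsilon> stp k w x \<longrightarrow> sub y k \<longrightarrow> (\<forall>z. z \<epsilon> k \<longrightarrow> z \<epsilon> x \<or> z \<epsilon> y) \<longrightarrow> y \<epsilon> stp k w x)"
  proof (cases ?c)
    case c: True
    have m: "y \<epsilon> stp k w x \<longleftrightarrow> sub y k \<and> (\<exists>a. a \<epsilon> w \<and> (\<forall>z. z \<epsilon> a \<longrightarrow> z \<epsilon> x \<longrightarrow> z \<epsilon> y))" for y
      using c by (intro mem_stp) blast
    have s: "sub w (stp k w x)" unfolding sub_def[of w "stp k w x"] m using fil_sub[OF w] by blast
    have "fil k (stp k w x)" unfolding fil_def
    proof (intro conjI allI impI)
      fix y assume "y \<epsilon> stp k w x" then show "sub y k" unfolding m by blast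
    next
      fix d y assume "d \<epsilon> k" "sub y k" "\<forall>x. x \<epsilon> k \<longrightarrow> x \<epsilon> d \<or> x \<epsilon> y"
      then show "y \<epsilon> stp k w x" using s subD fil_base[OF w] by blast
    next
      fix a b y assume a: "a \<epsilon> stp k w x" "b \<epsilon> stp k w x" "sub y k" "\<forall>x. x \<epsilon> a \<longrightarrow> x \<epsilon> b \<longrightarrow> x \<epsilon> y"
      obtain a' b' where a': "a' \<epsilon> w" "\<forall>z. z \<epsilon> a' \<longrightarrow> z \<epsilon> x \<longrightarrow> z \<epsilon> a" "b' \<epsilon> w" "\<forall>z. z \<epsilon> b' \<longrightarrow> z \<epsilon> x \<longrightarrow> z \<epsilon> b"
        using a(1,2) unfolding m by blast
      have D: "D1 (\<lambda>z. z \<epsilon> b')" unfolding D1_def by (intro dfi)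
      have "sep a' (\<lambda>z. z \<epsilon> b') \<epsilon> w"
        using fil_int[OF w a'(1,3), of "sep a' (\<lambda>z. z \<epsilon> b')"] fil_sub[OF w a'(1)]
        unfolding sub_def mem_sep[OF D] by blast
      moreover have "\<forall>z. z \<epsilon> sep a' (\<lambda>z. z \<epsilon> b') \<longrightarrow> z \<epsilon> x \<longrightarrow> z \<epsilon> y"
        unfolding mem_sep[OF D] using a' a(4) by blast
      ultimately show "y \<epsilon> stp k w x" unfolding m using a(3) by blast
    next
      fix d y assume "d \<epsilon> k" "y \<epsilon> stp k w x"
      then show "\<exists>x. x \<epsilon> y \<and> \<not> x \<epsilon> d" unfolding m using c by blast
    qed
    moreover have "x \<epsilon> stp k w x" if "sub x k" "sub y k" "\<not> y \<epsilon> stp k w x" "\<forall>z. z \<epsilon> k \<longrightarrow> z \<epsilon> x \<or> z \<epsilon> y"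
    proof -
      have "k \<epsilon> w" using fil_base[OF w k] sub_refl by blast
      then show ?thesis unfolding m using that by blast
    qed
    ultimately show ?thesis using s by blast
  next
    case False
    then have e: "stp k w x = w" unfolding stp_def by (simp only: if_False)
    obtain a d where a: "a \<epsilon> w" "d \<epsilon> k" "\<And>z. z \<epsilon> a \<Longrightarrow> z \<epsilon> x \<Longrightarrow> z \<epsilon> d" using False by blast
    have "y \<epsilon> w" if y: "sub y k" "\<forall>z. z \<epsilon> k \<longrightarrow> z \<epsilon> x \<or> z \<epsilon> y"
    proof -
      have D: "D1 (\<lambda>z. \<not> z \<epsilon> d)" unfolding D1_def by (intro dfi)
      have "sep k (\<lambda>z. \<not> z \<epsilon> d) \<epsilon> w"
        using fil_base[OF w a(2), of "sep k (\<lambda>z. \<not> z \<epsilon> d)"] unfolding sub_def mem_sep[OF D] by blast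
      then show ?thesis
      proof (rule fil_int[OF w a(1) _ y(1)])
        fix z assume "z \<epsilon> a" "z \<epsilon> sep k (\<lambda>z. \<not> z \<epsilon> d)"
        then show "z \<epsilon> y" using a(3) y(2) unfolding mem_sep[OF D] by blast
      qed
    qed
    then show ?thesis unfolding e using w by simp
  qed
  then show "fil k (stp k w x)" "sub w (stp k w x)"
    "sub x k \<Longrightarrow> \<not> x \<epsilon> stp k w x \<Longrightarrow> sub y k \<Longrightarrow> (\<And>z. z \<epsilon> k \<Longrightarrow> z \<epsilon> x \<or> z \<epsilon> y) \<Longrightarrow> y \<epsilon> stp k w x"
    by blast+
qed

lemma fil_base_ex:
  assumes k: "Ord k" "e \<epsilon> k"
  obtains w where "fil k w" "\<And>v. fil k v \<Longrightarrow> sub w v"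
proof -
  define P where "P y \<longleftrightarrow> (\<exists>d. d \<epsilon> k \<and> (\<forall>x. x \<epsilon> k \<longrightarrow> x \<epsilon> d \<or> x \<epsilon> y))" for y
  have D: "D1 P" unfolding D1_def P_def by (intro dfi)
  define w where "w = sep (pw k) P"
  have w: "y \<epsilon> w \<longleftrightarrow> sub y k \<and> P y" for y unfolding w_def mem_sep[OF D] by simp
  have cup: "cup d d' \<epsilon> k" if "d \<epsilon> k" "d' \<epsilon> k" for d d'
    using cup_Ord[OF Ord_in[OF k(1) that(1)] Ord_in[OF k(1) that(2)]] that by metis
  have "fil k w" unfolding fil_def
  proof (intro conjI allI impI)
    fix y assume "y \<epsilon> w" then show "sub y k" unfolding w by blast
  next
    fix d y assume "d \<epsilon> k" "sub y k" "\<forall>x. x \<epsilon> k \<longrightarrow> x \<epsilon> d \<or> x \<epsilon> y"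
    then show "y \<epsilon> w" unfolding w P_def by blast
  next
    fix a b y assume a: "a \<epsilon> w" "b \<epsilon> w" "sub y k" "\<forall>x. x \<epsilon> a \<longrightarrow> x \<epsilon> b \<longrightarrow> x \<epsilon> y"
    then obtain d d' where d: "d \<epsilon> k" "\<forall>x. x \<epsilon> k \<longrightarrow> x \<epsilon> d \<or> x \<epsilon> a"
      "d' \<epsilon> k" "\<forall>x. x \<epsilon> k \<longrightarrow> x \<epsilon> d' \<or> x \<epsilon> b" unfolding w P_def by blast
    have "\<forall>x. x \<epsilon> k \<longrightarrow> x \<epsilon> cup d d' \<or> x \<epsilon> y" unfolding mem_cup using d(2,4) a(4) by blast
    then show "y \<epsilon> w" unfolding w P_def using cup[OF d(1,3)] a(3) by blast
  next
    fix d y assume d: "d \<epsilon> k" "y \<epsilon> w"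
    then obtain d' where d': "d' \<epsilon> k" "\<forall>x. x \<epsilon> k \<longrightarrow> x \<epsilon> d' \<or> x \<epsilon> y" unfolding w P_def by blast
    \<comment> \<open>The larger of \<open>d\<close> and \<open>d'\<close> is the required element
      of \<open>y\<close>, since it belongs to neither.\<close>
    have "\<not> cup d d' \<epsilon> d" "\<not> cup d d' \<epsilon> d'" using mem_irrefl[of "cup d d'"] mem_cup by metis+
    then show "\<exists>x. x \<epsilon> y \<and> \<not> x \<epsilon> d" using d'(2) cup[OF d(1) d'(1)] by blast
  qed
  moreover have "sub w v" if "fil k v" for v
    unfolding sub_def[of w v] w P_def using fil_base[OF that] by blast
  ultimately show thesis by (rule that)
qed

text \<open>The covering by the ordinal \<open>d\<close> stands in for choice. \<open>S x\<close> is
  the union of \<open>b0\<close> and all extensions made before \<open>x\<close>, without a case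
  distinction at limits. Any two members of \<open>S x\<close> lie in a common earlier filter, which
  is how the filter properties pass to the union.\<close>

theorem ultrafilter_ex:
  assumes k: "Ord k" "e \<epsilon> k" and d: "Ord d" "cov d (pw k)"
  shows "\<exists>u. uf u k \<and> (\<forall>y. y \<epsilon> u \<longrightarrow> (\<forall>a. a \<epsilon> k \<longrightarrow> (\<exists>x. x \<epsilon> y \<and> \<not> x \<epsilon> a)))"
proof -
  obtain b0 where b0: "fil k b0" "\<And>v. fil k v \<Longrightarrow> sub b0 v" using fil_base_ex[OF k] by blast
  obtain g where g: "func g" "\<And>z. z \<epsilon> pw k \<Longrightarrow> \<exists>u. u \<epsilon> d \<and> pair u z \<epsilon> g"
    using d(2) unfolding cov_def by blast
  define F where "F x h = cup b0 (uni (rep x (\<lambda>b. stp k (ap h b) (ap g b))))" for x h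
  have F: "F2 F" unfolding F2_def F_def by (intro dfi)
  define S where "S = wrec (\<lambda>x. x) F"
  have FS: "F1 S" unfolding S_def by (intro F1_wrec F1_id F)
  note [dfi] = F1I[OF FS]
  have S: "y \<epsilon> S x \<longleftrightarrow> y \<epsilon> b0 \<or> (\<exists>b. b \<epsilon> x \<and> y \<epsilon> stp k (S b) (ap g b))" for x y
  proof -
    have FF: "F1 (\<lambda>b. stp k (ap (lam x S) b) (ap g b))" unfolding F1_def by (intro dfi)
    have "S x = F x (lam x S)" unfolding S_def by (rule erec_eq[OF F])
    then have "y \<epsilon> S x \<longleftrightarrow> y \<epsilon> b0 \<or> (\<exists>b. b \<epsilon> x \<and> y \<epsilon> stp k (ap (lam x S) b) (ap g b))"
      unfolding F_def using mem_uni_rep[OF FF] by simp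
    then show ?thesis using ap_lam[OF FS] by metis
  qed
  have DS: "D1 (\<lambda>x. fil k (S x))" unfolding D1_def by (intro dfi)
  have fil: "fil k (S a)" if a: "Ord a" for a
    using a DS
  proof (rule Ord_induct)
    fix x assume x: "Ord x" and IH: "\<And>y. y \<epsilon> x \<Longrightarrow> fil k (S y)"
    have bs: "sub b0 (S x)" unfolding sub_def S by blast
    have st: "fil k (stp k (S b) (ap g b))" "sub (stp k (S b) (ap g b)) (S x)"
      "sub (S b) (stp k (S b) (ap g b))" if "b \<epsilon> x" for b
      using stp(1,2)[OF k(2) IH[OF that]] that unfolding sub_def S[of _ x] by blast+
    have in_stp: "y \<epsilon> stp k (S b) (ap g b)" if "b \<epsilon> x" "y \<epsilon> S b" for b y
      using st(3)[OF that(1)] that(2) subD by blast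
    have "\<exists>w. fil k w \<and> sub w (S x) \<and> y \<epsilon> w \<and> z \<epsilon> w" if y: "y \<epsilon> S x" and z: "z \<epsilon> S x" for y z
    proof -
      have "y \<epsilon> b0 \<and> z \<epsilon> b0 \<or> (\<exists>b. b \<epsilon> x \<and> y \<epsilon> stp k (S b) (ap g b) \<and> z \<epsilon> stp k (S b) (ap g b))"
      proof -
        have A: "\<exists>b. b \<epsilon> x \<and> y \<epsilon> stp k (S b) (ap g b) \<and> z \<epsilon> stp k (S b) (ap g b)"
          if "z \<epsilon> b0" "b \<epsilon> x" "y \<epsilon> stp k (S b) (ap g b)" for b y z
        proof -
          have "z \<epsilon> S b" unfolding S using that(1) by blast
          then show ?thesis using that in_stp by blast
        qed
        have B: "\<exists>b. b \<epsilon> x \<and> y \<epsilon> stp k (S b) (ap g b) \<and> z \<epsilon> stp k (S b) (ap g b)"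
          if "b \<epsilon> x" "c \<epsilon> b" "y \<epsilon> stp k (S b) (ap g b)" "z \<epsilon> stp k (S c) (ap g c)" for b c y z
        proof -
          have "z \<epsilon> S b" unfolding S[of _ b] using that(2,4) by blast
          then show ?thesis using that in_stp by blast
        qed
        from y consider "y \<epsilon> b0" | b where "b \<epsilon> x" "y \<epsilon> stp k (S b) (ap g b)" unfolding S[of _ x] by blast
        then show ?thesis
        proof cases
          case 1
          from z consider "z \<epsilon> b0" | c where "c \<epsilon> x" "z \<epsilon> stp k (S c) (ap g c)" unfolding S[of _ x] by blast
          then show ?thesis using 1 A[OF 1] by cases blast+
        next
          case (2 b)
          from z consider "z \<epsilon> b0" | c where "c \<epsilon> x" "z \<epsilon> stp k (S c) (ap g c)" unfolding S[of _ x] by blast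
          then show ?thesis
          proof cases
            case 1
            then show ?thesis using A[OF 1 2] by blast
          next
            case (2 c)
            note b = \<open>b \<epsilon> x\<close> \<open>y \<epsilon> stp k (S b) (ap g b)\<close>
            consider "b = c" | "c \<epsilon> b" | "b \<epsilon> c"
              using Ord_linear[OF Ord_in[OF x b(1)] Ord_in[OF x 2(1)]] by blast
            then show ?thesis
              using 2 b B[OF b(1) _ b(2) 2(2)] B[OF 2(1) _ 2(2) b(2)] by cases blast+
          qed
        qed
      qed
      then show ?thesis using b0(1) bs st(1,2) by blast
    qed
    then have com: "\<And>thesis. (\<And>w. fil k w \<Longrightarrow> sub w (S x) \<Longrightarrow> y \<epsilon> w \<Longrightarrow> z \<epsilon> w \<Longrightarrow> thesis) \<Longrightarrow> thesis"
      if "y \<epsilon> S x" "z \<epsilon> S x" for y z using that by blast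
    show "fil k (S x)" unfolding fil_def
    proof (intro conjI allI impI)
      fix y assume "y \<epsilon> S x" then show "sub y k" using com[of y y] fil_sub by metis
    next
      fix d y assume "d \<epsilon> k" "sub y k" "\<forall>x. x \<epsilon> k \<longrightarrow> x \<epsilon> d \<or> x \<epsilon> y"
      then show "y \<epsilon> S x" using fil_base[OF b0(1)] subD[OF bs] by blast
    next
      fix a b y assume a: "a \<epsilon> S x" "b \<epsilon> S x" "sub y k" "\<forall>x. x \<epsilon> a \<longrightarrow> x \<epsilon> b \<longrightarrow> x \<epsilon> y"
      obtain w where w: "fil k w" "sub w (S x)" "a \<epsilon> w" "b \<epsilon> w" using com[OF a(1,2)] by blast
      show "y \<epsilon> S x" using fil_int[OF w(1,3,4) a(3)] a(4) subD[OF w(2)] by blast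
    next
      fix d y assume "d \<epsilon> k" "y \<epsilon> S x" then show "\<exists>x. x \<epsilon> y \<and> \<not> x \<epsilon> d" using com[of y y] fil_unb by metis
    qed
  qed
  note f = fil[OF d(1)]
  have dec: "y \<epsilon> S d" if x: "sub x k" "\<not> x \<epsilon> S d" and y: "sub y k" "\<And>z. z \<epsilon> k \<Longrightarrow> z \<epsilon> x \<or> z \<epsilon> y" for x y
  proof -
    obtain b where b: "b \<epsilon> d" "pair b x \<epsilon> g" using g(2)[of x] x(1) unfolding mem_pw by blast
    have ap: "ap g b = x" by (rule ap_eq[OF g(1) b(2)])
    have "y' \<epsilon> S d" if "y' \<epsilon> stp k (S b) x" for y' unfolding S[of _ d] using b(1) that ap by blast
    then show ?thesis using stp(3)[OF k(2) fil[OF Ord_in[OF d(1) b(1)]], of x y] x y by blast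
  qed
  have "uf (S d) k" unfolding uf_def
  proof (intro conjI allI impI)
    fix x assume "x \<epsilon> S d" then show "sub x k" by (rule fil_sub[OF f])
  next
    show "k \<epsilon> S d" using fil_base[OF f k(2)] sub_refl by blast
  next
    fix x assume "x \<epsilon> S d" then show "x \<noteq> emp" using fil_unb[OF f k(2)] mem_emp by blast
  next
    fix x y assume xy: "x \<epsilon> S d" "y \<epsilon> S d"
    have D: "D1 (\<lambda>z. z \<epsilon> y)" unfolding D1_def by (intro dfi)
    have "sub (sep x (\<lambda>z. z \<epsilon> y)) k"
      using fil_sub[OF f xy(1)] unfolding sub_def mem_sep[OF D] by blast
    then have "sep x (\<lambda>z. z \<epsilon> y) \<epsilon> S d" by (rule fil_int[OF f xy]) (simp add: mem_sep[OF D])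
    then show "\<exists>z. z \<epsilon> S d \<and> (\<forall>w. w \<epsilon> z \<longleftrightarrow> w \<epsilon> x \<and> w \<epsilon> y)" using mem_sep[OF D] by blast
  next
    fix x y assume "x \<epsilon> S d" "sub x y \<and> sub y k"
    then show "y \<epsilon> S d" using fil_int[OF f, of x x y] subD by blast
  next
    fix x assume x: "sub x k" "\<not> x \<epsilon> S d"
    have D: "D1 (\<lambda>z. \<not> z \<epsilon> x)" unfolding D1_def by (intro dfi)
    have "sep k (\<lambda>z. \<not> z \<epsilon> x) \<epsilon> S d"
      by (rule dec[OF x], unfold sub_def mem_sep[OF D]) blast+
    then show "\<exists>z. z \<epsilon> S d \<and> (\<forall>w. w \<epsilon> z \<longleftrightarrow> w \<epsilon> k \<and> \<not> w \<epsilon> x)" using mem_sep[OF D] by blast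
  qed
  then show ?thesis using fil_unb[OF f] by blast
qed

end

section \<open>A criterion for the least cardinal without a uniform ultrafilter\<close>

lemma (in zf) uf_sub: "uf u k \<Longrightarrow> x \<epsilon> u \<Longrightarrow> sub x k"
  unfolding uf_def by (elim conjE allE[of _ x]) simp

text \<open>Collects what has to be shown about the extension, in terms of coverings and bounds:
  regularity of the entries, the absence of cardinals between two successive ones, well-ordered
  power sets, and small members in ultrafilters over \<open>l\<close>.\<close>

locale aleph_sequence = zf +
  fixes f l
  assumes mem_f: "w \<epsilon> f \<longleftrightarrow> (\<exists>n. natural n \<and> w = pair n (ap f n))"
    and f_emp: "ap f emp = om"
    and f_Ord: "natural n \<Longrightarrow> Ord (ap f n)"
    and f_suc: "natural n \<Longrightarrow> ap f n \<epsilon> ap f (suc n)"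
    and f_bounded: "natural n \<Longrightarrow> sub x (ap f n) \<Longrightarrow> sm (ap f n) x \<Longrightarrow> \<exists>d. d \<epsilon> ap f n \<and> sub x d"
    and f_cov: "natural n \<Longrightarrow> b \<epsilon> ap f (suc n) \<Longrightarrow> cov (ap f n) b"
    and f_pw: "natural n \<Longrightarrow> \<exists>d. Ord d \<and> cov d (pw (ap f n))"
    and mem_l: "x \<epsilon> l \<longleftrightarrow> (\<exists>n. natural n \<and> x \<epsilon> ap f n)"
    and small_in_uf: "uf u l \<Longrightarrow> \<exists>z n. z \<epsilon> u \<and> natural n \<and> sm (ap f n) z"
begin

lemma pair_f: "pair x y \<epsilon> f \<longleftrightarrow> natural x \<and> y = ap f x"
  unfolding mem_f by auto

lemma not_sm_f:
  assumes "natural n" shows "\<not> sm (ap f n) (ap f n)"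
proof
  assume "sm (ap f n) (ap f n)"
  then obtain d where "d \<epsilon> ap f n" "sub (ap f n) d" using f_bounded[OF assms sub_refl] by blast
  then show False using subD[of "ap f n" d d] by simp
qed

lemma om_sub_f: "natural n \<Longrightarrow> sub om (ap f n)"
proof -
  assume n: "natural n"
  have D: "D1 (\<lambda>n. sub om (ap f n))" unfolding D1_def by (intro dfi)
  show "sub om (ap f n)"
  proof (rule om_induct[OF n D])
    show "sub om (ap f emp)" unfolding f_emp by simp
  next
    fix m assume m: "natural m" "sub om (ap f m)"
    then show "sub om (ap f (suc m))"
      unfolding sub_def using Ord_trans[OF f_Ord[OF natural_suc[OF m(1)]] f_suc[OF m(1)]] by blast
  qed
qed

lemma card_f: "natural n \<Longrightarrow> card (ap f n)"
  unfolding card_def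
  using f_Ord om_sub_f not_sm_f eqp_cov unfolding sm_def by blast

text \<open>Being covered by \<open>ap f n\<close>, the ordinal \<open>b\<close> is equipotent with
  an ordinal of at most that size, which is a member of \<open>b\<close>.\<close>

lemma next_card_f:
  assumes n: "natural n" and b: "b \<epsilon> ap f (suc n)" "ap f n \<epsilon> b"
  shows "\<not> card b"
proof -
  obtain g where g: "Ord g" "sub g (ap f n)" "eqp g b"
    using cov_Ord_eqp[OF f_Ord[OF n] f_cov[OF n b(1)]] by blast
  have "Ord b" by (rule Ord_in[OF f_Ord[OF natural_suc[OF n]] b(1)])
  then have "g \<epsilon> b" using b(2) g(2) Ord_sub_iff[OF g(1) f_Ord[OF n]] Ord_trans by blast
  then show ?thesis using g(3) unfolding card_def by blast
qed

lemma card_in_l: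
  assumes x: "x \<epsilon> l" "card x"
  shows "\<exists>n. natural n \<and> x = ap f n"
proof -
  obtain n where n: "natural n" "x \<epsilon> ap f n" using x(1) unfolding mem_l by blast
  have D: "D1 (\<lambda>n. x \<epsilon> ap f n \<longrightarrow> (\<exists>n. natural n \<and> x = ap f n))" unfolding D1_def by (intro dfi)
  have "x \<epsilon> ap f n \<longrightarrow> (\<exists>n. natural n \<and> x = ap f n)"
  proof (rule om_induct[OF n(1) D])
    show "x \<epsilon> ap f emp \<longrightarrow> (\<exists>n. natural n \<and> x = ap f n)"
      unfolding f_emp using x(2) subD mem_irrefl unfolding card_def by blast
  next
    fix m assume m: "natural m" "x \<epsilon> ap f m \<longrightarrow> (\<exists>n. natural n \<and> x = ap f n)"
    have "Ord x" using x(2) unfolding card_def by blast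
    then show "x \<epsilon> ap f (suc m) \<longrightarrow> (\<exists>n. natural n \<and> x = ap f n)"
      using Ord_linear[OF _ f_Ord[OF m(1)], of x] m next_card_f[OF m(1), of x] x(2) by blast
  qed
  then show ?thesis using n(2) by blast
qed

lemma card_l: "card l"
  unfolding card_def
proof (intro conjI allI impI)
  have F: "F1 (ap f)" unfolding F1_def by (intro dfi)
  have "l = uni (rep om (ap f))" by (rule ext) (simp only: mem_l mem_uni_rep[OF F] mem_om)
  moreover have "Ord (uni (rep om (ap f)))" by (rule Ord_uni) (use f_Ord mem_rep[OF F] in auto)
  ultimately show "Ord l" by simp
  show "sub om l" unfolding sub_def mem_l using f_emp natural_emp by metis
  fix y assume y: "y \<epsilon> l"
  then obtain n where n: "natural n" "y \<epsilon> ap f n" unfolding mem_l by blast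
  have "sub (ap f n) l" unfolding sub_def mem_l using n(1) by blast
  then have "cov y (ap f n)" if "cov y l" using cov_mono[OF that sub_refl] by blast
  then show "\<not> eqp y l" using not_sm_f[OF n(1)] n(2) eqp_cov unfolding sm_def by blast
qed

lemma no_uniform_l: "uf u l \<Longrightarrow> \<exists>x. x \<epsilon> u \<and> \<not> eqp x l"
proof -
  assume "uf u l"
  then obtain z n b where z: "z \<epsilon> u" "natural n" "b \<epsilon> ap f n" "cov b z"
    using small_in_uf unfolding sm_def by blast
  have "sub (ap f n) l" unfolding sub_def mem_l using z(2) by blast
  then have "cov b (ap f n)" if "eqp z l"
    using cov_mono[OF cov_trans[OF z(4) eqp_cov[OF that]] sub_refl] by blast
  then show ?thesis using z not_sm_f[OF z(2)] unfolding sm_def by blast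
qed

text \<open>Members of the ultrafilter are unbounded, whereas a subset equipotent with a smaller
  ordinal would be bounded by regularity.\<close>

lemma uniform_f:
  assumes n: "natural n"
  shows "\<exists>u. uf u (ap f n) \<and> (\<forall>x. x \<epsilon> u \<longrightarrow> eqp x (ap f n))"
proof -
  let ?k = "ap f n"
  have e: "emp \<epsilon> ?k" using om_sub_f[OF n] natural_emp unfolding sub_def by simp
  obtain d where d: "Ord d" "cov d (pw ?k)" using f_pw[OF n] by blast
  obtain u where u: "uf u ?k" "\<forall>y. y \<epsilon> u \<longrightarrow> (\<forall>a. a \<epsilon> ?k \<longrightarrow> (\<exists>x. x \<epsilon> y \<and> \<not> x \<epsilon> a))"
    using ultrafilter_ex[OF f_Ord[OF n] e d] by blast
  have "eqp x ?k" if x: "x \<epsilon> u" for x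
  proof -
    have s: "sub x ?k" by (rule uf_sub[OF u(1) x])
    obtain g where g: "Ord g" "sub g ?k" "eqp g x"
      using cov_Ord_eqp[OF f_Ord[OF n] cov_mono[OF cov_refl sub_refl s]] by blast
    have "\<not> g \<epsilon> ?k"
    proof
      assume "g \<epsilon> ?k"
      then have "sm ?k x" using eqp_cov[OF g(3)] unfolding sm_def by blast
      then obtain a where "a \<epsilon> ?k" "sub x a" using f_bounded[OF n s] by blast
      then show False using u(2) x subD by blast
    qed
    then have "g = ?k" using g(2) Ord_sub_iff[OF g(1) f_Ord[OF n]] by blast
    then show ?thesis using eqp_sym g(3) by blast
  qed
  then show ?thesis using u(1) by blast
qed

end

context zf
begin

definition inU where "inU k \<longleftrightarrow> card k \<and> (\<exists>u. uf u k \<and> (\<forall>x. x \<epsilon> u \<longrightarrow> eqp x k))"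

lemma sat_inU [simp]: "sat E e (inU_fm k) \<longleftrightarrow> inU (e k)"
  unfolding inU_fm_def uniform_ultrafilter_fm_def inU_def
  by (simp only: sat.simps sat_cardinal sat_ultrafilter sat_eqpoll nat.case not_imp not_not simp_thms
      not_ex[symmetric] add_2_eq_Suc' add_Suc_right add_0_right One_nat_def numeral_2_eq_2)

lemma sat_next_cardinal [simp]: "sat E e (next_cardinal_fm k m) \<longleftrightarrow>
    card (e m) \<and> e k \<epsilon> e m \<and> (\<forall>x. x \<epsilon> e m \<longrightarrow> e k \<epsilon> x \<longrightarrow> \<not> card x)"
  unfolding next_cardinal_fm_def
  by (simp only: sat.simps sat_cardinal nat.case not_imp not_not simp_thms
      not_ex[symmetric] add_2_eq_Suc' add_Suc_right add_0_right One_nat_def numeral_2_eq_2)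

lemma sat_aleph_sequence [simp]: "sat E e (aleph_sequence_fm f w) \<longleftrightarrow>
    (\<exists>b. fn (e f) (e w) b) \<and> pair emp (e w) \<epsilon> e f
    \<and> (\<forall>n. n \<epsilon> e w \<longrightarrow> (\<forall>k m. pair n k \<epsilon> e f \<and> pair (suc n) m \<epsilon> e f \<longrightarrow>
        card m \<and> k \<epsilon> m \<and> (\<forall>x. x \<epsilon> m \<longrightarrow> k \<epsilon> x \<longrightarrow> \<not> card x)))"
proof -
  have "sat E e (aleph_sequence_fm f w) \<longleftrightarrow>
    (\<exists>b. fn (e f) (e w) b) \<and> (\<exists>z. z = emp \<and> pair z (e w) \<epsilon> e f)
    \<and> (\<forall>n. n \<epsilon> e w \<longrightarrow> (\<forall>n' k m. n' = suc n \<and> pair n k \<epsilon> e f \<and> pair n' m \<epsilon> e f \<longrightarrow>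
        card m \<and> k \<epsilon> m \<and> (\<forall>x. x \<epsilon> m \<longrightarrow> k \<epsilon> x \<longrightarrow> \<not> card x)))"
    unfolding aleph_sequence_fm_def
    by (simp only: sat.simps sat_fun sat_empty sat_app sat_succ sat_next_cardinal nat.case not_imp not_not simp_thms
      not_ex[symmetric] eval_nat_numeral BitM.simps add_Suc_right add_0_right One_nat_def)
  then show ?thesis by simp
qed

lemma sat_aleph_omega_least:
  "sat E e aleph_omega_least_not_inU \<longleftrightarrow> (\<exists>l. (\<exists>f. (\<exists>b. fn f om b) \<and> pair emp om \<epsilon> f
    \<and> (\<forall>n. natural n \<longrightarrow> (\<forall>k m. pair n k \<epsilon> f \<and> pair (suc n) m \<epsilon> f \<longrightarrow>
        card m \<and> k \<epsilon> m \<and> (\<forall>x. x \<epsilon> m \<longrightarrow> k \<epsilon> x \<longrightarrow> \<not> card x)))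
    \<and> (\<forall>x. x \<epsilon> l \<longleftrightarrow> (\<exists>n. natural n \<and> (\<exists>k. pair n k \<epsilon> f \<and> x \<epsilon> k))))
    \<and> card l \<and> \<not> inU l \<and> (\<forall>x. x \<epsilon> l \<longrightarrow> card x \<longrightarrow> inU x))"
proof -
  have iff: "(A \<longrightarrow> B) \<and> \<not> (B \<and> \<not> A) \<longleftrightarrow> (A \<longleftrightarrow> B)" for A B by blast
  have ex1: "(\<exists>w f. w = om \<and> P w f) \<longleftrightarrow> (\<exists>f. P om f)" for P by blast
  show ?thesis
    unfolding aleph_omega_least_not_inU_def aleph_omega_fm_def least_cardinal_not_inU_fm_def
    by (simp only: sat.simps sat_omega sat_app sat_aleph_sequence sat_cardinal sat_inU nat.case
      not_imp not_not simp_thms iff not_ex[symmetric] eval_nat_numeral BitM.simps add_Suc_right add_0_right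
      One_nat_def ex1 mem_om conj_assoc)
qed

end

theorem (in aleph_sequence) aleph_omega_least: "sat E e aleph_omega_least_not_inU"
  unfolding sat_aleph_omega_least
proof (rule exI[of _ l], intro conjI)
  have F: "F1 (ap f)" unfolding F1_def by (intro dfi)
  have fn: "fn f om (rep om (ap f))"
    unfolding fn_def func_def pair_f mem_rep[OF F] mem_om using mem_f by blast
  show "\<exists>f. (\<exists>b. fn f om b) \<and> pair emp om \<epsilon> f
    \<and> (\<forall>n. natural n \<longrightarrow> (\<forall>k m. pair n k \<epsilon> f \<and> pair (suc n) m \<epsilon> f \<longrightarrow>
        card m \<and> k \<epsilon> m \<and> (\<forall>x. x \<epsilon> m \<longrightarrow> k \<epsilon> x \<longrightarrow> \<not> card x)))
    \<and> (\<forall>x. x \<epsilon> l \<longleftrightarrow> (\<exists>n. natural n \<and> (\<exists>k. pair n k \<epsilon> f \<and> x \<epsilon> k)))"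
  proof (rule exI[of _ f], intro conjI)
    show "\<exists>b. fn f om b" using fn by (rule exI)
    show "pair emp om \<epsilon> f" unfolding pair_f using f_emp natural_emp by simp
    show "\<forall>n. natural n \<longrightarrow> (\<forall>k m. pair n k \<epsilon> f \<and> pair (suc n) m \<epsilon> f \<longrightarrow>
        card m \<and> k \<epsilon> m \<and> (\<forall>x. x \<epsilon> m \<longrightarrow> k \<epsilon> x \<longrightarrow> \<not> card x))"
      unfolding pair_f using card_f[OF natural_suc] f_suc next_card_f by blast
    show "\<forall>x. x \<epsilon> l \<longleftrightarrow> (\<exists>n. natural n \<and> (\<exists>k. pair n k \<epsilon> f \<and> x \<epsilon> k))"
      unfolding pair_f mem_l by blast
  qed
  show "card l" by (rule card_l)
  show "\<not> inU l" unfolding inU_def using no_uniform_l by blast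
  show "\<forall>x. x \<epsilon> l \<longrightarrow> card x \<longrightarrow> inU x"
    using card_in_l uniform_f card_f unfolding inU_def by blast
qed

section \<open>Forcing\<close>

text \<open>Conditions are ordered by inclusion: \<open>sub p q\<close> means that \<open>q\<close> is stronger than \<open>p\<close>. An element
  \<open>pair \<rho> r\<close> of a name, with \<open>r\<close> a condition, puts the value of \<open>\<rho>\<close> into the value of the name if
  \<open>r\<close> is in the generic filter.\<close>

locale forcing = zf +
  fixes P :: 'a
  assumes emp_P: "emp \<epsilon> P"
begin

lemma rk_pair: "rk x \<epsilon> rk (pair x y)" "rk y \<epsilon> rk (pair x y)"
proof -
  have "rk x \<epsilon> rk (upr x y)" "rk y \<epsilon> rk (upr x y)" "rk (upr x y) \<epsilon> rk (pair x y)"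
    unfolding pair_def by (simp_all add: rk_mem)
  then show "rk x \<epsilon> rk (pair x y)" "rk y \<epsilon> rk (pair x y)"
    using Ord_trans[OF Ord_rk] by blast+
qed

lemma rk_name: "pair \<rho> r \<epsilon> x \<Longrightarrow> rk \<rho> \<epsilon> rk x"
  using rk_mem rk_pair(1) Ord_trans[OF Ord_rk] by blast

text \<open>One of the two inclusions in a forced equality: below \<open>p\<close>, elements of
  \<open>x\<close> are densely matched with elements of \<open>y\<close>.\<close>

definition half :: "('a \<Rightarrow> 'a \<Rightarrow> 'a \<Rightarrow> bool) \<Rightarrow> 'a \<Rightarrow> 'a \<Rightarrow> 'a \<Rightarrow> bool" where
  "half Q p x y \<longleftrightarrow> (\<forall>\<rho> r q. pair \<rho> r \<epsilon> x \<and> r \<epsilon> P \<and> q \<epsilon> P \<and> sub p q \<and> sub r q \<longrightarrow>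
    (\<exists>s \<sigma> t. s \<epsilon> P \<and> sub q s \<and> pair \<sigma> t \<epsilon> y \<and> t \<epsilon> P \<and> sub t s \<and> Q s \<rho> \<sigma>))"

definition bisim :: "('a \<Rightarrow> 'a \<Rightarrow> 'a \<Rightarrow> bool) \<Rightarrow> bool" where
  "bisim Q \<longleftrightarrow> (\<forall>p x y. Q p x y \<longrightarrow> p \<epsilon> P \<and> half Q p x y \<and> half (\<lambda>s a b. Q s b a) p y x)"

text \<open>Forced equality is the largest bisimulation. On well-founded names this agrees with the usual
  recursive definition, and no recursion is needed to see that it is definable.\<close>

definition feq where
  "feq p x y \<longleftrightarrow> (\<exists>R. pair p (pair x y) \<epsilon> R \<and> bisim (\<lambda>p x y. pair p (pair x y) \<epsilon> R))"

definition fmem where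
  "fmem p x y \<longleftrightarrow> (\<forall>q. q \<epsilon> P \<and> sub p q \<longrightarrow>
    (\<exists>s \<sigma> t. s \<epsilon> P \<and> sub q s \<and> pair \<sigma> t \<epsilon> y \<and> t \<epsilon> P \<and> sub t s \<and> feq s x \<sigma>))"

lemma D3_feq: "D3 feq"
  unfolding D3_def feq_def bisim_def half_def by (intro dfi)

lemmas [dfi] = D3I[OF D3_feq]

lemma D3_fmem: "D3 fmem"
  unfolding D3_def fmem_def by (intro dfi)

lemmas [dfi] = D3I[OF D3_fmem]

lemma half_mono: "half Q p x y \<Longrightarrow> (\<And>s a b. Q s a b \<Longrightarrow> Q' s a b) \<Longrightarrow> half Q' p x y"
  unfolding half_def by blast

lemma half_mono_names:
  assumes "half Q p x y"
    "\<And>s \<rho> \<sigma> r t. s \<epsilon> P \<Longrightarrow> pair \<rho> r \<epsilon> x \<Longrightarrow> pair \<sigma> t \<epsilon> y \<Longrightarrow> Q s \<rho> \<sigma> \<Longrightarrow> Q' s \<rho> \<sigma>"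
  shows "half Q' p x y"
  unfolding half_def
proof (intro allI impI, elim conjE)
  fix \<rho> r q assume q: "pair \<rho> r \<epsilon> x" "r \<epsilon> P" "q \<epsilon> P" "sub p q" "sub r q"
  then obtain s \<sigma> t where s: "s \<epsilon> P" "sub q s" "pair \<sigma> t \<epsilon> y" "t \<epsilon> P" "sub t s" "Q s \<rho> \<sigma>"
    using assms(1) unfolding half_def by blast
  then show "\<exists>s \<sigma> t. s \<epsilon> P \<and> sub q s \<and> pair \<sigma> t \<epsilon> y \<and> t \<epsilon> P \<and> sub t s \<and> Q' s \<rho> \<sigma>"
    using assms(2)[OF s(1) q(1) s(3,6)] by blast
qed

text \<open>The bisimulation in \<open>feq\<close> has to be a set, so the class \<open>Q\<close> is
  restricted to names of bounded rank. It remains a bisimulation because \<open>half\<close> only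
  passes to elements of names, whose rank is smaller.\<close>

lemma feq_coinduct:
  assumes Q: "D3 Q" "bisim Q" "Q p x y" shows "feq p x y"
proof -
  let ?t = "Vs (suc (rk (pair x y)))"
  have t: "\<rho> \<epsilon> ?t" if "a \<epsilon> ?t" "pair \<rho> r \<epsilon> a" for a \<rho> r
    using that rk_name Ord_trans[of "suc (rk (pair x y))" "rk a" "rk \<rho>"]
    by (simp add: mem_Vs_iff del: mem_suc)
  have D: "D1 (\<lambda>z. Q (fstp z) (fstp (sndp z)) (sndp (sndp z)))"
    unfolding D1_def by (intro dfi D3I[OF Q(1)])
  define R where "R = sep (prod P (prod ?t ?t)) (\<lambda>z. Q (fstp z) (fstp (sndp z)) (sndp (sndp z)))"
  have R: "pair p (pair x y) \<epsilon> R \<longleftrightarrow> p \<epsilon> P \<and> x \<epsilon> ?t \<and> y \<epsilon> ?t \<and> Q p x y" for p x y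
    unfolding R_def mem_sep[OF D] by auto
  have "bisim (\<lambda>p x y. pair p (pair x y) \<epsilon> R)"
    unfolding bisim_def
  proof (intro allI impI)
    fix p a b assume "pair p (pair a b) \<epsilon> R"
    then have p: "p \<epsilon> P" "a \<epsilon> ?t" "b \<epsilon> ?t" "Q p a b" unfolding R by blast+
    then have h: "half Q p a b" "half (\<lambda>s a b. Q s b a) p b a" using Q(2) unfolding bisim_def by blast+
    show "p \<epsilon> P \<and> half (\<lambda>p a b. pair p (pair a b) \<epsilon> R) p a b \<and> half (\<lambda>s a b. pair s (pair b a) \<epsilon> R) p b a"
      by (intro conjI p(1) half_mono_names[OF h(1)] half_mono_names[OF h(2)];
        unfold R; intro conjI; (erule t[OF p(2)] t[OF p(3)] | assumption))
  qed
  moreover have "x \<epsilon> ?t" "y \<epsilon> ?t" using rk_pair by (auto simp: mem_Vs_iff)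
  ultimately show ?thesis
    unfolding feq_def using R Q(2,3) unfolding bisim_def by blast
qed

lemma feq_bisim: "bisim feq"
  unfolding bisim_def
proof (intro allI impI)
  fix p x y assume "feq p x y"
  then obtain R where R: "pair p (pair x y) \<epsilon> R" "bisim (\<lambda>p x y. pair p (pair x y) \<epsilon> R)"
    unfolding feq_def by blast
  then have "pair s (pair a b) \<epsilon> R \<Longrightarrow> feq s a b" for s a b unfolding feq_def by blast
  then show "p \<epsilon> P \<and> half feq p x y \<and> half (\<lambda>s a b. feq s b a) p y x"
    using R half_mono unfolding bisim_def by (metis (no_types, lifting))
qed

text \<open>The unfolding of the largest bisimulation is again a bisimulation and so contained in
  it. This recovers the usual recursive clause.\<close>

lemma feq_step: "feq p x y \<longleftrightarrow> p \<epsilon> P \<and> half feq p x y \<and> half (\<lambda>s a b. feq s b a) p y x"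
proof
  show "feq p x y \<Longrightarrow> p \<epsilon> P \<and> half feq p x y \<and> half (\<lambda>s a b. feq s b a) p y x"
    using feq_bisim unfolding bisim_def by blast
  assume A: "p \<epsilon> P \<and> half feq p x y \<and> half (\<lambda>s a b. feq s b a) p y x"
  let ?Q = "\<lambda>p x y. p \<epsilon> P \<and> half feq p x y \<and> half (\<lambda>s a b. feq s b a) p y x"
  have i: "feq s a b \<Longrightarrow> ?Q s a b" for s a b using feq_bisim unfolding bisim_def by blast
  have "D3 ?Q" unfolding D3_def half_def by (intro dfi)
  moreover have "bisim ?Q" unfolding bisim_def
  proof (intro allI impI)
    fix p a b assume a: "?Q p a b"
    then have "half feq p a b" "half (\<lambda>s a b. feq s b a) p b a" by blast+
    note h = this
    have "half ?Q p a b" by (rule half_mono[OF h(1) i])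
    moreover have "half (\<lambda>s a b. ?Q s b a) p b a" by (rule half_mono[OF h(2) i])
    ultimately
    show "p \<epsilon> P \<and> half ?Q p a b \<and> half (\<lambda>s a b. ?Q s b a) p b a" using a by blast
  qed
  ultimately show "feq p x y" using feq_coinduct[of ?Q p x y] A by blast
qed

lemma half_weaken: "half Q p x y \<Longrightarrow> sub p q \<Longrightarrow> half Q q x y"
  unfolding half_def using sub_trans by blast

lemma feq_P: "feq p x y \<Longrightarrow> p \<epsilon> P" using feq_step by blast

lemma feq_mono: "feq p x y \<Longrightarrow> q \<epsilon> P \<Longrightarrow> sub p q \<Longrightarrow> feq q x y"
  unfolding feq_step[of p x y] feq_step[of q x y] using half_weaken by blast

lemma feq_refl: "p \<epsilon> P \<Longrightarrow> feq p x x"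
proof (rule feq_coinduct[of "\<lambda>p x y. p \<epsilon> P \<and> x = y"])
  show "D3 (\<lambda>p x y. p \<epsilon> P \<and> x = y)" unfolding D3_def by (intro dfi)
  show "bisim (\<lambda>p x y. p \<epsilon> P \<and> x = y)"
    unfolding bisim_def half_def using sub_refl by blast
qed auto

lemma feq_sym: "feq p x y \<Longrightarrow> feq p y x"
proof (rule feq_coinduct[of "\<lambda>p x y. feq p y x"])
  show "D3 (\<lambda>p x y. feq p y x)" unfolding D3_def by (intro dfi)
  show "bisim (\<lambda>p x y. feq p y x)"
    using feq_bisim unfolding bisim_def by blast
qed

lemma halfD:
  "half Q p x y \<Longrightarrow> pair \<rho> r \<epsilon> x \<Longrightarrow> r \<epsilon> P \<Longrightarrow> q \<epsilon> P \<Longrightarrow> sub p q \<Longrightarrow> sub r q \<Longrightarrow>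
    \<exists>s \<sigma> t. s \<epsilon> P \<and> sub q s \<and> pair \<sigma> t \<epsilon> y \<and> t \<epsilon> P \<and> sub t s \<and> Q s \<rho> \<sigma>"
  unfolding half_def by blast

lemma half_feq_trans:
  assumes "half feq p x y" "half feq p y z"
  shows "half (\<lambda>s a c. \<exists>b. feq s a b \<and> feq s b c) p x z"
  unfolding half_def
proof (intro allI impI, elim conjE)
  fix \<rho> r q
  assume q: "pair \<rho> r \<epsilon> x" "r \<epsilon> P" "q \<epsilon> P" "sub p q" "sub r q"
  obtain s \<sigma> t where s: "s \<epsilon> P" "sub q s" "pair \<sigma> t \<epsilon> y" "t \<epsilon> P" "sub t s" "feq s \<rho> \<sigma>"
    using halfD[OF assms(1) q] by blast
  obtain u \<tau> w where u: "u \<epsilon> P" "sub s u" "pair \<tau> w \<epsilon> z" "w \<epsilon> P" "sub w u" "feq u \<sigma> \<tau>"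
    using halfD[OF assms(2) s(3,4,1) _ s(5)] sub_trans[OF q(4) s(2)] by blast
  show "\<exists>s \<sigma> t. s \<epsilon> P \<and> sub q s \<and> pair \<sigma> t \<epsilon> z \<and> t \<epsilon> P \<and> sub t s \<and> (\<exists>b. feq s \<rho> b \<and> feq s b \<sigma>)"
    using u s(2) sub_trans feq_mono[OF s(6) u(1,2)] by blast
qed

lemma feq_trans: "feq p x y \<Longrightarrow> feq p y z \<Longrightarrow> feq p x z"
proof (rule feq_coinduct[of "\<lambda>p x z. \<exists>y. feq p x y \<and> feq p y z"])
  show "D3 (\<lambda>p x z. \<exists>y. feq p x y \<and> feq p y z)" unfolding D3_def by (intro dfi)
  show "bisim (\<lambda>p x z. \<exists>y. feq p x y \<and> feq p y z)"
    unfolding bisim_def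
  proof (intro allI impI, elim exE conjE)
    fix p x z y assume xy: "feq p x y" "feq p y z"
    then have yx: "feq p z y" "feq p y x" using feq_sym by blast+
    note h = xy[unfolded feq_step[of p]] yx[unfolded feq_step[of p]]
    have 1: "half (\<lambda>s a c. \<exists>b. feq s a b \<and> feq s b c) p x z"
      and 2: "half (\<lambda>s a c. \<exists>b. feq s a b \<and> feq s b c) p z x"
      using h half_feq_trans by blast+
    have "half (\<lambda>s a b. \<exists>y. feq s b y \<and> feq s y a) p z x"
      by (rule half_mono[OF 2]) (use feq_sym in blast)
    with 1 feq_P[OF xy(1)] show "p \<epsilon> P \<and> half (\<lambda>p x z. \<exists>y. feq p x y \<and> feq p y z) p x z
        \<and> half (\<lambda>s a b. \<exists>y. feq s b y \<and> feq s y a) p z x" by blast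
  qed
qed auto

lemma fmemD: "fmem p x y \<Longrightarrow> q \<epsilon> P \<Longrightarrow> sub p q \<Longrightarrow>
    \<exists>s \<sigma> t. s \<epsilon> P \<and> sub q s \<and> pair \<sigma> t \<epsilon> y \<and> t \<epsilon> P \<and> sub t s \<and> feq s x \<sigma>"
  unfolding fmem_def by blast

lemma fmem_mono: "fmem p x y \<Longrightarrow> sub p q \<Longrightarrow> fmem q x y"
  unfolding fmem_def using sub_trans by blast

lemma half_feq_iff: "half feq p x y \<longleftrightarrow>
    (\<forall>\<rho> r q. pair \<rho> r \<epsilon> x \<and> r \<epsilon> P \<and> q \<epsilon> P \<and> sub p q \<and> sub r q \<longrightarrow> fmem q \<rho> y)"
proof
  assume h: "half feq p x y"
  show "\<forall>\<rho> r q. pair \<rho> r \<epsilon> x \<and> r \<epsilon> P \<and> q \<epsilon> P \<and> sub p q \<and> sub r q \<longrightarrow> fmem q \<rho> y"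
  proof (intro allI impI, elim conjE)
    fix \<rho> r q assume q: "pair \<rho> r \<epsilon> x" "r \<epsilon> P" "q \<epsilon> P" "sub p q" "sub r q"
    show "fmem q \<rho> y" unfolding fmem_def
    proof (intro allI impI, elim conjE)
      fix q' assume q': "q' \<epsilon> P" "sub q q'"
      show "\<exists>s \<sigma> t. s \<epsilon> P \<and> sub q' s \<and> pair \<sigma> t \<epsilon> y \<and> t \<epsilon> P \<and> sub t s \<and> feq s \<rho> \<sigma>"
        by (rule halfD[OF h q(1,2) q'(1) sub_trans[OF q(4) q'(2)] sub_trans[OF q(5) q'(2)]])
    qed
  qed
next
  assume A: "\<forall>\<rho> r q. pair \<rho> r \<epsilon> x \<and> r \<epsilon> P \<and> q \<epsilon> P \<and> sub p q \<and> sub r q \<longrightarrow> fmem q \<rho> y"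
  show "half feq p x y" unfolding half_def
  proof (intro allI impI)
    fix \<rho> r q assume "pair \<rho> r \<epsilon> x \<and> r \<epsilon> P \<and> q \<epsilon> P \<and> sub p q \<and> sub r q"
    with A have "q \<epsilon> P" "fmem q \<rho> y" by blast+
    then show "\<exists>s \<sigma> t. s \<epsilon> P \<and> sub q s \<and> pair \<sigma> t \<epsilon> y \<and> t \<epsilon> P \<and> sub t s \<and> feq s \<rho> \<sigma>"
      using fmemD sub_refl by blast
  qed
qed

lemma feq_iff: "feq p x y \<longleftrightarrow> p \<epsilon> P \<and> half feq p x y \<and> half feq p y x"
proof -
  have "(\<lambda>s a b. feq s b a) = feq" using feq_sym by blast
  then show ?thesis using feq_step[of p x y] by simp
qed

lemma fmem_name: "pair \<rho> r \<epsilon> x \<Longrightarrow> r \<epsilon> P \<Longrightarrow> q \<epsilon> P \<Longrightarrow> sub r q \<Longrightarrow> fmem q \<rho> x"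
  unfolding fmem_def
proof (intro allI impI)
  fix q' assume "pair \<rho> r \<epsilon> x" "r \<epsilon> P" "q \<epsilon> P" "sub r q" "q' \<epsilon> P \<and> sub q q'"
  then have "q' \<epsilon> P \<and> sub q' q' \<and> pair \<rho> r \<epsilon> x \<and> r \<epsilon> P \<and> sub r q' \<and> feq q' \<rho> \<rho>"
    using feq_refl sub_trans by auto
  then show "\<exists>s \<sigma> t. s \<epsilon> P \<and> sub q' s \<and> pair \<sigma> t \<epsilon> x \<and> t \<epsilon> P \<and> sub t s \<and> feq s \<rho> \<sigma>" by blast
qed

lemma fmem_cong1: "feq p x x' \<Longrightarrow> fmem p x y \<Longrightarrow> fmem p x' y"
  unfolding fmem_def
proof (intro allI impI)
  fix q assume e: "feq p x x'" and m: "\<forall>q. q \<epsilon> P \<and> sub p q \<longrightarrow>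
      (\<exists>s \<sigma> t. s \<epsilon> P \<and> sub q s \<and> pair \<sigma> t \<epsilon> y \<and> t \<epsilon> P \<and> sub t s \<and> feq s x \<sigma>)" and q: "q \<epsilon> P \<and> sub p q"
  then obtain s \<sigma> t where s: "s \<epsilon> P" "sub q s" "pair \<sigma> t \<epsilon> y" "t \<epsilon> P" "sub t s" "feq s x \<sigma>" by blast
  then have "feq s x' \<sigma>"
    using feq_mono[OF e s(1)] q sub_trans feq_sym feq_trans by blast
  then show "\<exists>s \<sigma> t. s \<epsilon> P \<and> sub q s \<and> pair \<sigma> t \<epsilon> y \<and> t \<epsilon> P \<and> sub t s \<and> feq s x' \<sigma>" using s by blast
qed

lemma fmem_regular:
  assumes "\<And>q. q \<epsilon> P \<Longrightarrow> sub p q \<Longrightarrow> \<exists>s. s \<epsilon> P \<and> sub q s \<and> fmem s x y" shows "fmem p x y"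
  unfolding fmem_def
proof (intro allI impI)
  fix q assume "q \<epsilon> P \<and> sub p q"
  with assms obtain q' where q': "q' \<epsilon> P" "sub q q'" "fmem q' x y" by blast
  then show "\<exists>s \<sigma> t. s \<epsilon> P \<and> sub q s \<and> pair \<sigma> t \<epsilon> y \<and> t \<epsilon> P \<and> sub t s \<and> feq s x \<sigma>"
    using fmemD[OF q'(3) q'(1) sub_refl] sub_trans[OF q'(2)] by blast
qed

lemma fmem_cong2: "feq p y y' \<Longrightarrow> fmem p x y \<Longrightarrow> fmem p x y'"
proof (rule fmem_regular)
  fix q assume e: "feq p y y'" and m: "fmem p x y" and q: "q \<epsilon> P" "sub p q"
  obtain s \<sigma> t where s: "s \<epsilon> P" "sub q s" "pair \<sigma> t \<epsilon> y" "t \<epsilon> P" "sub t s" "feq s x \<sigma>"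
    using fmemD[OF m q] by blast
  have "half feq p y y'" using e feq_iff by blast
  then have "fmem s \<sigma> y'" unfolding half_feq_iff using s q sub_trans by blast
  then have "fmem s x y'" using fmem_cong1[OF feq_sym[OF s(6)]] by blast
  then show "\<exists>s. s \<epsilon> P \<and> sub q s \<and> fmem s x y'" using s by blast
qed

text \<open>Passes through \<open>fmem\<close>, which is dense by its definition: the two inclusions
  are checked element by element below conditions that force equality.\<close>

lemma feq_regular:
  assumes p: "p \<epsilon> P" and "\<And>q. q \<epsilon> P \<Longrightarrow> sub p q \<Longrightarrow> \<exists>s. s \<epsilon> P \<and> sub q s \<and> feq s x y"
  shows "feq p x y"
proof -
  have "half feq p x y"
    if d: "\<And>q. q \<epsilon> P \<Longrightarrow> sub p q \<Longrightarrow> \<exists>s. s \<epsilon> P \<and> sub q s \<and> feq s x y" for x y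
    unfolding half_feq_iff
  proof (intro allI impI, elim conjE)
    fix \<rho> r q assume q: "pair \<rho> r \<epsilon> x" "r \<epsilon> P" "q \<epsilon> P" "sub p q" "sub r q"
    show "fmem q \<rho> y"
    proof (rule fmem_regular)
      fix q' assume q': "q' \<epsilon> P" "sub q q'"
      obtain s where s: "s \<epsilon> P" "sub q' s" "feq s x y"
        using d[OF q'(1) sub_trans[OF q(4) q'(2)]] by blast
      have "fmem s \<rho> x"
        by (rule fmem_name[OF q(1,2) s(1) sub_trans[OF sub_trans[OF q(5) q'(2)] s(2)]])
      then show "\<exists>s. s \<epsilon> P \<and> sub q' s \<and> fmem s \<rho> y" using fmem_cong2[OF s(3)] s by blast
    qed
  qed
  note h = this
  have "half feq p x y" by (rule h) (rule assms(2))
  moreover have "half feq p y x" by (rule h) (use assms(2) feq_sym in blast)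
  ultimately show ?thesis using p feq_iff[of p x y] by blast
qed

text \<open>Quantifiers range over the class \<open>C\<close> of names, later the symmetric ones.
  With falsity, implication and the universal quantifier as primitives, regularity passes from the
  atomic formulas to all others.\<close>

primrec frc :: "('a \<Rightarrow> bool) \<Rightarrow> 'a \<Rightarrow> (nat \<Rightarrow> 'a) \<Rightarrow> fm \<Rightarrow> bool" where
  "frc C p e (x \<^bold>\<in> y) = fmem p (e x) (e y)"
| "frc C p e (x \<^bold>= y) = feq p (e x) (e y)"
| "frc C p e \<^bold>\<bottom> = False"
| "frc C p e (a \<^bold>\<longrightarrow> b) = (\<forall>q. q \<epsilon> P \<and> sub p q \<and> frc C q e a \<longrightarrow> frc C q e b)"
| "frc C p e (\<^bold>\<forall>a) = (\<forall>x. C x \<longrightarrow> frc C p (case_nat x e) a)"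

lemma frc_mono: "frc C p e a \<Longrightarrow> q \<epsilon> P \<Longrightarrow> sub p q \<Longrightarrow> frc C q e a"
proof (induction a arbitrary: e)
  case (Imp a b)
  then show ?case unfolding frc.simps using sub_trans by blast
qed (auto intro: fmem_mono feq_mono)

lemma frc_regular:
  "p \<epsilon> P \<Longrightarrow> (\<And>q. q \<epsilon> P \<Longrightarrow> sub p q \<Longrightarrow> \<exists>s. s \<epsilon> P \<and> sub q s \<and> frc C s e a) \<Longrightarrow> frc C p e a"
proof (induction a arbitrary: p e)
  case (Mem x y)
  then show ?case by (auto intro: fmem_regular)
next
  case (Eq x y)
  then show ?case by (auto intro: feq_regular)
next
  case Fls
  then show ?case using sub_refl by fastforce
next
  case (Imp a b)
  show ?case unfolding frc.simps
  proof (intro allI impI, elim conjE)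
    fix q assume q: "q \<epsilon> P" "sub p q" "frc C q e a"
    show "frc C q e b"
    proof (rule Imp.IH(2)[OF q(1)])
      fix q' assume q': "q' \<epsilon> P" "sub q q'"
      obtain s where s: "s \<epsilon> P" "sub q' s" "frc C s e (a \<^bold>\<longrightarrow> b)"
        using Imp.prems(2)[OF q'(1) sub_trans[OF q(2) q'(2)]] by blast
      moreover have "frc C s e a" by (rule frc_mono[OF q(3) s(1) sub_trans[OF q'(2) s(2)]])
      ultimately show "\<exists>s. s \<epsilon> P \<and> sub q' s \<and> frc C s e b" using sub_refl by auto
    qed
  qed
next
  case (Forall a)
  show ?case unfolding frc.simps
  proof (intro allI impI)
    fix x assume "C x"
    then show "frc C p (case_nat x e) a"
      using Forall.prems(2) unfolding frc.simps by (intro Forall.IH[OF Forall.prems(1)]) blast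
  qed
qed

lemma frc_Conj: "p \<epsilon> P \<Longrightarrow> frc C p e (a \<^bold>\<and> b) \<longleftrightarrow> frc C p e a \<and> frc C p e b"
proof
  assume p: "p \<epsilon> P" and f: "frc C p e (a \<^bold>\<and> b)"
  have *: "\<exists>s. s \<epsilon> P \<and> sub q s \<and> frc C s e a \<and> frc C s e b" if q: "q \<epsilon> P" "sub p q" for q
  proof (rule ccontr)
    assume "\<not> ?thesis"
    then have "frc C q e (a \<^bold>\<longrightarrow> \<^bold>\<not>b)"
      unfolding frc.simps using sub_trans frc_mono by blast
    then show False using f q sub_refl unfolding frc.simps by blast
  qed
  then show "frc C p e a \<and> frc C p e b" using frc_regular[OF p] by meson
next
  assume p: "p \<epsilon> P" and f: "frc C p e a \<and> frc C p e b"
  then show "frc C p e (a \<^bold>\<and> b)"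
    unfolding frc.simps using frc_mono[of C p e a] frc_mono[of C p e b] sub_refl by blast
qed

lemma frc_Exists: "p \<epsilon> P \<Longrightarrow> frc C p e (\<^bold>\<exists>a) \<Longrightarrow> \<exists>s x. s \<epsilon> P \<and> sub p s \<and> C x \<and> frc C s (case_nat x e) a"
proof (rule ccontr)
  assume p: "p \<epsilon> P" and f: "frc C p e (\<^bold>\<exists>a)" and n: "\<nexists>s x. s \<epsilon> P \<and> sub p s \<and> C x \<and> frc C s (case_nat x e) a"
  then have "frc C p e (\<^bold>\<forall>(\<^bold>\<not>a))" unfolding frc.simps by blast
  then show False using f p sub_refl unfolding frc.simps by blast
qed

lemma dfb_frc:
  assumes C: "D1 C" shows "dfb (\<lambda>e. frc C (e 0) (\<lambda>n. e (Suc n)) a)"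
proof (induction a)
  case (Imp a b)
  have *: "dfb (\<lambda>e. frc C (e 0) (\<lambda>n. e (Suc (Suc n))) c)"
    if "dfb (\<lambda>e. frc C (e 0) (\<lambda>n. e (Suc n)) c)" for c
    using dfb_subst[OF that, of "\<lambda>e n. case n of 0 \<Rightarrow> e 0 | Suc n \<Rightarrow> e (Suc (Suc n))"]
    by (simp add: atom_case)
  show ?case unfolding frc.simps by (intro dfi * Imp)
next
  case (Forall a)
  have "dfb (\<lambda>e. frc C (e 1) (case_nat (e 0) (\<lambda>n. e (Suc (Suc n)))) a)"
    using dfb_subst[OF Forall, of "\<lambda>e n. case n of 0 \<Rightarrow> e 1 | Suc n \<Rightarrow>
      (case n of 0 \<Rightarrow> e 0 | Suc n \<Rightarrow> e (Suc (Suc n)))"]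
    by (simp add: atom_case)
  then show ?case unfolding frc.simps by (intro dfb_all dfb_imp D1I[OF C] dft_var) simp
qed (unfold frc.simps, (intro dfi)+)

definition chk where "chk = wrec (\<lambda>x. x) (\<lambda>x g. rep (rng g) (\<lambda>z. pair z emp))"

lemma F1_chk: "F1 chk"
  unfolding chk_def by (intro F1_wrec F1_id, unfold F2_def, intro dfi)

lemmas [dfi] = F1I[OF F1_chk]

lemma mem_chk: "z \<epsilon> chk x \<longleftrightarrow> (\<exists>y. y \<epsilon> x \<and> z = pair (chk y) emp)"
proof -
  have F: "F2 (\<lambda>x g. rep (rng g) (\<lambda>z. pair z emp))" and F': "F1 (\<lambda>z. pair z emp)"
    unfolding F1_def F2_def by (intro dfi)+
  have "chk x = rep (rep x chk) (\<lambda>z. pair z emp)"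
    using erec_eq[OF F, of x] unfolding chk_def[symmetric] by (simp add: rng_lam[OF F1_chk])
  then show ?thesis by (auto simp: mem_rep[OF F'] mem_rep[OF F1_chk])
qed

text \<open>The standard name for a definable subset of \<open>a\<close>. That the value lies in
  \<open>a\<close> is not built in; \<open>N_sepn\<close> puts it into the formula.\<close>

definition sepn where
  "sepn C a e \<phi> = sep (prod (dom a) P) (\<lambda>z. C (fstp z) \<and> frc C (sndp z) (case_nat (fstp z) e) \<phi>)"

end

text \<open>Closure properties of a class of names that suffice for ZF in the extension.
  \<open>C_bound\<close> only gives a name for a superset; exact sets are then cut out by
  \<open>C_sep\<close>.\<close>

locale name_class = forcing +
  fixes C :: "'a \<Rightarrow> bool"
  assumes D1_C: "D1 C"
    and C_elem: "C x \<Longrightarrow> pair \<rho> r \<epsilon> x \<Longrightarrow> r \<epsilon> P \<Longrightarrow> C \<rho>"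
    and C_chk: "C (chk x)"
    and C_bound: "(\<And>x. x \<epsilon> t \<Longrightarrow> C x) \<Longrightarrow> \<exists>y. C y \<and> (\<forall>x. x \<epsilon> t \<longrightarrow> pair x emp \<epsilon> y)"
    and C_sep: "C a \<Longrightarrow> (\<And>n. C (e n)) \<Longrightarrow> C (sepn C a e \<phi>)"
begin

lemmas [dfi] = D1I[OF D1_C]

lemma frc_D: "D1 (\<lambda>p. frc C p e \<phi>)" "D2 (\<lambda>p x. frc C p (case_nat x e) \<phi>)"
  "D3 (\<lambda>p x y. frc C p (case_nat x (case_nat y e)) \<phi>)"
proof -
  show "D1 (\<lambda>p. frc C p e \<phi>)" unfolding D1_def
    using dfb_subst[OF dfb_frc[OF D1_C, of \<phi>], of "\<lambda>e' n. case n of 0 \<Rightarrow> e' 0 | Suc n \<Rightarrow> e n"]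
    by (simp add: atom_case)
  show "D2 (\<lambda>p x. frc C p (case_nat x e) \<phi>)" unfolding D2_def
    using dfb_subst[OF dfb_frc[OF D1_C, of \<phi>], of "\<lambda>e' n. case n of 0 \<Rightarrow> e' 0 | Suc n \<Rightarrow> case_nat (e' 1) e n"]
    by (simp add: atom_case)
  show "D3 (\<lambda>p x y. frc C p (case_nat x (case_nat y e)) \<phi>)" unfolding D3_def
    using dfb_subst[OF dfb_frc[OF D1_C, of \<phi>],
      of "\<lambda>e' n. case n of 0 \<Rightarrow> e' 0 | Suc n \<Rightarrow> (case n of 0 \<Rightarrow> e' 1 | Suc n \<Rightarrow> case_nat (e' 2) e n)"]
    by (simp add: atom_case)
qed

lemma mem_sepn: "pair \<rho> p \<epsilon> sepn C a e \<phi> \<longleftrightarrow>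
    (\<exists>r. pair \<rho> r \<epsilon> a) \<and> p \<epsilon> P \<and> C \<rho> \<and> frc C p (case_nat \<rho> e) \<phi>"
proof -
  have "D1 (\<lambda>z. C (fstp z) \<and> frc C (sndp z) (case_nat (fstp z) e) \<phi>)"
    unfolding D1_def by (intro dfi D2I[OF frc_D(2)])
  then show ?thesis unfolding sepn_def by (auto simp: mem_sep)
qed

lemma sepn_elem: "z \<epsilon> sepn C a e \<phi> \<Longrightarrow> \<exists>\<rho> p. z = pair \<rho> p"
proof -
  have "D1 (\<lambda>z. C (fstp z) \<and> frc C (sndp z) (case_nat (fstp z) e) \<phi>)"
    unfolding D1_def by (intro dfi D2I[OF frc_D(2)])
  then show "z \<epsilon> sepn C a e \<phi> \<Longrightarrow> \<exists>\<rho> p. z = pair \<rho> p"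
    unfolding sepn_def by (auto simp: mem_sep mem_prod)
qed

end

text \<open>Elements of the extension are represented by names, two of them being identified if a
  condition in \<open>G\<close> forces their equality. Genericity concerns classes that are
  definable with parameters.\<close>

locale generic_ext = name_class +
  fixes G :: "'a set" and v :: "'a \<Rightarrow> 'a" and EN :: "'a \<Rightarrow> 'a \<Rightarrow> bool"
  assumes G_P: "p \<in> G \<Longrightarrow> p \<epsilon> P"
    and G_up: "p \<in> G \<Longrightarrow> q \<epsilon> P \<Longrightarrow> sub q p \<Longrightarrow> q \<in> G"
    and G_dir: "p \<in> G \<Longrightarrow> q \<in> G \<Longrightarrow> \<exists>r. r \<in> G \<and> sub p r \<and> sub q r"
    and G_dense: "D1 D \<Longrightarrow> (\<And>p. p \<epsilon> P \<Longrightarrow> \<exists>q. q \<epsilon> P \<and> sub p q \<and> D q) \<Longrightarrow> \<exists>q. q \<in> G \<and> D q"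
    and v_eq: "C x \<Longrightarrow> C y \<Longrightarrow> v x = v y \<longleftrightarrow> (\<exists>p. p \<in> G \<and> feq p x y)"
    and v_surj: "\<exists>x. C x \<and> v x = a"
    and EN_def: "EN a b \<longleftrightarrow> (\<exists>x y p. C x \<and> C y \<and> v x = a \<and> v y = b \<and> p \<in> G \<and> fmem p x y)"
begin

lemma emp_G: "emp \<in> G"
proof -
  have "D1 (\<lambda>_. True)" unfolding D1_def by (intro dfi)
  then obtain q where "q \<in> G" using G_dense[of "\<lambda>_. True"] sub_refl by blast
  then show ?thesis using G_up emp_P by (metis mem_emp sub_def)
qed

text \<open>\<open>D\<close> below \<open>p\<close>, together with the conditions incompatible with
  \<open>p\<close>, is dense.\<close>

lemma G_dense_below:
  assumes D: "D1 D" and p: "p \<in> G"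
    and d: "\<And>q. q \<epsilon> P \<Longrightarrow> sub p q \<Longrightarrow> \<exists>s. s \<epsilon> P \<and> sub q s \<and> D s"
  shows "\<exists>s. s \<in> G \<and> sub p s \<and> D s"
proof -
  let ?D = "\<lambda>q. D q \<and> sub p q \<or> \<not> (\<exists>r. r \<epsilon> P \<and> sub p r \<and> sub q r)"
  have "D1 ?D" unfolding D1_def by (intro dfi D1I[OF D])
  moreover have "\<exists>s. s \<epsilon> P \<and> sub q s \<and> ?D s" if "q \<epsilon> P" for q
  proof (cases "\<exists>r. r \<epsilon> P \<and> sub p r \<and> sub q r")
    case True
    then obtain r s where "r \<epsilon> P" "sub p r" "sub q r" "s \<epsilon> P" "sub r s" "D s" using d by blast
    then show ?thesis using sub_trans by blast
  next
    case False
    then show ?thesis using that sub_refl by blast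
  qed
  ultimately obtain q where "q \<in> G" "?D q" using G_dense[of ?D] by blast
  then show ?thesis using G_dir[OF p \<open>q \<in> G\<close>] G_P by blast
qed

lemma EN_v:
  assumes "C x" "C y" shows "EN (v x) (v y) \<longleftrightarrow> (\<exists>p. p \<in> G \<and> fmem p x y)"
proof
  assume "EN (v x) (v y)"
  then obtain x' y' p where x': "C x'" "C y'" "v x' = v x" "v y' = v y" "p \<in> G" "fmem p x' y'"
    unfolding EN_def by blast
  then obtain q r where q: "q \<in> G" "feq q x' x" and r: "r \<in> G" "feq r y' y"
    using v_eq assms by blast
  obtain s where s: "s \<in> G" "sub p s" "sub q s" using G_dir x'(5) q(1) by blast
  obtain t where t: "t \<in> G" "sub s t" "sub r t" using G_dir s(1) r(1) by blast
  have "fmem t x' y'" "feq t x' x" "feq t y' y"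
    using t s x'(6) q(2) r(2) G_P sub_trans fmem_mono feq_mono by blast+
  then show "\<exists>p. p \<in> G \<and> fmem p x y" using t(1) fmem_cong1 fmem_cong2 by blast
qed (use assms EN_def in blast)

text \<open>Recovers the usual evaluation of names: by genericity, a forced membership is realized
  by some pair in \<open>y\<close> whose condition lies in \<open>G\<close>.\<close>

lemma EN_name:
  assumes "C y" shows "EN a (v y) \<longleftrightarrow> (\<exists>\<rho> r. pair \<rho> r \<epsilon> y \<and> r \<in> G \<and> a = v \<rho>)"
proof
  assume "EN a (v y)"
  then obtain x where x: "C x" "v x = a" using v_surj by blast
  then obtain p where p: "p \<in> G" "fmem p x y" using \<open>EN a (v y)\<close> EN_v assms by blast
  let ?D = "\<lambda>s. \<exists>\<sigma> t. pair \<sigma> t \<epsilon> y \<and> t \<epsilon> P \<and> sub t s \<and> feq s x \<sigma>"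
  have "D1 ?D" unfolding D1_def by (intro dfi)
  from G_dense_below[OF this p(1)] obtain s \<sigma> t where
    s: "s \<in> G" "pair \<sigma> t \<epsilon> y" "t \<epsilon> P" "sub t s" "feq s x \<sigma>"
    using fmemD[OF p(2)] by metis
  then have "v x = v \<sigma>" using v_eq[OF x(1) C_elem[OF assms s(2,3)]] by blast
  then show "\<exists>\<rho> r. pair \<rho> r \<epsilon> y \<and> r \<in> G \<and> a = v \<rho>"
    using s x(2) G_up by blast
next
  assume "\<exists>\<rho> r. pair \<rho> r \<epsilon> y \<and> r \<in> G \<and> a = v \<rho>"
  then obtain \<rho> r where r: "pair \<rho> r \<epsilon> y" "r \<in> G" "a = v \<rho>" by blast
  then have "fmem r \<rho> y" using fmem_name G_P sub_refl by blast
  then show "EN a (v y)" using EN_v[OF C_elem[OF assms r(1)] assms] r G_P by blast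
qed

lemma v_case: "(\<lambda>n. v (case_nat x e n)) = case_nat (v x) (\<lambda>n. v (e n))"
  by (auto simp: fun_eq_iff split: nat.splits)

lemma C_case: "C x \<Longrightarrow> (\<And>n. C (e n)) \<Longrightarrow> C (case_nat x e n)"
  by (cases n) auto

lemma frc_not_dense:
  "p \<epsilon> P \<Longrightarrow> \<not> frc C p e \<phi> \<Longrightarrow> \<exists>q. q \<epsilon> P \<and> sub p q \<and> (\<forall>s. s \<epsilon> P \<and> sub q s \<longrightarrow> \<not> frc C s e \<phi>)"
  using frc_regular by blast

text \<open>For implications and quantifiers, the conditions that force the formula or exclude it
  through a counterexample are dense.\<close>

theorem truth: "(\<And>n. C (e n)) \<Longrightarrow> sat EN (\<lambda>n. v (e n)) \<phi> \<longleftrightarrow> (\<exists>p. p \<in> G \<and> frc C p e \<phi>)"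
proof (induction \<phi> arbitrary: e)
  case (Mem x y)
  then show ?case by (simp add: EN_v)
next
  case (Eq x y)
  then show ?case by (simp add: v_eq)
next
  case Fls
  then show ?case by simp
next
  case (Imp a b)
  note IH = Imp.IH[OF Imp.prems]
  show ?case
  proof
    assume L: "sat EN (\<lambda>n. v (e n)) (a \<^bold>\<longrightarrow> b)"
    let ?D = "\<lambda>p. frc C p e (a \<^bold>\<longrightarrow> b) \<or> frc C p e a \<and> (\<forall>s. s \<epsilon> P \<and> sub p s \<longrightarrow> \<not> frc C s e b)"
    have "D1 ?D" unfolding D1_def by (intro dfi D1I[OF frc_D(1)])
    moreover have "\<exists>q. q \<epsilon> P \<and> sub p q \<and> ?D q" if p: "p \<epsilon> P" for p
    proof (cases "frc C p e (a \<^bold>\<longrightarrow> b)")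
      case True
      then show ?thesis using p sub_refl by blast
    next
      case False
      then obtain q where q: "q \<epsilon> P" "sub p q" "frc C q e a" "\<not> frc C q e b" by auto
      obtain s where "s \<epsilon> P" "sub q s" "\<forall>t. t \<epsilon> P \<and> sub s t \<longrightarrow> \<not> frc C t e b"
        using frc_not_dense[OF q(1,4)] by blast
      then show ?thesis using q frc_mono sub_trans by blast
    qed
    ultimately obtain q where q: "q \<in> G" "?D q" using G_dense[of ?D] by blast
    show "\<exists>p. p \<in> G \<and> frc C p e (a \<^bold>\<longrightarrow> b)"
    proof (cases "frc C q e (a \<^bold>\<longrightarrow> b)")
      case False
      with q have q': "frc C q e a" "\<And>s. s \<epsilon> P \<and> sub q s \<Longrightarrow> \<not> frc C s e b" by blast+
      then obtain r where r: "r \<in> G" "frc C r e b" using L IH q(1) by auto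
      obtain s where "s \<in> G" "sub q s" "sub r s" using G_dir[OF q(1) r(1)] by blast
      then show ?thesis using q'(2) frc_mono[OF r(2)] G_P by blast
    qed (use q in blast)
  next
    assume "\<exists>p. p \<in> G \<and> frc C p e (a \<^bold>\<longrightarrow> b)"
    then obtain p where p: "p \<in> G" "frc C p e (a \<^bold>\<longrightarrow> b)" by blast
    have "\<exists>s. s \<in> G \<and> frc C s e b" if "q \<in> G" "frc C q e a" for q
    proof -
      obtain s where s: "s \<in> G" "sub p s" "sub q s" using G_dir[OF p(1) \<open>q \<in> G\<close>] by blast
      then show ?thesis using p(2) frc_mono[OF \<open>frc C q e a\<close>] G_P by auto
    qed
    then show "sat EN (\<lambda>n. v (e n)) (a \<^bold>\<longrightarrow> b)" using IH by auto
  qed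
next
  case (Forall a)
  have IH: "sat EN (case_nat (v x) (\<lambda>n. v (e n))) a \<longleftrightarrow> (\<exists>p. p \<in> G \<and> frc C p (case_nat x e) a)"
    if "C x" for x
    using Forall.IH[of "case_nat x e"] C_case[OF that Forall.prems] by (simp add: v_case)
  show ?case
  proof
    assume L: "sat EN (\<lambda>n. v (e n)) (\<^bold>\<forall>a)"
    let ?D = "\<lambda>p. frc C p e (\<^bold>\<forall>a) \<or> (\<exists>x. C x \<and> (\<forall>s. s \<epsilon> P \<and> sub p s \<longrightarrow> \<not> frc C s (case_nat x e) a))"
    have "D1 ?D" unfolding D1_def by (intro dfi D1I[OF frc_D(1)] D2I[OF frc_D(2)])
    moreover have "\<exists>q. q \<epsilon> P \<and> sub p q \<and> ?D q" if p: "p \<epsilon> P" for p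
    proof (cases "frc C p e (\<^bold>\<forall>a)")
      case True
      then show ?thesis using p sub_refl by blast
    next
      case False
      then obtain x where "C x" "\<not> frc C p (case_nat x e) a" by auto
      then show ?thesis using frc_not_dense[OF p] by blast
    qed
    ultimately obtain q where q: "q \<in> G" "?D q" using G_dense[of ?D] by blast
    show "\<exists>p. p \<in> G \<and> frc C p e (\<^bold>\<forall>a)"
    proof (cases "frc C q e (\<^bold>\<forall>a)")
      case False
      with q obtain x where x: "C x" "\<And>s. s \<epsilon> P \<and> sub q s \<Longrightarrow> \<not> frc C s (case_nat x e) a" by blast
      then obtain r where r: "r \<in> G" "frc C r (case_nat x e) a" using L IH[OF x(1)] by auto
      obtain s where "s \<in> G" "sub q s" "sub r s" using G_dir[OF q(1) r(1)] by blast
      then show ?thesis using x(2) frc_mono[OF r(2)] G_P by blast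
    qed (use q in blast)
  next
    assume "\<exists>p. p \<in> G \<and> frc C p e (\<^bold>\<forall>a)"
    then obtain p where p: "p \<in> G" "frc C p e (\<^bold>\<forall>a)" by blast
    show "sat EN (\<lambda>n. v (e n)) (\<^bold>\<forall>a)" unfolding sat.simps
    proof
      fix z obtain x where "C x" "v x = z" using v_surj by blast
      then show "sat EN (case_nat z (\<lambda>n. v (e n))) a" using p IH by auto
    qed
  qed
qed

lemma ex_names: obtains f where "\<And>n. C (f n)" "e = (\<lambda>n. v (f n))"
proof -
  have "\<forall>n. \<exists>x. C x \<and> v x = e n" using v_surj by blast
  then obtain f where "\<forall>n. C (f n) \<and> v (f n) = e n" by metis
  then show ?thesis using that[of f] by auto
qed

text \<open>The two inclusions are true, so conditions in \<open>G\<close> force them; a common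
  extension forces both halves of equality.\<close>

lemma N_ext:
  assumes "\<And>z. EN z a \<longleftrightarrow> EN z b" shows "a = b"
proof -
  obtain x y where x: "C x" "v x = a" and y: "C y" "v y = b" using v_surj by metis
  let ?e = "case_nat x (\<lambda>_. y)"
  have e: "C (?e n)" for n using x y by (auto split: nat.split)
  have "sat EN (\<lambda>n. v (?e n)) (\<^bold>\<forall>(0 \<^bold>\<in> 1 \<^bold>\<longrightarrow> 0 \<^bold>\<in> 2))" "sat EN (\<lambda>n. v (?e n)) (\<^bold>\<forall>(0 \<^bold>\<in> 2 \<^bold>\<longrightarrow> 0 \<^bold>\<in> 1))"
    using assms x y by (auto simp: v_case numeral_2_eq_2)
  then obtain p q where p: "p \<in> G" "frc C p ?e (\<^bold>\<forall>(0 \<^bold>\<in> 1 \<^bold>\<longrightarrow> 0 \<^bold>\<in> 2))"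
    and q: "q \<in> G" "frc C q ?e (\<^bold>\<forall>(0 \<^bold>\<in> 2 \<^bold>\<longrightarrow> 0 \<^bold>\<in> 1))"
    unfolding truth[of ?e, OF e] by blast
  obtain r where r: "r \<in> G" "sub p r" "sub q r" using G_dir p q by blast
  have "half feq r x y" unfolding half_feq_iff
  proof (intro allI impI, elim conjE)
    fix \<rho> t s assume s: "pair \<rho> t \<epsilon> x" "t \<epsilon> P" "s \<epsilon> P" "sub r s" "sub t s"
    then have "fmem s \<rho> x" "C \<rho>" using fmem_name C_elem x by blast+
    then show "fmem s \<rho> y"
      using p(2) s sub_trans[OF r(2) s(4)] by (simp add: numeral_2_eq_2)
  qed
  moreover have "half feq r y x" unfolding half_feq_iff
  proof (intro allI impI, elim conjE)
    fix \<rho> t s assume s: "pair \<rho> t \<epsilon> y" "t \<epsilon> P" "s \<epsilon> P" "sub r s" "sub t s"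
    then have "fmem s \<rho> y" "C \<rho>" using fmem_name C_elem y by blast+
    then show "fmem s \<rho> x"
      using q(2) s sub_trans[OF r(3) s(4)] by (simp add: numeral_2_eq_2)
  qed
  ultimately have "feq r x y" using feq_iff[of r x y] G_P[OF r(1)] by blast
  then show ?thesis using v_eq x y r(1) by blast
qed

lemma N_sepn:
  fixes \<phi> :: fm
  assumes a: "C a" and e: "\<And>n. C (e n)"
  defines "s \<equiv> sepn C a (case_nat a e) (0 \<^bold>\<in> 1 \<^bold>\<and> lift 1 \<phi>)"
  shows "C s" "EN z (v s) \<longleftrightarrow> EN z (v a) \<and> sat EN (case_nat z (\<lambda>n. v (e n))) \<phi>"
proof -
  show s: "C s" unfolding s_def by (rule C_sep[OF a C_case[OF a e]])
  have t: "(\<exists>p. p \<in> G \<and> frc C p (case_nat \<rho> (case_nat a e)) (0 \<^bold>\<in> 1 \<^bold>\<and> lift 1 \<phi>)) \<longleftrightarrow>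
      EN (v \<rho>) (v a) \<and> sat EN (case_nat (v \<rho>) (\<lambda>n. v (e n))) \<phi>" if "C \<rho>" for \<rho>
    unfolding truth[of "case_nat \<rho> (case_nat a e)", OF C_case[OF that C_case[OF a e]], symmetric]
    by (simp add: v_case sat_lift_below)
  show "EN z (v s) \<longleftrightarrow> EN z (v a) \<and> sat EN (case_nat z (\<lambda>n. v (e n))) \<phi>"
  proof
    assume "EN z (v s)"
    then obtain \<rho> p where p: "pair \<rho> p \<epsilon> s" "p \<in> G" "z = v \<rho>" using EN_name[OF s] by blast
    then have "C \<rho>" "frc C p (case_nat \<rho> (case_nat a e)) (0 \<^bold>\<in> 1 \<^bold>\<and> lift 1 \<phi>)"
      unfolding s_def mem_sepn by blast+
    then show "EN z (v a) \<and> sat EN (case_nat z (\<lambda>n. v (e n))) \<phi>" using t p by blast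
  next
    assume z: "EN z (v a) \<and> sat EN (case_nat z (\<lambda>n. v (e n))) \<phi>"
    then obtain \<rho> r where r: "pair \<rho> r \<epsilon> a" "r \<in> G" "z = v \<rho>" using EN_name[OF a] by blast
    then have c: "C \<rho>" using C_elem a G_P by blast
    then obtain p where "p \<in> G" "frc C p (case_nat \<rho> (case_nat a e)) (0 \<^bold>\<in> 1 \<^bold>\<and> lift 1 \<phi>)"
      using t z r by blast
    then have "pair \<rho> p \<epsilon> s" "p \<in> G" unfolding s_def mem_sepn using r c G_P by blast+
    then show "EN z (v s)" using EN_name[OF s] r by blast
  qed
qed

lemma N_bound:
  assumes "\<And>x. x \<epsilon> t \<Longrightarrow> C x" shows "\<exists>b. \<forall>x. x \<epsilon> t \<longrightarrow> EN (v x) b"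
proof -
  obtain y where "C y" "\<And>x. x \<epsilon> t \<Longrightarrow> pair x emp \<epsilon> y" using C_bound[OF assms] by blast
  then show ?thesis using EN_name emp_G by blast
qed

text \<open>Some condition would force the absence of a minimal element. Inside the ground model
  names have ranks, and by induction on them nothing can be forced into such a set below that
  condition.\<close>

lemma N_foundation:
  assumes "EN b a" shows "\<exists>y. EN y a \<and> (\<forall>z. EN z y \<longrightarrow> \<not> EN z a)"
proof (rule ccontr)
  assume neg: "\<not> ?thesis"
  obtain x y where x: "C x" "v x = a" and y: "C y" "v y = b" using v_surj by metis
  let ?f = "\<^bold>\<forall>(0 \<^bold>\<in> 1 \<^bold>\<longrightarrow> \<^bold>\<exists>(0 \<^bold>\<in> 1 \<^bold>\<and> 0 \<^bold>\<in> 2))"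
  have "sat EN (\<lambda>n. v x) ?f" using neg x by (auto simp: numeral_2_eq_2)
  then obtain p where p: "p \<in> G" "frc C p (\<lambda>_. x) ?f" using truth[of "\<lambda>_. x" ?f] x by blast
  have step: "\<exists>s z. s \<epsilon> P \<and> sub q s \<and> C z \<and> fmem s z u \<and> fmem s z x"
    if q: "C u" "q \<epsilon> P" "sub p q" "fmem q u x" for u q
  proof -
    have "frc C q (case_nat u (\<lambda>_. x)) (\<^bold>\<exists>(0 \<^bold>\<in> 1 \<^bold>\<and> 0 \<^bold>\<in> 2))"
      using p(2) q unfolding frc.simps by simp
    then obtain s z where s: "s \<epsilon> P" "sub q s" "C z"
      "frc C s (case_nat z (case_nat u (\<lambda>_. x))) (0 \<^bold>\<in> 1 \<^bold>\<and> 0 \<^bold>\<in> 2)"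
      using frc_Exists[OF q(2)] by blast
    from s(4) have "fmem s z u" "fmem s z x"
      unfolding frc_Conj[OF s(1)] by (simp_all add: numeral_2_eq_2)
    then show ?thesis using s by blast
  qed
  have D: "D1 (\<lambda>u. C u \<longrightarrow> (\<forall>q. q \<epsilon> P \<and> sub p q \<longrightarrow> \<not> fmem q u x))"
    unfolding D1_def by (intro dfi)
  have "C u \<longrightarrow> (\<forall>q. q \<epsilon> P \<and> sub p q \<longrightarrow> \<not> fmem q u x)" for u
  proof (rule rk_induct[OF D], intro impI allI notI)
    fix u q assume IH: "\<And>w. rk w \<epsilon> rk u \<Longrightarrow> C w \<longrightarrow> (\<forall>q. q \<epsilon> P \<and> sub p q \<longrightarrow> \<not> fmem q w x)"
      and u: "C u" "q \<epsilon> P \<and> sub p q" "fmem q u x"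
    obtain s z where s: "s \<epsilon> P" "sub q s" "C z" "fmem s z u" "fmem s z x" using step[of u q] u by blast
    obtain s' w t where s': "s' \<epsilon> P" "sub s s'" "pair w t \<epsilon> u" "t \<epsilon> P" "feq s' z w"
      using fmemD[OF s(4,1) sub_refl] by blast
    have "fmem s' w x" using fmem_cong1[OF s'(5) fmem_mono[OF s(5) s'(2)]] .
    moreover have "sub p s'" using u(2) s(2) s'(2) sub_trans by blast
    ultimately show False using IH[OF rk_name[OF s'(3)]] C_elem[OF u(1) s'(3,4)] s'(1) by blast
  qed
  moreover obtain q where q: "q \<in> G" "fmem q y x" using EN_v x y assms by blast
  moreover obtain r where "r \<in> G" "sub p r" "sub q r" using G_dir[OF p(1) q(1)] by blast
  ultimately show False using y(1) G_P fmem_mono by blast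
qed

lemma N_separation: "\<exists>c. \<forall>z. EN z c \<longleftrightarrow> EN z b \<and> sat EN (case_nat z e) \<phi>"
proof -
  obtain x where x: "C x" "v x = b" using v_surj by blast
  obtain f where f: "\<And>n. C (f n)" "e = (\<lambda>n. v (f n))" using ex_names by metis
  show ?thesis
    unfolding f(2) x(2)[symmetric] by (rule exI, rule allI, rule N_sepn(2)[OF x(1) f(1)])
qed

lemma v_chk_mem: "EN a (v (chk x)) \<longleftrightarrow> (\<exists>y. y \<epsilon> x \<and> a = v (chk y))"
  unfolding EN_name[OF C_chk] mem_chk using emp_G by auto

theorem N_zf: "zf EN"
proof
  show "(\<And>z. EN z x = EN z y) \<Longrightarrow> x = y" for x y by (rule N_ext)
  show "EN y x \<Longrightarrow> \<exists>y. EN y x \<and> (\<forall>z. EN z y \<longrightarrow> \<not> EN z x)" for x y by (rule N_foundation)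
  show sep: "\<exists>b. \<forall>x. EN x b \<longleftrightarrow> EN x a \<and> sat EN (case_nat x e) \<phi>" for a e \<phi>
    by (rule N_separation)
  show "\<exists>z. \<forall>w. EN w z \<longleftrightarrow> w = x \<or> w = y" for x y
  proof -
    obtain x' y' where n: "C x'" "v x' = x" "C y'" "v y' = y" using v_surj by metis
    have "\<exists>b. \<forall>z. z \<epsilon> upr x' y' \<longrightarrow> EN (v z) b" by (rule N_bound) (use n in auto)
    then obtain b where b: "EN x b" "EN y b" using n by auto
    obtain c where "\<forall>z. EN z c \<longleftrightarrow> EN z b \<and> sat EN (case_nat z (case_nat x (\<lambda>_. y))) (0 \<^bold>= 1 \<^bold>\<or> 0 \<^bold>= 2)"
      using sep by blast
    then show ?thesis using b by (intro exI[of _ c]) (auto simp: numeral_2_eq_2)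
  qed
  show "\<exists>u. \<forall>z. EN z u \<longleftrightarrow> (\<exists>y. EN y x \<and> EN z y)" for x
  proof -
    obtain x' where x: "C x'" "v x' = x" using v_surj by blast
    let ?Q = "\<lambda>\<sigma>. \<exists>\<rho> r t. pair \<rho> r \<epsilon> x' \<and> r \<epsilon> P \<and> pair \<sigma> t \<epsilon> \<rho> \<and> t \<epsilon> P"
    have Q: "D1 ?Q" unfolding D1_def by (intro dfi)
    let ?t = "sep (Vs (rk x')) ?Q"
    have "?Q \<sigma> \<Longrightarrow> \<sigma> \<epsilon> Vs (rk x')" for \<sigma>
      using rk_name Ord_trans[OF Ord_rk] by (auto simp: mem_Vs_iff) blast
    then have t: "\<sigma> \<epsilon> ?t \<longleftrightarrow> ?Q \<sigma>" for \<sigma> unfolding mem_sep[OF Q] by blast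
    have "C z" if "z \<epsilon> ?t" for z using that C_elem x unfolding t by blast
    from N_bound[OF this] obtain b where b: "\<And>z. z \<epsilon> ?t \<Longrightarrow> EN (v z) b" by blast
    have "EN z b" if "EN y x" "EN z y" for y z
    proof -
      obtain \<rho> r where r: "pair \<rho> r \<epsilon> x'" "r \<in> G" "y = v \<rho>"
        using EN_name[OF x(1)] x(2) \<open>EN y x\<close> by blast
      have c: "C \<rho>" using C_elem[OF x(1) r(1)] r(2) G_P by blast
      then obtain \<sigma> t where s: "pair \<sigma> t \<epsilon> \<rho>" "t \<in> G" "z = v \<sigma>"
        using EN_name[OF c] r(3) \<open>EN z y\<close> by blast
      have "\<sigma> \<epsilon> ?t" unfolding t using r s G_P by blast
      then show ?thesis using b s(3) by blast
    qed
    then show ?thesis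
      using sep[of b "\<lambda>_. x" "\<^bold>\<exists>(0 \<^bold>\<in> 2 \<^bold>\<and> 1 \<^bold>\<in> 0)"] by (simp add: numeral_2_eq_2) blast
  qed
  show "\<exists>u. \<forall>z. EN z u \<longleftrightarrow> (\<forall>w. EN w z \<longrightarrow> EN w x)" for x
  proof -
    obtain x' where x: "C x'" "v x' = x" using v_surj by blast
    let ?t = "sep (pw (prod (dom x') P)) C"
    have "C z" if "z \<epsilon> ?t" for z using that by (simp add: mem_sep[OF D1_C])
    from N_bound[OF this] obtain b where b: "\<And>z. z \<epsilon> ?t \<Longrightarrow> EN (v z) b" by blast
    have "EN z b" if "\<forall>w. EN w z \<longrightarrow> EN w x" for z
    proof -
      obtain z' where z: "C z'" "v z' = z" using v_surj by blast
      \<comment> \<open>Every subset of \<open>x\<close> is the value of a name of this form, and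
        all names of this form lie in the set \<open>?t\<close>.\<close>
      let ?s = "sepn C x' (case_nat x' (\<lambda>_. z')) (0 \<^bold>\<in> 1 \<^bold>\<and> lift 1 (0 \<^bold>\<in> 1))"
      note s = N_sepn[OF x(1) z(1), where \<phi>="0 \<^bold>\<in> 1"]
      have "v ?s = z" by (rule N_ext) (use s(2) that x z in auto)
      moreover have "sub ?s (prod (dom x') P)"
        using sepn_elem mem_sepn by (auto simp: sub_def) (metis mem_dom mem_sepn pair_mem_prod)
      ultimately show ?thesis using b[of ?s] s(1) by (simp add: mem_sep[OF D1_C])
    qed
    then show ?thesis
      using sep[of b "\<lambda>_. x" "\<^bold>\<forall>(0 \<^bold>\<in> 1 \<^bold>\<longrightarrow> 0 \<^bold>\<in> 2)"] by (simp add: numeral_2_eq_2) blast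
  qed
  show "\<exists>i. (\<exists>x. EN x i \<and> (\<forall>z. \<not> EN z x))
        \<and> (\<forall>x. EN x i \<longrightarrow> (\<exists>y. EN y i \<and> (\<forall>z. EN z y \<longleftrightarrow> EN z x \<or> z = x)))"
  proof (rule exI[of _ "v (chk om)"], intro conjI allI impI)
    show "\<exists>x. EN x (v (chk om)) \<and> (\<forall>z. \<not> EN z x)"
      using natural_emp by (rule_tac exI[of _ "v (chk emp)"]) (auto simp: v_chk_mem)
    fix x assume "EN x (v (chk om))"
    then obtain n where "natural n" "x = v (chk n)" by (auto simp: v_chk_mem)
    then show "\<exists>y. EN y (v (chk om)) \<and> (\<forall>z. EN z y \<longleftrightarrow> EN z x \<or> z = x)"
      using natural_suc by (rule_tac exI[of _ "v (chk (suc n))"]) (auto simp: v_chk_mem)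
  qed
  show "\<exists>b. \<forall>x. EN x a \<longrightarrow> (\<exists>y. EN y b \<and> sat EN (case_nat y (case_nat x e)) \<phi>)"
    if f: "\<And>x. EN x a \<Longrightarrow> \<exists>!y. sat EN (case_nat y (case_nat x e)) \<phi>" for a e \<phi>
  proof -
    obtain a' where a: "C a'" "v a' = a" using v_surj by blast
    obtain e' where e: "\<And>n. C (e' n)" "e = (\<lambda>n. v (e' n))" using ex_names by metis
    \<comment> \<open>Values are collected in the ground model for all pairs of an element name and
      a condition, since it depends on \<open>G\<close> which condition will be relevant.\<close>
    let ?R = "\<lambda>z y. C y \<and> frc C (sndp z) (case_nat y (case_nat (fstp z) e')) \<phi>"
    have "D2 ?R" unfolding D2_def by (intro dfi D3I[OF frc_D(3)])
    from collection[OF this, of "prod (dom a') P"] obtain t where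
      t: "\<And>z. z \<epsilon> prod (dom a') P \<Longrightarrow> \<exists>y. ?R z y \<Longrightarrow> \<exists>y. y \<epsilon> t \<and> ?R z y" by blast
    have "\<exists>b. \<forall>z. z \<epsilon> sep t C \<longrightarrow> EN (v z) b"
      by (rule N_bound) (simp add: mem_sep[OF D1_C])
    then obtain b where b: "\<And>z. z \<epsilon> t \<Longrightarrow> C z \<Longrightarrow> EN (v z) b"
      unfolding mem_sep[OF D1_C] by blast
    have "\<exists>y. EN y b \<and> sat EN (case_nat y (case_nat x e)) \<phi>" if x: "EN x a" for x
    proof -
      obtain \<rho> r where r: "pair \<rho> r \<epsilon> a'" "r \<in> G" "x = v \<rho>" using x EN_name[OF a(1)] a(2) by blast
      then have c: "C \<rho>" using C_elem a G_P by blast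
      have tr: "sat EN (case_nat (v y) (case_nat x e)) \<phi> \<longleftrightarrow>
          (\<exists>p. p \<in> G \<and> frc C p (case_nat y (case_nat \<rho> e')) \<phi>)" if "C y" for y
        using truth[of "case_nat y (case_nat \<rho> e')", OF C_case[OF that C_case[OF c e(1)]]]
        by (simp add: v_case r(3) e(2))
      obtain y where "C y" "sat EN (case_nat (v y) (case_nat x e)) \<phi>" using f[OF x] v_surj by metis
      then obtain p where p: "p \<in> G" "frc C p (case_nat y (case_nat \<rho> e')) \<phi>" using tr by blast
      have "pair \<rho> p \<epsilon> prod (dom a') P" using r p G_P by auto
      moreover have "?R (pair \<rho> p) y" using p \<open>C y\<close> by simp
      ultimately obtain y' where "y' \<epsilon> t" "?R (pair \<rho> p) y'" using t by blast
      then have "y' \<epsilon> t" "C y'" "frc C p (case_nat y' (case_nat \<rho> e')) \<phi>" by simp_all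
      then show ?thesis using b tr p(1) by blast
    qed
    then show ?thesis by blast
  qed
qed

end

section \<open>The symmetric system\<close>

context zfc
begin

text \<open>A condition gives, for every \<open>n\<close>, fewer than \<open>K n\<close> entries of a generic function from \<open>lm\<close> to
  \<open>Vs (K n)\<close>. This function collapses \<open>Vs (K n)\<close>, and with it everything below \<open>K (n + 1)\<close>, to \<open>K n\<close>;
  its set of arguments is as large as \<open>lm\<close> for the sake of the ultrafilters on \<open>lm\<close>.\<close>

definition slc where "slc n p = col (\<lambda>x. \<exists>y. pair (pair n x) y \<epsilon> p)"

definition cnd where
  "cnd p \<longleftrightarrow> func p
    \<and> (\<forall>z. z \<epsilon> p \<longrightarrow> (\<exists>n x y. z = pair (pair n x) y \<and> natural n \<and> x \<epsilon> lm \<and> y \<epsilon> Vs (K n)))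
    \<and> (\<forall>n. natural n \<longrightarrow> sm (K n) (slc n p))"

definition conds where "conds = sep (pw (prod (prod om lm) (Vs lm))) cnd"

lemma F2_slc: "F2 slc" unfolding F2_def slc_def by (intro dfi)
lemmas [dfi] = F2I[OF F2_slc]

lemma D1_cnd: "D1 cnd" unfolding D1_def cnd_def by (intro dfi)
lemmas [dfi] = D1I[OF D1_cnd]

lemma mem_slc [simp]: "x \<epsilon> slc n p \<longleftrightarrow> (\<exists>y. pair (pair n x) y \<epsilon> p)"
proof -
  have "D1 (\<lambda>x. \<exists>y. pair (pair n x) y \<epsilon> p)" unfolding D1_def by (intro dfi)
  moreover have "z \<epsilon> uni (uni (dom p))" if "\<exists>y. pair (pair n z) y \<epsilon> p" for z
    using that pair_mem_uni_uni[of n z "dom p"] by (auto simp del: mem_uni)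
  ultimately show ?thesis unfolding slc_def by (intro mem_col_isset isset_sub)
qed

lemma Vs_mono: "Ord a \<Longrightarrow> Ord b \<Longrightarrow> sub a b \<Longrightarrow> sub (Vs a) (Vs b)"
  unfolding sub_def by (simp add: mem_Vs_iff)

lemma cnd_elem:
  assumes "cnd p" "pair u y \<epsilon> p"
  obtains n x where "u = pair n x" "natural n" "x \<epsilon> lm" "y \<epsilon> Vs (K n)"
  using assms unfolding cnd_def by (metis pair_eq)

lemma cnd_elem': "cnd p \<Longrightarrow> z \<epsilon> p \<Longrightarrow> \<exists>n x y. z = pair (pair n x) y \<and> natural n \<and> x \<epsilon> lm \<and> y \<epsilon> Vs (K n)"
  unfolding cnd_def by blast

lemma cnd_func: "cnd p \<Longrightarrow> func p" by (simp add: cnd_def)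

lemma cnd_slc: "cnd p \<Longrightarrow> natural n \<Longrightarrow> sm (K n) (slc n p)" by (simp add: cnd_def)

lemma mem_conds [simp]: "p \<epsilon> conds \<longleftrightarrow> cnd p"
proof -
  have "sub p (prod (prod om lm) (Vs lm))" if "cnd p"
    unfolding sub_def
  proof (intro allI impI)
    fix z assume "z \<epsilon> p"
    then obtain n x y where "z = pair (pair n x) y" "natural n" "x \<epsilon> lm" "y \<epsilon> Vs (K n)"
      using cnd_elem' \<open>cnd p\<close> by blast
    moreover then have "y \<epsilon> Vs lm"
      using Vs_mono[OF Ord_K Ord_lm K_sub_lm] by (auto simp: sub_def)
    ultimately show "z \<epsilon> prod (prod om lm) (Vs lm)" by simp
  qed
  then show ?thesis by (auto simp: conds_def mem_sep[OF D1_cnd])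
qed

lemma cnd_sub: "cnd p \<Longrightarrow> sub q p \<Longrightarrow> cnd q"
proof -
  assume p: "cnd p" "sub q p"
  have "sub (slc n q) (slc n p)" for n using p(2) by (auto simp: sub_def)
  then show "cnd q" using p func_sub[of p q] sm_sub unfolding cnd_def by (metis subD)
qed

lemma cnd_emp: "cnd emp"
proof -
  have "sm (K n) (slc n emp)" if "natural n" for n
  proof -
    have "sub (slc n emp) emp" by (simp add: sub_def)
    then show ?thesis using sm_sub sm_mem regD(2)[OF reg_K[OF that] natural_emp] by blast
  qed
  then show ?thesis by (simp add: cnd_def func_def)
qed

subsection \<open>The group\<close>

text \<open>A set \<open>h\<close> of positions acts on a condition by toggling membership of \<open>emp\<close> in the entries at the
  positions in \<open>h\<close>.\<close>

definition tg where "tg y = col (\<lambda>z. (z \<epsilon> y) \<noteq> (z = emp))"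
definition hact where
  "hact h p = rep p (\<lambda>z. pair (fstp z) (if fstp z \<epsilon> h then tg (sndp z) else sndp z))"
definition Grp where "Grp = pw (prod om lm)"
text \<open>Symmetric difference is the operation of the group, which is therefore commutative and
  consists of involutions.\<close>

definition sd where "sd g h = col (\<lambda>z. (z \<epsilon> g) \<noteq> (z \<epsilon> h))"

lemma F_tg: "F1 tg" "F2 sd"
  unfolding F1_def F2_def tg_def sd_def by (intro dfi)+
lemmas [dfi] = F1I[OF F_tg(1)] F2I[OF F_tg(2)]
lemma F2_hact: "F2 hact" unfolding F2_def hact_def by (intro dfi)
lemmas [dfi] = F2I[OF F2_hact]

lemma mem_tg: "z \<epsilon> tg y \<longleftrightarrow> (z \<epsilon> y) \<noteq> (z = emp)"
proof -
  have "D1 (\<lambda>z. (z \<epsilon> y) \<noteq> (z = emp))" unfolding D1_def by (intro dfi)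
  then show ?thesis unfolding tg_def
    by (intro mem_col_isset isset_sub[of _ "cup y (upr emp emp)"]) auto
qed

lemma mem_sd: "z \<epsilon> sd g h \<longleftrightarrow> (z \<epsilon> g) \<noteq> (z \<epsilon> h)"
proof -
  have "D1 (\<lambda>z. (z \<epsilon> g) \<noteq> (z \<epsilon> h))" unfolding D1_def by (intro dfi)
  then show ?thesis unfolding sd_def
    by (intro mem_col_isset isset_sub[of _ "cup g h"]) auto
qed

lemma tg_tg [simp]: "tg (tg y) = y"
  by (rule ext) (auto simp: mem_tg)

lemma tg_Vs:
  assumes "Ord k" "\<And>a. a \<epsilon> k \<Longrightarrow> suc a \<epsilon> k" "y \<epsilon> Vs k" shows "tg y \<epsilon> Vs k"
proof -
  obtain b where b: "b \<epsilon> k" "sub y (Vs b)" using assms(3) mem_Vs by blast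
  then have ob: "Ord b" using Ord_in assms(1) by blast
  have e: "emp \<epsilon> suc b" using Ord_sub_iff[of emp b] ob by (auto simp: sub_def)
  have "sub (tg y) (Vs (suc b))"
    unfolding sub_def mem_tg
  proof (intro allI impI)
    fix z assume "(z \<epsilon> y) \<noteq> (z = emp)"
    then consider "z \<epsilon> y" | "z = emp" by blast
    then show "z \<epsilon> Vs (suc b)"
    proof cases
      case 1
      then show ?thesis using b(2) mem_Vs_iff[OF ob] mem_Vs_iff[of "suc b"] ob by (auto simp: sub_def)
    next
      case 2
      then show ?thesis using e mem_Vs_iff[of "suc b"] ob rk_Ord[OF Ord_emp] by simp
    qed
  qed
  then show ?thesis using mem_Vs assms(2)[OF b(1)] by blast
qed

lemma pair_mem_hact:
  assumes "cnd p"
  shows "pair u y \<epsilon> hact h p \<longleftrightarrow> (\<exists>y'. pair u y' \<epsilon> p \<and> y = (if u \<epsilon> h then tg y' else y'))"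
proof -
  have F: "F1 (\<lambda>z. pair (fstp z) (if fstp z \<epsilon> h then tg (sndp z) else sndp z))"
    unfolding F1_def by (intro dfi)
  show ?thesis unfolding hact_def mem_rep[OF F]
  proof
    assume "\<exists>x. x \<epsilon> p \<and> pair u y = pair (fstp x) (if fstp x \<epsilon> h then tg (sndp x) else sndp x)"
    then obtain x where x: "x \<epsilon> p" "u = fstp x" "y = (if fstp x \<epsilon> h then tg (sndp x) else sndp x)"
      by auto
    moreover obtain a b where "x = pair a b" using cnd_elem'[OF assms x(1)] by blast
    ultimately show "\<exists>y'. pair u y' \<epsilon> p \<and> y = (if u \<epsilon> h then tg y' else y')" by auto
  next
    assume "\<exists>y'. pair u y' \<epsilon> p \<and> y = (if u \<epsilon> h then tg y' else y')"
    then obtain y' where "pair u y' \<epsilon> p" "y = (if u \<epsilon> h then tg y' else y')" by blast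
    then show "\<exists>x. x \<epsilon> p \<and> pair u y = pair (fstp x) (if fstp x \<epsilon> h then tg (sndp x) else sndp x)"
      by (intro exI[of _ "pair u y'"]) simp
  qed
qed

lemma hact_elem: "z \<epsilon> hact h p \<Longrightarrow> \<exists>u y. z = pair u y"
proof -
  have F: "F1 (\<lambda>z. pair (fstp z) (if fstp z \<epsilon> h then tg (sndp z) else sndp z))"
    unfolding F1_def by (intro dfi)
  show "z \<epsilon> hact h p \<Longrightarrow> \<exists>u y. z = pair u y" unfolding hact_def mem_rep[OF F] by blast
qed

lemma rel_ext:
  assumes "\<And>z. z \<epsilon> p \<Longrightarrow> \<exists>u y. z = pair u y" "\<And>z. z \<epsilon> q \<Longrightarrow> \<exists>u y. z = pair u y"
    "\<And>u y. pair u y \<epsilon> p \<longleftrightarrow> pair u y \<epsilon> q"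
  shows "p = q"
  by (rule ext) (metis assms)

lemma cnd_hact:
  assumes p: "cnd p" shows "cnd (hact h p)"
  unfolding cnd_def
proof (intro conjI allI impI)
  show "func (hact h p)"
    unfolding func_def pair_mem_hact[OF p] using funcD[OF cnd_func[OF p]] by metis
  fix n assume n: "natural n"
  have "slc n (hact h p) = slc n p"
    by (rule ext) (auto simp: pair_mem_hact[OF p])
  then show "sm (K n) (slc n (hact h p))" using cnd_slc[OF p n] by simp
next
  fix z assume z: "z \<epsilon> hact h p"
  then obtain u y where uy: "z = pair u y" using hact_elem by blast
  then obtain y' where y': "pair u y' \<epsilon> p" "y = (if u \<epsilon> h then tg y' else y')"
    using z pair_mem_hact[OF p] by blast
  then obtain n x where n: "u = pair n x" "natural n" "x \<epsilon> lm" "y' \<epsilon> Vs (K n)"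
    using cnd_elem[OF p] by metis
  have "tg y' \<epsilon> Vs (K n)" using tg_Vs[OF Ord_K[OF n(2)] regD(3)[OF reg_K[OF n(2)]] n(4)] by blast
  then show "\<exists>n x y. z = pair (pair n x) y \<and> natural n \<and> x \<epsilon> lm \<and> y \<epsilon> Vs (K n)"
    using uy y' n by auto
qed

lemma hact_hact: "cnd p \<Longrightarrow> hact g (hact h p) = hact (sd g h) p"
  by (rule rel_ext) (auto simp: pair_mem_hact cnd_hact mem_sd dest: hact_elem)

lemma hact_id: "cnd p \<Longrightarrow> (\<And>u y. pair u y \<epsilon> p \<Longrightarrow> \<not> u \<epsilon> h) \<Longrightarrow> hact h p = p"
  by (rule rel_ext) (auto simp: pair_mem_hact dest: hact_elem cnd_elem')

lemma sd_self [simp]: "sd h h = emp" "sd emp h = h"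
  by (rule ext, simp add: mem_sd)+

lemma sd_comm: "sd g h = sd h g"
  by (rule ext) (auto simp: mem_sd)

lemma hact_inv [simp]: "cnd p \<Longrightarrow> hact h (hact h p) = p"
  by (simp add: hact_hact hact_id)

lemma hact_mono: "cnd q \<Longrightarrow> sub p q \<Longrightarrow> sub (hact h p) (hact h q)"
proof -
  assume A: "cnd q" "sub p q"
  then have p: "cnd p" using cnd_sub by blast
  show "sub (hact h p) (hact h q)" unfolding sub_def
  proof (intro allI impI)
    fix z assume "z \<epsilon> hact h p"
    moreover then obtain u y where "z = pair u y" using hact_elem by blast
    ultimately show "z \<epsilon> hact h q" using A(2) pair_mem_hact[OF p] pair_mem_hact[OF A(1)] by (metis subD)
  qed
qed

lemma hact_emp [simp]: "hact h emp = emp"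
  using hact_id[OF cnd_emp] by simp

subsection \<open>The action on names\<close>

text \<open>Elements that are not pairs of a name and a condition are dropped, which gives the
  action a uniform meaning on all sets.\<close>

definition act where
  "act h = wrec dom (\<lambda>x g. rep (sep x (\<lambda>z. \<exists>\<rho> r. z = pair \<rho> r \<and> cnd r))
    (\<lambda>z. pair (ap g (fstp z)) (hact h (sndp z))))"

text \<open>\<open>F1_wrec\<close> yields definability for a fixed \<open>h\<close> only; here it is
  needed jointly in \<open>h\<close>, so the recursion is unfolded.\<close>

lemma F2_act: "F2 act"
  unfolding F2_def act_def wrec_def rec_approx_def by (intro dfi)
lemmas [dfi] = F2I[OF F2_act]

lemma F1_act: "F1 (act h)" unfolding F1_def by (intro dfi)

lemma rk_dom: "y \<epsilon> dom x \<Longrightarrow> rk y \<epsilon> rk x"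
proof -
  assume "y \<epsilon> dom x"
  then obtain z where z: "pair y z \<epsilon> x" by auto
  have "rk y \<epsilon> rk (upr y y)" "rk (upr y y) \<epsilon> rk (pair y z)"
    unfolding pair_def by (simp_all add: rk_mem)
  then show ?thesis using rk_mem[OF z] Ord_trans[OF Ord_rk] by blast
qed

lemma rk_pair_mem: "pair y z \<epsilon> x \<Longrightarrow> rk y \<epsilon> rk x"
  using rk_dom by auto

lemma mem_act: "z \<epsilon> act h x \<longleftrightarrow> (\<exists>\<rho> r. pair \<rho> r \<epsilon> x \<and> cnd r \<and> z = pair (act h \<rho>) (hact h r))"
proof -
  let ?P = "\<lambda>z. \<exists>\<rho> r. z = pair \<rho> r \<and> cnd r"
  have F: "F2 (\<lambda>x g. rep (sep x ?P) (\<lambda>z. pair (ap g (fstp z)) (hact h (sndp z))))"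
    and D: "D1 ?P" and R: "F1 (\<lambda>z. pair (ap g (fstp z)) (hact h (sndp z)))" for g
    unfolding F1_def F2_def D1_def by (intro dfi)+
  have eq: "act h x = rep (sep x ?P) (\<lambda>z. pair (ap (lam (dom x) (act h)) (fstp z)) (hact h (sndp z)))"
    unfolding act_def by (rule wrec_rk_eq[OF F_basic2(4) F rk_dom])
  have *: "z \<epsilon> act h x \<longleftrightarrow> (\<exists>w. w \<epsilon> x \<and> ?P w
      \<and> z = pair (ap (lam (dom x) (act h)) (fstp w)) (hact h (sndp w)))"
    by (simp only: eq mem_rep[OF R] mem_sep[OF D] conj_assoc)
  have a: "ap (lam (dom x) (act h)) \<rho> = act h \<rho>" if "pair \<rho> r \<epsilon> x" for \<rho> r
    by (rule ap_lam[OF F1_act]) (use that in auto)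
  show ?thesis
  proof
    assume "z \<epsilon> act h x"
    then obtain \<rho> r where "pair \<rho> r \<epsilon> x" "cnd r"
      "z = pair (ap (lam (dom x) (act h)) (fstp (pair \<rho> r))) (hact h (sndp (pair \<rho> r)))"
      unfolding * by blast
    then show "\<exists>\<rho> r. pair \<rho> r \<epsilon> x \<and> cnd r \<and> z = pair (act h \<rho>) (hact h r)" using a by auto
  next
    assume "\<exists>\<rho> r. pair \<rho> r \<epsilon> x \<and> cnd r \<and> z = pair (act h \<rho>) (hact h r)"
    then obtain \<rho> r where r: "pair \<rho> r \<epsilon> x" "cnd r" "z = pair (act h \<rho>) (hact h r)" by blast
    then show "z \<epsilon> act h x" unfolding * using a by (intro exI[of _ "pair \<rho> r"]) auto
  qed
qed

lemma act_act: "act g (act h x) = act (sd g h) x"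
proof (rule rk_induct[of "\<lambda>x. act g (act h x) = act (sd g h) x"])
  show "D1 (\<lambda>x. act g (act h x) = act (sd g h) x)" unfolding D1_def by (intro dfi)
  fix x assume IH: "\<And>y. rk y \<epsilon> rk x \<Longrightarrow> act g (act h y) = act (sd g h) y"
  show "act g (act h x) = act (sd g h) x"
  proof (rule ext)
    fix z
    have "z \<epsilon> act g (act h x) \<longleftrightarrow>
        (\<exists>\<rho> r. pair \<rho> r \<epsilon> x \<and> cnd r \<and> z = pair (act g (act h \<rho>)) (hact g (hact h r)))"
      unfolding mem_act[of z] mem_act[of _ h x] using cnd_hact by (metis pair_eq)
    also have "\<dots> \<longleftrightarrow> z \<epsilon> act (sd g h) x"
      unfolding mem_act[of z] using IH[OF rk_pair_mem] hact_hact by (metis (no_types))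
    finally show "z \<epsilon> act g (act h x) \<longleftrightarrow> z \<epsilon> act (sd g h) x" .
  qed
qed

subsection \<open>Hereditarily symmetric names\<close>

text \<open>A name is symmetric if it is fixed by all toggles outside of finitely many coordinates.\<close>

definition fixg where
  "fixg k h \<longleftrightarrow> h \<epsilon> Grp \<and> (\<forall>n x. n \<epsilon> k \<longrightarrow> \<not> pair n x \<epsilon> h)"

text \<open>A natural number \<open>k\<close> is the set of the coordinates below it. Such initial
  segments suffice as supports, because every finite set of coordinates lies in one.\<close>

definition supp where "supp k x \<longleftrightarrow> (\<forall>h. fixg k h \<longrightarrow> act h x = x)"

definition symn where
  "symn x \<longleftrightarrow> (\<forall>z. z \<epsilon> x \<longrightarrow> (\<exists>\<rho> r. z = pair \<rho> r \<and> cnd r)) \<and> (\<exists>k. natural k \<and> supp k x)"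

text \<open>A set of symmetric names closed under elements witnesses hereditary symmetry, so that
  definability is immediate.\<close>

definition HS where
  "HS x \<longleftrightarrow> (\<exists>t. x \<epsilon> t \<and> (\<forall>y. y \<epsilon> t \<longrightarrow> symn y \<and> (\<forall>\<rho> r. pair \<rho> r \<epsilon> y \<longrightarrow> \<rho> \<epsilon> t)))"

lemma D1_HS: "D1 HS"
  unfolding D1_def HS_def symn_def supp_def fixg_def by (intro dfi)
lemmas [dfi] = D1I[OF D1_HS]

lemma HS_symn: "HS x \<Longrightarrow> symn x" unfolding HS_def by blast

lemma HS_elem: "HS x \<Longrightarrow> pair \<rho> r \<epsilon> x \<Longrightarrow> HS \<rho>" unfolding HS_def by blast

lemma HS_pair: "HS x \<Longrightarrow> z \<epsilon> x \<Longrightarrow> \<exists>\<rho> r. z = pair \<rho> r \<and> cnd r \<and> HS \<rho>"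
  using HS_symn[of x] HS_elem[of x] unfolding symn_def by blast

lemma HSI:
  assumes "symn x" "\<And>\<rho> r. pair \<rho> r \<epsilon> x \<Longrightarrow> HS \<rho>" shows "HS x"
proof -
  have D: "D1 (\<lambda>y. HS y \<or> y = x)" unfolding D1_def by (intro dfi)
  let ?t = "sep (Vs (suc (rk x))) (\<lambda>y. HS y \<or> y = x)"
  have "x \<epsilon> ?t" by (simp add: mem_sep[OF D] mem_Vs_iff)
  moreover have "symn y \<and> (\<forall>\<rho> r. pair \<rho> r \<epsilon> y \<longrightarrow> \<rho> \<epsilon> ?t)" if "y \<epsilon> ?t" for y
  proof -
    have y: "HS y \<or> y = x" "rk y \<epsilon> suc (rk x)" using that by (auto simp: mem_sep[OF D] mem_Vs_iff)
    have "\<rho> \<epsilon> ?t" if r: "pair \<rho> r \<epsilon> y" for \<rho> r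
      using rk_pair_mem[OF r] y Ord_trans[of "suc (rk x)" "rk y" "rk \<rho>"] HS_elem assms(2) r
      by (auto simp: mem_sep[OF D] mem_Vs_iff simp del: mem_suc)
    then show ?thesis using y(1) assms(1) HS_symn by blast
  qed
  ultimately show ?thesis unfolding HS_def by blast
qed

lemma fixg_mono: "sub k k' \<Longrightarrow> fixg k' h \<Longrightarrow> fixg k h"
  unfolding fixg_def sub_def by blast

lemma supp_mono: "supp k x \<Longrightarrow> sub k k' \<Longrightarrow> supp k' x"
  unfolding supp_def using fixg_mono by blast

lemma fixg_emp: "fixg k emp" by (simp add: fixg_def Grp_def sub_def)

lemma Grp_sd: "g \<epsilon> Grp \<Longrightarrow> h \<epsilon> Grp \<Longrightarrow> sd g h \<epsilon> Grp"
  by (auto simp: Grp_def sub_def mem_sd)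

lemma act_emp: "HS x \<Longrightarrow> act emp x = x"
  using HS_symn[of x] fixg_emp unfolding symn_def supp_def by blast

lemma act_inv [simp]: "HS x \<Longrightarrow> act h (act h x) = x"
  by (simp add: act_act act_emp)

text \<open>Conjugation is trivial in a commutative group. This takes the place of normality of the
  filter of subgroups.\<close>

lemma supp_act: "supp k x \<Longrightarrow> supp k (act h x)"
  unfolding supp_def by (metis act_act sd_comm)

lemma HS_act: "HS x \<Longrightarrow> HS (act h x)"
proof -
  have D: "D1 (\<lambda>x. HS x \<longrightarrow> HS (act h x))" unfolding D1_def by (intro dfi)
  have "HS x \<longrightarrow> HS (act h x)"
  proof (rule rk_induct[OF D], intro impI)
    fix x assume IH: "\<And>y. rk y \<epsilon> rk x \<Longrightarrow> HS y \<longrightarrow> HS (act h y)" and x: "HS x"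
    obtain k where "natural k" "supp k x" using HS_symn[OF x] unfolding symn_def by blast
    then have "symn (act h x)"
      unfolding symn_def using supp_act mem_act cnd_hact by metis
    then show "HS (act h x)"
    proof (rule HSI)
      fix \<rho> r assume "pair \<rho> r \<epsilon> act h x"
      then obtain \<sigma> s where "pair \<sigma> s \<epsilon> x" "\<rho> = act h \<sigma>" unfolding mem_act by auto
      then show "HS \<rho>" using IH[OF rk_pair_mem] HS_elem[OF x] by blast
    qed
  qed
  then show "HS x \<Longrightarrow> HS (act h x)" by blast
qed

text \<open>For hereditarily symmetric names one inclusion suffices, because the action is involutive.\<close>

lemma supp_closedI:
  assumes x: "\<And>z. z \<epsilon> x \<Longrightarrow> \<exists>\<rho> r. z = pair \<rho> r \<and> cnd r \<and> HS \<rho>"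
    and h: "\<And>h \<rho> r. fixg k h \<Longrightarrow> pair \<rho> r \<epsilon> x \<Longrightarrow> pair (act h \<rho>) (hact h r) \<epsilon> x"
  shows "supp k x"
  unfolding supp_def
proof (intro allI impI, rule ext)
  fix g z assume g: "fixg k g"
  show "z \<epsilon> act g x \<longleftrightarrow> z \<epsilon> x"
  proof
    assume "z \<epsilon> act g x"
    then show "z \<epsilon> x" unfolding mem_act using h[OF g] by blast
  next
    assume z: "z \<epsilon> x"
    then obtain \<rho> r where r: "z = pair \<rho> r" "cnd r" "HS \<rho>" using x by blast
    then have "pair (act g \<rho>) (hact g r) \<epsilon> x" using h[OF g] z by blast
    then show "z \<epsilon> act g x" unfolding mem_act
      using r cnd_hact by (intro exI[of _ "act g \<rho>"] exI[of _ "hact g r"]) simp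
  qed
qed

end

section \<open>The symmetry lemma and closure properties of symmetric names\<close>

sublocale zfc \<subseteq> forcing E conds
  by unfold_locales (simp add: cnd_emp)

context zfc
begin

lemma half_act:
  assumes "half feq p x y" "cnd p"
  shows "half (\<lambda>q a b. \<exists>p x y. q = hact h p \<and> a = act h x \<and> b = act h y \<and> feq p x y)
    (hact h p) (act h x) (act h y)"
  unfolding half_def
proof (intro allI impI, elim conjE)
  fix \<rho>' r' q assume *: "pair \<rho>' r' \<epsilon> act h x" "r' \<epsilon> conds" "q \<epsilon> conds" "sub (hact h p) q" "sub r' q"
  then obtain \<rho> r where r: "pair \<rho> r \<epsilon> x" "cnd r" "\<rho>' = act h \<rho>" "r' = hact h r" unfolding mem_act by auto
  have q: "cnd q" "cnd (hact h q)" using *(3) cnd_hact by auto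
  have "sub p (hact h q)" "sub r (hact h q)"
    using hact_mono[OF q(1) *(4), of h] hact_mono[OF q(1) *(5), of h] r assms(2) by simp_all
  then obtain s \<sigma> t where s: "cnd s" "sub (hact h q) s" "pair \<sigma> t \<epsilon> y" "cnd t" "sub t s" "feq s \<rho> \<sigma>"
    using halfD[OF assms(1) r(1), of "hact h q"] r(2) q(2) by auto
  have "cnd (hact h s)" "sub q (hact h s)" "pair (act h \<sigma>) (hact h t) \<epsilon> act h y" "cnd (hact h t)"
    "sub (hact h t) (hact h s)"
    using s hact_mono[OF s(1,2), of h] hact_mono[OF s(1) s(5)] q(1) cnd_hact mem_act by auto
  then show "\<exists>s \<sigma> t. s \<epsilon> conds \<and> sub q s \<and> pair \<sigma> t \<epsilon> act h y \<and> t \<epsilon> conds \<and> sub t s \<and>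
      (\<exists>p x y. s = hact h p \<and> \<rho>' = act h x \<and> \<sigma> = act h y \<and> feq p x y)"
    using r(3) s(6) mem_conds by blast
qed

text \<open>The image of forced equality under \<open>h\<close> is again a bisimulation.\<close>

lemma feq_act:
  assumes "feq p x y" shows "feq (hact h p) (act h x) (act h y)"
proof -
  let ?Q = "\<lambda>q a b. \<exists>p x y. q = hact h p \<and> a = act h x \<and> b = act h y \<and> feq p x y"
  have "D3 ?Q" unfolding D3_def by (intro dfi)
  moreover have "bisim ?Q" unfolding bisim_def
  proof (intro allI impI, elim exE conjE)
    fix q a b p x y assume q: "q = hact h p" "a = act h x" "b = act h y" "feq p x y"
    then have p: "cnd p" "half feq p x y" "half feq p y x" using feq_iff[of p x y] by auto
    have "half ?Q q a b" unfolding q(1-3) by (rule half_act[OF p(2,1)])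
    moreover have "half (\<lambda>s a b. ?Q s b a) q b a" unfolding q(1-3)
      by (rule half_mono[OF half_act[OF p(3,1)]]) (use feq_sym in blast)
    ultimately show "q \<epsilon> conds \<and> half ?Q q a b \<and> half (\<lambda>s a b. ?Q s b a) q b a"
      using q(1) p(1) cnd_hact by simp
  qed
  ultimately show ?thesis using feq_coinduct[of ?Q "hact h p" "act h x" "act h y"] assms by blast
qed

lemma fmem_act:
  assumes "fmem p x y" "cnd p" shows "fmem (hact h p) (act h x) (act h y)"
  unfolding fmem_def
proof (intro allI impI, elim conjE)
  fix q assume q: "q \<epsilon> conds" "sub (hact h p) q"
  then have q': "cnd q" "cnd (hact h q)" using cnd_hact by auto
  have "sub p (hact h q)" using hact_mono[OF q'(1) q(2), of h] assms(2) by simp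
  then obtain s \<sigma> t where s: "cnd s" "sub (hact h q) s" "pair \<sigma> t \<epsilon> y" "cnd t" "sub t s" "feq s x \<sigma>"
    using fmemD[OF assms(1), of "hact h q"] q'(2) by auto
  have "cnd (hact h s)" "sub q (hact h s)" "pair (act h \<sigma>) (hact h t) \<epsilon> act h y" "cnd (hact h t)"
    "sub (hact h t) (hact h s)" "feq (hact h s) (act h x) (act h \<sigma>)"
    using s hact_mono[OF s(1,2), of h] hact_mono[OF s(1) s(5)] q'(1) cnd_hact mem_act feq_act by auto
  then show "\<exists>s \<sigma> t. s \<epsilon> conds \<and> sub q s \<and> pair \<sigma> t \<epsilon> act h y \<and> t \<epsilon> conds \<and> sub t s \<and> feq s (act h x) \<sigma>"
    using mem_conds by blast
qed

text \<open>The symmetry lemma. One direction suffices, as \<open>h\<close> is an involution on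
  conditions and symmetric names; at implications and quantifiers this is also what carries the
  induction.\<close>

lemma frc_act:
  "cnd p \<Longrightarrow> (\<And>n. HS (e n)) \<Longrightarrow> frc HS p e \<phi> \<Longrightarrow> frc HS (hact h p) (\<lambda>n. act h (e n)) \<phi>"
proof (induction \<phi> arbitrary: p e)
  case (Mem x y)
  then show ?case by (simp add: fmem_act)
next
  case (Eq x y)
  then show ?case by (simp add: feq_act)
next
  case Fls
  then show ?case by simp
next
  case (Imp a b)
  show ?case unfolding frc.simps
  proof (intro allI impI, elim conjE)
    fix q assume q: "q \<epsilon> conds" "sub (hact h p) q" "frc HS q (\<lambda>n. act h (e n)) a"
    then have q': "cnd q" "cnd (hact h q)" using cnd_hact by auto
    have "frc HS (hact h q) (\<lambda>n. act h (act h (e n))) a"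
      by (rule Imp.IH(1)) (use q q' HS_act Imp.prems in auto)
    then have "frc HS (hact h q) e a" using Imp.prems(2) by simp
    moreover have "sub p (hact h q)" using hact_mono[OF q'(1) q(2), of h] Imp.prems(1) by simp
    ultimately have "frc HS (hact h q) e b" using Imp.prems(3) q'(2) by simp
    from Imp.IH(2)[OF q'(2) Imp.prems(2) this] show "frc HS q (\<lambda>n. act h (e n)) b"
      using q'(1) by simp
  qed
next
  case (Forall a)
  show ?case unfolding frc.simps
  proof (intro allI impI)
    fix x assume x: "HS x"
    have "frc HS (hact h p) (\<lambda>n. act h (case_nat (act h x) e n)) a"
      by (rule Forall.IH) (use Forall.prems HS_act[OF x] in \<open>auto split: nat.splits\<close>)
    moreover have "(\<lambda>n. act h (case_nat (act h x) e n)) = case_nat x (\<lambda>n. act h (e n))"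
      using x by (auto simp: fun_eq_iff split: nat.splits)
    ultimately show "frc HS (hact h p) (case_nat x (\<lambda>n. act h (e n))) a" by simp
  qed
qed

lemma frc_arity: "(\<And>n. n < arity \<phi> \<Longrightarrow> e n = e' n) \<Longrightarrow> frc C p e \<phi> = frc C p e' \<phi>"
proof (induction \<phi> arbitrary: e e' p)
  case (Imp a b)
  have "frc C q e a = frc C q e' a" "frc C q e b = frc C q e' b" for q
    using Imp.prems by (auto intro!: Imp.IH)
  then show ?case by simp
next
  case (Forall a)
  have "frc C p (case_nat x e) a = frc C p (case_nat x e') a" for x
    by (rule Forall.IH) (use Forall.prems in \<open>auto split: nat.splits\<close>)
  then show ?case by simp
qed auto

lemma HS_support: "HS x \<Longrightarrow> \<exists>k. natural k \<and> supp k x"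
  using HS_symn unfolding symn_def by blast

lemma common_support:
  "(\<And>n. HS (e n)) \<Longrightarrow> \<exists>k. natural k \<and> (\<forall>n<N::nat. supp k (e n))"
proof (induction N)
  case 0
  then show ?case using natural_emp by auto
next
  case (Suc N)
  then obtain k where k: "natural k" "\<And>n. n < N \<Longrightarrow> supp k (e n)" by blast
  obtain l where l: "natural l" "supp l (e N)" using HS_support Suc.prems by blast
  have "natural (cup k l)" using cup_Ord[of k l] k l natural_Ord by metis
  moreover have "sub k (cup k l)" "sub l (cup k l)" by (auto simp: sub_def)
  ultimately show ?case using k l supp_mono by (metis less_Suc_eq)
qed

lemma act_chk: "act h (chk x) = chk x"
proof (rule eps_induct[of "\<lambda>x. act h (chk x) = chk x"])
  show "D1 (\<lambda>x. act h (chk x) = chk x)" unfolding D1_def by (intro dfi)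
  fix x assume "\<And>y. y \<epsilon> x \<Longrightarrow> act h (chk y) = chk y"
  then show "act h (chk x) = chk x"
    by (intro ext) (auto simp: mem_act mem_chk cnd_emp, metis cnd_emp hact_emp)
qed

lemma HS_chk: "HS (chk x)"
proof (rule eps_induct[of "\<lambda>x. HS (chk x)"])
  show "D1 (\<lambda>x. HS (chk x))" unfolding D1_def by (intro dfi)
  fix x assume IH: "\<And>y. y \<epsilon> x \<Longrightarrow> HS (chk y)"
  have "symn (chk x)" unfolding symn_def supp_def
    using mem_chk cnd_emp act_chk natural_emp by blast
  then show "HS (chk x)"
  proof (rule HSI)
    fix \<rho> r assume "pair \<rho> r \<epsilon> chk x"
    then obtain y where "y \<epsilon> x" "\<rho> = chk y" unfolding mem_chk by auto
    then show "HS \<rho>" using IH by blast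
  qed
qed

text \<open>Singleton names will show that the extension has infinitely many elements, so that it
  can be numbered by \<open>nat\<close>.\<close>

lemma HS_sng: "HS x \<Longrightarrow> HS (upr (pair x emp) (pair x emp))"
proof (rule HSI)
  assume x: "HS x"
  obtain k where k: "natural k" "supp k x" using HS_support[OF x] by blast
  have "supp k (upr (pair x emp) (pair x emp))"
    by (rule supp_closedI) (use x k in \<open>auto simp: cnd_emp supp_def\<close>)
  then show "symn (upr (pair x emp) (pair x emp))" unfolding symn_def using k cnd_emp by auto
qed auto

text \<open>The members of \<open>t\<close> may lack a common support. Taking all their images under
  the group gives a name that the whole group fixes.\<close>

lemma HS_bound:
  assumes t: "\<And>x. x \<epsilon> t \<Longrightarrow> HS x" shows "\<exists>y. HS y \<and> (\<forall>x. x \<epsilon> t \<longrightarrow> pair x emp \<epsilon> y)"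
proof -
  let ?F = "\<lambda>z. pair (act (fstp z) (sndp z)) emp"
  have F: "F1 ?F" unfolding F1_def by (intro dfi)
  let ?y = "rep (prod Grp t) ?F"
  have y: "z \<epsilon> ?y \<longleftrightarrow> (\<exists>h x. h \<epsilon> Grp \<and> x \<epsilon> t \<and> z = pair (act h x) emp)" for z
    unfolding mem_rep[OF F] mem_prod by (metis fstp_pair sndp_pair)
  have "supp emp ?y"
  proof (rule supp_closedI)
    show "\<exists>\<rho> r. z = pair \<rho> r \<and> cnd r \<and> HS \<rho>" if "z \<epsilon> ?y" for z
      using that t HS_act cnd_emp unfolding y by blast
    fix h \<rho> r assume "fixg emp h" "pair \<rho> r \<epsilon> ?y"
    then obtain g x where "h \<epsilon> Grp" "g \<epsilon> Grp" "x \<epsilon> t" "\<rho> = act g x" "r = emp"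
      unfolding y fixg_def by auto
    then show "pair (act h \<rho>) (hact h r) \<epsilon> ?y"
      unfolding y using Grp_sd[of h g] by (intro exI[of _ "sd h g"] exI[of _ x]) (simp add: act_act)
  qed
  then have "symn ?y" unfolding symn_def using y natural_emp cnd_emp by blast
  then have "HS ?y" by (rule HSI) (use t HS_act in \<open>auto simp: y\<close>)
  moreover have "pair x emp \<epsilon> ?y" if "x \<epsilon> t" for x
    unfolding y using act_emp[OF t[OF that]] fixg_emp[of emp] that
    by (intro exI[of _ emp] exI[of _ x]) (auto simp: fixg_def)
  ultimately show ?thesis by blast
qed

text \<open>Only the parameters below \<open>arity \<phi>\<close> matter, and finitely many names
  have a common support. By the symmetry lemma the separated name has the same support.\<close>

lemma HS_sep:
  assumes a: "HS a" and e: "\<And>n. HS (e n)" shows "HS (sepn HS a e \<phi>)"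
proof -
  have "D1 (\<lambda>z. HS (fstp z) \<and> frc HS (sndp z) (case_nat (fstp z) e) \<phi>)"
  proof -
    have "dfb (\<lambda>e'. frc HS (e' 0) (case_nat (e' 1) e) \<phi>)"
      using dfb_subst[OF dfb_frc[OF D1_HS, of \<phi>], of "\<lambda>e' n. case n of 0 \<Rightarrow> e' 0 | Suc n \<Rightarrow> case_nat (e' 1) e n"]
      by (simp add: atom_case)
    then have "D2 (\<lambda>p x. frc HS p (case_nat x e) \<phi>)" by (simp add: D2_def)
    then show ?thesis unfolding D1_def by (intro dfi D2I[of "\<lambda>p x. frc HS p (case_nat x e) \<phi>"])
  qed
  then have m: "z \<epsilon> sepn HS a e \<phi> \<longleftrightarrow> (\<exists>\<rho> p. z = pair \<rho> p \<and> (\<exists>r. pair \<rho> r \<epsilon> a) \<and> cnd p \<and> HS \<rho>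
      \<and> frc HS p (case_nat \<rho> e) \<phi>)" for z
    unfolding sepn_def by (auto simp: mem_sep mem_prod)
  have C: "HS (case_nat a e n)" for n using a e by (auto split: nat.split)
  obtain k where k: "natural k" "\<And>n. n < Suc (arity \<phi>) \<Longrightarrow> supp k (case_nat a e n)"
    using common_support[of "case_nat a e" "Suc (arity \<phi>)", OF C] by blast
  have ka: "supp k a" and ke: "supp k (e n)" if "n < arity \<phi>" for n
    using k(2)[of 0] k(2)[of "Suc n"] that by auto
  have ka: "supp k a" using k(2)[of 0] by simp
  have "supp k (sepn HS a e \<phi>)"
  proof (rule supp_closedI)
    show "\<exists>\<rho> r. z = pair \<rho> r \<and> cnd r \<and> HS \<rho>" if "z \<epsilon> sepn HS a e \<phi>" for z
      using that unfolding m by blast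
    fix h \<rho> p assume h: "fixg k h" and "pair \<rho> p \<epsilon> sepn HS a e \<phi>"
    then obtain r where r: "pair \<rho> r \<epsilon> a" "cnd p" "HS \<rho>" "frc HS p (case_nat \<rho> e) \<phi>"
      unfolding m by auto
    have "cnd r" using HS_pair[OF a r(1)] by auto
    then have "pair (act h \<rho>) (hact h r) \<epsilon> act h a" using mem_act r(1) by blast
    then have "pair (act h \<rho>) (hact h r) \<epsilon> a" using ka h unfolding supp_def by simp
    moreover have "frc HS (hact h p) (case_nat (act h \<rho>) e) \<phi>"
    proof -
      have "frc HS (hact h p) (\<lambda>n. act h (case_nat \<rho> e n)) \<phi>"
        by (rule frc_act) (use r e in \<open>auto split: nat.split\<close>)
      moreover have "act h (case_nat \<rho> e n) = case_nat (act h \<rho>) e n" if "n < arity \<phi>" for n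
        using ke[of "n - 1"] that h unfolding supp_def by (cases n) auto
      ultimately show ?thesis using frc_arity by metis
    qed
    ultimately show "pair (act h \<rho>) (hact h p) \<epsilon> sepn HS a e \<phi>"
      unfolding m using r HS_act cnd_hact by blast
  qed
  then have "symn (sepn HS a e \<phi>)" unfolding symn_def using m k(1) by blast
  then show ?thesis by (rule HSI) (use m in auto)
qed

end

sublocale zfc \<subseteq> name_class E conds HS
proof
  show "D1 HS" by (rule D1_HS)
  show "HS x \<Longrightarrow> pair \<rho> r \<epsilon> x \<Longrightarrow> r \<epsilon> conds \<Longrightarrow> HS \<rho>" for x \<rho> r by (rule HS_elem)
qed (rule HS_chk HS_bound HS_sep; assumption)+

section \<open>Deciding many statements at once\<close>

context zfc
begin

lemma sm_upr: "reg k \<Longrightarrow> sm k (upr a b)"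
proof -
  assume k: "reg k"
  have "cov (suc (suc emp)) (upr a b)"
  proof (rule covI[of "\<lambda>u z. u = emp \<and> z = a \<or> u = suc emp \<and> z = b"])
    show "\<exists>u. u \<epsilon> suc (suc emp) \<and> (u = emp \<and> z = a \<or> u = suc emp \<and> z = b)" if "z \<epsilon> upr a b" for z
      using that unfolding mem_upr mem_suc by blast
  qed (auto simp: D2_def intro!: dfi)
  then show ?thesis
    unfolding sm_def using regD(2)[OF k natural_suc[OF natural_suc[OF natural_emp]]] by blast
qed

lemma sm_cup: "reg k \<Longrightarrow> sm k a \<Longrightarrow> sm k b \<Longrightarrow> sm k (cup a b)"
proof -
  assume k: "reg k" "sm k a" "sm k b"
  have "cup a b = uni (upr a b)" by (rule ext) auto
  then show ?thesis using regD(5)[OF k(1) sm_upr[OF k(1), of a b]] k by auto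
qed

lemma sm_family:
  assumes "reg k" "F1 F" "sm k a" "\<And>x. x \<epsilon> a \<Longrightarrow> sm k (F x)" shows "sm k (uni (rep a F))"
  using regD(5)[OF assms(1) sm_cov[OF assms(3) cov_rep[OF assms(2)]]] assms(4)
  by (auto simp: mem_rep[OF assms(2)])

lemma sm_emp: "reg k \<Longrightarrow> sm k emp"
  using sm_mem regD(2) natural_emp by blast

lemma cnd_cup:
  assumes p: "cnd p" and q: "cnd q" and f: "func (cup p q)" shows "cnd (cup p q)"
  unfolding cnd_def
proof (intro conjI allI impI f)
  fix z assume "z \<epsilon> cup p q"
  then show "\<exists>n x y. z = pair (pair n x) y \<and> natural n \<and> x \<epsilon> lm \<and> y \<epsilon> Vs (K n)"
    using cnd_elem'[OF p] cnd_elem'[OF q] by auto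
next
  fix n assume n: "natural n"
  have "slc n (cup p q) = cup (slc n p) (slc n q)" by (rule ext) auto
  then show "sm (K n) (slc n (cup p q))"
    using sm_cup[OF reg_K[OF n]] cnd_slc p q n by simp
qed

text \<open>The head of a condition consists of the coordinates up to \<open>n\<close>, the tail of the others. A tail
  carries, as its slice at \<open>n + 1\<close>, a set of positions for the heads to be considered.\<close>

definition isT where
  "isT n t \<longleftrightarrow> cnd t \<and> (\<forall>m x y. pair (pair m x) y \<epsilon> t \<longrightarrow> \<not> m \<epsilon> suc n)"
definition isH where
  "isH n h \<longleftrightarrow> cnd h \<and> (\<forall>m x y. pair (pair m x) y \<epsilon> h \<longrightarrow> m \<epsilon> suc n)"
definition Fn where
  "Fn n t h \<longleftrightarrow> isH n h \<and> (\<forall>m x y. pair (pair m x) y \<epsilon> h \<longrightarrow> x \<epsilon> slc (suc n) t)"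
definition hd where "hd n p = sep p (\<lambda>z. fstp (fstp z) \<epsilon> suc n)"
definition tl where "tl n p = sep p (\<lambda>z. \<not> fstp (fstp z) \<epsilon> suc n)"

lemma D_head: "D2 isT" "D2 isH" "D3 Fn" "F2 hd" "F2 tl"
  unfolding D2_def D3_def F2_def isT_def isH_def Fn_def hd_def tl_def by (intro dfi)+
lemmas [dfi] = D2I[OF D_head(1)] D2I[OF D_head(2)] D3I[OF D_head(3)] F2I[OF D_head(4)] F2I[OF D_head(5)]

lemma mem_hd [simp]: "z \<epsilon> hd n p \<longleftrightarrow> z \<epsilon> p \<and> fstp (fstp z) \<epsilon> suc n"
  unfolding hd_def by (rule mem_sep) (unfold D1_def, intro dfi)

lemma mem_tl [simp]: "z \<epsilon> tl n p \<longleftrightarrow> z \<epsilon> p \<and> \<not> fstp (fstp z) \<epsilon> suc n"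
  unfolding tl_def by (rule mem_sep) (unfold D1_def, intro dfi)

lemma isT_cnd: "isT n t \<Longrightarrow> cnd t" and isH_cnd: "isH n h \<Longrightarrow> cnd h" and Fn_isH: "Fn n t h \<Longrightarrow> isH n h"
  by (simp_all add: isT_def isH_def Fn_def)

lemma isT_tl: "cnd p \<Longrightarrow> isT n (tl n p)"
  unfolding isT_def using cnd_sub[of p "tl n p"] by (auto simp: sub_def simp del: mem_suc)

lemma isH_hd: "cnd p \<Longrightarrow> isH n (hd n p)"
  unfolding isH_def using cnd_sub[of p "hd n p"] by (auto simp: sub_def simp del: mem_suc)

lemma isH_sub: "isH n h \<Longrightarrow> sub h' h \<Longrightarrow> isH n h'"
  unfolding isH_def sub_def using cnd_sub[unfolded sub_def] by blast

lemma cup_hd_tl: "cup (hd n p) (tl n p) = p"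
  by (rule ext) (auto simp del: mem_suc)

lemma cnd_head_tail:
  assumes "isH n h" "isT n t" shows "cnd (cup h t)"
proof (rule cnd_cup[OF isH_cnd[OF assms(1)] isT_cnd[OF assms(2)]])
  have h: "func h" "func t" using isH_cnd isT_cnd cnd_func assms by blast+
  have "False" if "pair u y \<epsilon> h" "pair u y' \<epsilon> t" for u y y'
    using that cnd_elem[OF isH_cnd[OF assms(1)]] assms unfolding isH_def isT_def by metis
  then show "func (cup h t)" using h unfolding func_def mem_cup by blast
qed

lemma Fn_mono: "Fn n t h \<Longrightarrow> sub t t' \<Longrightarrow> Fn n t' h"
  unfolding Fn_def sub_def by (auto simp del: mem_suc) blast

text \<open>Every nonempty slice of a tail is at a coordinate \<open>k\<close> beyond
  \<open>n\<close>. There \<open>K k\<close> is regular and at least \<open>K (suc n)\<close>, so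
  fewer than \<open>K (suc n)\<close> small slices have a small union.\<close>

lemma isT_chain:
  assumes n: "natural n" and m: "m \<epsilon> K (suc n)" and s: "F1 s"
    and t: "\<And>x. x \<epsilon> m \<Longrightarrow> isT n (s x)" and i: "\<And>x y. x \<epsilon> y \<Longrightarrow> y \<epsilon> m \<Longrightarrow> sub (s x) (s y)"
  shows "isT n (uni (rep m s))"
proof -
  note mu = mem_uni_rep[OF s]
  have om: "Ord m" using Ord_in[OF Ord_K[OF natural_suc[OF n]] m] .
  have c: "cnd (s x)" if "x \<epsilon> m" for x using t[OF that] isT_cnd by blast
  have "func (uni (rep m s))" unfolding func_def mu
  proof (intro allI impI, elim exE conjE)
    fix u y z a b assume a: "a \<epsilon> m" "pair u y \<epsilon> s a" and b: "b \<epsilon> m" "pair u z \<epsilon> s b"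
    consider "a \<epsilon> b" | "a = b" | "b \<epsilon> a" using Ord_linear Ord_in om a b by metis
    then show "y = z"
    proof cases
      case 1
      then have "pair u y \<epsilon> s b" using i[OF 1 b(1)] a(2) by (auto simp: sub_def)
      then show ?thesis using funcD[OF cnd_func[OF c[OF b(1)]]] b(2) by blast
    next
      case 2
      then show ?thesis using funcD[OF cnd_func[OF c[OF b(1)]]] a b by blast
    next
      case 3
      then have "pair u z \<epsilon> s a" using i[OF 3 a(1)] b(2) by (auto simp: sub_def)
      then show ?thesis using funcD[OF cnd_func[OF c[OF a(1)]]] a(2) by blast
    qed
  qed
  moreover have "\<exists>n x y. z = pair (pair n x) y \<and> natural n \<and> x \<epsilon> lm \<and> y \<epsilon> Vs (K n)"
    if "z \<epsilon> uni (rep m s)" for z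
    using that cnd_elem'[OF c] unfolding mu by blast
  moreover have "sm (K k) (slc k (uni (rep m s)))" if k: "natural k" for k
  proof (cases "k \<epsilon> suc n")
    case True
    then have "sub (slc k (uni (rep m s))) emp"
      using t unfolding sub_def mem_slc mu isT_def by blast
    then show ?thesis using sm_sub sm_emp[OF reg_K[OF k]] by blast
  next
    case False
    have S: "F1 (\<lambda>x. slc k (s x))" unfolding F1_def by (intro dfi F1I[OF s])
    have "slc k (uni (rep m s)) = uni (rep m (\<lambda>x. slc k (s x)))"
      by (rule ext) (simp only: mem_slc mu mem_uni_rep[OF S], blast)
    moreover have "suc n \<epsilon> suc k"
      using False Ord_linear[of k "suc n"] natural_Ord[OF k] natural_Ord[OF n] by auto
    then have "m \<epsilon> K k" using m K_sub[OF k] by (auto simp: sub_def)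
    then have "sm (K k) m" by (rule sm_mem)
    ultimately show ?thesis
      using sm_family[OF reg_K[OF k] S] cnd_slc[OF c k] by simp
  qed
  ultimately show ?thesis using t unfolding isT_def cnd_def mu by blast
qed

text \<open>\<open>b x\<close> is the tail reached before step \<open>x\<close>, and
  \<open>F x\<close> extends it further. The last property records the stage at which an entry of
  the final tail has come in, which \<open>tail_decides\<close> will need.\<close>

lemma chain:
  assumes n: "natural n" and m: "m \<epsilon> K (suc n)" and F: "F2 F" and t0: "isT n t0"
    and step: "\<And>x u. x \<epsilon> m \<Longrightarrow> isT n u \<Longrightarrow> isT n (F x u) \<and> sub u (F x u)"
  obtains b where "F1 b" "isT n (b m)" "sub t0 (b m)" "\<And>x. x \<epsilon> m \<Longrightarrow> isT n (b x) \<and> sub t0 (b x)"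
    "\<And>x y. x \<epsilon> y \<Longrightarrow> y \<epsilon> suc m \<Longrightarrow> sub (F x (b x)) (b y)"
    "\<And>z. z \<epsilon> b m \<Longrightarrow> z \<epsilon> t0 \<or> (\<exists>x. x \<epsilon> m \<and> z \<epsilon> F x (b x))"
proof -
  define H where "H x g = F x (cup t0 (uni (rng g)))" for x g
  have H: "F2 H" unfolding F2_def H_def by (intro dfi F2I[OF F])
  define s where "s = wrec (\<lambda>x. x) H"
  have s: "F1 s" unfolding s_def by (intro F1_wrec F1_id H)
  note [dfi] = F1I[OF s]
  define b where "b x = cup t0 (uni (rep x s))" for x
  have b: "F1 b" unfolding F1_def b_def by (intro dfi)
  note [dfi] = F1I[OF b]
  have sb: "s x = F x (b x)" for x
    using erec_eq[OF H, of x] unfolding s_def[symmetric] H_def b_def by (simp add: rng_lam[OF s])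
  have mb: "z \<epsilon> b x \<longleftrightarrow> z \<epsilon> t0 \<or> (\<exists>y. y \<epsilon> x \<and> z \<epsilon> F y (b y))" for x z
    unfolding b_def[of x] mem_cup mem_uni_rep[OF s] sb by blast
  have om: "Ord m" using Ord_in[OF Ord_K[OF natural_suc[OF n]] m] .
  have D: "D1 (\<lambda>x. x \<epsilon> suc m \<longrightarrow> isT n (b x))" unfolding D1_def by (intro dfi)
  have inc: "sub (F x (b x)) (b y)" if "x \<epsilon> y" for x y
    using that unfolding sub_def mb by blast
  have T: "x \<epsilon> suc m \<longrightarrow> isT n (b x)" if "Ord x" for x
  proof (rule Ord_induct[OF that D], intro impI)
    fix x assume x: "Ord x" "\<And>y. y \<epsilon> x \<Longrightarrow> y \<epsilon> suc m \<longrightarrow> isT n (b y)" "x \<epsilon> suc m"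
    have xm: "y \<epsilon> m" if "y \<epsilon> x" for y using that x(3) Ord_trans[OF om] by auto
    have Tb: "isT n (b y)" if "y \<epsilon> x" for y using x(2)[OF that] xm[OF that] by simp
    have Ts: "isT n (s y)" "sub (b y) (s y)" if "y \<epsilon> x" for y
      unfolding sb using step[OF xm[OF that] Tb[OF that]] by blast+
    show "isT n (b x)"
    proof (cases "x = emp")
      case True
      then have "b x = t0" by (intro ext) (simp add: mb)
      then show ?thesis using t0 by simp
    next
      case False
      then obtain y where y: "y \<epsilon> x" using emp_iff by blast
      have "sub t0 (b y)" by (simp add: sub_def mb)
      then have "sub t0 (s y)" using Ts(2)[OF y] sub_trans by blast
      then have eq: "b x = uni (rep x s)"
        using y by (intro ext) (auto simp del: mem_uni simp: b_def mem_uni_rep[OF s] sub_def)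
      have xK: "x \<epsilon> K (suc n)" using x(3) m Ord_trans[OF Ord_K[OF natural_suc[OF n]]] by auto
      show ?thesis unfolding eq
      proof (rule isT_chain[OF n xK s Ts(1)])
        show "sub (s u) (s w)" if "u \<epsilon> w" "w \<epsilon> x" for u w
          using inc[OF that(1)] Ts(2)[OF that(2)] sub_trans unfolding sb by blast
      qed
    qed
  qed
  show ?thesis
  proof (rule that[OF b])
    show "isT n (b m)" using T[OF om] by simp
    show "sub t0 (b m)" by (simp add: sub_def mb)
    show "isT n (b x) \<and> sub t0 (b x)" if "x \<epsilon> m" for x
      using T[OF Ord_in[OF om that]] that by (simp add: sub_def mb)
    show "sub (F x (b x)) (b y)" if "x \<epsilon> y" "y \<epsilon> suc m" for x y by (rule inc[OF that(1)])
    show "z \<epsilon> t0 \<or> (\<exists>x. x \<epsilon> m \<and> z \<epsilon> F x (b x))" if "z \<epsilon> b m" for z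
      using that by (simp add: mb)
  qed
qed

lemma cov_prod:
  assumes p: "\<And>u v. u \<epsilon> a \<Longrightarrow> v \<epsilon> a \<Longrightarrow> pair u v \<epsilon> a" and "cov a x" "cov a y"
  shows "cov a (prod x y)"
proof -
  obtain f g where f: "func f" "\<And>z. z \<epsilon> x \<Longrightarrow> \<exists>u. u \<epsilon> a \<and> pair u z \<epsilon> f"
    and g: "func g" "\<And>z. z \<epsilon> y \<Longrightarrow> \<exists>u. u \<epsilon> a \<and> pair u z \<epsilon> g"
    using assms unfolding cov_def by blast
  show ?thesis
  proof (rule covI[of "\<lambda>w z. \<exists>u v z1 z2. w = pair u v \<and> z = pair z1 z2 \<and> pair u z1 \<epsilon> f \<and> pair v z2 \<epsilon> g"])
    show "D2 (\<lambda>w z. \<exists>u v z1 z2. w = pair u v \<and> z = pair z1 z2 \<and> pair u z1 \<epsilon> f \<and> pair v z2 \<epsilon> g)"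
      unfolding D2_def by (intro dfi)
    show "z = z'"
      if "\<exists>u v z1 z2. w = pair u v \<and> z = pair z1 z2 \<and> pair u z1 \<epsilon> f \<and> pair v z2 \<epsilon> g"
        "\<exists>u v z1 z2. w = pair u v \<and> z' = pair z1 z2 \<and> pair u z1 \<epsilon> f \<and> pair v z2 \<epsilon> g" for w z z'
      using that funcD[OF f(1)] funcD[OF g(1)] by auto
    fix z assume "z \<epsilon> prod x y"
    then obtain z1 z2 where z: "z = pair z1 z2" "z1 \<epsilon> x" "z2 \<epsilon> y" by (auto simp: mem_prod)
    then obtain u v where "u \<epsilon> a" "pair u z1 \<epsilon> f" "v \<epsilon> a" "pair v z2 \<epsilon> g" using f g by blast
    then show "\<exists>w. w \<epsilon> a \<and> (\<exists>u v z1 z2. w = pair u v \<and> z = pair z1 z2 \<and> pair u z1 \<epsilon> f \<and> pair v z2 \<epsilon> g)"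
      using p z(1) by blast
  qed
qed

definition pos where "pos n p = uni (rep (suc n) (\<lambda>m. slc m p))"

lemma F2_pos: "F2 pos" unfolding F2_def pos_def by (intro dfi)
lemmas [dfi] = F2I[OF F2_pos]

lemma mem_pos: "x \<epsilon> pos n p \<longleftrightarrow> (\<exists>m y. m \<epsilon> suc n \<and> pair (pair m x) y \<epsilon> p)"
proof -
  have "F1 (\<lambda>m. slc m p)" unfolding F1_def by (intro dfi)
  then show ?thesis unfolding pos_def by (simp only: mem_uni_rep mem_slc) blast
qed

lemma sm_pos: "natural n \<Longrightarrow> cnd p \<Longrightarrow> sm (K n) (pos n p)"
  unfolding pos_def
proof (rule sm_family[OF reg_K])
  assume n: "natural n" "cnd p"
  show "F1 (\<lambda>m. slc m p)" unfolding F1_def by (intro dfi)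
  show "sm (K n) (suc n)" using sm_mem regD(2)[OF reg_K] natural_suc n by blast
  show "sm (K n) (slc m p)" if m: "m \<epsilon> suc n" for m
    using sm_mono[OF cnd_slc[OF n(2)] K_sub[OF n(1) m]] natural_in[OF natural_suc[OF n(1)] m] by blast
qed

lemma sm_head:
  assumes n: "natural n" and h: "isH n h" shows "sm (K n) h"
proof -
  have G: "F1 (\<lambda>x. pair (pair m x) (ap h (pair m x)))"
    and F: "F1 (\<lambda>m. rep (slc m h) (\<lambda>x. pair (pair m x) (ap h (pair m x))))" for m
    unfolding F1_def by (intro dfi)+
  have "sm (K n) (uni (rep (suc n) (\<lambda>m. rep (slc m h) (\<lambda>x. pair (pair m x) (ap h (pair m x))))))"
  proof (rule sm_family[OF reg_K[OF n] F])
    show "sm (K n) (suc n)" using sm_mem regD(2)[OF reg_K] natural_suc n by blast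
    show "sm (K n) (rep (slc m h) (\<lambda>x. pair (pair m x) (ap h (pair m x))))" if m: "m \<epsilon> suc n" for m
      using sm_cov[OF sm_mono[OF cnd_slc[OF isH_cnd[OF h]] K_sub[OF n m]] cov_rep[OF G]]
        natural_in[OF natural_suc[OF n] m] by blast
  qed
  moreover have "sub h (uni (rep (suc n) (\<lambda>m. rep (slc m h) (\<lambda>x. pair (pair m x) (ap h (pair m x))))))"
    unfolding sub_def mem_uni_rep[OF F] mem_rep[OF G]
  proof (intro allI impI)
    fix z assume z: "z \<epsilon> h"
    then obtain m x y where zm: "z = pair (pair m x) y" using cnd_elem'[OF isH_cnd[OF h]] by blast
    then have "m \<epsilon> suc n" "x \<epsilon> slc m h" "y = ap h (pair m x)"
      using h z ap_eq[OF cnd_func[OF isH_cnd[OF h]]] unfolding isH_def mem_slc by blast+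
    then show "\<exists>m. m \<epsilon> suc n \<and> (\<exists>x. x \<epsilon> slc m h \<and> z = pair (pair m x) (ap h (pair m x)))"
      using zm by blast
  qed
  ultimately show ?thesis using sm_sub by blast
qed

definition FnS where "FnS n t = sep conds (Fn n t)"

lemma mem_FnS [simp]: "h \<epsilon> FnS n t \<longleftrightarrow> Fn n t h"
proof -
  have "D1 (Fn n t)" unfolding D1_def by (intro dfi)
  moreover have "Fn n t h \<Longrightarrow> cnd h" using Fn_isH isH_cnd by blast
  ultimately show ?thesis unfolding FnS_def by (auto simp: mem_sep)
qed

text \<open>A head can be coded by a small subset of \<open>Vs (K n)\<close>, which is an element of \<open>Vs (K n)\<close>.\<close>

lemma cov_FnS:
  assumes n: "natural n" and t: "isT n t" shows "cov (Vs (K n)) (FnS n t)"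
proof -
  let ?I = "slc (suc n) t"
  have "cov (Vs (K n)) ?I"
    using cnd_slc[OF isT_cnd[OF t] natural_suc[OF n]] by (simp add: K_suc[OF n] sm_nx)
  then obtain f where f: "func f" "\<And>x. x \<epsilon> ?I \<Longrightarrow> \<exists>u. u \<epsilon> Vs (K n) \<and> pair u x \<epsilon> f"
    unfolding cov_def by blast
  have "D2 (\<lambda>x u. u \<epsilon> Vs (K n) \<and> pair u x \<epsilon> f)" unfolding D2_def by (intro dfi)
  from choice_rel[OF this f(2)] obtain g where
    g: "\<And>x. x \<epsilon> ?I \<Longrightarrow> ap g x \<epsilon> Vs (K n) \<and> pair (ap g x) x \<epsilon> f" by blast
  have ginj: "x = y" if "x \<epsilon> ?I" "y \<epsilon> ?I" "ap g x = ap g y" for x y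
    using g[OF that(1)] g[OF that(2)] that(3) funcD[OF f(1)] by metis
  \<comment> \<open>Positions are ordinals in \<open>lm\<close> and may have large rank, so they are
    replaced by their codes in \<open>Vs (K n)\<close>.\<close>
  define c where "c z = pair (pair (fstp (fstp z)) (ap g (sndp (fstp z)))) (sndp z)" for z
  have c: "F1 c" unfolding F1_def c_def by (intro dfi)
  note [dfi] = F1I[OF c]
  have cp: "c (pair (pair m x) y) = pair (pair m (ap g x)) y" for m x y by (simp add: c_def)
  have elem: "\<exists>m x y. z = pair (pair m x) y \<and> m \<epsilon> suc n \<and> x \<epsilon> ?I \<and> y \<epsilon> Vs (K m)"
    if f: "Fn n t h" "z \<epsilon> h" for h z
  proof -
    have h: "isH n h" using f(1) Fn_isH by blast
    obtain m x y where "z = pair (pair m x) y" "y \<epsilon> Vs (K m)"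
      using cnd_elem'[OF isH_cnd[OF h] f(2)] by blast
    then show ?thesis using f unfolding Fn_def isH_def by blast
  qed
  have cinj: "z = w" if e: "Fn n t h" "Fn n t h'" "z \<epsilon> h" "w \<epsilon> h'" "c z = c w" for h h' z w
  proof -
    obtain m x y where z: "z = pair (pair m x) y" "x \<epsilon> ?I" using elem[OF e(1,3)] by blast
    obtain m' x' y' where w: "w = pair (pair m' x') y'" "x' \<epsilon> ?I" using elem[OF e(2,4)] by blast
    show ?thesis using e(5) ginj[OF z(2) w(2)] unfolding z(1) w(1) cp by simp
  qed
  show ?thesis
  proof (rule covI[of "\<lambda>u h. u = rep h c"])
    show "D2 (\<lambda>u h. u = rep h c)" unfolding D2_def by (intro dfi)
    show "h = h'" if h: "h \<epsilon> FnS n t" "h' \<epsilon> FnS n t" and e: "u = rep h c" "u = rep h' c" for u h h'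
    proof (rule ext)
      have "\<exists>w. w \<epsilon> b \<and> c w = c z" if "rep a c = rep b c" "z \<epsilon> a" for a b z
        using that mem_rep[OF c, of "c z"] by metis
      then show "z \<epsilon> h \<longleftrightarrow> z \<epsilon> h'" for z
        using e h cinj unfolding mem_FnS by metis
    qed
    fix h assume "h \<epsilon> FnS n t"
    then have h: "Fn n t h" by simp
    have "sub (rep h c) (Vs (K n))" unfolding sub_def mem_rep[OF c]
    proof (intro allI impI, elim exE conjE)
      fix u z assume z: "z \<epsilon> h" "u = c z"
      obtain m x y where mx: "z = pair (pair m x) y" "m \<epsilon> suc n" "x \<epsilon> ?I" "y \<epsilon> Vs (K m)"
        using elem[OF h z(1)] by blast
      have m: "natural m" by (rule natural_in[OF natural_suc[OF n] mx(2)])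
      have "m \<epsilon> Vs (K n)"
        using regD(2)[OF reg_K[OF n] m] Ord_sub_Vs[OF Ord_K[OF n]] by (auto simp: sub_def)
      moreover have "y \<epsilon> Vs (K n)"
        using Vs_mono[OF Ord_K[OF m] Ord_K[OF n] K_sub[OF n mx(2)]] mx(4) by (auto simp: sub_def)
      ultimately show "u \<epsilon> Vs (K n)"
        unfolding z(2) mx(1) cp using reg_Vs_pair[OF reg_K[OF n]] g[OF mx(3)] by blast
    qed
    moreover have "sm (K n) (rep h c)"
      using sm_cov[OF sm_head[OF n Fn_isH[OF h]] cov_rep[OF c]] .
    ultimately show "\<exists>u. u \<epsilon> Vs (K n) \<and> u = rep h c"
      using reg_Vs_small[OF reg_K[OF n]] by blast
  qed
qed

text \<open>The tail of \<open>q\<close>, enlarged by dummy entries so that the head of \<open>q\<close> becomes admissible for it.\<close>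

definition ext_tail where
  "ext_tail n q = cup (tl n q)
    (rep (sep (pos n q) (\<lambda>x. \<not> x \<epsilon> slc (suc n) q)) (\<lambda>x. pair (pair (suc n) x) emp))"

lemma F2_ext_tail: "F2 ext_tail" unfolding F2_def ext_tail_def by (intro dfi)
lemmas [dfi] = F2I[OF F2_ext_tail]

lemma mem_ext_tail: "z \<epsilon> ext_tail n q \<longleftrightarrow> z \<epsilon> tl n q \<or>
    (\<exists>x. x \<epsilon> pos n q \<and> \<not> x \<epsilon> slc (suc n) q \<and> z = pair (pair (suc n) x) emp)"
proof -
  have F: "F1 (\<lambda>x. pair (pair (suc n) x) emp)" and D: "D1 (\<lambda>x. \<not> x \<epsilon> slc (suc n) q)"
    unfolding F1_def D1_def by (intro dfi)+
  show ?thesis unfolding ext_tail_def mem_cup mem_rep[OF F] mem_sep[OF D] by blast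
qed

text \<open>Up to coordinate \<open>n\<close> there are fewer than \<open>K n\<close> positions in
  \<open>q\<close>, so the dummy entries keep the slice at \<open>suc n\<close> smaller than
  \<open>K (suc n)\<close>.\<close>

lemma ext_tail:
  assumes n: "natural n" and q: "cnd q"
  shows "isT n (ext_tail n q)" "sub (tl n q) (ext_tail n q)" "Fn n (ext_tail n q) (hd n q)"
proof -
  show sub: "sub (tl n q) (ext_tail n q)" by (simp add: sub_def mem_ext_tail)
  define j where "j = rep (sep (pos n q) (\<lambda>x. \<not> x \<epsilon> slc (suc n) q)) (\<lambda>x. pair (pair (suc n) x) emp)"
  have F: "F1 (\<lambda>x. pair (pair (suc n) x) emp)" and D: "D1 (\<lambda>x. \<not> x \<epsilon> slc (suc n) q)"
    unfolding F1_def D1_def by (intro dfi)+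
  have mj: "z \<epsilon> j \<longleftrightarrow> (\<exists>x. x \<epsilon> pos n q \<and> \<not> x \<epsilon> slc (suc n) q \<and> z = pair (pair (suc n) x) emp)" for z
    unfolding j_def mem_rep[OF F] mem_sep[OF D] by blast
  have plm: "x \<epsilon> lm" if "x \<epsilon> pos n q" for x
    using that cnd_elem[OF q] unfolding mem_pos by (metis pair_eq)
  have "cnd j" unfolding cnd_def
  proof (intro conjI allI impI)
    show "func j" unfolding func_def mj by auto
    have "emp \<epsilon> Vs (K (suc n))"
      using regD(2)[OF reg_K[OF natural_suc[OF n]] natural_emp]
        Ord_sub_Vs[OF Ord_K[OF natural_suc[OF n]]] by (auto simp: sub_def)
    then show "\<exists>n x y. z = pair (pair n x) y \<and> natural n \<and> x \<epsilon> lm \<and> y \<epsilon> Vs (K n)" if "z \<epsilon> j" for z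
      using that plm natural_suc[OF n] unfolding mj by blast
    fix k assume k: "natural k"
    show "sm (K k) (slc k j)"
    proof (cases "k = suc n")
      case True
      have "sub (slc k j) (pos n q)" unfolding sub_def mem_slc mj by auto
      moreover have "sm (K k) (pos n q)"
        unfolding True by (rule sm_mono[OF sm_pos[OF n q] K_sub[OF natural_suc[OF n]]]) simp
      ultimately show ?thesis using sm_sub by blast
    next
      case False
      then have "sub (slc k j) emp" unfolding sub_def mem_slc mj by auto
      then show ?thesis using sm_sub sm_emp[OF reg_K[OF k]] by blast
    qed
  qed
  moreover have "func (cup (tl n q) j)"
    using funcD[OF cnd_func[OF q]] unfolding func_def mem_cup mj mem_tl mem_slc by (auto simp del: mem_suc)
  ultimately have "cnd (ext_tail n q)"
    using cnd_cup[OF isT_cnd[OF isT_tl[OF q]]] unfolding ext_tail_def j_def by blast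
  then show "isT n (ext_tail n q)"
    unfolding isT_def mem_ext_tail by (auto simp del: mem_suc)
  have "x \<epsilon> slc (suc n) (ext_tail n q)" if "pair (pair m x) y \<epsilon> hd n q" for m x y
  proof (cases "x \<epsilon> slc (suc n) q")
    case True
    then obtain y' where "pair (pair (suc n) x) y' \<epsilon> q" by auto
    moreover have "\<not> suc n \<epsilon> suc n" by (rule mem_irrefl)
    ultimately show ?thesis unfolding mem_slc mem_ext_tail mem_tl fstp_pair by blast
  next
    case False
    have "x \<epsilon> pos n q" using that unfolding mem_pos by (auto simp del: mem_suc)
    then show ?thesis using False unfolding mem_slc[of x "suc n" "ext_tail n q"] mem_ext_tail by blast
  qed
  then show "Fn n (ext_tail n q) (hd n q)" unfolding Fn_def using isH_hd[OF q] by blast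
qed

end

text \<open>\<open>Dec a p\<close> is to be read as: \<open>p\<close> decides statement
  \<open>a\<close>. For each of the statements the deciding conditions are open and dense, and there
  are at most as many statements as \<open>Vs (K n)\<close> can cover.\<close>

locale decision = zfc +
  fixes Dec :: "'a \<Rightarrow> 'a \<Rightarrow> bool" and n J :: 'a
  assumes D2_Dec: "D2 Dec" and nat_n: "natural n" and cov_J: "cov (Vs (K n)) J"
    and Dec_mono: "a \<epsilon> J \<Longrightarrow> Dec a p \<Longrightarrow> cnd q \<Longrightarrow> sub p q \<Longrightarrow> Dec a q"
    and Dec_dense: "a \<epsilon> J \<Longrightarrow> cnd p \<Longrightarrow> \<exists>q. cnd q \<and> sub p q \<and> Dec a q"
begin

lemmas [dfi] = D2I[OF D2_Dec]

text \<open>There are fewer than \<open>K (suc n)\<close> pairs of a statement and a head considered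
  by \<open>t\<close>, so a chain of tails can serve them all. Each step extends the head and the
  current tail to a deciding condition and keeps its tail, with dummy entries that admit the new
  head.\<close>

lemma one_step:
  assumes t: "isT n t"
  shows "\<exists>t'. isT n t' \<and> sub t t' \<and> (\<forall>a h. a \<epsilon> J \<and> Fn n t h \<longrightarrow>
    (\<exists>h'. Fn n t' h' \<and> sub h h' \<and> Dec a (cup h' t')))"
proof -
  have "cov (Vs (K n)) (prod J (FnS n t))"
    by (intro cov_prod reg_Vs_pair reg_K nat_n cov_J cov_FnS t)
  then have "sm (K (suc n)) (prod J (FnS n t))" by (simp add: K_suc[OF nat_n] sm_nx)
  then obtain m f where m: "m \<epsilon> K (suc n)" and f: "func f"
    "\<And>w. w \<epsilon> prod J (FnS n t) \<Longrightarrow> \<exists>x. x \<epsilon> m \<and> pair x w \<epsilon> f"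
    unfolding sm_def cov_def by blast
  let ?R = "\<lambda>w q. cnd q \<and> sub (cup (sndp (fstp w)) (sndp w)) q \<and> Dec (fstp (fstp w)) q"
  have R: "D2 ?R" and RD: "D1 (\<lambda>w. \<exists>q. ?R w q)" unfolding D1_def D2_def by (intro dfi)+
  let ?W = "sep (prod (prod J (FnS n t)) conds) (\<lambda>w. \<exists>q. ?R w q)"
  obtain c where c: "\<And>w. w \<epsilon> ?W \<Longrightarrow> ?R w (ap c w)"
    using choice_rel[OF R, of ?W] unfolding mem_sep[OF RD] by blast
  have q: "cnd (ap c (pair (pair a h) u)) \<and> sub (cup h u) (ap c (pair (pair a h) u))
      \<and> Dec a (ap c (pair (pair a h) u))" if a: "a \<epsilon> J" "Fn n t h" "isT n u" for a h u
  proof -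
    have "cnd (cup h u)" using cnd_head_tail[OF Fn_isH[OF a(2)] a(3)] .
    then have "\<exists>q. ?R (pair (pair a h) u) q" using Dec_dense[OF a(1)] by simp
    then have "pair (pair a h) u \<epsilon> ?W"
      unfolding mem_sep[OF RD] using a isT_cnd by simp
    then show ?thesis using c[of "pair (pair a h) u"] by simp
  qed
  \<comment> \<open>Step \<open>x\<close> serves the pair that \<open>f\<close> assigns to
    \<open>x\<close>; without such a pair the tail is left unchanged.\<close>
  define F where "F x u = (if \<exists>a h. pair x (pair a h) \<epsilon> f \<and> a \<epsilon> J \<and> Fn n t h \<and> isT n u
    then ext_tail n (ap c (pair (ap f x) u)) else u)" for x u
  have F: "F2 F" unfolding F2_def F_def by (intro dfi)
  have Fq: "F x u = ext_tail n (ap c (pair (pair a h) u))"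
    if "pair x (pair a h) \<epsilon> f" "a \<epsilon> J" "Fn n t h" "isT n u" for x u a h
    unfolding F_def using that ap_eq[OF f(1) that(1)] by auto
  have su: "sub u (ext_tail n q)" if u: "isT n u" "cnd q" "sub u q" for u q
  proof -
    have "sub u (tl n q)" unfolding sub_def
    proof (intro allI impI)
      fix z assume z: "z \<epsilon> u"
      then obtain k x y where "z = pair (pair k x) y" using cnd_elem'[OF isT_cnd[OF u(1)]] by blast
      then show "z \<epsilon> tl n q" using z u(1,3) unfolding isT_def sub_def mem_tl by auto
    qed
    then show ?thesis using ext_tail(2)[OF nat_n u(2)] sub_trans by blast
  qed
  have step: "isT n (F x u) \<and> sub u (F x u)" if "isT n u" for x u
  proof (cases "\<exists>a h. pair x (pair a h) \<epsilon> f \<and> a \<epsilon> J \<and> Fn n t h \<and> isT n u")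
    case True
    then obtain a h where a: "pair x (pair a h) \<epsilon> f" "a \<epsilon> J" "Fn n t h" by blast
    have "sub u (ap c (pair (pair a h) u))" using q[OF a(2,3) that] by (auto simp: sub_def)
    then show ?thesis unfolding Fq[OF a that] using q[OF a(2,3) that] ext_tail(1)[OF nat_n] su[OF that] by blast
  next
    case False
    then have "F x u = u" unfolding F_def by (rule if_not_P)
    then show ?thesis using that by simp
  qed
  obtain b where b: "isT n (b m)" "sub t (b m)" "\<And>x. x \<epsilon> m \<Longrightarrow> isT n (b x) \<and> sub t (b x)"
    "\<And>x y. x \<epsilon> y \<Longrightarrow> y \<epsilon> suc m \<Longrightarrow> sub (F x (b x)) (b y)"
    by (rule chain[OF nat_n m F t step]) blast+
  have "\<exists>h'. Fn n (b m) h' \<and> sub h h' \<and> Dec a (cup h' (b m))" if a: "a \<epsilon> J" "Fn n t h" for a h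
  proof -
    obtain x where x: "x \<epsilon> m" "pair x (pair a h) \<epsilon> f" using f(2)[of "pair a h"] a by auto
    have T: "isT n (b x)" using b(3)[OF x(1)] by blast
    define r where "r = ap c (pair (pair a h) (b x))"
    have r: "cnd r" "sub (cup h (b x)) r" "Dec a r" using q[OF a T] unfolding r_def by blast+
    have "F x (b x) = ext_tail n r" unfolding r_def by (rule Fq[OF x(2) a T])
    then have e: "sub (ext_tail n r) (b m)" using b(4)[OF x(1)] by simp
    have F': "Fn n (b m) (hd n r)" using Fn_mono[OF ext_tail(3)[OF nat_n r(1)] e] .
    have "sub h (hd n r)" unfolding sub_def
    proof (intro allI impI)
      fix z assume z: "z \<epsilon> h"
      then obtain k y w where "z = pair (pair k y) w" using cnd_elem'[OF isH_cnd[OF Fn_isH[OF a(2)]]] by blast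
      then show "z \<epsilon> hd n r" using z r(2) Fn_isH[OF a(2)] unfolding isH_def sub_def mem_hd by auto
    qed
    moreover have "sub r (cup (hd n r) (b m))"
      using cup_hd_tl[of n r] sub_trans[OF ext_tail(2)[OF nat_n r(1)] e] unfolding sub_def by (metis mem_cup)
    then have "Dec a (cup (hd n r) (b m))"
      using Dec_mono[OF a(1) r(3) cnd_head_tail[OF Fn_isH[OF F'] b(1)]] by blast
    ultimately show ?thesis using F' by blast
  qed
  then show ?thesis using b by blast
qed

text \<open>Tails are extended \<open>K n\<close> times. A head has fewer than \<open>K n\<close> positions, so by regularity of \<open>K n\<close> each
  head considered in the end is already considered at an earlier stage.\<close>

theorem tail_decides:
  assumes t0: "isT n t0"
  obtains t where "isT n t" "sub t0 t"
    "\<And>a h. a \<epsilon> J \<Longrightarrow> Fn n t h \<Longrightarrow> \<exists>h'. Fn n t h' \<and> sub h h' \<and> Dec a (cup h' t)"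
proof -
  let ?R = "\<lambda>t t'. isT n t' \<and> sub t t' \<and> (\<forall>a h. a \<epsilon> J \<and> Fn n t h \<longrightarrow>
    (\<exists>h'. Fn n t' h' \<and> sub h h' \<and> Dec a (cup h' t')))"
  have R: "D2 ?R" unfolding D2_def by (intro dfi)
  have D: "D1 (isT n)" unfolding D1_def by (intro dfi)
  obtain c where "\<And>u. u \<epsilon> sep conds (isT n) \<Longrightarrow> ?R u (ap c u)"
    using choice_rel[OF R, of "sep conds (isT n)"] one_step unfolding mem_sep[OF D] by blast
  then have c: "?R u (ap c u)" if "isT n u" for u
    using that isT_cnd unfolding mem_sep[OF D] by simp
  have F: "F2 (\<lambda>x u. ap c u)" unfolding F2_def by (intro dfi)
  obtain b where bF: "F1 b" and b: "isT n (b (K n))" "sub t0 (b (K n))"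
    "\<And>x. x \<epsilon> K n \<Longrightarrow> isT n (b x) \<and> sub t0 (b x)"
    "\<And>x y. x \<epsilon> y \<Longrightarrow> y \<epsilon> suc (K n) \<Longrightarrow> sub (ap c (b x)) (b y)"
    "\<And>z. z \<epsilon> b (K n) \<Longrightarrow> z \<epsilon> t0 \<or> (\<exists>x. x \<epsilon> K n \<and> z \<epsilon> ap c (b x))"
    by (rule chain[OF nat_n K_mem_suc[OF nat_n] F t0]) (use c in blast)+
  note [dfi] = F1I[OF bF]
  note k = reg_K[OF nat_n]
  have mono: "sub (b x) (b y)" if "x \<epsilon> y" "y \<epsilon> K n" for x y
  proof -
    have "x \<epsilon> K n" using that Ord_trans[OF regD(1)[OF k]] by blast
    then have "sub (b x) (ap c (b x))" using b(3) c by blast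
    then show ?thesis using b(4)[OF that(1)] that(2) sub_trans by (metis mem_suc)
  qed
  have early: "\<exists>x. x \<epsilon> K n \<and> Fn n (b x) h" if h: "Fn n (b (K n)) h" for h
  proof -
    let ?in = "\<lambda>u x. u \<epsilon> slc (suc n) (b x)"
    have ex: "\<exists>x. x \<epsilon> K n \<and> ?in u x" if "u \<epsilon> pos n h" for u
    proof -
      have "?in u (K n)" using that h unfolding mem_pos Fn_def by blast
      then obtain y where y: "pair (pair (suc n) u) y \<epsilon> b (K n)" by auto
      have 0: "emp \<epsilon> K n" using regD(2)[OF k natural_emp] .
      from b(5)[OF y] consider "pair (pair (suc n) u) y \<epsilon> t0"
        | x where "x \<epsilon> K n" "pair (pair (suc n) u) y \<epsilon> ap c (b x)" by blast
      then show ?thesis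
      proof cases
        case 1
        then have "pair (pair (suc n) u) y \<epsilon> b emp" using b(3)[OF 0] by (auto simp: sub_def)
        then show ?thesis using 0 by auto
      next
        case 2
        have s: "suc x \<epsilon> K n" using regD(3)[OF k 2(1)] .
        have "sub (ap c (b x)) (b (suc x))" by (rule b(4)) (use s in auto)
        then show ?thesis using 2(2) s by (auto simp: sub_def)
      qed
    qed
    \<comment> \<open>Each position of \<open>h\<close> is assigned the least stage at which it is
      admissible. These stages form a small subset of \<open>K n\<close> and so have a bound below
      \<open>K n\<close>.\<close>
    let ?L = "\<lambda>u x. x \<epsilon> K n \<and> ?in u x \<and> (\<forall>y. y \<epsilon> x \<longrightarrow> \<not> ?in u y)"
    have L: "D2 ?L" and LD: "D1 (\<lambda>x. \<exists>u. u \<epsilon> pos n h \<and> ?L u x)" and LE: "D1 (\<lambda>x. x \<epsilon> K n \<and> ?in u x)" for u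
      unfolding D2_def D1_def by (intro dfi)+
    let ?Y = "sep (K n) (\<lambda>x. \<exists>u. u \<epsilon> pos n h \<and> ?L u x)"
    have OK: "Ord x" if "x \<epsilon> K n" for x using that Ord_in[OF regD(1)[OF k]] by blast
    have "cov (pos n h) ?Y"
    proof (rule covI[OF L])
      show "x = y" if "?L u x" "?L u y" for u x y using that Ord_linear[OF OK OK, of x y] by blast
    qed (use mem_sep[OF LD] in blast)
    then have "sm (K n) ?Y"
      using sm_cov[OF sm_pos[OF nat_n isH_cnd[OF Fn_isH[OF h]]]] by blast
    moreover have "sub ?Y (K n)" unfolding sub_def mem_sep[OF LD] by blast
    ultimately obtain x where x: "x \<epsilon> K n" "sub ?Y x" using reg_bounded[OF k] by blast
    have "?in u x" if u: "u \<epsilon> pos n h" for u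
    proof -
      obtain z where z: "z \<epsilon> K n \<and> ?in u z" using ex[OF u] by blast
      then have "Ord z" using OK by blast
      from Ord_least_ex[OF LE this z] obtain y where
        y: "y \<epsilon> K n \<and> ?in u y" "\<forall>c. c \<epsilon> y \<longrightarrow> \<not> (c \<epsilon> K n \<and> ?in u c)" by blast
      then have y: "?L u y" using Ord_trans[OF regD(1)[OF k]] by blast
      then have "y \<epsilon> ?Y" unfolding mem_sep[OF LD] using u by blast
      then have "y \<epsilon> x" using x(2) by (auto simp: sub_def)
      then show ?thesis using y mono[OF _ x(1)] by (auto simp: sub_def)
    qed
    then have "Fn n (b x) h" using h unfolding Fn_def mem_pos isH_def by blast
    then show ?thesis using x(1) by blast
  qed
  show ?thesis
  proof (rule that[OF b(1,2)])
    fix a h assume a: "a \<epsilon> J" "Fn n (b (K n)) h"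
    then obtain x where x: "x \<epsilon> K n" "Fn n (b x) h" using early by blast
    have s: "sub (ap c (b x)) (b (K n))" by (rule b(4)[OF x(1)]) simp
    obtain h' where h': "Fn n (ap c (b x)) h'" "sub h h'" "Dec a (cup h' (ap c (b x)))"
      using c[of "b x"] b(3)[OF x(1)] a(1) x(2) by blast
    have F': "Fn n (b (K n)) h'" using Fn_mono[OF h'(1) s] .
    have "sub (cup h' (ap c (b x))) (cup h' (b (K n)))" using s by (auto simp: sub_def)
    then have "Dec a (cup h' (b (K n)))"
      using Dec_mono[OF a(1) h'(3) cnd_head_tail[OF Fn_isH[OF F'] b(1)]] by blast
    then show "\<exists>h'. Fn n (b (K n)) h' \<and> sub h h' \<and> Dec a (cup h' (b (K n)))" using F' h'(2) by blast
  qed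
qed

end

section \<open>The symmetric extension\<close>

locale sym_ext = zfc E + generic_ext E "zfc.conds E" "zfc.HS E" G v EN
  for E :: "'a \<Rightarrow> 'a \<Rightarrow> bool"  (infix "\<epsilon>" 50) and G v EN

sublocale sym_ext \<subseteq> N: zf EN
  by (rule N_zf)

context sym_ext
begin

abbreviation inN  (infix "\<in>\<^sub>N" 50) where "x \<in>\<^sub>N y \<equiv> EN x y"

section \<open>The embedding of the ground model\<close>

definition c where "c x = v (chk x)"

lemma mem_c: "a \<in>\<^sub>N c x \<longleftrightarrow> (\<exists>y. y \<epsilon> x \<and> a = c y)"
  unfolding c_def by (rule v_chk_mem)

text \<open>By induction on membership, elements of check names can be matched only with the names
  of equal sets. Hence the embedding is injective.\<close>

lemma feq_chk: "feq p (chk x) (chk y) \<Longrightarrow> x = y"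
proof -
  have D: "D1 (\<lambda>x. \<forall>y p. feq p (chk x) (chk y) \<longrightarrow> x = y)" unfolding D1_def by (intro dfi)
  have h: "\<exists>w s. w \<epsilon> y \<and> feq s (chk z) (chk w)" if "feq p (chk x) (chk y)" "z \<epsilon> x" for p x y z
  proof -
    have "half feq p (chk x) (chk y)" "p \<epsilon> conds" using that(1) feq_iff by blast+
    moreover have "pair (chk z) emp \<epsilon> chk x" using that(2) mem_chk by blast
    ultimately obtain s \<sigma> t where "pair \<sigma> t \<epsilon> chk y" "feq s (chk z) \<sigma>"
      using halfD[of feq p "chk x" "chk y" "chk z" emp p] emp_P sub_refl by (metis mem_emp sub_def)
    then show ?thesis unfolding mem_chk by auto
  qed
  have "\<forall>y p. feq p (chk x) (chk y) \<longrightarrow> x = y"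
  proof (rule eps_induct[OF D], intro allI impI)
    fix x y p assume IH: "\<And>z. z \<epsilon> x \<Longrightarrow> \<forall>y p. feq p (chk z) (chk y) \<longrightarrow> z = y"
      and e: "feq p (chk x) (chk y)"
    have "z \<epsilon> x \<longleftrightarrow> z \<epsilon> y" for z
    proof
      assume z: "z \<epsilon> x"
      then obtain w s where "w \<epsilon> y" "feq s (chk z) (chk w)" using h[OF e] by blast
      then show "z \<epsilon> y" using IH[OF z] by blast
    next
      assume "z \<epsilon> y"
      then obtain w s where "w \<epsilon> x" "feq s (chk z) (chk w)" using h[OF feq_sym[OF e]] by blast
      then show "z \<epsilon> x" using IH feq_sym by blast
    qed
    then show "x = y" by (rule ext)
  qed
  then show "feq p (chk x) (chk y) \<Longrightarrow> x = y" by blast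
qed

lemma c_eq [simp]: "c x = c y \<longleftrightarrow> x = y"
  unfolding c_def v_eq[OF HS_chk HS_chk] using feq_chk feq_refl emp_G emp_P by blast

lemma c_mem [simp]: "c x \<in>\<^sub>N c y \<longleftrightarrow> x \<epsilon> y"
  by (auto simp: mem_c)

lemma c_sub [simp]: "N.sub (c x) (c y) \<longleftrightarrow> sub x y"
  by (auto simp: N.sub_def sub_def mem_c)

lemma sub_cD: "N.sub a (c x) \<Longrightarrow> z \<in>\<^sub>N a \<Longrightarrow> \<exists>y. y \<epsilon> x \<and> z = c y"
  by (auto simp: N.sub_def mem_c)

lemma c_emp [simp]: "c emp = N.emp"
  by (rule N.ext) (auto simp: mem_c)

lemma c_upr [simp]: "N.upr (c x) (c y) = c (upr x y)"
  by (rule N.ext) (auto simp: mem_c)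

lemma c_pair [simp]: "N.pair (c x) (c y) = c (pair x y)"
  by (simp add: N.pair_def pair_def)

lemma c_suc [simp]: "N.suc (c x) = c (suc x)"
  by (rule N.ext) (auto simp: mem_c)

text \<open>Elements of embedded sets are embedded sets, and the components of a pair are elements
  of its elements.\<close>

lemma c_pairD: assumes "N.pair a b = c z" obtains x y where "a = c x" "b = c y" "z = pair x y"
proof -
  have "N.upr a a \<in>\<^sub>N c z" "N.upr a b \<in>\<^sub>N c z" using assms by (auto simp: N.pair_def[symmetric] simp flip: assms) (simp_all add: N.pair_def)
  then obtain p q where "N.upr a a = c p" "N.upr a b = c q" unfolding mem_c by blast
  then have "a \<in>\<^sub>N c p" "b \<in>\<^sub>N c q" by (metis N.mem_upr)+
  then obtain x y where "a = c x" "b = c y" unfolding mem_c by blast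
  then show ?thesis using that assms by simp
qed

lemma c_Ord [simp]: "N.Ord (c x) \<longleftrightarrow> Ord x"
proof -
  have t: "N.trs (c x) \<longleftrightarrow> trs x" for x by (auto simp: N.trs_def trs_def mem_c)
  then show ?thesis by (auto simp: N.Ord_def Ord_def mem_c)
qed

lemma c_om: "N.om = c om"
proof (rule N.om_unique[symmetric])
  have l: "N.lim (c x) \<longleftrightarrow> lim x" for x
    by (auto simp: N.lim_def lim_def mem_c simp flip: c_emp)
  show "N.lim (c om)" using l lim_om by blast
  show "\<forall>y. y \<in>\<^sub>N c om \<longrightarrow> \<not> N.lim y" using l not_lim_natural by (auto simp: mem_c)
qed

lemma c_natural [simp]: "N.natural (c n) \<longleftrightarrow> natural n"
  using c_mem[of n om] N.mem_om[of "c n"] by (simp add: c_om)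

lemma N_naturalD: "N.natural a \<Longrightarrow> \<exists>n. natural n \<and> a = c n"
  using N.mem_om[of a] by (auto simp: c_om mem_c)

lemma c_func: "func f \<Longrightarrow> N.func (c f)"
  unfolding N.func_def
proof (intro allI impI)
  fix x y z assume f: "func f" and *: "N.pair x y \<in>\<^sub>N c f" "N.pair x z \<in>\<^sub>N c f"
  then obtain p q where p: "p \<epsilon> f" "N.pair x y = c p" and q: "q \<epsilon> f" "N.pair x z = c q"
    unfolding mem_c by blast
  obtain a b where a: "x = c a" "y = c b" "p = pair a b" using c_pairD[OF p(2)] .
  obtain a' d where d: "x = c a'" "z = c d" "q = pair a' d" using c_pairD[OF q(2)] .
  show "y = z" using a d p q funcD[OF f] by auto
qed

lemma c_cov: "cov a x \<Longrightarrow> N.cov (c a) (c x)"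
proof -
  assume "cov a x"
  then obtain f where "func f" "\<And>z. z \<epsilon> x \<Longrightarrow> \<exists>u. u \<epsilon> a \<and> pair u z \<epsilon> f" unfolding cov_def by blast
  then show ?thesis
    unfolding N.cov_def by (intro exI[of _ "c f"]) (auto simp: c_func mem_c, metis c_mem c_pair)
qed

lemma EN_c_v: "HS x \<Longrightarrow> c a \<in>\<^sub>N v x \<longleftrightarrow> (\<exists>p. p \<in> G \<and> fmem p (chk a) x)"
  unfolding c_def by (rule EN_v[OF HS_chk])

lemma G_cnd: "p \<in> G \<Longrightarrow> cnd p" using G_P by simp

lemma G_sub: "p \<in> G \<Longrightarrow> sub q p \<Longrightarrow> q \<in> G"
  using G_up G_cnd cnd_sub by (metis mem_conds)

lemma G_cup: "p \<in> G \<Longrightarrow> q \<in> G \<Longrightarrow> cup p q \<in> G"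
proof -
  assume "p \<in> G" "q \<in> G"
  then obtain r where "r \<in> G" "sub p r" "sub q r" using G_dir by blast
  then show ?thesis using G_sub[of r "cup p q"] by (auto simp: sub_def)
qed

lemma G_functional: "p \<in> G \<Longrightarrow> q \<in> G \<Longrightarrow> pair u y \<epsilon> p \<Longrightarrow> pair u z \<epsilon> q \<Longrightarrow> y = z"
  using funcD[OF cnd_func[OF G_cnd[OF G_cup]], of p q u y z] by simp

text \<open>By density \<open>G\<close> has a tail as in \<open>tail_decides\<close>. Below this
  tail, for every statement, the conditions that contain a deciding head are dense in turn.\<close>

lemma decided_in_G:
  assumes "decision E Dec n J"
  obtains t where "t \<in> G" "isT n t"
    "\<And>a. a \<epsilon> J \<Longrightarrow> \<exists>h. h \<in> G \<and> Fn n t h \<and> cup h t \<in> G \<and> Dec a (cup h t)"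
proof -
  interpret decision E Dec n J by (rule assms)
  let ?PT = "\<lambda>t. isT n t \<and> (\<forall>a h. a \<epsilon> J \<and> Fn n t h \<longrightarrow>
    (\<exists>h'. Fn n t h' \<and> sub h h' \<and> Dec a (cup h' t)))"
  have "D1 (\<lambda>q. ?PT (tl n q))" unfolding D1_def by (intro dfi)
  moreover have "\<exists>q. q \<epsilon> conds \<and> sub p q \<and> ?PT (tl n q)" if p: "p \<epsilon> conds" for p
  proof -
    have cp: "cnd p" using p by simp
    obtain t where t: "isT n t" "sub (tl n p) t"
      "\<And>a h. a \<epsilon> J \<Longrightarrow> Fn n t h \<Longrightarrow> \<exists>h'. Fn n t h' \<and> sub h h' \<and> Dec a (cup h' t)"
      using tail_decides[OF isT_tl[OF cp]] by blast
    have tt: "\<not> fstp (fstp z) \<epsilon> suc n" if z: "z \<epsilon> t" for z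
    proof -
      obtain k x y where "z = pair (pair k x) y" using cnd_elem'[OF isT_cnd[OF t(1)] z] by blast
      then show ?thesis using t(1) z unfolding isT_def fstp_pair by (metis fstp_pair)
    qed
    have "tl n (cup (hd n p) t) = t" by (rule ext) (use tt in \<open>auto simp del: mem_suc\<close>)
    moreover have "sub p (cup (hd n p) t)"
      using t(2) cup_hd_tl[of n p] unfolding sub_def by (metis mem_cup)
    ultimately show ?thesis
      using cnd_head_tail[OF isH_hd[OF cp] t(1)] t(1,3) by (intro exI[of _ "cup (hd n p) t"]) auto
  qed
  ultimately obtain q where q: "q \<in> G" "?PT (tl n q)" using G_dense[of "\<lambda>q. ?PT (tl n q)"] by blast
  define t where "t = tl n q"
  have t: "isT n t" "\<And>a h. a \<epsilon> J \<Longrightarrow> Fn n t h \<Longrightarrow> \<exists>h'. Fn n t h' \<and> sub h h' \<and> Dec a (cup h' t)"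
    using q(2) unfolding t_def by blast+
  have tG: "t \<in> G" using G_sub[OF q(1)] unfolding t_def by (simp add: sub_def)
  show ?thesis
  proof (rule that[OF tG t(1)])
    fix a assume a: "a \<epsilon> J"
    let ?D = "\<lambda>q. \<exists>h. Fn n t h \<and> sub h q \<and> Dec a (cup h t)"
    have D: "D1 ?D" unfolding D1_def by (intro dfi)
    have "\<exists>s. s \<epsilon> conds \<and> sub q s \<and> ?D s" if q: "q \<epsilon> conds" "sub t q" for q
    proof -
      have cq: "cnd q" using q by simp
      have S: "D1 (\<lambda>z. sndp (fstp z) \<epsilon> slc (suc n) t)" unfolding D1_def by (intro dfi)
      \<comment> \<open>The part of the head of \<open>q\<close> that \<open>t\<close> considers.
        All positions of an extension \<open>h'\<close> considered by \<open>t\<close> are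
        admissible, and there \<open>q\<close> agrees with \<open>h\<close>, so \<open>q\<close> and
        \<open>h'\<close> are compatible.\<close>
      define h where "h = sep (hd n q) (\<lambda>z. sndp (fstp z) \<epsilon> slc (suc n) t)"
      have h: "z \<epsilon> h \<longleftrightarrow> z \<epsilon> hd n q \<and> sndp (fstp z) \<epsilon> slc (suc n) t" for z
        unfolding h_def by (rule mem_sep[OF S])
      have "isH n h" by (rule isH_sub[OF isH_hd[OF cq]]) (simp add: sub_def h)
      then have "Fn n t h" unfolding Fn_def h by simp
      then obtain h' where h': "Fn n t h'" "sub h h'" "Dec a (cup h' t)" using t(2)[OF a] by blast
      note ch = isH_cnd[OF Fn_isH[OF h'(1)]]
      have "y = z" if yz: "pair u y \<epsilon> q" "pair u z \<epsilon> h'" for u y z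
      proof -
        obtain m x where u: "u = pair m x" using cnd_elem[OF ch yz(2)] by metis
        have "m \<epsilon> suc n" "x \<epsilon> slc (suc n) t"
          using h'(1) yz(2) unfolding Fn_def isH_def u by blast+
        then have "pair u y \<epsilon> h" unfolding h u using yz(1) u by simp
        then show ?thesis using h'(2) yz(2) funcD[OF cnd_func[OF ch]] by (auto simp: sub_def)
      qed
      then have "func (cup q h')"
        using cnd_func[OF cq] cnd_func[OF ch] unfolding func_def mem_cup by metis
      then have "cnd (cup q h')" by (rule cnd_cup[OF cq ch])
      then show ?thesis using h'(1,3) by (intro exI[of _ "cup q h'"]) (auto simp: sub_def)
    qed
    from G_dense_below[OF D tG this] obtain s h where
      "s \<in> G" "Fn n t h" "sub h s" "Dec a (cup h t)" by blast
    then show "\<exists>h. h \<in> G \<and> Fn n t h \<and> cup h t \<in> G \<and> Dec a (cup h t)"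
      using G_sub G_cup tG by blast
  qed
qed

subsection \<open>The heads of the generic filter\<close>

text \<open>A name for the set of heads in \<open>G\<close>. It is symmetric because toggles beyond
  coordinate \<open>n\<close> leave all heads fixed, and it brings the first generic functions into
  the extension.\<close>

definition gam where "gam n = rep (sep conds (isH n)) (\<lambda>h. pair (chk h) h)"

lemma mem_gam: "z \<epsilon> gam n \<longleftrightarrow> (\<exists>h. isH n h \<and> z = pair (chk h) h)"
proof -
  have F: "F1 (\<lambda>h. pair (chk h) h)" and D: "D1 (isH n)" unfolding F1_def D1_def by (intro dfi)+
  show ?thesis unfolding gam_def mem_rep[OF F] mem_sep[OF D] using isH_cnd by auto
qed

lemma HS_gam: assumes n: "natural n" shows "HS (gam n)"
proof (rule HSI)
  have "supp (suc n) (gam n)"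
  proof (rule supp_closedI)
    show "\<exists>\<rho> r. z = pair \<rho> r \<and> cnd r \<and> HS \<rho>" if "z \<epsilon> gam n" for z
      using that mem_gam HS_chk isH_cnd by blast
    fix h \<rho> r assume h: "fixg (suc n) h" and "pair \<rho> r \<epsilon> gam n"
    then have r: "isH n r" "\<rho> = chk r" unfolding mem_gam by auto
    have "hact h r = r"
      by (rule hact_id[OF isH_cnd[OF r(1)]])
        (use h r(1) cnd_elem[OF isH_cnd[OF r(1)]] in \<open>unfold fixg_def isH_def, metis\<close>)
    then show "pair (act h \<rho>) (hact h r) \<epsilon> gam n" unfolding mem_gam using r act_chk by auto
  qed
  then show "symn (gam n)" unfolding symn_def using mem_gam isH_cnd natural_suc[OF n] by blast
  show "HS \<rho>" if "pair \<rho> r \<epsilon> gam n" for \<rho> r using that HS_chk unfolding mem_gam by auto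
qed

lemma mem_v_gam: "natural n \<Longrightarrow> a \<in>\<^sub>N v (gam n) \<longleftrightarrow> (\<exists>h. h \<in> G \<and> isH n h \<and> a = c h)"
  unfolding EN_name[OF HS_gam] mem_gam c_def by auto

lemma cnd_single:
  assumes p: "cnd p" and n: "natural n" and x: "x \<epsilon> lm" and y: "y \<epsilon> Vs (K n)"
    and f: "\<not> x \<epsilon> slc n p"
  shows "cnd (cup p (upr (pair (pair n x) y) (pair (pair n x) y)))"
proof (rule cnd_cup[OF p])
  let ?s = "upr (pair (pair n x) y) (pair (pair n x) y)"
  have "sm (K m) (slc m ?s)" if m: "natural m" for m
    by (rule sm_sub[OF sm_upr[OF reg_K[OF m], of x x]]) (auto simp: sub_def)
  then show "cnd ?s" unfolding cnd_def func_def using n x y by auto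
  show "func (cup p ?s)"
    using cnd_func[OF p] f unfolding func_def mem_cup mem_upr by auto
qed

lemma total:
  assumes n: "natural n" and x: "x \<epsilon> lm" obtains y where "upr (pair (pair n x) y) (pair (pair n x) y) \<in> G"
proof -
  let ?D = "\<lambda>q. \<exists>y. pair (pair n x) y \<epsilon> q"
  have "D1 ?D" unfolding D1_def by (intro dfi)
  moreover have "\<exists>q. q \<epsilon> conds \<and> sub p q \<and> ?D q" if p: "p \<epsilon> conds" for p
  proof (cases "?D p")
    case True
    then show ?thesis using p sub_refl by blast
  next
    case False
    let ?s = "upr (pair (pair n x) emp) (pair (pair n x) emp)"
    have "emp \<epsilon> Vs (K n)"
      using regD(2)[OF reg_K[OF n] natural_emp] Ord_sub_Vs[OF Ord_K[OF n]] by (auto simp: sub_def)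
    then have "cnd (cup p ?s)" using cnd_single[OF _ n x, of p emp] False p by simp
    then show ?thesis by (intro exI[of _ "cup p ?s"]) (auto simp: sub_def)
  qed
  ultimately obtain q y where "q \<in> G" "pair (pair n x) y \<epsilon> q" using G_dense[of ?D] by blast
  then show ?thesis using that[of y] G_sub[of q] by (auto simp: sub_def)
qed

lemma entry: "N.pair (N.pair (c n) a) y \<in>\<^sub>N c p \<longleftrightarrow> (\<exists>x w. a = c x \<and> y = c w \<and> pair (pair n x) w \<epsilon> p)"
proof
  assume "N.pair (N.pair (c n) a) y \<in>\<^sub>N c p"
  then obtain z where z: "z \<epsilon> p" "N.pair (N.pair (c n) a) y = c z" unfolding mem_c by blast
  obtain u w where u: "N.pair (c n) a = c u" "y = c w" "z = pair u w" using c_pairD[OF z(2)] .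
  obtain m x where m: "c n = c m" "a = c x" "u = pair m x" using c_pairD[OF u(1)] .
  show "\<exists>x w. a = c x \<and> y = c w \<and> pair (pair n x) w \<epsilon> p" using z u m by auto
qed auto

lemma gam_entry:
  assumes n: "natural n"
  shows "(\<exists>h. h \<in>\<^sub>N v (gam n) \<and> N.pair (N.pair (c n) a) y \<in>\<^sub>N h) \<longleftrightarrow>
    (\<exists>x w h. a = c x \<and> y = c w \<and> h \<in> G \<and> pair (pair n x) w \<epsilon> h)"
proof
  assume "\<exists>h. h \<in>\<^sub>N v (gam n) \<and> N.pair (N.pair (c n) a) y \<in>\<^sub>N h"
  then show "\<exists>x w h. a = c x \<and> y = c w \<and> h \<in> G \<and> pair (pair n x) w \<epsilon> h"
    unfolding mem_v_gam[OF n] using entry by blast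
next
  assume "\<exists>x w h. a = c x \<and> y = c w \<and> h \<in> G \<and> pair (pair n x) w \<epsilon> h"
  then obtain x w h where x: "a = c x" "y = c w" "h \<in> G" "pair (pair n x) w \<epsilon> h" by blast
  then have "hd n h \<in> G" "isH n (hd n h)" "pair (pair n x) w \<epsilon> hd n h"
    using G_sub[of h "hd n h"] isH_hd G_cnd by (auto simp: sub_def)
  then show "\<exists>h. h \<in>\<^sub>N v (gam n) \<and> N.pair (N.pair (c n) a) y \<in>\<^sub>N h"
    unfolding mem_v_gam[OF n] x(1,2) using entry by blast
qed

lemma frc_rename: "frc C p e (rename f \<phi>) = frc C p (\<lambda>n. e (f n)) \<phi>"
proof (induction \<phi> arbitrary: p e f)
  case (Forall \<phi>)
  have "(\<lambda>n. case_nat a e (case n of 0 \<Rightarrow> 0 | Suc n \<Rightarrow> Suc (f n))) = case_nat a (\<lambda>n. e (f n))" for a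
    by (auto simp: fun_eq_iff split: nat.splits)
  then show ?case by (simp add: Forall)
qed auto

subsection \<open>Cardinals of the extension\<close>

text \<open>A condition has fewer than \<open>K n\<close> entries at coordinate \<open>n\<close>, so
  some argument below \<open>K n\<close> is still free for any prescribed value.\<close>

lemma N_collapse:
  assumes n: "natural n" shows "N.cov (c (K n)) (c (Vs (K n)))"
proof (rule N.covI[of "\<lambda>a y. \<exists>h. h \<in>\<^sub>N v (gam n) \<and> N.pair (N.pair (c n) a) y \<in>\<^sub>N h"])
  show "N.D2 (\<lambda>a y. \<exists>h. h \<in>\<^sub>N v (gam n) \<and> N.pair (N.pair (c n) a) y \<in>\<^sub>N h)"
    unfolding N.D2_def by (intro dfi)
  show "y = z" if "\<exists>h. h \<in>\<^sub>N v (gam n) \<and> N.pair (N.pair (c n) a) y \<in>\<^sub>N h"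
    "\<exists>h. h \<in>\<^sub>N v (gam n) \<and> N.pair (N.pair (c n) a) z \<in>\<^sub>N h" for a y z
    using that G_functional unfolding gam_entry[OF n] by auto
  fix z assume "z \<in>\<^sub>N c (Vs (K n))"
  then obtain y where y: "y \<epsilon> Vs (K n)" "z = c y" unfolding mem_c by blast
  let ?D = "\<lambda>q. \<exists>x. x \<epsilon> K n \<and> pair (pair n x) y \<epsilon> q"
  have "D1 ?D" unfolding D1_def by (intro dfi)
  moreover have "\<exists>q. q \<epsilon> conds \<and> sub p q \<and> ?D q" if p: "p \<epsilon> conds" for p
  proof -
    have "\<exists>x. x \<epsilon> K n \<and> \<not> x \<epsilon> slc n p"
      using sm_sub[OF cnd_slc[OF _ n], of p "K n"] regD(4)[OF reg_K[OF n]] p by (auto simp: sub_def)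
    then obtain x where x: "x \<epsilon> K n" "\<not> x \<epsilon> slc n p" by blast
    let ?q = "cup p (upr (pair (pair n x) y) (pair (pair n x) y))"
    have "x \<epsilon> lm" using x(1) n mem_lm by blast
    then have "cnd ?q" using cnd_single[OF _ n _ y(1) x(2)] p by simp
    then show ?thesis using x(1) by (intro exI[of _ ?q]) (auto simp: sub_def)
  qed
  ultimately obtain q where "q \<in> G" "?D q" using G_dense[of ?D] by blast
  then obtain x where x: "x \<epsilon> K n" "pair (pair n x) y \<epsilon> q" by blast
  then have "c x \<in>\<^sub>N c (K n)" "\<exists>h. h \<in>\<^sub>N v (gam n) \<and> N.pair (N.pair (c n) (c x)) z \<in>\<^sub>N h"
    unfolding gam_entry[OF n] using y(2) \<open>q \<in> G\<close> by auto
  then show "\<exists>a. a \<in>\<^sub>N c (K n) \<and> (\<exists>h. h \<in>\<^sub>N v (gam n) \<and> N.pair (N.pair (c n) a) z \<in>\<^sub>N h)" by blast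
qed

lemma N_cov_K:
  assumes n: "natural n" and b: "b \<epsilon> K (suc n)" shows "N.cov (c (K n)) (c b)"
proof -
  have "cov (Vs (K n)) b" using b by (simp add: K_suc[OF n] nx_def mem_hart)
  then show ?thesis using N.cov_trans[OF N_collapse[OF n] c_cov] by blast
qed

lemma frc_compat:
  assumes "p \<in> G" "q \<in> G" "frc HS p e a" "\<And>s. s \<epsilon> conds \<and> sub q s \<Longrightarrow> \<not> frc HS s e a"
  shows False
proof -
  obtain r where "r \<in> G" "sub p r" "sub q r" using G_dir assms(1,2) by blast
  then show False using frc_mono[OF assms(3)] assms(4) G_P by blast
qed

text \<open>A single tail in \<open>G\<close> decides a subset of \<open>K n\<close> up to the heads, so the subset can be recovered from a
  ground model relation between heads and ordinals.\<close>

theorem N_Pow_covered: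
  assumes n: "natural n" shows "\<exists>d. N.Ord d \<and> N.cov d (N.pw (c (K n)))"
proof -
  let ?S = "pw (prod conds (K n))"
  let ?\<Gamma> = "v (gam n)"
  let ?R = "\<lambda>w x. N.sub x (c (K n)) \<and>
    (\<forall>a. a \<in>\<^sub>N c (K n) \<longrightarrow> (a \<in>\<^sub>N x \<longleftrightarrow> (\<exists>h. h \<in>\<^sub>N ?\<Gamma> \<and> N.pair h a \<in>\<^sub>N w)))"
  have "N.cov (c ?S) (N.pw (c (K n)))"
  proof (rule N.covI[of ?R])
    show "N.D2 ?R" unfolding N.D2_def by (intro dfi)
    show "x = y" if "?R w x" "?R w y" for w x y
      by (rule N.ext) (use that in \<open>unfold N.sub_def, blast\<close>)
    fix x assume "x \<in>\<^sub>N N.pw (c (K n))"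
    then have x: "N.sub x (c (K n))" by simp
    obtain x' where x': "HS x'" "v x' = x" using v_surj by blast
    let ?Dec = "\<lambda>a p. fmem p (chk a) x' \<or> (\<forall>q. q \<epsilon> conds \<and> sub p q \<longrightarrow> \<not> fmem q (chk a) x')"
    have dec: "decision E ?Dec n (K n)"
    proof
      show "D2 ?Dec" unfolding D2_def by (intro dfi)
      show "cov (Vs (K n)) (K n)"
        using cov_mono[OF cov_refl sub_refl Ord_sub_Vs[OF Ord_K[OF n]]] .
      show "?Dec a q" if "?Dec a p" "cnd q" "sub p q" for a p q
        using that fmem_mono sub_trans by blast
      show "\<exists>q. cnd q \<and> sub p q \<and> ?Dec a q" if "cnd p" for a p
      proof (cases "\<exists>q. q \<epsilon> conds \<and> sub p q \<and> fmem q (chk a) x'")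
        case True
        then show ?thesis using mem_conds by blast
      next
        case False
        then show ?thesis using that sub_refl by blast
      qed
    qed (rule n)
    obtain t where t: "t \<in> G" "isT n t"
      "\<And>a. a \<epsilon> K n \<Longrightarrow> \<exists>h. h \<in> G \<and> Fn n t h \<and> cup h t \<in> G \<and> ?Dec a (cup h t)"
      by (rule decided_in_G[OF dec], rule that)
    let ?P = "\<lambda>z. isH n (fstp z) \<and> fmem (cup (fstp z) t) (chk (sndp z)) x'"
    have P: "D1 ?P" unfolding D1_def by (intro dfi)
    define w where "w = sep (prod conds (K n)) ?P"
    have w: "pair h a \<epsilon> w \<longleftrightarrow> cnd h \<and> a \<epsilon> K n \<and> isH n h \<and> fmem (cup h t) (chk a) x'" for h a
      unfolding w_def mem_sep[OF P] by simp
    have ws: "w \<epsilon> ?S" unfolding w_def mem_pw sub_def mem_sep[OF P] by blast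
    have "a \<in>\<^sub>N x \<longleftrightarrow> (\<exists>h. h \<in>\<^sub>N ?\<Gamma> \<and> N.pair h a \<in>\<^sub>N c w)" if a: "a \<in>\<^sub>N c (K n)" for a
    proof -
      obtain b where b: "b \<epsilon> K n" "a = c b" using a unfolding mem_c by blast
      have "(\<exists>h. h \<in>\<^sub>N ?\<Gamma> \<and> N.pair h a \<in>\<^sub>N c w) \<longleftrightarrow> (\<exists>h. h \<in> G \<and> isH n h \<and> fmem (cup h t) (chk b) x')"
        unfolding mem_v_gam[OF n] b(2) using w b(1) G_cnd by auto
      also have "\<dots> \<longleftrightarrow> (\<exists>p. p \<in> G \<and> fmem p (chk b) x')"
      proof
        assume "\<exists>h. h \<in> G \<and> isH n h \<and> fmem (cup h t) (chk b) x'"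
        then show "\<exists>p. p \<in> G \<and> fmem p (chk b) x'" using G_cup t(1) by blast
      next
        assume "\<exists>p. p \<in> G \<and> fmem p (chk b) x'"
        then obtain p where p: "p \<in> G" "fmem p (chk b) x'" by blast
        obtain h where h: "h \<in> G" "Fn n t h" "cup h t \<in> G" "?Dec b (cup h t)" using t(3)[OF b(1)] by blast
        obtain r where "r \<in> G" "sub p r" "sub (cup h t) r" using G_dir p(1) h(3) by blast
        then have "fmem (cup h t) (chk b) x'" using h(4) fmem_mono[OF p(2)] G_P by blast
        then show "\<exists>h. h \<in> G \<and> isH n h \<and> fmem (cup h t) (chk b) x'" using h(1,2) Fn_isH by blast
      qed
      also have "\<dots> \<longleftrightarrow> a \<in>\<^sub>N x" using EN_c_v[OF x'(1)] x'(2) b(2) by blast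
      finally show ?thesis by blast
    qed
    then show "\<exists>u. u \<in>\<^sub>N c ?S \<and> ?R u x" using ws x by (intro exI[of _ "c w"]) simp
  qed
  moreover obtain d where "Ord d" "cov d ?S" using well_order by blast
  ultimately show ?thesis using N.cov_trans[OF c_cov] by (intro exI[of _ "c d"]) simp
qed

text \<open>For \<open>n = emp\<close> this is regularity of \<open>om\<close> in any model of ZF.
  For \<open>n = suc m\<close>, a tail beyond \<open>m\<close> decides all values up to heads; the
  possible values are indexed by pairs of an argument and a head, which \<open>Vs (K m)\<close>
  covers, so they are bounded by regularity of \<open>K n\<close> in the ground model.\<close>

theorem N_bounded:
  assumes n: "natural n" and b: "b \<epsilon> K n" and g: "N.func g"
  shows "\<exists>d. d \<epsilon> K n \<and> (\<forall>a x. a \<epsilon> b \<longrightarrow> x \<epsilon> K n \<longrightarrow> N.pair (c a) (c x) \<in>\<^sub>N g \<longrightarrow> x \<epsilon> d)"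
proof (cases "n = emp")
  case True
  have D: "N.D1 (\<lambda>x. \<exists>a. a \<in>\<^sub>N c b \<and> N.pair a x \<in>\<^sub>N g)" unfolding N.D1_def by (intro dfi)
  define s where "s = N.sep N.om (\<lambda>x. \<exists>a. a \<in>\<^sub>N c b \<and> N.pair a x \<in>\<^sub>N g)"
  have s: "x \<in>\<^sub>N s \<longleftrightarrow> x \<in>\<^sub>N N.om \<and> (\<exists>a. a \<in>\<^sub>N c b \<and> N.pair a x \<in>\<^sub>N g)" for x
    unfolding s_def by (rule N.mem_sep[OF D])
  have "N.cov (c b) s" unfolding N.cov_def using g s by blast
  moreover have "c b \<in>\<^sub>N N.om" using b True by (simp add: c_om del: N.mem_om)
  ultimately have "N.sm N.om s" unfolding N.sm_def by blast
  moreover have "N.sub s N.om" unfolding N.sub_def s by blast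
  ultimately obtain d where d: "d \<in>\<^sub>N N.om" "N.sub s d" using N.reg_bounded[OF N.reg_om] by blast
  then obtain d' where d': "d' \<epsilon> om" "d = c d'" unfolding c_om mem_c by blast
  have "x \<epsilon> d'" if "a \<epsilon> b" "x \<epsilon> K n" "N.pair (c a) (c x) \<in>\<^sub>N g" for a x
  proof -
    have "c x \<in>\<^sub>N s" unfolding s using that True c_mem by (metis K_emp c_om)
    then show ?thesis using N.subD[OF d(2)] d'(2) c_mem by metis
  qed
  then show ?thesis using d'(1) True by auto
next
  case False
  then obtain m where m: "natural m" "n = suc m" using natural_cases[OF n] by blast
  obtain g' where g': "HS g'" "v g' = g" using v_surj by blast
  \<comment> \<open>Under the quantifier, indices 1, 2 and 3 are \<open>x\<close>, \<open>a\<close>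
    and \<open>g\<close>. As uniqueness of the value is part of the formula, a condition can force
    it for at most one \<open>x\<close> even if it does not force \<open>g\<close> to be a
    function.\<close>
  let ?f = "\<^bold>\<forall>(app_fm 3 2 0 \<^bold>\<longleftrightarrow> 0 \<^bold>= 1)"
  let ?e = "\<lambda>x a. case_nat (chk x) (case_nat (chk a) (\<lambda>_. g'))"
  let ?F = "\<lambda>p x a. frc HS p (?e x a) ?f"
  have F3: "D3 ?F"
  proof -
    have *: "D3 (\<lambda>p x a. frc HS p (case_nat x (case_nat a (\<lambda>_. g'))) ?f)" by (rule frc_D(3))
    show ?thesis unfolding D3_def by (rule D3I[OF *]) (intro dfi)+
  qed
  note [dfi] = D3I[OF F3]
  have HSe: "HS (?e x a k)" for x a k using HS_chk g'(1) by (auto split: nat.split)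
  have ve: "(\<lambda>k. v (?e x a k)) = case_nat (c x) (case_nat (c a) (\<lambda>_. g))" for x a
    using g'(2) by (auto simp: fun_eq_iff c_def split: nat.split)
  have sat: "sat EN (\<lambda>k. v (?e x a k)) ?f \<longleftrightarrow> (\<forall>z. N.pair (c a) z \<in>\<^sub>N g \<longleftrightarrow> z = c x)" for x a
    unfolding ve
    by (simp only: sat.simps N.sat_app nat.case numeral_2_eq_2 numeral_3_eq_3 One_nat_def) blast
  have tr: "(\<exists>p. p \<in> G \<and> ?F p x a) \<longleftrightarrow> (\<forall>z. N.pair (c a) z \<in>\<^sub>N g \<longleftrightarrow> z = c x)" for x a
    using truth[of "?e x a" ?f] HSe sat by blast
  have Fuq: "x = y" if F: "?F p x a" "?F p y a" and p: "cnd p" for p x y a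
  proof -
    let ?x = "case_nat (chk x) (?e x a)" and ?y = "case_nat (chk x) (?e y a)"
    have pc: "p \<epsilon> conds" using p by simp
    have "frc HS p ?x (app_fm 3 2 0 \<^bold>\<longleftrightarrow> 0 \<^bold>= 1)" "frc HS p ?y (app_fm 3 2 0 \<^bold>\<longleftrightarrow> 0 \<^bold>= 1)"
      using F HS_chk unfolding frc.simps(5) by blast+
    then have 1: "frc HS p ?x (0 \<^bold>= 1 \<^bold>\<longrightarrow> app_fm 3 2 0)" and 2: "frc HS p ?y (app_fm 3 2 0 \<^bold>\<longrightarrow> 0 \<^bold>= 1)"
      unfolding frc_Conj[OF pc] by blast+
    have "frc HS p ?x (app_fm 3 2 0)"
      using 1 pc sub_refl feq_refl[OF pc] by simp
    moreover have "frc HS p ?x (app_fm 3 2 0) = frc HS p ?y (app_fm 3 2 0)"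
    proof -
      have "app_fm 3 2 0 = rename (\<lambda>k. if k = 0 then 0 else Suc k) (app_fm 2 1 0)"
        by (simp add: app_fm_def pair_fm_def upair_fm_def eval_nat_numeral)
      moreover have "(\<lambda>k. ?x (if k = 0 then 0 else Suc k)) = (\<lambda>k. ?y (if k = 0 then 0 else Suc k))"
        by (auto simp: fun_eq_iff split: nat.split)
      ultimately show ?thesis by (simp only: frc_rename)
    qed
    ultimately have "feq p (chk x) (chk y)" using 2 pc sub_refl by simp
    then show ?thesis by (rule feq_chk)
  qed
  let ?Dec = "\<lambda>a p. (\<exists>x. x \<epsilon> K n \<and> ?F p x a)
    \<or> (\<forall>x. x \<epsilon> K n \<longrightarrow> (\<forall>q. q \<epsilon> conds \<and> sub p q \<longrightarrow> \<not> ?F q x a))"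
  have cb: "cov (Vs (K m)) b" using b m by (simp add: K_suc nx_def mem_hart)
  have dec: "decision E ?Dec m b"
  proof
    show "D2 ?Dec" unfolding D2_def by (intro dfi)
    show "?Dec a q" if "?Dec a p" "cnd q" "sub p q" for a p q
      using that frc_mono sub_trans mem_conds by meson
    show "\<exists>q. cnd q \<and> sub p q \<and> ?Dec a q" if "cnd p" for a p
    proof (cases "\<exists>q x. q \<epsilon> conds \<and> sub p q \<and> x \<epsilon> K n \<and> ?F q x a")
      case True
      then show ?thesis using mem_conds by blast
    next
      case False
      then show ?thesis using that sub_refl by blast
    qed
  qed (rule m cb)+
  obtain t where t: "t \<in> G" "isT m t"
    "\<And>a. a \<epsilon> b \<Longrightarrow> \<exists>h. h \<in> G \<and> Fn m t h \<and> cup h t \<in> G \<and> ?Dec a (cup h t)"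
    by (rule decided_in_G[OF dec], rule that)
  let ?Q = "\<lambda>x. \<exists>a h. a \<epsilon> b \<and> Fn m t h \<and> ?F (cup h t) x a"
  have Q: "D1 ?Q" unfolding D1_def by (intro dfi)
  define s where "s = sep (K n) ?Q"
  have s: "x \<epsilon> s \<longleftrightarrow> x \<epsilon> K n \<and> ?Q x" for x unfolding s_def by (rule mem_sep[OF Q])
  have "cov (prod b (FnS m t)) s"
  proof (rule covI[of "\<lambda>w x. Fn m t (sndp w) \<and> ?F (cup (sndp w) t) x (fstp w)"])
    show "D2 (\<lambda>w x. Fn m t (sndp w) \<and> ?F (cup (sndp w) t) x (fstp w))" unfolding D2_def by (intro dfi)
    show "x = y" if "Fn m t (sndp w) \<and> ?F (cup (sndp w) t) x (fstp w)"
      "Fn m t (sndp w) \<and> ?F (cup (sndp w) t) y (fstp w)" for w x y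
      using that Fuq cnd_head_tail[OF Fn_isH t(2)] by blast
    show "\<exists>w. w \<epsilon> prod b (FnS m t) \<and> Fn m t (sndp w) \<and> ?F (cup (sndp w) t) x (fstp w)" if x: "x \<epsilon> s" for x
    proof -
      obtain a h where "a \<epsilon> b" "Fn m t h" "?F (cup h t) x a" using x unfolding s by blast
      then show ?thesis by (intro exI[of _ "pair a h"]) simp
    qed
  qed
  then have "cov (Vs (K m)) s"
    using cov_trans[OF cov_prod[OF reg_Vs_pair[OF reg_K[OF m(1)]] cb cov_FnS[OF m(1) t(2)]]] by blast
  then have "sm (K n) s" by (simp add: m K_suc sm_nx)
  moreover have "sub s (K n)" unfolding sub_def s by blast
  ultimately obtain d where d: "d \<epsilon> K n" "sub s d" using reg_bounded[OF reg_K[OF n]] by blast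
  have "x \<epsilon> d" if x: "a \<epsilon> b" "x \<epsilon> K n" "N.pair (c a) (c x) \<in>\<^sub>N g" for a x
  proof -
    have "\<forall>z. N.pair (c a) z \<in>\<^sub>N g \<longleftrightarrow> z = c x" using x(3) N.funcD[OF g] by blast
    then obtain p where p: "p \<in> G" "?F p x a" using tr by blast
    obtain h where h: "h \<in> G" "Fn m t h" "cup h t \<in> G" "?Dec a (cup h t)" using t(3)[OF x(1)] by blast
    have "\<exists>y. y \<epsilon> K n \<and> ?F (cup h t) y a"
      using h(4) frc_compat[OF p(1) h(3) p(2)] x(2) by blast
    then obtain y where y: "y \<epsilon> K n" "?F (cup h t) y a" by blast
    then have "\<forall>z. N.pair (c a) z \<in>\<^sub>N g \<longleftrightarrow> z = c y" using tr h(3) by blast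
    then have "c x = c y" using x(3) by blast
    then have "x = y" by simp
    then have "x \<epsilon> s" unfolding s using x(1) y h(2) by blast
    then show ?thesis using d(2) by (auto simp: sub_def)
  qed
  then show ?thesis using d(1) by blast
qed

subsection \<open>No uniform ultrafilter on the supremum\<close>

text \<open>The subset of \<open>lm\<close> read off from coordinate \<open>n\<close> of the generic object.\<close>

definition bit where
  "bit g n x \<longleftrightarrow> (\<exists>h. h \<in>\<^sub>N g \<and> (\<exists>y. N.pair (N.pair (c n) x) y \<in>\<^sub>N h \<and> N.emp \<in>\<^sub>N y))"

text \<open>\<open>bit_fm\<close> says, of \<open>u, g, n, l\<close> at indices 0 to 3, that \<open>{x \<in> l. bit g n x}\<close> is an element of \<open>u\<close>.\<close>

definition bit_fm where
  "bit_fm = ExIn 0 (\<^bold>\<forall>(0 \<^bold>\<in> 1 \<^bold>\<longleftrightarrow> 0 \<^bold>\<in> 5 \<^bold>\<and> ExIn 3 (\<^bold>\<exists>\<^bold>\<exists>(pair_fm 7 3 1 \<^bold>\<and> app_fm 2 1 0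
    \<^bold>\<and> \<^bold>\<exists>(empty_fm 0 \<^bold>\<and> 0 \<^bold>\<in> 1)))))"

lemma sat_bit_fm:
  "sat EN (case_nat u (case_nat g (case_nat (c n) (\<lambda>_. l)))) bit_fm \<longleftrightarrow>
    (\<exists>b. b \<in>\<^sub>N u \<and> (\<forall>x. x \<in>\<^sub>N b \<longleftrightarrow> x \<in>\<^sub>N l \<and> bit g n x))"
proof -
  have 1: "(\<exists>z. z = N.emp \<and> z \<in>\<^sub>N y) \<longleftrightarrow> N.emp \<in>\<^sub>N y" for y by blast
  have 2: "(\<exists>q y. q = p \<and> N.pair q y \<in>\<^sub>N h \<and> N.emp \<in>\<^sub>N y) \<longleftrightarrow> (\<exists>y. N.pair p y \<in>\<^sub>N h \<and> N.emp \<in>\<^sub>N y)" for p h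
    by blast
  have iff: "(A \<longrightarrow> B) \<and> \<not> (B \<and> \<not> A) \<longleftrightarrow> (A \<longleftrightarrow> B)" for A B by blast
  show ?thesis
    unfolding bit_fm_def bit_def
    by (simp only: sat.simps N.sat_app N.sat_pair N.sat_empty nat.case eval_nat_numeral BitM.simps
      One_nat_def add_Suc_right add_0_right not_imp not_not not_ex[symmetric] simp_thms iff 1 2)
qed

text \<open>Toggling coordinate \<open>n\<close> outside of the slice of a condition \<open>p\<close> fixes \<open>p\<close> and the name of \<open>u\<close>, but complements
  the generic set outside of the slice. So neither that set nor its complement can be in \<open>u\<close>, unless \<open>u\<close> contains
  the slice.\<close>

theorem N_small_in_ultrafilter:
  assumes u: "N.uf u (c lm)"
  shows "\<exists>n d. natural n \<and> sm (K n) d \<and> c d \<in>\<^sub>N u"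
proof -
  obtain u' where u': "HS u'" "v u' = u" using v_surj by blast
  obtain n where n: "natural n" "supp n u'" using HS_support[OF u'(1)] by blast
  let ?e = "case_nat u' (case_nat (gam n) (case_nat (chk n) (\<lambda>_. chk lm)))"
  have HSe: "HS (?e k)" for k using u'(1) HS_gam[OF n(1)] HS_chk by (auto split: nat.split)
  have ve: "(\<lambda>k. v (?e k)) = case_nat u (case_nat (v (gam n)) (case_nat (c n) (\<lambda>_. c lm)))"
    using u'(2) by (auto simp: fun_eq_iff c_def split: nat.split)
  \<comment> \<open>Whichever of the two holds is forced by some \<open>p\<close> in
    \<open>G\<close>, and then the symmetry carries it over to the toggled name.\<close>
  obtain \<chi> where \<chi>: "\<chi> = bit_fm \<or> \<chi> = (\<^bold>\<not>bit_fm)" "sat EN (\<lambda>k. v (?e k)) \<chi>" by (metis sat.simps(3,4))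
  obtain p where p: "p \<in> G" "frc HS p ?e \<chi>" using truth[of ?e, OF HSe] \<chi>(2) by blast
  note cp = G_cnd[OF p(1)]
  define d where "d = slc n p"
  have X: "D1 (\<lambda>z. fstp z = n \<and> \<not> sndp z \<epsilon> d)" unfolding D1_def by (intro dfi)
  \<comment> \<open>The support \<open>n\<close> comprises the coordinates below \<open>n\<close>,
    so coordinate \<open>n\<close> itself may be toggled.\<close>
  define h where "h = sep (prod om lm) (\<lambda>z. fstp z = n \<and> \<not> sndp z \<epsilon> d)"
  have h: "pair m x \<epsilon> h \<longleftrightarrow> x \<epsilon> lm \<and> m = n \<and> \<not> x \<epsilon> d" for m x
    unfolding h_def mem_sep[OF X] using n(1) by auto
  have fx: "fixg n h"
    unfolding fixg_def Grp_def mem_pw h by (auto simp: sub_def h_def mem_sep[OF X])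
  have hp: "hact h p = p"
  proof (rule hact_id[OF cp])
    fix w y assume w: "pair w y \<epsilon> p"
    then obtain m x where "w = pair m x" using cnd_elem[OF cp] by metis
    then show "\<not> w \<epsilon> h" using w unfolding h d_def mem_slc by (simp only: h) (auto simp: d_def)
  qed
  let ?g = "v (gam n)" and ?g' = "v (act h (gam n))"
  have ve': "(\<lambda>k. v (act h (?e k))) = case_nat u (case_nat ?g' (case_nat (c n) (\<lambda>_. c lm)))"
    using u'(2) n(2) fx by (auto simp: fun_eq_iff c_def act_chk supp_def split: nat.split)
  have "frc HS p (\<lambda>k. act h (?e k)) \<chi>" using frc_act[OF cp HSe p(2), of h] hp by simp
  then have "sat EN (\<lambda>k. v (act h (?e k))) \<chi>"
    using truth[of "\<lambda>k. act h (?e k)" \<chi>] HS_act[OF HSe] p(1) by blast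
  then have same: "(\<exists>b. b \<in>\<^sub>N u \<and> (\<forall>x. x \<in>\<^sub>N b \<longleftrightarrow> x \<in>\<^sub>N c lm \<and> bit ?g n x)) \<longleftrightarrow>
      (\<exists>b. b \<in>\<^sub>N u \<and> (\<forall>x. x \<in>\<^sub>N b \<longleftrightarrow> x \<in>\<^sub>N c lm \<and> bit ?g' n x))"
    using \<chi> unfolding ve ve' sat_bit_fm[symmetric] by auto
  have g: "bit ?g n (c x) \<longleftrightarrow> (\<exists>q y. q \<in> G \<and> pair (pair n x) y \<epsilon> q \<and> emp \<epsilon> y)" for x
  proof -
    have "bit ?g n (c x) \<longleftrightarrow> (\<exists>y. (\<exists>h. h \<in>\<^sub>N ?g \<and> N.pair (N.pair (c n) (c x)) y \<in>\<^sub>N h) \<and> N.emp \<in>\<^sub>N y)"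
      unfolding bit_def by blast
    also have "\<dots> \<longleftrightarrow> (\<exists>q y. q \<in> G \<and> pair (pair n x) y \<epsilon> q \<and> emp \<epsilon> y)"
    proof -
      have "N.emp \<in>\<^sub>N c w \<longleftrightarrow> emp \<epsilon> w" for w by (simp flip: c_emp)
      then show ?thesis unfolding gam_entry[OF n(1)] by (auto; blast)
    qed
    finally show ?thesis .
  qed
  have g': "bit ?g' n (c x) \<longleftrightarrow> (\<exists>q y. q \<in> G \<and> pair (pair n x) y \<epsilon> q \<and> \<not> emp \<epsilon> y)"
    if x: "x \<epsilon> lm" "\<not> x \<epsilon> d" for x
  proof -
    have el: "a \<in>\<^sub>N ?g' \<longleftrightarrow> (\<exists>r. isH n r \<and> hact h r \<in> G \<and> a = c r)" for a
      unfolding EN_name[OF HS_act[OF HS_gam[OF n(1)]]] mem_act mem_gam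
      using isH_cnd by (auto simp: act_chk c_def) (metis isH_cnd)
    have hx: "pair n x \<epsilon> h" using x h by blast
    show ?thesis
    proof
      assume "bit ?g' n (c x)"
      then obtain r y where r: "isH n r" "hact h r \<in> G" "N.pair (N.pair (c n) (c x)) y \<in>\<^sub>N c r" "N.emp \<in>\<^sub>N y"
        unfolding bit_def el by blast
      then obtain w where w: "y = c w" "pair (pair n x) w \<epsilon> r" unfolding entry by auto
      then have "emp \<epsilon> w" using r(4) by (simp flip: c_emp)
      moreover have "pair (pair n x) (tg w) \<epsilon> hact h r"
        using w(2) hx pair_mem_hact[OF isH_cnd[OF r(1)]] by auto
      ultimately show "\<exists>q y. q \<in> G \<and> pair (pair n x) y \<epsilon> q \<and> \<not> emp \<epsilon> y"
        using r(2) by (intro exI[of _ "hact h r"] exI[of _ "tg w"]) (simp add: mem_tg)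
    next
      assume "\<exists>q y. q \<in> G \<and> pair (pair n x) y \<epsilon> q \<and> \<not> emp \<epsilon> y"
      then obtain q y where q: "q \<in> G" "pair (pair n x) y \<epsilon> q" "\<not> emp \<epsilon> y" by blast
      define r where "r = hd n q"
      have r: "r \<in> G" "isH n r" "pair (pair n x) y \<epsilon> r"
        using q G_sub[of q r] isH_hd[OF G_cnd[OF q(1)]] unfolding r_def by (auto simp: sub_def)
      have cr: "cnd r" using isH_cnd r by blast
      have pr: "pair (pair n x) (tg y) \<epsilon> hact h r" using r(3) hx pair_mem_hact[OF cr] by auto
      have "isH n (hact h r)"
        unfolding isH_def pair_mem_hact[OF cr] using cnd_hact[OF cr] r(2) unfolding isH_def by blast
      then have "c (hact h r) \<in>\<^sub>N ?g'" unfolding el using r(1) cr by auto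
      moreover have "N.pair (N.pair (c n) (c x)) (c (tg y)) \<in>\<^sub>N c (hact h r)" using pr by simp
      moreover have "N.emp \<in>\<^sub>N c (tg y)" using q(3) by (simp add: mem_tg flip: c_emp)
      ultimately show "bit ?g' n (c x)" unfolding bit_def by blast
    qed
  qed
  have dl: "sub d lm" unfolding d_def sub_def mem_slc using cnd_elem[OF cp] by (metis pair_eq)
  have int: "\<exists>z. z \<in>\<^sub>N u \<and> (\<forall>w. w \<in>\<^sub>N z \<longleftrightarrow> w \<in>\<^sub>N a \<and> w \<in>\<^sub>N b)" if "a \<in>\<^sub>N u" "b \<in>\<^sub>N u" for a b
    using u that unfolding N.uf_def by blast
  have "\<exists>z. z \<in>\<^sub>N u \<and> N.sub z (c d)"
  proof (cases "\<exists>b. b \<in>\<^sub>N u \<and> (\<forall>x. x \<in>\<^sub>N b \<longleftrightarrow> x \<in>\<^sub>N c lm \<and> bit ?g n x)")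
    case True
    then obtain a where a: "a \<in>\<^sub>N u" "\<forall>x. x \<in>\<^sub>N a \<longleftrightarrow> x \<in>\<^sub>N c lm \<and> bit ?g n x" by (elim exE conjE)
    obtain b where b: "b \<in>\<^sub>N u" "\<forall>x. x \<in>\<^sub>N b \<longleftrightarrow> x \<in>\<^sub>N c lm \<and> bit ?g' n x"
      using iffD1[OF same True] by (elim exE conjE)
    obtain z where z: "z \<in>\<^sub>N u" "\<forall>w. w \<in>\<^sub>N z \<longleftrightarrow> w \<in>\<^sub>N a \<and> w \<in>\<^sub>N b"
      using int[OF a(1) b(1)] by (elim exE conjE)
    have "w \<in>\<^sub>N c d" if w: "w \<in>\<^sub>N z" for w
    proof -
      have w': "w \<in>\<^sub>N c lm" "bit ?g n w" "bit ?g' n w" using w z(2) a(2) b(2) by simp_all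
      then obtain x where x: "x \<epsilon> lm" "w = c x" unfolding mem_c by blast
      show ?thesis
      proof (rule ccontr)
        assume "\<not> w \<in>\<^sub>N c d"
        then have "\<not> x \<epsilon> d" using x(2) by simp
        then show False using w'(2,3) G_functional unfolding x(2) g g'[OF x(1) \<open>\<not> x \<epsilon> d\<close>] by blast
      qed
    qed
    then show ?thesis using z(1) unfolding N.sub_def by blast
  next
    case False
    have compl: "\<exists>a. a \<in>\<^sub>N u \<and> (\<forall>x. x \<in>\<^sub>N a \<longleftrightarrow> x \<in>\<^sub>N c lm \<and> \<not> bit g n x)"
      if f: "\<not> (\<exists>b. b \<in>\<^sub>N u \<and> (\<forall>x. x \<in>\<^sub>N b \<longleftrightarrow> x \<in>\<^sub>N c lm \<and> bit g n x))" for g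
    proof -
      have D: "N.D1 (bit g n)" unfolding N.D1_def bit_def by (intro dfi)
      let ?b = "N.sep (c lm) (bit g n)"
      have "N.sub ?b (c lm)" "\<not> ?b \<in>\<^sub>N u" using f unfolding N.sub_def by (auto simp: N.mem_sep[OF D])
      have "\<forall>x. N.sub x (c lm) \<longrightarrow> \<not> x \<in>\<^sub>N u \<longrightarrow> (\<exists>z. z \<in>\<^sub>N u \<and> (\<forall>w. w \<in>\<^sub>N z \<longleftrightarrow> w \<in>\<^sub>N c lm \<and> \<not> w \<in>\<^sub>N x))"
        using u unfolding N.uf_def by (elim conjE)
      then have "\<exists>z. z \<in>\<^sub>N u \<and> (\<forall>w. w \<in>\<^sub>N z \<longleftrightarrow> w \<in>\<^sub>N c lm \<and> \<not> w \<in>\<^sub>N ?b)"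
        using \<open>N.sub ?b (c lm)\<close> \<open>\<not> ?b \<in>\<^sub>N u\<close> by simp
      then show ?thesis unfolding N.mem_sep[OF D] by (auto; blast)
    qed
    obtain a where a: "a \<in>\<^sub>N u" "\<forall>x. x \<in>\<^sub>N a \<longleftrightarrow> x \<in>\<^sub>N c lm \<and> \<not> bit ?g n x"
      using compl[OF False] by (elim exE conjE)
    obtain b where b: "b \<in>\<^sub>N u" "\<forall>x. x \<in>\<^sub>N b \<longleftrightarrow> x \<in>\<^sub>N c lm \<and> \<not> bit ?g' n x"
      using compl[OF False[unfolded same]] by (elim exE conjE)
    obtain z where z: "z \<in>\<^sub>N u" "\<forall>w. w \<in>\<^sub>N z \<longleftrightarrow> w \<in>\<^sub>N a \<and> w \<in>\<^sub>N b"
      using int[OF a(1) b(1)] by (elim exE conjE)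
    have "w \<in>\<^sub>N c d" if w: "w \<in>\<^sub>N z" for w
    proof -
      have w': "w \<in>\<^sub>N c lm" "\<not> bit ?g n w" "\<not> bit ?g' n w" using w z(2) a(2) b(2) by simp_all
      then obtain x where x: "x \<epsilon> lm" "w = c x" unfolding mem_c by blast
      obtain y where y: "upr (pair (pair n x) y) (pair (pair n x) y) \<in> G" using total[OF n(1) x(1)] by blast
      show ?thesis
      proof (rule ccontr)
        assume "\<not> w \<in>\<^sub>N c d"
        then have "\<not> x \<epsilon> d" using x(2) by simp
        then show False using w'(2,3) y unfolding x(2) g g'[OF x(1) \<open>\<not> x \<epsilon> d\<close>] by (metis mem_upr)
      qed
    qed
    then show ?thesis using z(1) unfolding N.sub_def by blast
  qed
  then have "c d \<in>\<^sub>N u" using u dl unfolding N.uf_def by (metis c_sub)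
  moreover have "sm (K n) d" unfolding d_def by (rule cnd_slc[OF cp n(1)])
  ultimately show ?thesis using n(1) by blast
qed

text \<open>The sequence is an embedded set of the ground model, and so is its supremum; the
  collapses turn its entries into successive cardinals.\<close>

theorem aleph_sequence_N: "aleph_sequence EN (c (lam om K)) (c lm)"
proof -
  have k: "N.ap (c (lam om K)) (c n) = c (K n)" if "natural n" for n
  proof (rule N.ap_eq)
    show "N.func (c (lam om K))" by (rule c_func[OF func_lam[OF F1_K]])
    show "N.pair (c n) (c (K n)) \<in>\<^sub>N c (lam om K)" using that by (simp add: pair_mem_lam[OF F1_K])
  qed
  show ?thesis
  proof unfold_locales
    fix w
    show "w \<in>\<^sub>N c (lam om K) \<longleftrightarrow> (\<exists>n. N.natural n \<and> w = N.pair n (N.ap (c (lam om K)) n))"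
    proof
      assume "w \<in>\<^sub>N c (lam om K)"
      then obtain n where "natural n" "w = c (pair n (K n))" unfolding mem_c mem_lam[OF F1_K] by auto
      then show "\<exists>n. N.natural n \<and> w = N.pair n (N.ap (c (lam om K)) n)"
        using k by (intro exI[of _ "c n"]) simp
    next
      assume "\<exists>n. N.natural n \<and> w = N.pair n (N.ap (c (lam om K)) n)"
      then obtain n where "natural n" "w = c (pair n (K n))" using k N_naturalD by fastforce
      then show "w \<in>\<^sub>N c (lam om K)" by (simp add: pair_mem_lam[OF F1_K])
    qed
  next
    show "N.ap (c (lam om K)) N.emp = N.om" using k[OF natural_emp] by (simp add: c_om)
  next
    fix n assume "N.natural n"
    then obtain m where m: "natural m" "n = c m" using N_naturalD by blast
    show "N.Ord (N.ap (c (lam om K)) n)" using m Ord_K by (simp add: k)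
    show "N.ap (c (lam om K)) n \<in>\<^sub>N N.ap (c (lam om K)) (N.suc n)"
      using m natural_suc[OF m(1)] K_mem_suc by (simp add: k)
    show "\<exists>d. N.Ord d \<and> N.cov d (N.pw (N.ap (c (lam om K)) n))" using m N_Pow_covered by (simp add: k)
  next
    fix n x assume "N.natural n" and x: "N.sub x (N.ap (c (lam om K)) n)" "N.sm (N.ap (c (lam om K)) n) x"
    then obtain m where m: "natural m" "n = c m" using N_naturalD by blast
    obtain b where b: "b \<epsilon> K m" "N.cov (c b) x" using x(2) unfolding N.sm_def m(2) k[OF m(1)] mem_c by blast
    obtain g where g: "N.func g" "\<And>z. z \<in>\<^sub>N x \<Longrightarrow> \<exists>u. u \<in>\<^sub>N c b \<and> N.pair u z \<in>\<^sub>N g"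
      using b(2) unfolding N.cov_def by blast
    obtain d where d: "d \<epsilon> K m"
      "\<forall>a x. a \<epsilon> b \<longrightarrow> x \<epsilon> K m \<longrightarrow> N.pair (c a) (c x) \<in>\<^sub>N g \<longrightarrow> x \<epsilon> d"
      using N_bounded[OF m(1) b(1) g(1)] by blast
    have "z \<in>\<^sub>N c d" if z: "z \<in>\<^sub>N x" for z
    proof -
      obtain y where y: "y \<epsilon> K m" "z = c y" using sub_cD z x(1) unfolding m(2) k[OF m(1)] by blast
      obtain a where "a \<epsilon> b" "N.pair (c a) z \<in>\<^sub>N g" using g(2)[OF z] unfolding mem_c by blast
      then show ?thesis using d(2) y by simp
    qed
    then show "\<exists>d. d \<in>\<^sub>N N.ap (c (lam om K)) n \<and> N.sub x d"
      unfolding m(2) k[OF m(1)] N.sub_def using d(1) by (intro exI[of _ "c d"]) simp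
  next
    fix n b assume "N.natural n" and b: "b \<in>\<^sub>N N.ap (c (lam om K)) (N.suc n)"
    then obtain m where m: "natural m" "n = c m" using N_naturalD by blast
    have "b \<in>\<^sub>N c (K (suc m))" using b m natural_suc[OF m(1)] by (simp add: k)
    then show "N.cov (N.ap (c (lam om K)) n) b" using N_cov_K[OF m(1)] m unfolding mem_c by (auto simp: k)
  next
    fix x
    show "x \<in>\<^sub>N c lm \<longleftrightarrow> (\<exists>n. N.natural n \<and> x \<in>\<^sub>N N.ap (c (lam om K)) n)"
    proof
      assume "x \<in>\<^sub>N c lm"
      then obtain n y where "natural n" "y \<epsilon> K n" "x = c y" unfolding mem_c mem_lm by blast
      then show "\<exists>n. N.natural n \<and> x \<in>\<^sub>N N.ap (c (lam om K)) n"
        using k by (intro exI[of _ "c n"]) simp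
    next
      assume "\<exists>n. N.natural n \<and> x \<in>\<^sub>N N.ap (c (lam om K)) n"
      then obtain n where "natural n" "x \<in>\<^sub>N c (K n)" using k N_naturalD by fastforce
      then show "x \<in>\<^sub>N c lm" unfolding mem_c mem_lm by blast
    qed
  next
    fix u assume "N.uf u (c lm)"
    then obtain n d where n: "natural n" "sm (K n) d" "c d \<in>\<^sub>N u" using N_small_in_ultrafilter by blast
    have "N.sm (c (K n)) (c d)" using n(2) c_cov unfolding sm_def N.sm_def by (metis c_mem)
    then show "\<exists>z n. z \<in>\<^sub>N u \<and> N.natural n \<and> N.sm (N.ap (c (lam om K)) n) z"
      using n(1,3) k[OF n(1)] by (intro exI[of _ "c d"] exI[of _ "c n"]) simp
  qed
qed

end

section \<open>The model\<close>

context forcing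
begin

lemma fmem_sng: "q \<epsilon> P \<Longrightarrow> feq q x y \<Longrightarrow> fmem q x (upr (pair y emp) (pair y emp))"
  by (rule fmem_cong1[OF feq_sym fmem_name[OF _ emp_P]]) (auto simp: sub_def)

text \<open>Makes the singleton map on classes of names well defined and injective, as
  \<open>infinite_quotient_naming\<close> requires.\<close>

lemma feq_sng:
  assumes p: "p \<epsilon> P"
  shows "feq p (upr (pair x emp) (pair x emp)) (upr (pair y emp) (pair y emp)) \<longleftrightarrow> feq p x y"
proof
  assume a: "feq p (upr (pair x emp) (pair x emp)) (upr (pair y emp) (pair y emp))"
  have "fmem q x (upr (pair y emp) (pair y emp))" if "q \<epsilon> P" "sub p q" for q
  proof (rule fmem_cong2[OF feq_mono[OF a that]])
    show "fmem q x (upr (pair x emp) (pair x emp))" by (rule fmem_sng[OF that(1) feq_refl[OF that(1)]])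
  qed
  note m = this
  show "feq p x y"
  proof (rule feq_regular[OF p])
    fix q assume q: "q \<epsilon> P" "sub p q"
    obtain s \<sigma> t where "s \<epsilon> P" "sub q s" "pair \<sigma> t \<epsilon> upr (pair y emp) (pair y emp)" "feq s x \<sigma>"
      using fmemD[OF m[OF q] q(1) sub_refl] by blast
    then show "\<exists>s. s \<epsilon> P \<and> sub q s \<and> feq s x y" by auto
  qed
next
  assume "feq p x y"
  then have "half feq p (upr (pair x emp) (pair x emp)) (upr (pair y emp) (pair y emp))" if "feq p x y" for x y
    using that unfolding half_feq_iff by (auto intro!: fmem_sng dest: feq_mono)
  then show "feq p (upr (pair x emp) (pair x emp)) (upr (pair y emp) (pair y emp))"
    unfolding feq_iff[of p "upr _ _"] using \<open>feq p x y\<close> feq_sym p by blast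
qed

lemma not_feq_emp_sng: "\<not> feq p (chk emp) (upr (pair x emp) (pair x emp))"
proof
  assume a: "feq p (chk emp) (upr (pair x emp) (pair x emp))"
  have p: "p \<epsilon> P" by (rule feq_P[OF a])
  have "fmem p x (chk emp)"
    by (rule fmem_cong2[OF feq_sym[OF a] fmem_sng[OF p feq_refl[OF p]]])
  then show False using fmemD[OF _ p sub_refl] mem_chk mem_emp by blast
qed

end

context zfc
begin

text \<open>The model is countable, so a filter can meet all of its dense sets.\<close>

lemma generic_filter:
  assumes "inj (num :: 'a \<Rightarrow> nat)"
  obtains G where "\<And>p. p \<in> G \<Longrightarrow> p \<epsilon> conds" "\<And>p q. p \<in> G \<Longrightarrow> q \<epsilon> conds \<Longrightarrow> sub q p \<Longrightarrow> q \<in> G"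
    and "\<And>p q. p \<in> G \<Longrightarrow> q \<in> G \<Longrightarrow> \<exists>r. r \<in> G \<and> sub p r \<and> sub q r"
    and "\<And>D. D1 D \<Longrightarrow> \<forall>p. p \<epsilon> conds \<longrightarrow> (\<exists>q. q \<epsilon> conds \<and> sub p q \<and> D q) \<Longrightarrow> \<exists>q. q \<in> G \<and> D q"
proof -
  \<comment> \<open>A definable dense class corresponds to the element \<open>sep conds D\<close> of
    the model, so that numbering the elements numbers all dense classes. An element that cannot be
    met above \<open>p\<close> leaves \<open>p\<close> unchanged.\<close>
  define step where "step p d = (if \<exists>q. cnd q \<and> sub p q \<and> q \<epsilon> d then SOME q. cnd q \<and> sub p q \<and> q \<epsilon> d else p)" for p d
  have step: "cnd (step p d)" "sub p (step p d)" "\<exists>q. cnd q \<and> sub p q \<and> q \<epsilon> d \<Longrightarrow> step p d \<epsilon> d"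
    if "cnd p" for p d
    using someI_ex[of "\<lambda>q. cnd q \<and> sub p q \<and> q \<epsilon> d"] that unfolding step_def by auto
  define s where "s = rec_nat emp (\<lambda>i p. step p (inv num i))"
  have s_simps: "s 0 = emp" "s (Suc i) = step (s i) (inv num i)" for i by (simp_all add: s_def)
  have cs: "cnd (s i)" for i by (induction i) (simp_all add: s_simps cnd_emp step)
  have mono: "sub (s i) (s j)" if "i \<le> j" for i j
    using that by (induction rule: dec_induct) (use sub_trans step(2)[OF cs] s_simps in \<open>auto\<close>)
  define G where "G = {p. cnd p \<and> (\<exists>i. sub p (s i))}"
  show thesis
  proof
    show "p \<epsilon> conds" if "p \<in> G" for p using that by (simp add: G_def)
    show "q \<in> G" if "p \<in> G" "q \<epsilon> conds" "sub q p" for p q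
      using that sub_trans unfolding G_def by auto
    show "\<exists>r. r \<in> G \<and> sub p r \<and> sub q r" if pq: "p \<in> G" "q \<in> G" for p q
    proof -
      obtain i j where ij: "sub p (s i)" "sub q (s j)" using pq unfolding G_def by blast
      have "sub p (s (max i j))" "sub q (s (max i j))"
        using sub_trans[OF ij(1) mono] sub_trans[OF ij(2) mono] by simp_all
      moreover have "s (max i j) \<in> G" unfolding G_def using cs sub_refl by blast
      ultimately show ?thesis by blast
    qed
    show "\<exists>q. q \<in> G \<and> D q" if D: "D1 D"
      and d: "\<forall>p. p \<epsilon> conds \<longrightarrow> (\<exists>q. q \<epsilon> conds \<and> sub p q \<and> D q)" for D
    proof -
      let ?d = "sep conds D" and ?i = "num (sep conds D)"
      have "inv num ?i = ?d" using assms by simp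
      moreover have "\<exists>q. cnd q \<and> sub (s ?i) q \<and> q \<epsilon> ?d"
        using d cs[of ?i] unfolding mem_sep[OF D] mem_conds by blast
      ultimately have "s (Suc ?i) \<epsilon> ?d" unfolding s_simps using step(3)[OF cs] by simp
      then show ?thesis unfolding mem_sep[OF D] G_def using cs sub_refl by blast
    qed
  qed
qed

end

lemma sym_ext_exists:
  fixes E :: "nat \<Rightarrow> nat \<Rightarrow> bool"
  assumes "zfc E"
  obtains G v EN where "sym_ext E G v EN"
proof -
  interpret zfc E by fact
  obtain G where G: "\<And>p. p \<in> G \<Longrightarrow> E p conds" "\<And>p q. p \<in> G \<Longrightarrow> E q conds \<Longrightarrow> sub q p \<Longrightarrow> q \<in> G"
    "\<And>p q. p \<in> G \<Longrightarrow> q \<in> G \<Longrightarrow> \<exists>r. r \<in> G \<and> sub p r \<and> sub q r"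
    "\<And>D. D1 D \<Longrightarrow> \<forall>p. E p conds \<longrightarrow> (\<exists>q. E q conds \<and> sub p q \<and> D q) \<Longrightarrow> \<exists>q. q \<in> G \<and> D q"
    by (rule generic_filter[OF inj_on_id], rule that)
  have "D1 (\<lambda>_. True)" unfolding D1_def by (intro dfi)
  then obtain p0 where p0: "p0 \<in> G" using G(4)[of "\<lambda>_. True"] sub_refl by blast
  define eq where "eq x y \<longleftrightarrow> (\<exists>p. p \<in> G \<and> feq p x y)" for x y
  have "\<exists>v :: nat \<Rightarrow> nat. v ` Collect HS = UNIV \<and> (\<forall>x y. HS x \<longrightarrow> HS y \<longrightarrow> (v x = v y \<longleftrightarrow> eq x y))"
  proof (rule infinite_quotient_naming[of "Collect HS" eq "\<lambda>x. upr (pair x emp) (pair x emp)" "chk emp"])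
    show "eq x x" for x unfolding eq_def using p0 G(1) feq_refl by blast
    show "eq y x" if "eq x y" for x y using that feq_sym unfolding eq_def by blast
    show "eq x z" if xy: "eq x y" "eq y z" for x y z
    proof -
      obtain p q where pq: "p \<in> G" "feq p x y" "q \<in> G" "feq q y z" using xy unfolding eq_def by blast
      obtain r where r: "r \<in> G" "sub p r" "sub q r" using G(3) pq(1,3) by blast
      have "feq r x z"
        by (rule feq_trans[OF feq_mono[OF pq(2) G(1)[OF r(1)] r(2)] feq_mono[OF pq(4) G(1)[OF r(1)] r(3)]])
      then show ?thesis unfolding eq_def using r(1) by blast
    qed
    show "upr (pair x emp) (pair x emp) \<in> Collect HS" if "x \<in> Collect HS" for x using that HS_sng by simp
    show "eq (upr (pair x emp) (pair x emp)) (upr (pair y emp) (pair y emp)) \<longleftrightarrow> eq x y" for x y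
      unfolding eq_def using feq_sng[OF G(1)] by blast
    show "chk emp \<in> Collect HS" using HS_chk by simp
    show "\<not> eq (chk emp) (upr (pair x emp) (pair x emp))" for x
      unfolding eq_def using not_feq_emp_sng by blast
    show ?thesis if "v ` Collect HS = UNIV"
      "\<And>x y. x \<in> Collect HS \<Longrightarrow> y \<in> Collect HS \<Longrightarrow> v x = v y \<longleftrightarrow> eq x y" for v :: "nat \<Rightarrow> nat"
      by (rule exI[of _ v]) (simp add: that)
  qed
  then obtain v :: "nat \<Rightarrow> nat" where v: "v ` Collect HS = UNIV"
    "\<And>x y. HS x \<Longrightarrow> HS y \<Longrightarrow> v x = v y \<longleftrightarrow> eq x y" by blast
  have "sym_ext E G v (\<lambda>a b. \<exists>x y p. HS x \<and> HS y \<and> v x = a \<and> v y = b \<and> p \<in> G \<and> fmem p x y)"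
  proof unfold_locales
    show "\<exists>x. HS x \<and> v x = a" for a using v(1) by (metis UNIV_I imageE mem_Collect_eq)
    show "\<exists>q. q \<in> G \<and> D q" if "D1 D" "\<And>p. E p conds \<Longrightarrow> \<exists>q. E q conds \<and> sub p q \<and> D q" for D
      using G(4)[OF that(1)] that(2) by blast
    show "HS x \<Longrightarrow> HS y \<Longrightarrow> v x = v y \<longleftrightarrow> (\<exists>p. p \<in> G \<and> feq p x y)" for x y
      using v(2) unfolding eq_def .
  qed (rule G(1) G(2) G(3) refl; assumption?)+
  then show thesis by (rule that)
qed

lemma ZFC_closed: "p \<in> ZFC \<Longrightarrow> arity p = 0"
  unfolding ZFC_def ZF_def
  by (auto simp: separation_ax_def replacement_ax_def arity_univ_closure choice_ax_def extensionality_ax_def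
      foundation_ax_def pairing_ax_def union_ax_def powerset_ax_def infinity_ax_def empty_fm_def upair_fm_def
      subset_fm_def succ_fm_def fun_fm_def app_fm_def pair_fm_def)

theorem theorem1p4:
  assumes "consistent ZFC"
  shows "consistent (insert aleph_omega_least_not_inU ZF)"
proof -
  interpret henkin ZFC by unfold_locales (use ZFC_closed assms in auto)
  obtain E :: "nat \<Rightarrow> nat \<Rightarrow> bool" where E: "\<And>p e. p \<in> ZFC \<Longrightarrow> sat E e p"
    by (rule countable_model) (auto simp: ZFC_def ZF_def)
  have "zf E" unfolding zf_iff using E by (auto simp: ZFC_def)
  then have "zfc E" by (rule zf.zfcI) (simp add: E ZFC_def)
  then obtain G v EN where "sym_ext E G v EN" by (rule sym_ext_exists)
  then interpret sym_ext E G v EN .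
  interpret A: aleph_sequence EN "c (lam om K)" "c lm" by (rule aleph_sequence_N)
  show ?thesis
    using A.aleph_omega_least N_zf[unfolded zf_iff] by (intro model_imp_consistent) auto
qed

end
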